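(* Let $\Omega$ be a nonconvex polygonal domain with exactly one reentrant angle $\omega\in(\pi,2\pi)$, and set $\beta=\pi/\omega\in(\tfrac12,1)$. Let $\beta<s\le1$, $0\le\delta\le1+s$ and $u_0\in\dot H^\delta(\Omega)$. Let $u$ be the solution of $$\partial_t^\alpha u+\mathcal L u=0\ \text{ in }\Omega\times(0,T],\qquad u(0)=u_0\ \text{ in }\Omega,\qquad u=0\ \text{ on }\partial\Omega\times(0,T],$$ and let $u_h:(0,T]\to V_h$ be the solution of $$(\partial_t^\alpha u_h,v_h)+a(u_h,v_h)=0\quad\forall v_h\in V_h,\ t>0,\qquad u_h(0)=P_hu_0 .$$ Then there is a constant $C=C_s$, depending on $s$ but independent of $h$, $t$ and $u_0$, such that $$\|(u_h-u)(t)\|\le C\,h^{2\beta}\,t^{-\alpha(1+s-\delta)/2}\,\|u_0\|_{\dot H^\delta(\Omega)},\qquad t\in(0,T].$$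
   Context: $\Omega\subset\mathbb R^2$ is a bounded polygonal domain, $T>0$ is fixed and $0<\alpha<1$. $(\cdot,\cdot)$ and $\|\cdot\|$ are the inner product and norm of $L^2(\Omega)$. The operator is $\mathcal L u=-\mathrm{div}[A(x)\nabla u]+c(x)u$, where $A(x)$ is a symmetric $2\times2$ matrix with smooth coefficients, uniformly positive definite in $\Omega$, and $c\in L^\infty(\Omega)$ is nonnegative. The associated bilinear form is $a(u,v)=(A\nabla u,\nabla v)+(cu,v)$. The Caputo derivative in time is $\partial_t^\alpha\varphi(t)=\int_0^t\omega_{1-\alpha}(t-s)\varphi'(s)\,ds=\frac{d}{dt}\int_0^t\omega_{1-\alpha}(t-s)(\varphi(s)-\varphi(0))\,ds$ with $\omega_\nu(t)=t^{\nu-1}/\Gamma(\nu)$. Let $\{\lambda_j\},\{\phi_j\}$ be the Dirichlet eigenvalues and $L^2(\Omega)$-orthonormal eigenfunctions of $\mathcal L$ on $\Omega$. For $r\ge0$, $\dot H^r(\Omega)=\{v\in L^2(\Omega):\sum_j\lambda_j^r(v,\phi_j)^2<\infty\}$ with norm $\|v\|_{\dot H^r(\Omega)}=(\sum_j\lambda_j^r(v,\phi_j)^2)^{1/2}$; for $r>0$, $\dot H^{-r}(\Omega)$ is the dual space of $\dot H^r(\Omega)$. The solution $u$ is the unique weak solution $u\in C([0,T],L^2(\Omega))\cap C((0,T],\dot H^2(\Omega))$ with $\partial_t^\alpha u\in C((0,T],L^2(\Omega))$. $\mathcal T_h$ is a family of shape-regular partitions of $\overline\Omega$ into triangles $K$,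 $h=\max_K h_K$ ($0<h<1$), with $h_K$ the diameter of $K$. $V_h=\{v_h\in C^0(\overline\Omega): v_h|_K \text{ is linear for all }K\in\mathcal T_h,\ v_h|_{\partial\Omega}=0\}$. $P_h$ is the $L^2(\Omega)$-orthogonal projection onto $V_h$. For $f\in L^2(\Omega)$, $Tf\in H_0^1(\Omega)$ is defined by $a(Tf,v)=(f,v)$ for all $v\in H_0^1(\Omega)$ and $T_hf\in V_h$ by $a(T_hf,\chi)=(f,\chi)$ for all $\chi\in V_h$. The paper takes as given in this setting the elliptic finite element error estimate $$\|T_hf-Tf\|+h^\beta\|\nabla(T_hf-Tf)\|\le C_s h^{2\beta}\|f\|_{\dot H^{-1+s}(\Omega)},\qquad \beta<s\le1.$$ Constants $C$ may depend on $\alpha$, $T$ and the fixed data ($\Omega$, $A$, $c$, shape-regularity of the meshes), but not on $h$. *)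

theory Defs
  imports "HOL-Analysis.Analysis"
begin

section \<open>The Hilbert space of square-integrable functions\<close>

definition sq_integrable :: "('a::euclidean_space \<Rightarrow> 'b::euclidean_space) \<Rightarrow> bool" where
  "sq_integrable f \<longleftrightarrow> f \<in> borel_measurable lebesgue \<and> integrable lebesgue (\<lambda>x. (norm (f x))\<^sup>2)"

lemma sq_integrable_inner:
  assumes "sq_integrable f" "sq_integrable g"
  shows "integrable lebesgue (\<lambda>x. f x \<bullet> g x)"
proof (rule Bochner_Integration.integrable_bound)
  show "integrable lebesgue (\<lambda>x. (norm (f x))\<^sup>2 + (norm (g x))\<^sup>2)"
    using assms by (simp add: sq_integrable_def)
  show "(\<lambda>x. f x \<bullet> g x) \<in> borel_measurable lebesgue"
    using assms by (intro borel_measurable_inner) (auto simp: sq_integrable_def)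
  have "\<bar>f x \<bullet> g x\<bar> \<le> (norm (f x))\<^sup>2 + (norm (g x))\<^sup>2" for x
  proof -
    have "\<bar>f x \<bullet> g x\<bar> \<le> norm (f x) * norm (g x)"
      by (rule Cauchy_Schwarz_ineq2)
    moreover have "2 * (norm (f x) * norm (g x)) \<le> (norm (f x))\<^sup>2 + (norm (g x))\<^sup>2"
      using sum_squares_bound[of "norm (f x)" "norm (g x)"] by (simp add: mult.assoc)
    moreover have "0 \<le> norm (f x) * norm (g x)"
      by simp
    ultimately show ?thesis by linarith
  qed
  then show "AE x in lebesgue. norm (f x \<bullet> g x) \<le> norm ((norm (f x))\<^sup>2 + (norm (g x))\<^sup>2)"
    by (intro AE_I2) (metis abs_ge_self order_trans real_norm_def)
qed

lemma sq_integrable_zero: "sq_integrable (\<lambda>x. 0)"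
  by (simp add: sq_integrable_def)

lemma sq_integrable_scaleR: "sq_integrable f \<Longrightarrow> sq_integrable (\<lambda>x. r *\<^sub>R f x)"
  by (auto simp: sq_integrable_def power_mult_distrib intro!: borel_measurable_scaleR)

lemma sq_integrable_add:
  assumes "sq_integrable f" "sq_integrable g"
  shows "sq_integrable (\<lambda>x. f x + g x)"
proof -
  have "integrable lebesgue (\<lambda>x. (norm (f x))\<^sup>2 + 2 * (f x \<bullet> g x) + (norm (g x))\<^sup>2)"
    using assms sq_integrable_inner[OF assms] by (simp add: sq_integrable_def)
  moreover have "(norm (f x))\<^sup>2 + 2 * (f x \<bullet> g x) + (norm (g x))\<^sup>2 = (norm (f x + g x))\<^sup>2" for x
    by (simp add: power2_norm_eq_inner inner_add_left inner_add_right inner_commute)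
  ultimately show ?thesis
    using assms by (auto simp: sq_integrable_def intro!: borel_measurable_add)
qed

lemma sq_integrable_uminus: "sq_integrable f \<Longrightarrow> sq_integrable (\<lambda>x. - f x)"
  using sq_integrable_scaleR[of f "-1"] by simp

lemma sq_integrable_diff:
  "sq_integrable f \<Longrightarrow> sq_integrable g \<Longrightarrow> sq_integrable (\<lambda>x. f x - g x)"
  using sq_integrable_add[of f "\<lambda>x. - g x"] sq_integrable_uminus[of g] by simp

definition L2_rel :: "('a::euclidean_space \<Rightarrow> 'b::euclidean_space) \<Rightarrow> ('a \<Rightarrow> 'b) \<Rightarrow> bool" where
  "L2_rel f g \<longleftrightarrow> sq_integrable f \<and> sq_integrable g \<and> (AE x in lebesgue. f x = g x)"

quotient_type (overloaded) ('a, 'b) L2 =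
  "'a::euclidean_space \<Rightarrow> 'b::euclidean_space" / partial: L2_rel
proof (rule part_equivpI)
  show "\<exists>f. L2_rel f f"
    by (rule exI[of _ "\<lambda>x. 0"]) (simp add: L2_rel_def sq_integrable_zero)
  show "symp L2_rel"
    by (rule sympI) (auto simp: L2_rel_def elim: AE_mp)
  show "transp L2_rel"
    by (rule transpI) (auto simp: L2_rel_def elim: AE_mp)
qed

instantiation L2 :: (euclidean_space, euclidean_space) real_vector
begin

lift_definition zero_L2 :: "('a, 'b) L2" is "\<lambda>x. 0"
  by (simp add: L2_rel_def sq_integrable_zero)

lift_definition plus_L2 :: "('a, 'b) L2 \<Rightarrow> ('a, 'b) L2 \<Rightarrow> ('a, 'b) L2" is "\<lambda>f g x. f x + g x"
  by (auto simp: L2_rel_def sq_integrable_add)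

lift_definition minus_L2 :: "('a, 'b) L2 \<Rightarrow> ('a, 'b) L2 \<Rightarrow> ('a, 'b) L2" is "\<lambda>f g x. f x - g x"
  by (auto simp: L2_rel_def sq_integrable_diff)

lift_definition uminus_L2 :: "('a, 'b) L2 \<Rightarrow> ('a, 'b) L2" is "\<lambda>f x. - f x"
  by (auto simp: L2_rel_def sq_integrable_uminus)

lift_definition scaleR_L2 :: "real \<Rightarrow> ('a, 'b) L2 \<Rightarrow> ('a, 'b) L2" is "\<lambda>r f x. r *\<^sub>R f x"
  by (auto simp: L2_rel_def sq_integrable_scaleR)

instance
proof
  fix f g h :: "('a, 'b) L2" and r s :: real
  show "f + g + h = f + (g + h)"
    by transfer (auto simp: L2_rel_def sq_integrable_add add.assoc)
  show "f + g = g + f"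
    by transfer (auto simp: L2_rel_def sq_integrable_add add.commute)
  show "0 + f = f"
    by transfer (auto simp: L2_rel_def)
  show "- f + f = 0"
    by transfer (auto simp: L2_rel_def sq_integrable_zero)
  show "f - g = f + - g"
    by transfer (auto simp: L2_rel_def sq_integrable_diff)
  show "r *\<^sub>R (f + g) = r *\<^sub>R f + r *\<^sub>R g"
    by transfer (auto simp: L2_rel_def sq_integrable_add sq_integrable_scaleR scaleR_add_right)
  show "(r + s) *\<^sub>R f = r *\<^sub>R f + s *\<^sub>R f"
    by transfer (auto simp: L2_rel_def sq_integrable_add sq_integrable_scaleR
        scaleR_add_left[symmetric] simp del: scaleR_add_left)
  show "r *\<^sub>R s *\<^sub>R f = (r * s) *\<^sub>R f"
    by transfer (auto simp: L2_rel_def intro!: sq_integrable_scaleR)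
  show "1 *\<^sub>R f = f"
    by transfer (auto simp: L2_rel_def)
qed

end

instantiation L2 :: (euclidean_space, euclidean_space) real_inner
begin

lift_definition inner_L2 :: "('a, 'b) L2 \<Rightarrow> ('a, 'b) L2 \<Rightarrow> real"
  is "\<lambda>f g. integral\<^sup>L lebesgue (\<lambda>x. f x \<bullet> g x)"
proof (goal_cases)
  case (1 f1 f2 g1 g2)
  then have m: "f1 \<in> borel_measurable lebesgue" "f2 \<in> borel_measurable lebesgue"
      "g1 \<in> borel_measurable lebesgue" "g2 \<in> borel_measurable lebesgue"
    and "AE x in lebesgue. f1 x = f2 x" "AE x in lebesgue. g1 x = g2 x"
    by (auto simp: L2_rel_def sq_integrable_def)
  then show ?case
    by (intro integral_cong_AE borel_measurable_inner m) auto
qed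

definition norm_L2 :: "('a, 'b) L2 \<Rightarrow> real" where
  "norm_L2 f = sqrt (f \<bullet> f)"

definition dist_L2 :: "('a, 'b) L2 \<Rightarrow> ('a, 'b) L2 \<Rightarrow> real" where
  "dist_L2 f g = norm (f - g)"

definition sgn_L2 :: "('a, 'b) L2 \<Rightarrow> ('a, 'b) L2" where
  "sgn_L2 f = f /\<^sub>R norm f"

definition uniformity_L2 :: "(('a, 'b) L2 \<times> ('a, 'b) L2) filter" where
  "uniformity_L2 = (INF e\<in>{0 <..}. principal {(x, y). dist x y < e})"

definition open_L2 :: "('a, 'b) L2 set \<Rightarrow> bool" where
  "open_L2 U \<longleftrightarrow> (\<forall>x\<in>U. eventually (\<lambda>(x', y). x' = x \<longrightarrow> y \<in> U) uniformity)"

instance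
proof
  fix f g h :: "('a, 'b) L2" and r :: real
  show "f \<bullet> g = g \<bullet> f"
    by transfer (simp add: inner_commute)
  show "(f + g) \<bullet> h = f \<bullet> h + g \<bullet> h"
    by transfer (auto simp: L2_rel_def inner_add_left intro!: Bochner_Integration.integral_add
        sq_integrable_inner)
  show "(r *\<^sub>R f) \<bullet> g = r * (f \<bullet> g)"
    by transfer simp
  show "0 \<le> f \<bullet> f"
    by transfer (simp add: integral_nonneg_AE)
  show "f \<bullet> f = 0 \<longleftrightarrow> f = 0"
  proof transfer
    fix f :: "'a \<Rightarrow> 'b"
    assume "L2_rel f f"
    then have sq: "sq_integrable f" by (simp add: L2_rel_def)
    have "integral\<^sup>L lebesgue (\<lambda>x. f x \<bullet> f x) = 0 \<longleftrightarrow> (AE x in lebesgue. f x \<bullet> f x = 0)"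
      by (rule integral_nonneg_eq_0_iff_AE) (auto intro: sq_integrable_inner sq)
    then show "(integral\<^sup>L lebesgue (\<lambda>x. f x \<bullet> f x) = 0) = L2_rel f (\<lambda>x. 0)"
      using sq by (simp add: L2_rel_def sq_integrable_zero)
  qed
qed (simp_all add: norm_L2_def dist_L2_def sgn_L2_def uniformity_L2_def open_L2_def)

end

type_synonym plane = "real^2"

text \<open>\<open>L\<^sup>2(\<Omega>)\<close> is identified with the closed subspace of \<open>L\<^sup>2(\<real>\<^sup>2)\<close> of classes vanishing almost
  everywhere outside \<open>\<Omega>\<close> (extension by zero); \<open>\<bullet>\<close> and \<^const>\<open>norm\<close> then are its inner
  product and norm.\<close>

definition L2_on :: "plane set \<Rightarrow> (plane, 'b::euclidean_space) L2 set" where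
  "L2_on \<Omega> = {f. AE x in lebesgue. x \<notin> \<Omega> \<longrightarrow> rep_L2 f x = 0}"

definition L2_class :: "plane set \<Rightarrow> (plane \<Rightarrow> 'b::euclidean_space) \<Rightarrow> (plane, 'b) L2" where
  "L2_class \<Omega> f = abs_L2 (\<lambda>x. indicator \<Omega> x *\<^sub>R f x)"


section \<open>Polygonal domains and their interior angles\<close>

definition has_interior_angle :: "plane set \<Rightarrow> plane \<Rightarrow> real \<Rightarrow> bool" where
  "has_interior_angle \<Omega> p \<theta> \<longleftrightarrow> 0 < \<theta> \<and> \<theta> < 2 * pi \<and>
     (\<exists>\<rho>>0. \<exists>\<gamma>. \<Omega> \<inter> ball p \<rho> =
        {p + r *\<^sub>R vector [cos t, sin t] | r t. 0 < r \<and> r < \<rho> \<and> \<gamma> < t \<and> t < \<gamma> + \<theta>})"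

text \<open>Points in the relative interior of a side have interior angle \<open>pi\<close>. The last condition
  excludes cracks and boundary points at which \<open>\<Omega>\<close> touches itself.\<close>

definition polygonal_domain :: "plane set \<Rightarrow> bool" where
  "polygonal_domain \<Omega> \<longleftrightarrow> open \<Omega> \<and> connected \<Omega> \<and> bounded \<Omega> \<and> \<Omega> \<noteq> {} \<and>
     (\<exists>S. finite S \<and> frontier \<Omega> = (\<Union>(p, q)\<in>S. closed_segment p q)) \<and>
     (\<forall>p\<in>frontier \<Omega>. \<exists>\<theta>. has_interior_angle \<Omega> p \<theta>)"

definition only_reentrant_angle :: "plane set \<Rightarrow> real \<Rightarrow> bool" where
  "only_reentrant_angle \<Omega> \<omega> \<longleftrightarrow>
     (\<exists>p. \<forall>q \<theta>. q \<in> frontier \<Omega> \<and> pi < \<theta> \<and> has_interior_angle \<Omega> q \<theta> \<longleftrightarrow> q = p \<and> \<theta> = \<omega>)"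


section \<open>Smooth functions, weak gradients and the space \<open>H\<^sub>0\<^sup>1\<close>\<close>

text \<open>Meant for open \<open>U\<close>.\<close>

fun Ck_on :: "nat \<Rightarrow> 'a::euclidean_space set \<Rightarrow> ('a \<Rightarrow> 'b::real_normed_vector) \<Rightarrow> bool" where
  "Ck_on 0 U f \<longleftrightarrow> continuous_on U f"
| "Ck_on (Suc k) U f \<longleftrightarrow> (\<forall>x\<in>U. f differentiable (at x)) \<and>
     (\<forall>i\<in>Basis. Ck_on k U (\<lambda>x. frechet_derivative f (at x) i))"

definition smooth_on :: "'a::euclidean_space set \<Rightarrow> ('a \<Rightarrow> 'b::real_normed_vector) \<Rightarrow> bool" where
  "smooth_on U f \<longleftrightarrow> (\<forall>k. Ck_on k U f)"

definition test_functions :: "plane set \<Rightarrow> (plane \<Rightarrow> real) set" where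
  "test_functions \<Omega> = {\<psi>. smooth_on UNIV \<psi> \<and>
     (\<exists>K. compact K \<and> K \<subseteq> \<Omega> \<and> (\<forall>x. x \<notin> K \<longrightarrow> \<psi> x = 0))}"

definition has_weak_gradient ::
    "plane set \<Rightarrow> (plane, real) L2 \<Rightarrow> (plane, plane) L2 \<Rightarrow> bool" where
  "has_weak_gradient \<Omega> v g \<longleftrightarrow> v \<in> L2_on \<Omega> \<and> g \<in> L2_on \<Omega> \<and>
     (\<forall>\<psi>\<in>test_functions \<Omega>. \<forall>i\<in>Basis.
        v \<bullet> L2_class \<Omega> (\<lambda>x. frechet_derivative \<psi> (at x) i) = - (g \<bullet> L2_class \<Omega> (\<lambda>x. \<psi> x *\<^sub>R i)))"

definition weak_gradient :: "plane set \<Rightarrow> (plane, real) L2 \<Rightarrow> (plane, plane) L2" where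
  "weak_gradient \<Omega> v = (THE g. has_weak_gradient \<Omega> v g)"

text \<open>The closure of the test functions in the \<open>H\<^sup>1(\<Omega>)\<close>-norm.\<close>

definition H10 :: "plane set \<Rightarrow> (plane, real) L2 set" where
  "H10 \<Omega> = {v. (\<exists>g. has_weak_gradient \<Omega> v g) \<and>
     (\<forall>\<epsilon>>0. \<exists>\<psi>\<in>test_functions \<Omega>.
        norm (v - L2_class \<Omega> \<psi>) < \<epsilon> \<and>
        norm (weak_gradient \<Omega> v - weak_gradient \<Omega> (L2_class \<Omega> \<psi>)) < \<epsilon>)}"


section \<open>The elliptic operator\<close>

text \<open>Smoothness of \<open>A\<close> is understood up to the boundary.\<close>

definition elliptic_coefficients ::
    "plane set \<Rightarrow> (plane \<Rightarrow> real^2^2) \<Rightarrow> (plane \<Rightarrow> real) \<Rightarrow> bool" where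
  "elliptic_coefficients \<Omega> A c \<longleftrightarrow>
     (\<exists>U. open U \<and> closure \<Omega> \<subseteq> U \<and> smooth_on U A) \<and>
     (\<forall>x\<in>\<Omega>. transpose (A x) = A x) \<and>
     (\<exists>a>0. \<forall>x\<in>\<Omega>. \<forall>\<xi>. a * (norm \<xi>)\<^sup>2 \<le> \<xi> \<bullet> (A x *v \<xi>)) \<and>
     c \<in> borel_measurable (lebesgue_on \<Omega>) \<and>
     (\<exists>M. AE x in lebesgue_on \<Omega>. c x \<le> M) \<and>
     (AE x in lebesgue_on \<Omega>. 0 \<le> c x)"

definition bilinear_form ::
    "plane set \<Rightarrow> (plane \<Rightarrow> real^2^2) \<Rightarrow> (plane \<Rightarrow> real) \<Rightarrow>
     (plane, real) L2 \<Rightarrow> (plane, real) L2 \<Rightarrow> real" where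
  "bilinear_form \<Omega> A c u v =
     (LINT x|lebesgue_on \<Omega>.
        (A x *v rep_L2 (weak_gradient \<Omega> u) x) \<bullet> rep_L2 (weak_gradient \<Omega> v) x) +
     (LINT x|lebesgue_on \<Omega>. c x * rep_L2 u x * rep_L2 v x)"

text \<open>With \<open>V = H10 \<Omega>\<close> this is the solution operator \<open>T\<close> of the Dirichlet problem, with a finite
  element space \<open>V\<close> its Galerkin approximation \<open>T\<^sub>h\<close>.\<close>

definition elliptic_solution ::
    "plane set \<Rightarrow> (plane \<Rightarrow> real^2^2) \<Rightarrow> (plane \<Rightarrow> real) \<Rightarrow>
     (plane, real) L2 set \<Rightarrow> (plane, real) L2 \<Rightarrow> (plane, real) L2" where
  "elliptic_solution \<Omega> A c V f = (THE w. w \<in> V \<and> (\<forall>v\<in>V. bilinear_form \<Omega> A c w v = f \<bullet> v))"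

definition dirichlet_eigensystem ::
    "plane set \<Rightarrow> (plane \<Rightarrow> real^2^2) \<Rightarrow> (plane \<Rightarrow> real) \<Rightarrow>
     (nat \<Rightarrow> real) \<Rightarrow> (nat \<Rightarrow> (plane, real) L2) \<Rightarrow> bool" where
  "dirichlet_eigensystem \<Omega> A c lam \<phi> \<longleftrightarrow>
     (\<forall>j. \<phi> j \<in> H10 \<Omega> \<and> (\<forall>v\<in>H10 \<Omega>. bilinear_form \<Omega> A c (\<phi> j) v = lam j * (\<phi> j \<bullet> v))) \<and>
     (\<forall>i j. \<phi> i \<bullet> \<phi> j = (if i = j then 1 else 0)) \<and>
     (\<forall>v\<in>L2_on \<Omega>. (\<lambda>j. (v \<bullet> \<phi> j) *\<^sub>R \<phi> j) sums v)"


section \<open>The spaces \<open>H\<^sup>r\<close> of Dirichlet type\<close>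

definition Hdot ::
    "plane set \<Rightarrow> (nat \<Rightarrow> real) \<Rightarrow> (nat \<Rightarrow> (plane, real) L2) \<Rightarrow> real \<Rightarrow> (plane, real) L2 set" where
  "Hdot \<Omega> lam \<phi> r = {v \<in> L2_on \<Omega>. summable (\<lambda>j. lam j powr r * (v \<bullet> \<phi> j)\<^sup>2)}"

definition Hdot_norm ::
    "(nat \<Rightarrow> real) \<Rightarrow> (nat \<Rightarrow> (plane, real) L2) \<Rightarrow> real \<Rightarrow> (plane, real) L2 \<Rightarrow> real" where
  "Hdot_norm lam \<phi> r v = sqrt (\<Sum>j. lam j powr r * (v \<bullet> \<phi> j)\<^sup>2)"

text \<open>The norm of the functional \<open>w \<mapsto> (f, w)\<close> in the dual space of \<^const>\<open>Hdot\<close>\<open> \<Omega> lam \<phi> r\<close>, for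
  \<open>f \<in> L\<^sup>2(\<Omega>)\<close>; for \<open>r = 0\<close> this is the norm of \<open>L\<^sup>2(\<Omega>)\<close>.\<close>

definition Hdot_dual_norm ::
    "plane set \<Rightarrow> (nat \<Rightarrow> real) \<Rightarrow> (nat \<Rightarrow> (plane, real) L2) \<Rightarrow> real \<Rightarrow> (plane, real) L2 \<Rightarrow> real" where
  "Hdot_dual_norm \<Omega> lam \<phi> r f = (SUP w\<in>{w \<in> Hdot \<Omega> lam \<phi> r. Hdot_norm lam \<phi> r w \<le> 1}. \<bar>f \<bullet> w\<bar>)"


section \<open>Finite element spaces\<close>

text \<open>\<^const>\<open>triangulation\<close> makes the partition finite and conforming (no hanging nodes).\<close>

definition triangular_mesh :: "plane set \<Rightarrow> plane set set \<Rightarrow> bool" where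
  "triangular_mesh \<Omega> \<T> \<longleftrightarrow> triangulation \<T> \<and> (\<forall>K\<in>\<T>. 2 simplex K) \<and> \<Union>\<T> = closure \<Omega>"

definition mesh_size :: "plane set set \<Rightarrow> real" where
  "mesh_size \<T> = Max (diameter ` \<T>)"

text \<open>Uniformly in the family, every triangle contains a disc of radius comparable with its
  diameter.\<close>

definition shape_regular_family :: "plane set set set \<Rightarrow> bool" where
  "shape_regular_family F \<longleftrightarrow>
     (\<exists>\<kappa>>0. \<forall>\<T>\<in>F. \<forall>K\<in>\<T>. \<exists>x. cball x (\<kappa> * diameter K) \<subseteq> K)"

definition fe_space :: "plane set \<Rightarrow> plane set set \<Rightarrow> (plane, real) L2 set" where
  "fe_space \<Omega> \<T> = {L2_class \<Omega> v | v. continuous_on (closure \<Omega>) v \<and>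
     (\<forall>K\<in>\<T>. \<exists>a b. \<forall>x\<in>K. v x = a \<bullet> x + b) \<and> (\<forall>x\<in>frontier \<Omega>. v x = 0)}"

definition L2_projection ::
    "(plane, real) L2 set \<Rightarrow> (plane, real) L2 \<Rightarrow> (plane, real) L2" where
  "L2_projection V f = (THE w. w \<in> V \<and> (\<forall>v\<in>V. (w - f) \<bullet> v = 0))"


section \<open>The Caputo derivative and the evolution problems\<close>

definition frac_kernel :: "real \<Rightarrow> real \<Rightarrow> real" where
  "frac_kernel \<nu> t = t powr (\<nu> - 1) / Gamma \<nu>"

text \<open>The form \<open>d/dt \<integral>\<^sub>0\<^sup>t \<omega>\<^bsub>1-\<alpha>\<^esub>(t - s) (u(s) - u(0)) ds\<close>, which needs no differentiability of \<open>u\<close>; the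
  derivative is one-sided at \<open>t = T\<close>. For \<open>L\<^sup>2\<close>-valued \<open>u\<close> both integral and derivative are
  those of the normed space \<^typ>\<open>(plane, real) L2\<close>.\<close>

definition has_caputo_derivative ::
    "real \<Rightarrow> real \<Rightarrow> (real \<Rightarrow> 'b::real_normed_vector) \<Rightarrow> 'b \<Rightarrow> real \<Rightarrow> bool" where
  "has_caputo_derivative \<alpha> T u w t \<longleftrightarrow>
     ((\<lambda>r. integral {0..r} (\<lambda>s. frac_kernel (1 - \<alpha>) (r - s) *\<^sub>R (u s - u 0)))
        has_vector_derivative w) (at t within {0..T})"

definition weak_solution ::
    "plane set \<Rightarrow> (plane \<Rightarrow> real^2^2) \<Rightarrow> (plane \<Rightarrow> real) \<Rightarrow>
     (nat \<Rightarrow> real) \<Rightarrow> (nat \<Rightarrow> (plane, real) L2) \<Rightarrow> real \<Rightarrow> real \<Rightarrow>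
     (plane, real) L2 \<Rightarrow> (real \<Rightarrow> (plane, real) L2) \<Rightarrow> bool" where
  "weak_solution \<Omega> A c lam \<phi> \<alpha> T u0 u \<longleftrightarrow>
     continuous_on {0..T} u \<and> (\<forall>t\<in>{0..T}. u t \<in> L2_on \<Omega>) \<and>
     (\<forall>t\<in>{0<..T}. u t \<in> Hdot \<Omega> lam \<phi> 2 \<and>
        ((\<lambda>s. Hdot_norm lam \<phi> 2 (u s - u t)) \<longlongrightarrow> 0) (at t within {0<..T})) \<and>
     u 0 = u0 \<and>
     (\<forall>t\<in>{0<..T}. u t \<in> H10 \<Omega>) \<and>
     (\<exists>w. continuous_on {0<..T} w \<and>
        (\<forall>t\<in>{0<..T}. has_caputo_derivative \<alpha> T u (w t) t \<and>
           (\<forall>v\<in>H10 \<Omega>. w t \<bullet> v + bilinear_form \<Omega> A c (u t) v = 0)))"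

definition semidiscrete_solution ::
    "plane set \<Rightarrow> (plane \<Rightarrow> real^2^2) \<Rightarrow> (plane \<Rightarrow> real) \<Rightarrow> plane set set \<Rightarrow> real \<Rightarrow> real \<Rightarrow>
     (plane, real) L2 \<Rightarrow> (real \<Rightarrow> (plane, real) L2) \<Rightarrow> bool" where
  "semidiscrete_solution \<Omega> A c \<T> \<alpha> T u0 uh \<longleftrightarrow>
     continuous_on {0..T} uh \<and> (\<forall>t\<in>{0<..T}. uh t \<in> fe_space \<Omega> \<T>) \<and>
     uh 0 = L2_projection (fe_space \<Omega> \<T>) u0 \<and>
     (\<forall>t\<in>{0<..T}. \<exists>w. has_caputo_derivative \<alpha> T uh w t \<and>
        (\<forall>v\<in>fe_space \<Omega> \<T>. w \<bullet> v + bilinear_form \<Omega> A c (uh t) v = 0))"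

text \<open>The elliptic finite element error estimate, uniform over a family \<open>F\<close> of meshes.\<close>

definition fe_error_estimate ::
    "plane set \<Rightarrow> (plane \<Rightarrow> real^2^2) \<Rightarrow> (plane \<Rightarrow> real) \<Rightarrow>
     (nat \<Rightarrow> real) \<Rightarrow> (nat \<Rightarrow> (plane, real) L2) \<Rightarrow> plane set set set \<Rightarrow> real \<Rightarrow> real \<Rightarrow> bool" where
  "fe_error_estimate \<Omega> A c lam \<phi> F \<beta> s \<longleftrightarrow>
     (\<exists>C. \<forall>\<T>\<in>F. \<forall>f\<in>L2_on \<Omega>.
        let Tf = elliptic_solution \<Omega> A c (H10 \<Omega>) f;
            Thf = elliptic_solution \<Omega> A c (fe_space \<Omega> \<T>) f;
            h = mesh_size \<T>
        in norm (Thf - Tf) + h powr \<beta> * norm (weak_gradient \<Omega> (Thf - Tf))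
             \<le> C * h powr (2 * \<beta>) * Hdot_dual_norm \<Omega> lam \<phi> (1 - s) f)"

end

theory Submission
  imports Defs "HOL-Real_Asymp.Real_Asymp"
begin

text \<open>Write \<open>w\<close> for the Caputo derivative of \<open>u\<close>, so that \<open>u(t) = T(- w(t))\<close> with the
solution operator \<open>T\<close> of the Dirichlet problem, and compare the error \<open>e = u\<^sub>h - u\<close> with
\<open>\<rho>(t) = T\<^sub>h (- w(t)) - u(t)\<close>. Since \<open>\<rho>\<close> is the error of an elliptic finite element
problem, the elliptic estimate bounds it by \<open>h\<close> to the power \<open>2\<beta>\<close> times the norm of
\<open>w(t)\<close> in the dual of the space of order \<open>1 - s\<close>.

\<^item> \<^emph>\<open>Size and variation of \<open>\<rho>\<close>.\<close> Against a Dirichlet eigenfunction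
  \<open>u\<close> solves a scalar equation, whose solution is a multiple of the relaxation function \<open>E\<close> (a
  Mittag-Leffler function of \<open>- \<lambda> t\<^sup>\<alpha>\<close>), see \<open>caputo_homogeneous_solution\<close>.
  Put \<open>\<theta> = (1 + s - \<delta>) / 2\<close>, which lies between 0 and 1. The bounds
  \<open>relaxation_smoothing\<close> and \<open>relaxation_difference_smoothing\<close> for \<open>\<lambda>\<close> to the
  power \<open>\<theta>\<close> times \<open>E(t)\<close> and times \<open>E(r) - E(t)\<close> then show, mode by mode, that
  \<open>\<rho>(t)\<close> is of size \<open>t\<close> to the power \<open>- \<alpha> \<theta>\<close>, and that
  \<open>\<rho>(r) - \<rho>(t)\<close> gains a factor \<open>(t - r) / r\<close>.

\<^item> \<^emph>\<open>The part of \<open>e\<close> outside the finite element space.\<close> As \<open>e - \<rho> =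
  u\<^sub>h - T\<^sub>h (- w)\<close> lies in \<open>V\<^sub>h\<close>, the distance of \<open>e\<close> from
  \<open>V\<^sub>h\<close> is at most the norm of \<open>\<rho>\<close>.

\<^item> \<^emph>\<open>The part of \<open>e\<close> inside.\<close> Let \<open>\<psi>\<^sub>i\<close> be an orthonormal
  basis of \<open>V\<^sub>h\<close> of eigenvectors of the bilinear form, with eigenvalues \<open>\<Lambda>\<^sub>i\<close>
  (\<open>eigenbasis_exists\<close>). The components \<open>e\<^sub>i\<close> and \<open>\<rho>\<^sub>i\<close> satisfy the
  scalar equation \<open>\<partial>\<^sup>\<alpha> e\<^sub>i + \<Lambda>\<^sub>i e\<^sub>i = \<Lambda>\<^sub>i
  \<rho>\<^sub>i\<close> with \<open>e\<^sub>i(0) = 0\<close>, so \<open>e\<^sub>i\<close> is the convolution of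
  \<open>\<rho>\<^sub>i\<close> with the resolvent kernel \<open>k = - E'\<close> for \<open>\<Lambda>\<^sub>i\<close>.
  Uniformly in \<open>\<Lambda>\<^sub>i\<close>, hence in the mesh, this kernel is positive, has mass at most 1 and is at
  most \<open>\<alpha> / t\<close>. On the first half of \<open>{0..t}\<close> the kernel is at most \<open>2 / t\<close> and
  the singularity of \<open>\<rho>\<close> at 0 is integrable because \<open>\<alpha> \<theta> < 1\<close>; on the second
  half \<open>\<rho>(s) = \<rho>(t) + (\<rho>(s) - \<rho>(t))\<close>, where the first term meets only the mass of the
  kernel, and the factor \<open>t - s\<close> in the bound of the second one cancels its singularity. This is
  \<open>convolution_error_bound\<close>. It works with the integrated identity \<open>\<integral>\<^sub>0\<^sup>t e\<^sub>i
  = \<integral>\<^sub>0\<^sup>t (1 - E(t - s)) \<rho>\<^sub>i(s) ds\<close> of \<open>caputo_solution_integrated\<close> and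
  difference quotients in \<open>t\<close>, because the equation only determines a derivative of a fractional integral of
  \<open>e\<^sub>i\<close>.

The kernel bounds rest on convolution identities for Mittag-Leffler kernels, obtained by integrating power series term by
term, and on the positivity of \<open>k\<close>, which follows from its Volterra equation. To take components under the
vector-valued fractional integral one needs the integrand to be integrable, and for that the completeness of
\<open>L\<^sup>2\<close>. To use the bilinear form on \<open>V\<^sub>h\<close>, weak gradients must be unique, which is the
fundamental lemma of the calculus of variations, and the form must be positive definite on \<open>V\<^sub>h\<close>. For the
latter, finite element functions are shown to be Lipschitz after extension by zero, hence to have weak gradients and to
satisfy a Poincare inequality.\<close>

section \<open>Mittag-Leffler kernels and fractional convolutions\<close>

text \<open>Log-convexity of Gamma between \<open>z + \<alpha>\<close> and \<open>z + \<alpha> + 1\<close>, evaluated at \<open>z +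
1\<close>. It says that \<open>Gamma z / Gamma (z + \<alpha>)\<close> decays like a negative power of \<open>z\<close>, which
makes the Mittag-Leffler series entire by the ratio test.\<close>

lemma Gamma_shift_lower_bound:
  assumes "z > (0::real)" "0 < \<alpha>" "\<alpha> < 1"
  shows "Gamma z * z \<le> Gamma (z + \<alpha>) * (z + \<alpha>) powr (1 - \<alpha>)"
proof -
  have "(ln \<circ> Gamma) ((1 - \<alpha>) *\<^sub>R (z + \<alpha> + 1) + \<alpha> *\<^sub>R (z + \<alpha>))
      \<le> (1 - \<alpha>) * (ln \<circ> Gamma) (z + \<alpha> + 1) + \<alpha> * (ln \<circ> Gamma) (z + \<alpha>)"
    using assms by (intro convex_onD[OF log_convex_Gamma_real]) auto
  also have "(1 - \<alpha>) *\<^sub>R (z + \<alpha> + 1) + \<alpha> *\<^sub>R (z + \<alpha>) = z + 1"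
    by (simp add: algebra_simps)
  finally have "ln (Gamma (z + 1)) \<le> (1 - \<alpha>) * ln (Gamma (z + \<alpha> + 1)) + \<alpha> * ln (Gamma (z + \<alpha>))"
    by simp
  also have "Gamma (z + \<alpha> + 1) = (z + \<alpha>) * Gamma (z + \<alpha>)"
    using assms by (intro Gamma_plus1) (auto elim!: nonpos_Ints_cases)
  also have "(1 - \<alpha>) * ln ((z + \<alpha>) * Gamma (z + \<alpha>)) + \<alpha> * ln (Gamma (z + \<alpha>))
      = ln (Gamma (z + \<alpha>) * (z + \<alpha>) powr (1 - \<alpha>))"
  proof -
    have g: "Gamma (z + \<alpha>) > 0" "z + \<alpha> > 0" using assms by auto
    have "ln ((z + \<alpha>) * Gamma (z + \<alpha>)) = ln (z + \<alpha>) + ln (Gamma (z + \<alpha>))"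
      using g by (intro ln_mult_pos) auto
    moreover have "ln (Gamma (z + \<alpha>) * (z + \<alpha>) powr (1 - \<alpha>))
        = ln (Gamma (z + \<alpha>)) + (1 - \<alpha>) * ln (z + \<alpha>)"
    proof -
      have "ln (Gamma (z + \<alpha>) * (z + \<alpha>) powr (1 - \<alpha>))
          = ln (Gamma (z + \<alpha>)) + ln ((z + \<alpha>) powr (1 - \<alpha>))"
        using g by (intro ln_mult_pos) auto
      then show ?thesis by (simp add: ln_powr)
    qed
    ultimately show ?thesis by (simp only:) (simp add: left_diff_distrib distrib_left)
  qed
  finally have "Gamma (z + 1) \<le> Gamma (z + \<alpha>) * (z + \<alpha>) powr (1 - \<alpha>)"
    using assms by (subst (asm) ln_le_cancel_iff) auto
  moreover have "Gamma (z + 1) = z * Gamma z"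
    using assms by (intro Gamma_plus1) (auto elim!: nonpos_Ints_cases)
  ultimately show ?thesis by (simp add: mult.commute)
qed

definition mittag_leffler :: "real \<Rightarrow> real \<Rightarrow> real \<Rightarrow> real" where
  "mittag_leffler \<alpha> b x = (\<Sum>n. inverse (Gamma (\<alpha> * real n + b)) * x ^ n)"

lemma summable_mittag_leffler:
  assumes "0 < \<alpha>" "\<alpha> < 1" "b > 0"
  shows "summable (\<lambda>n. inverse (Gamma (\<alpha> * real n + b)) * x ^ n)"
proof -
  have "eventually (\<lambda>n. \<bar>x\<bar> * (\<alpha> * real n + b + \<alpha>) powr (1 - \<alpha>) / (\<alpha> * real n + b) \<le> 1/2) at_top"
  proof -
    have "((\<lambda>n. \<bar>x\<bar> * (\<alpha> * real n + b + \<alpha>) powr (1 - \<alpha>) / (\<alpha> * real n + b)) \<longlongrightarrow> 0) at_top"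
      using assms by real_asymp
    then show ?thesis by (rule order_tendstoD(2)[of _ _ _ "1/2", THEN eventually_mono]) auto
  qed
  then obtain N where N: "\<And>n. n \<ge> N \<Longrightarrow> \<bar>x\<bar> * (\<alpha> * real n + b + \<alpha>) powr (1 - \<alpha>) / (\<alpha> * real n + b) \<le> 1/2"
    by (auto simp: eventually_at_top_linorder)
  show ?thesis
  proof (rule summable_ratio_test[of "1/2" N])
    fix n assume "n \<ge> N"
    define z where "z = \<alpha> * real n + b"
    have z: "z > 0" using assms by (auto simp: z_def add_nonneg_pos)
    have g: "Gamma z > 0" "Gamma (z + \<alpha>) > 0" using z assms by auto
    have "inverse (Gamma (z + \<alpha>)) \<le> (z + \<alpha>) powr (1 - \<alpha>) / z * inverse (Gamma z)"
      using Gamma_shift_lower_bound[OF z assms(1,2)] z g by (simp add: field_simps)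
    then have "\<bar>x\<bar> * inverse (Gamma (z + \<alpha>)) \<le> (\<bar>x\<bar> * (z + \<alpha>) powr (1 - \<alpha>) / z) * inverse (Gamma z)"
      using mult_left_mono[of _ _ "\<bar>x\<bar>"] by (force simp: mult.assoc)
    also have "\<dots> \<le> 1/2 * inverse (Gamma z)"
      using N[OF \<open>n \<ge> N\<close>] g by (intro mult_right_mono) (auto simp: z_def)
    finally have "\<bar>x\<bar> ^ n * (\<bar>x\<bar> * inverse (Gamma (z + \<alpha>))) \<le> \<bar>x\<bar> ^ n * (1/2 * inverse (Gamma z))"
      by (intro mult_left_mono) auto
    then show "norm (inverse (Gamma (\<alpha> * real (Suc n) + b)) * x ^ Suc n)
        \<le> 1/2 * norm (inverse (Gamma (\<alpha> * real n + b)) * x ^ n)"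
      using g by (simp add: abs_mult power_abs z_def algebra_simps)
  qed simp
qed

lemma summable_abs_mittag_leffler:
  assumes "0 < \<alpha>" "\<alpha> < 1" "b > 0"
  shows "summable (\<lambda>n. \<bar>inverse (Gamma (\<alpha> * real n + b)) * x ^ n\<bar>)"
proof -
  have "Gamma (\<alpha> * real n + b) > 0" for n
    using assms by (intro Gamma_real_pos) (auto simp: add_nonneg_pos)
  then show ?thesis
    using summable_mittag_leffler[OF assms, of "\<bar>x\<bar>"] by (simp add: abs_mult power_abs abs_of_pos)
qed

lemma continuous_on_mittag_leffler:
  assumes "0 < \<alpha>" "\<alpha> < 1" "b > 0"
  shows "continuous_on S (mittag_leffler \<alpha> b)"
proof -
  have "isCont (mittag_leffler \<alpha> b) x" for x
    unfolding mittag_leffler_def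
    using termdiffs_strong_converges_everywhere[OF summable_mittag_leffler[OF assms]]
    by (rule DERIV_isCont)
  then show ?thesis by (simp add: continuous_at_imp_continuous_on)
qed

text \<open>Integration of a series term by term. The functions \<open>f n\<close> are nonnegative and the signs are kept in the
coefficients \<open>c n\<close>: the integrals of the absolute values are then \<open>\<bar>c n\<bar> * I n\<close>, so
absolute convergence of the series of integrals can be read off from the final formula itself.\<close>

lemma has_integral_suminf_nonneg:
  fixes f :: "nat \<Rightarrow> real \<Rightarrow> real"
  assumes f: "\<And>n. (f n has_integral I n) S"
    and nonneg: "\<And>n x. x \<in> S \<Longrightarrow> f n x \<ge> 0"
    and sm: "summable (\<lambda>n. \<bar>c n\<bar> * I n)"
    and pt: "\<And>x. x \<in> S \<Longrightarrow> summable (\<lambda>n. \<bar>c n * f n x\<bar>)"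
  shows "((\<lambda>x. \<Sum>n. c n * f n x) has_integral (\<Sum>n. c n * I n)) S"
proof -
  have fa: "f n absolutely_integrable_on S" for n
    using f nonneg by (intro nonnegative_absolutely_integrable_1) (auto simp: has_integral_iff)
  have lf: "set_lebesgue_integral lebesgue S (f n) = I n" for n
    using set_lebesgue_integral_eq_integral(2)[OF fa] f by (simp add: integral_unique)
  have ia: "integrable lebesgue (\<lambda>x. c n * (indicator S x * f n x))" for n
    using fa[of n] by (auto simp: set_integrable_def)
  have eq: "norm (c n * (indicator S x * f n x)) = \<bar>c n\<bar> * (indicator S x * f n x)" for n x
    using nonneg by (auto simp: abs_mult indicator_def)
  have li: "(LINT x|lebesgue. indicator S x * f n x) = I n" for n
    using lf[of n] by (simp add: set_lebesgue_integral_def)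
  have ae: "AE x in lebesgue. summable (\<lambda>n. norm (c n * (indicator S x * f n x)))"
    using pt by (intro AE_I2) (auto simp: indicator_def)
  have sm': "summable (\<lambda>n. LINT x|lebesgue. norm (c n * (indicator S x * f n x)))"
    unfolding eq using sm by (simp add: li)
  have "(LINT x|lebesgue. (\<Sum>n. c n * (indicator S x * f n x))) = (\<Sum>n. LINT x|lebesgue. c n * (indicator S x * f n x))"
    by (rule integral_suminf[OF ia ae sm'])
  moreover have "integrable lebesgue (\<lambda>x. \<Sum>n. c n * (indicator S x * f n x))"
    by (rule integrable_suminf[OF ia ae sm'])
  moreover have "(\<Sum>n. c n * (indicator S x * f n x)) = indicator S x *\<^sub>R (\<Sum>n. c n * f n x)" for x
    by (auto simp: indicator_def)
  ultimately have "set_integrable lebesgue S (\<lambda>x. \<Sum>n. c n * f n x)"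
     "set_lebesgue_integral lebesgue S (\<lambda>x. \<Sum>n. c n * f n x) = (\<Sum>n. c n * I n)"
    by (auto simp: set_integrable_def set_lebesgue_integral_def li)
  then show ?thesis
    using set_lebesgue_integral_eq_integral[of S "\<lambda>x. \<Sum>n. c n * f n x"]
    by (metis has_integral_integral)
qed

lemma frac_kernel_nonneg: "\<nu> > 0 \<Longrightarrow> frac_kernel \<nu> t \<ge> 0"
  by (simp add: frac_kernel_def)

text \<open>The semigroup property of fractional integration, which is Euler's Beta integral after rescaling to the unit interval.\<close>

lemma has_integral_frac_kernel_convolution:
  assumes a: "a > 0" and b: "b > 0" and t: "t > 0"
  shows "((\<lambda>s. frac_kernel a (t - s) * frac_kernel b s) has_integral frac_kernel (a + b) t) {0..t}"
proof -
  have "((\<lambda>x. x powr (b - 1) * (1 - x) powr (a - 1)) has_integral Beta b a) (cbox 0 1)"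
    using has_integral_Beta_real[OF b a] by simp
  from has_integral_affinity'[OF this, of "1 / t" 0] t
  have "((\<lambda>x. (x / t) powr (b - 1) * (1 - x / t) powr (a - 1)) has_integral (Beta b a * t)) {0..t}"
    by (simp add: field_simps)
  from has_integral_mult_right[OF this, of "t powr (a - 1) * t powr (b - 1) / (Gamma a * Gamma b)"]
  have "((\<lambda>x. t powr (a - 1) * t powr (b - 1) / (Gamma a * Gamma b) *
      ((x / t) powr (b - 1) * (1 - x / t) powr (a - 1)))
      has_integral t powr (a - 1) * t powr (b - 1) / (Gamma a * Gamma b) * (Beta b a * t)) {0..t}" .
  also have "?this \<longleftrightarrow> ?thesis"
  proof -
    have "t powr (a - 1) * t powr (b - 1) / (Gamma a * Gamma b) *
        ((x / t) powr (b - 1) * (1 - x / t) powr (a - 1)) = frac_kernel a (t - x) * frac_kernel b x"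
      if "x \<in> {0..t}" for x
    proof -
      have 1: "t powr (a - 1) * (1 - x / t) powr (a - 1) = (t - x) powr (a - 1)"
        using that t by (subst powr_mult[symmetric]) (auto simp: right_diff_distrib)
      have 2: "t powr (b - 1) * (x / t) powr (b - 1) = x powr (b - 1)"
        using that t by (subst powr_mult[symmetric]) (auto simp: field_simps)
      show ?thesis unfolding frac_kernel_def 1[symmetric] 2[symmetric] by (simp add: field_simps)
    qed
    moreover have "t powr (a - 1) * t powr (b - 1) / (Gamma a * Gamma b) * (Beta b a * t)
        = frac_kernel (a + b) t"
    proof -
      have "t powr (a - 1) * t powr (b - 1) * t = t powr (a + b - 1)"
      proof -
        have "t powr (a - 1) * t powr (b - 1) * t powr 1 = t powr ((a - 1) + (b - 1) + 1)"
          by (simp only: powr_add)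
        also have "(a - 1) + (b - 1) + 1 = a + b - 1" by simp
        finally show ?thesis using t by simp
      qed
      moreover have "Gamma a > 0" "Gamma b > 0" using a b by auto
      ultimately show ?thesis
        by (simp add: frac_kernel_def Beta_def field_simps)
    qed
    ultimately show ?thesis using has_integral_cong[of "{0..t}"] by (smt (verit, best))
  qed
  finally show ?thesis .
qed

text \<open>As a series of fractional kernels this is the sum over \<open>n\<close> of \<open>(- lam) ^ n * frac_kernel (\<alpha> * n +
b)\<close> (see \<open>ml_kernel_sums\<close>), that is, the function with Laplace transform \<open>z\<^sup>\<alpha>
z\<^sup>-\<^sup>b / (z\<^sup>\<alpha> + lam)\<close>. The identities for convolutions below are products of such transforms.\<close>

definition ml_kernel :: "real \<Rightarrow> real \<Rightarrow> real \<Rightarrow> real \<Rightarrow> real" where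
  "ml_kernel \<alpha> lam b t = t powr (b - 1) * mittag_leffler \<alpha> b (- lam * t powr \<alpha>)"

lemma frac_kernel_add_multiple:
  assumes "t > 0"
  shows "frac_kernel (\<alpha> * real n + b) t = t powr (b - 1) * (inverse (Gamma (\<alpha> * real n + b)) * (t powr \<alpha>) ^ n)"
proof -
  have "(t powr \<alpha>) ^ n = t powr (\<alpha> * real n)"
    using assms by (simp add: powr_powr powr_realpow[symmetric])
  moreover have "t powr (\<alpha> * real n + b - 1) = t powr (b - 1) * t powr (\<alpha> * real n)"
    by (simp add: powr_add[symmetric] algebra_simps)
  ultimately show ?thesis by (simp add: frac_kernel_def divide_inverse)
qed

lemma summable_abs_ml_kernel:
  assumes "0 < \<alpha>" "\<alpha> < 1" "b > 0" "t \<ge> 0"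
  shows "summable (\<lambda>n. \<bar>(- lam) ^ n * frac_kernel (\<alpha> * real n + b) t\<bar>)"
proof (cases "t > 0")
  case True
  have "summable (\<lambda>n. t powr (b - 1) * \<bar>inverse (Gamma (\<alpha> * real n + b)) * (- lam * t powr \<alpha>) ^ n\<bar>)"
    by (intro summable_mult summable_abs_mittag_leffler assms)
  then show ?thesis
    unfolding frac_kernel_add_multiple[OF True] power_mult_distrib abs_mult
    by (simp add: abs_mult power_abs mult_ac)
next
  case False
  then show ?thesis using assms by (simp add: frac_kernel_def)
qed

lemma ml_kernel_sums:
  assumes "0 < \<alpha>" "\<alpha> < 1" "b > 0" "t \<ge> 0"
  shows "(\<lambda>n. (- lam) ^ n * frac_kernel (\<alpha> * real n + b) t) sums ml_kernel \<alpha> lam b t"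
proof (cases "t = 0")
  case True
  then show ?thesis by (simp add: frac_kernel_def ml_kernel_def)
next
  case False
  then have t: "t > 0" using assms by simp
  have "(\<lambda>n. t powr (b - 1) * (inverse (Gamma (\<alpha> * real n + b)) * (- lam * t powr \<alpha>) ^ n))
      sums ml_kernel \<alpha> lam b t"
    unfolding ml_kernel_def mittag_leffler_def
    by (intro sums_mult summable_sums summable_mittag_leffler assms)
  then show ?thesis
    unfolding frac_kernel_add_multiple[OF t] power_mult_distrib by (simp only: mult_ac)
qed

lemma frac_kernel_convolution_ml_kernel:
  assumes \<alpha>: "0 < \<alpha>" "\<alpha> < 1" and a: "a > 0" and b: "b > 0" and t: "t > 0"
  shows "((\<lambda>s. frac_kernel a (t - s) * ml_kernel \<alpha> lam b s) has_integral ml_kernel \<alpha> lam (a + b) t) {0..t}"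
proof -
  have pos: "\<alpha> * real n + b > 0" for n using assms by (intro add_nonneg_pos) auto
  have h1: "((\<lambda>s. \<Sum>n. (- lam) ^ n * (frac_kernel a (t - s) * frac_kernel (\<alpha> * real n + b) s))
      has_integral (\<Sum>n. (- lam) ^ n * frac_kernel (\<alpha> * real n + (a + b)) t)) {0..t}"
  proof (rule has_integral_suminf_nonneg)
    fix n
    show "((\<lambda>s. frac_kernel a (t - s) * frac_kernel (\<alpha> * real n + b) s)
        has_integral frac_kernel (\<alpha> * real n + (a + b)) t) {0..t}"
      using has_integral_frac_kernel_convolution[OF a pos t, of n] by (simp add: add_ac)
    show "frac_kernel a (t - s) * frac_kernel (\<alpha> * real n + b) s \<ge> 0" for s
      using frac_kernel_nonneg[OF a] frac_kernel_nonneg[OF pos] by simp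
  next
    have "0 \<le> frac_kernel (\<alpha> * real n + (a + b)) t" for n
      using assms by (intro frac_kernel_nonneg add_nonneg_pos) auto
    then show "summable (\<lambda>n. \<bar>(- lam) ^ n\<bar> * frac_kernel (\<alpha> * real n + (a + b)) t)"
      using summable_abs_ml_kernel[OF \<alpha>, of "a + b" t lam] a b t by (simp add: abs_mult)
  next
    fix s assume s: "s \<in> {0..t}"
    have "summable (\<lambda>n. \<bar>frac_kernel a (t - s)\<bar> * \<bar>(- lam) ^ n * frac_kernel (\<alpha> * real n + b) s\<bar>)"
      using s by (intro summable_mult summable_abs_ml_kernel \<alpha> b) auto
    then show "summable (\<lambda>n. \<bar>(- lam) ^ n * (frac_kernel a (t - s) * frac_kernel (\<alpha> * real n + b) s)\<bar>)"
      by (simp add: abs_mult mult_ac)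
  qed
  have h2: "(\<Sum>n. (- lam) ^ n * (frac_kernel a (t - s) * frac_kernel (\<alpha> * real n + b) s))
      = frac_kernel a (t - s) * ml_kernel \<alpha> lam b s" if "s \<in> {0..t}" for s
    using sums_mult[OF ml_kernel_sums[OF \<alpha> b, of s lam], of "frac_kernel a (t - s)"] that
    by (simp add: sums_iff mult_ac)
  have h3: "(\<Sum>n. (- lam) ^ n * frac_kernel (\<alpha> * real n + (a + b)) t) = ml_kernel \<alpha> lam (a + b) t"
    using ml_kernel_sums[OF \<alpha>, of "a + b" t lam] a b t by (simp add: sums_iff)
  show ?thesis using has_integral_eq[OF h2 h1] unfolding h3 by simp
qed

lemma ml_kernel_shift:
  assumes \<alpha>: "0 < \<alpha>" "\<alpha> < 1" and b: "b > 0" and t: "t \<ge> 0"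
  shows "ml_kernel \<alpha> lam b t = frac_kernel b t - lam * ml_kernel \<alpha> lam (b + \<alpha>) t"
proof -
  have "(\<lambda>n. - lam * ((- lam) ^ n * frac_kernel (\<alpha> * real n + (b + \<alpha>)) t)) sums
      (- lam * ml_kernel \<alpha> lam (b + \<alpha>) t)"
    using assms by (intro sums_mult ml_kernel_sums) auto
  then have "(\<lambda>n. (- lam) ^ Suc n * frac_kernel (\<alpha> * real (Suc n) + b) t) sums
      (- lam * ml_kernel \<alpha> lam (b + \<alpha>) t)"
    by (simp add: algebra_simps)
  then have "(\<lambda>n. (- lam) ^ n * frac_kernel (\<alpha> * real n + b) t) sums
      (- lam * ml_kernel \<alpha> lam (b + \<alpha>) t + frac_kernel b t)"
    by (subst (asm) sums_Suc_iff) (simp add: algebra_simps)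
  then show ?thesis
    using ml_kernel_sums[OF \<alpha> b t, of lam] sums_unique2 by fastforce
qed

text \<open>On the Laplace side the left-hand side is the product of \<open>1 / (z\<^sup>\<alpha> + lam)\<close> and
\<open>z\<^sup>\<alpha> z\<^sup>-\<^sup>1 / (z\<^sup>\<alpha> + lam)\<close>, which is \<open>- 1 / \<alpha>\<close> times
the derivative of \<open>1 / (z\<^sup>\<alpha> + lam)\<close>; this explains the factor \<open>t / \<alpha>\<close>. The
proof multiplies the two series. All \<open>n + 1\<close> terms of order \<open>n\<close> of the Cauchy product integrate to
the same kernel, and \<open>n + 1\<close> combines with its Gamma factor \<open>Gamma (\<alpha> * n + \<alpha> + 1)\<close>
to \<open>Gamma (\<alpha> * n + \<alpha>) * \<alpha>\<close>.\<close>

lemma ml_kernel_convolution: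
  assumes \<alpha>: "0 < \<alpha>" "\<alpha> < 1" and t: "t > 0"
  shows "((\<lambda>s. ml_kernel \<alpha> lam \<alpha> (t - s) * ml_kernel \<alpha> lam 1 s) has_integral (t * ml_kernel \<alpha> lam \<alpha> t / \<alpha>)) {0..t}"
proof -
  define w where "w i s = frac_kernel (\<alpha> * real i + \<alpha>) s" for i s
  define v where "v i s = frac_kernel (\<alpha> * real i + 1) s" for i s
  define c where "c i = (- lam) ^ i" for i :: nat
  have posa: "\<alpha> * real n + \<alpha> > 0" and pos1: "\<alpha> * real n + 1 > 0" for n
    using assms by (auto intro!: add_nonneg_pos)
  have w0: "w i s \<ge> 0" and v0: "v i s \<ge> 0" for i s
    using frac_kernel_nonneg[OF posa] frac_kernel_nonneg[OF pos1] by (auto simp: w_def v_def)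
  have sw: "(\<lambda>n. c n * w n s) sums ml_kernel \<alpha> lam \<alpha> s" "summable (\<lambda>n. \<bar>c n * w n s\<bar>)" if "s \<ge> 0" for s
    unfolding c_def w_def using ml_kernel_sums[OF \<alpha> \<alpha>(1) that] summable_abs_ml_kernel[OF \<alpha> \<alpha>(1) that] by auto
  have sv: "(\<lambda>n. c n * v n s) sums ml_kernel \<alpha> lam 1 s" "summable (\<lambda>n. \<bar>c n * v n s\<bar>)" if "s \<ge> 0" for s
    unfolding c_def v_def using ml_kernel_sums[OF \<alpha> _ that, of 1] summable_abs_ml_kernel[OF \<alpha> _ that, of 1] by auto
  define f where "f n s = (\<Sum>i\<le>n. w i (t - s) * v (n - i) s)" for n s
  have I: "real (Suc n) * frac_kernel (\<alpha> * real n + (\<alpha> + 1)) t = t * w n t / \<alpha>" for n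
  proof -
    have "Gamma (\<alpha> * real n + \<alpha> + 1) = (\<alpha> * real n + \<alpha>) * Gamma (\<alpha> * real n + \<alpha>)"
      using posa[of n] by (intro Gamma_plus1) (auto elim!: nonpos_Ints_cases)
    moreover have "t powr (\<alpha> * real n + \<alpha>) = t * t powr (\<alpha> * real n + \<alpha> - 1)"
      using t by (simp add: powr_mult_base)
    moreover have "real (Suc n) * (t * X) / ((\<alpha> * real n + \<alpha>) * G) = t * (X / G) / \<alpha>" if "G > 0" for X G
    proof -
      have "\<alpha> * real n + \<alpha> = \<alpha> * real (Suc n)" by (simp add: algebra_simps)
      then show ?thesis using that \<alpha> by (simp only:) (simp add: divide_simps)
    qed
    ultimately show ?thesis using posa[of n]
      by (simp add: w_def frac_kernel_def add.assoc[symmetric])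
  qed
  have cf: "c n * f n s = (\<Sum>i\<le>n. (c i * w i (t - s)) * (c (n - i) * v (n - i) s))" for n s
    unfolding f_def sum_distrib_left
  proof (intro sum.cong refl)
    fix i assume "i \<in> {..n}"
    then have "c n = c i * c (n - i)" by (simp add: c_def flip: power_add)
    then show "c n * (w i (t - s) * v (n - i) s) = (c i * w i (t - s)) * (c (n - i) * v (n - i) s)" by simp
  qed
  have acf: "\<bar>c n * f n s\<bar> = (\<Sum>i\<le>n. \<bar>c i * w i (t - s)\<bar> * \<bar>c (n - i) * v (n - i) s\<bar>)" for n s
  proof -
    have "\<bar>c n * f n s\<bar> = \<bar>c n\<bar> * f n s"
      unfolding f_def using w0 v0 by (simp add: abs_mult sum_nonneg)
    also have "\<dots> = (\<Sum>i\<le>n. \<bar>c i * w i (t - s)\<bar> * \<bar>c (n - i) * v (n - i) s\<bar>)"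
      unfolding f_def sum_distrib_left
    proof (intro sum.cong refl)
      fix i assume "i \<in> {..n}"
      then have "\<bar>c n\<bar> = \<bar>c i\<bar> * \<bar>c (n - i)\<bar>" by (simp add: c_def abs_mult[symmetric] flip: power_add)
      then show "\<bar>c n\<bar> * (w i (t - s) * v (n - i) s) = \<bar>c i * w i (t - s)\<bar> * \<bar>c (n - i) * v (n - i) s\<bar>"
        using w0 v0 by (simp add: abs_mult)
    qed
    finally show ?thesis .
  qed
  have h1: "((\<lambda>s. \<Sum>n. c n * f n s) has_integral (\<Sum>n. c n * (t * w n t / \<alpha>))) {0..t}"
  proof (rule has_integral_suminf_nonneg)
    fix n
    have "(f n has_integral (\<Sum>i\<le>n. frac_kernel ((\<alpha> * real i + \<alpha>) + (\<alpha> * real (n - i) + 1)) t)) {0..t}"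
      unfolding f_def w_def v_def
      by (intro has_integral_sum finite_atMost has_integral_frac_kernel_convolution posa pos1 t)
    also have "(\<Sum>i\<le>n. frac_kernel ((\<alpha> * real i + \<alpha>) + (\<alpha> * real (n - i) + 1)) t)
        = (\<Sum>i\<le>n. frac_kernel (\<alpha> * real n + (\<alpha> + 1)) t)"
      by (intro sum.cong refl) (simp add: of_nat_diff algebra_simps)
    also have "\<dots> = t * w n t / \<alpha>" using I[of n] by simp
    finally show "(f n has_integral t * w n t / \<alpha>) {0..t}" .
    show "f n s \<ge> 0" for s unfolding f_def using w0 v0 by (intro sum_nonneg) auto
  next
    have "summable (\<lambda>n. t / \<alpha> * \<bar>c n * w n t\<bar>)" using t by (intro summable_mult sw) auto
    then show "summable (\<lambda>n. \<bar>c n\<bar> * (t * w n t / \<alpha>))"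
      using w0 by (simp add: abs_mult mult_ac)
  next
    fix s assume s: "s \<in> {0..t}"
    have "(\<lambda>n. \<Sum>i\<le>n. \<bar>c i * w i (t - s)\<bar> * \<bar>c (n - i) * v (n - i) s\<bar>) sums
       ((\<Sum>n. \<bar>c n * w n (t - s)\<bar>) * (\<Sum>n. \<bar>c n * v n s\<bar>))"
      using s sw(2)[of "t - s"] sv(2)[of s] by (intro Cauchy_product_sums) auto
    then show "summable (\<lambda>n. \<bar>c n * f n s\<bar>)" unfolding acf by (rule sums_summable)
  qed
  have h2: "(\<Sum>n. c n * f n s) = ml_kernel \<alpha> lam \<alpha> (t - s) * ml_kernel \<alpha> lam 1 s" if s: "s \<in> {0..t}" for s
  proof -
    have "(\<lambda>n. c n * f n s) sums ((\<Sum>n. c n * w n (t - s)) * (\<Sum>n. c n * v n s))"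
      unfolding cf using s sw(2)[of "t - s"] sv(2)[of s] by (intro Cauchy_product_sums) auto
    then show ?thesis using sw(1)[of "t - s"] sv(1)[of s] s by (simp add: sums_iff)
  qed
  have h3: "(\<Sum>n. c n * (t * w n t / \<alpha>)) = t * ml_kernel \<alpha> lam \<alpha> t / \<alpha>"
    using sums_mult[OF sw(1)[of t], of "t / \<alpha>"] t by (simp add: sums_iff mult_ac)
  show ?thesis using has_integral_eq[OF h2 h1] unfolding h3 by simp
qed

section \<open>The scalar relaxation function\<close>

text \<open>The solution \<open>E\<close> of \<open>\<partial>\<^sup>\<alpha> E + lam * E = 0\<close>, \<open>E 0 = 1\<close>. Written
with \<open>ml_kernel\<close> of index \<open>\<alpha> + 1\<close> instead of 1, the value at 0 is right in spite of \<open>0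
powr 0 = 0\<close>, and continuity up to 0 is visible.\<close>

definition relaxation :: "real \<Rightarrow> real \<Rightarrow> real \<Rightarrow> real" where
  "relaxation \<alpha> lam t = 1 - lam * ml_kernel \<alpha> lam (\<alpha> + 1) t"

text \<open>The resolvent kernel \<open>k = - E'\<close>: the solution of \<open>\<partial>\<^sup>\<alpha> y + lam * y = lam * f\<close>,
\<open>y 0 = 0\<close> is the convolution of \<open>k\<close> with \<open>f\<close>.\<close>

definition relaxation_rate :: "real \<Rightarrow> real \<Rightarrow> real \<Rightarrow> real" where
  "relaxation_rate \<alpha> lam t = lam * ml_kernel \<alpha> lam \<alpha> t"

lemma integrable_on_split_left:
  fixes f :: "real \<Rightarrow> real"
  assumes "f integrable_on {a..c}" "a \<le> b" "b \<le> c"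
  shows "integral {a..c} f = integral {a..b} f + integral {b..c} f"
        "f integrable_on {a..b}" "f integrable_on {b..c}"
proof -
  show "integral {a..c} f = integral {a..b} f + integral {b..c} f"
    using assms by (intro Henstock_Kurzweil_Integration.integral_combine[symmetric]) auto
  show "f integrable_on {a..b}" "f integrable_on {b..c}"
    using assms by (auto intro: integrable_on_subinterval)
qed

lemma has_integral_frac_kernel_shifted:
  assumes "a > 0" "x \<le> t"
  shows "((\<lambda>s. frac_kernel a (t - s)) has_integral frac_kernel (a + 1) (t - x)) {x..t}"
proof (cases "x = t")
  case True
  then show ?thesis using assms by (simp add: frac_kernel_def has_integral_refl(2))
next
  case False
  define d where "d = t - x"
  have d: "d > 0" using False assms by (simp add: d_def)
  have "((\<lambda>s. frac_kernel a (d - s) * frac_kernel 1 s) has_integral frac_kernel (a + 1) d) {0..d}"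
    using assms d by (intro has_integral_frac_kernel_convolution) auto
  then have "((\<lambda>s. frac_kernel a (d - s)) has_integral frac_kernel (a + 1) d) {0..d}"
    by (rule has_integral_spike[of "{0}", rotated -1]) (auto simp: frac_kernel_def[of 1])
  from has_integral_affinity'[where m=1 and c="-x", of _ _ 0 d, simplified, OF this]
  show ?thesis by (simp add: d_def)
qed

context
  fixes \<alpha> lam :: real
  assumes \<alpha>: "0 < \<alpha>" "\<alpha> < 1" and lam: "lam > 0"
begin

lemma relaxation_rate_eq:
  assumes "t > 0"
  shows "relaxation_rate \<alpha> lam t = lam * t powr (\<alpha> - 1) * mittag_leffler \<alpha> \<alpha> (- lam * t powr \<alpha>)"
  by (simp add: relaxation_rate_def ml_kernel_def)

lemma continuous_on_relaxation_rate: "continuous_on {0<..} (relaxation_rate \<alpha> lam)"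
  unfolding relaxation_rate_def ml_kernel_def using \<alpha>
  by (intro continuous_intros continuous_on_compose2[OF continuous_on_mittag_leffler[of \<alpha> \<alpha> UNIV]]) auto

lemma continuous_on_relaxation: "continuous_on {0..} (relaxation \<alpha> lam)"
  unfolding relaxation_def ml_kernel_def using \<alpha>
  by (intro continuous_intros continuous_on_powr' continuous_on_compose2[OF continuous_on_mittag_leffler[of \<alpha> "\<alpha>+1" UNIV]]) auto

lemma relaxation_0 [simp]: "relaxation \<alpha> lam 0 = 1"
  by (simp add: relaxation_def ml_kernel_def)

lemma relaxation_eq: "t > 0 \<Longrightarrow> relaxation \<alpha> lam t = ml_kernel \<alpha> lam 1 t"
  using ml_kernel_shift[OF \<alpha>, of 1 t lam] by (simp add: relaxation_def frac_kernel_def add.commute)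

lemma has_integral_relaxation_rate:
  assumes "t \<ge> 0"
  shows "(relaxation_rate \<alpha> lam has_integral (1 - relaxation \<alpha> lam t)) {0..t}"
proof (cases "t = 0")
  case True
  then show ?thesis by (simp add: has_integral_refl(2))
next
  case False
  then have t: "t > 0" using assms by simp
  have "((\<lambda>s. lam * (frac_kernel 1 (t - s) * ml_kernel \<alpha> lam \<alpha> s)) has_integral lam * ml_kernel \<alpha> lam (1 + \<alpha>) t) {0..t}"
    using frac_kernel_convolution_ml_kernel[OF \<alpha> _ \<alpha>(1) t, of 1] by (intro has_integral_mult_right) auto
  then have "(relaxation_rate \<alpha> lam has_integral lam * ml_kernel \<alpha> lam (1 + \<alpha>) t) {0..t}"
    by (rule has_integral_spike[of "{t}", rotated -1]) (auto simp: frac_kernel_def[of 1] relaxation_rate_def)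
  then show ?thesis by (simp add: relaxation_def add.commute)
qed

text \<open>The Volterra equation of the resolvent kernel; its positivity is derived from this equation.\<close>

lemma frac_kernel_convolution_relaxation_rate:
  assumes "t > 0"
  shows "((\<lambda>s. frac_kernel \<alpha> (t - s) * relaxation_rate \<alpha> lam s) has_integral
    (frac_kernel \<alpha> t - relaxation_rate \<alpha> lam t / lam)) {0..t}"
proof -
  have "((\<lambda>s. lam * (frac_kernel \<alpha> (t - s) * ml_kernel \<alpha> lam \<alpha> s)) has_integral lam * ml_kernel \<alpha> lam (\<alpha> + \<alpha>) t) {0..t}"
    using assms by (intro has_integral_mult_right frac_kernel_convolution_ml_kernel \<alpha>) auto
  moreover have "lam * ml_kernel \<alpha> lam (\<alpha> + \<alpha>) t = frac_kernel \<alpha> t - relaxation_rate \<alpha> lam t / lam"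
    using ml_kernel_shift[OF \<alpha> \<alpha>(1), of t lam] assms lam by (simp add: relaxation_rate_def)
  ultimately show ?thesis by (simp add: relaxation_rate_def mult_ac)
qed

lemma frac_kernel_complement_convolution_relaxation_rate:
  assumes "t > 0"
  shows "((\<lambda>s. frac_kernel (1 - \<alpha>) (t - s) * relaxation_rate \<alpha> lam s) has_integral lam * relaxation \<alpha> lam t) {0..t}"
proof -
  have "((\<lambda>s. lam * (frac_kernel (1 - \<alpha>) (t - s) * ml_kernel \<alpha> lam \<alpha> s)) has_integral lam * ml_kernel \<alpha> lam (1 - \<alpha> + \<alpha>) t) {0..t}"
    using assms \<alpha> by (intro has_integral_mult_right frac_kernel_convolution_ml_kernel) auto
  then show ?thesis using relaxation_eq[OF assms] by (simp add: relaxation_rate_def mult_ac)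
qed

lemma frac_kernel_convolution_relaxation:
  assumes "t > 0"
  shows "((\<lambda>s. frac_kernel \<alpha> (t - s) * relaxation \<alpha> lam s) has_integral (1 - relaxation \<alpha> lam t) / lam) {0..t}"
proof -
  have "((\<lambda>s. frac_kernel \<alpha> (t - s) * ml_kernel \<alpha> lam 1 s) has_integral ml_kernel \<alpha> lam (\<alpha> + 1) t) {0..t}"
    using assms \<alpha> by (intro frac_kernel_convolution_ml_kernel) auto
  then have "((\<lambda>s. frac_kernel \<alpha> (t - s) * relaxation \<alpha> lam s) has_integral ml_kernel \<alpha> lam (\<alpha> + 1) t) {0..t}"
    by (rule has_integral_spike[of "{0}", rotated -1]) (auto simp: relaxation_eq)
  then show ?thesis using lam by (simp add: relaxation_def)
qed

lemma relaxation_rate_convolution_relaxation: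
  assumes "t > 0"
  shows "((\<lambda>s. relaxation_rate \<alpha> lam (t - s) * relaxation \<alpha> lam s) has_integral t * relaxation_rate \<alpha> lam t / \<alpha>) {0..t}"
proof -
  have "((\<lambda>s. lam * (ml_kernel \<alpha> lam \<alpha> (t - s) * ml_kernel \<alpha> lam 1 s)) has_integral lam * (t * ml_kernel \<alpha> lam \<alpha> t / \<alpha>)) {0..t}"
    by (intro has_integral_mult_right ml_kernel_convolution \<alpha> assms)
  then have "((\<lambda>s. relaxation_rate \<alpha> lam (t - s) * relaxation \<alpha> lam s) has_integral lam * (t * ml_kernel \<alpha> lam \<alpha> t / \<alpha>)) {0..t}"
    by (rule has_integral_spike[of "{0}", rotated -1]) (auto simp: relaxation_eq relaxation_rate_def)
  then show ?thesis by (simp add: relaxation_rate_def mult_ac)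
qed

text \<open>Let \<open>\<omega>\<close> be the fractional kernel of order \<open>\<alpha>\<close>, so that \<open>k / lam = \<omega> -
\<omega> * k\<close> (with convolution on the right). Near 0 the kernel \<open>k\<close> behaves like \<open>lam *
\<omega>\<close> and is positive. Suppose \<open>t0\<close> is the first point with \<open>k t0 \<le> 0\<close>, and compare
with the point \<open>t\<close> at which \<open>k\<close> is largest on a short interval \<open>{t0 - \<eta>..t0}\<close>. As
time passes from \<open>t\<close> to \<open>t0\<close>, the term \<open>\<omega>\<close> shrinks by the factor
\<open>q\<close>, whereas the weight \<open>\<omega> (t - s)\<close> of the history before \<open>t\<close> shrinks at least
by this factor; hence the history contributes to \<open>(\<omega> * k) t0\<close> at most \<open>q * (\<omega> * k) t =
\<omega> t0 - q * k t / lam\<close>. The part between \<open>t\<close> and \<open>t0\<close> contributes at most \<open>k t /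
(4 * lam)\<close> if \<open>\<eta>\<close> is small, and \<open>q \<ge> 1 / 2\<close>. So \<open>(\<omega> * k) t0 < \<omega>
t0\<close>, which says \<open>k t0 > 0\<close>.\<close>

lemma relaxation_rate_pos:
  assumes "x > 0"
  shows "relaxation_rate \<alpha> lam x > 0"
proof (rule ccontr)
  let ?k = "relaxation_rate \<alpha> lam" and ?w = "frac_kernel \<alpha>"
  assume "\<not> ?k x > 0"
  define Z where "Z = {t. 0 < t \<and> ?k t \<le> 0}"
  have xZ: "x \<in> Z" using assms \<open>\<not> ?k x > 0\<close> by (auto simp: Z_def)
  have "((\<lambda>t. mittag_leffler \<alpha> \<alpha> (- lam * t powr \<alpha>)) \<longlongrightarrow> mittag_leffler \<alpha> \<alpha> (- lam * 0 powr \<alpha>)) (at_right 0)"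
  proof -
    have "continuous_on {0..} (\<lambda>t. mittag_leffler \<alpha> \<alpha> (- lam * t powr \<alpha>))"
      using \<alpha> by (intro continuous_intros continuous_on_powr'
          continuous_on_compose2[OF continuous_on_mittag_leffler[of \<alpha> \<alpha> UNIV]]) auto
    then have "((\<lambda>t. mittag_leffler \<alpha> \<alpha> (- lam * t powr \<alpha>)) \<longlongrightarrow> mittag_leffler \<alpha> \<alpha> (- lam * 0 powr \<alpha>)) (at 0 within {0..})"
      unfolding continuous_on_def by (rule bspec) simp
    then show ?thesis by (rule tendsto_within_subset) auto
  qed
  moreover have "mittag_leffler \<alpha> \<alpha> (- lam * 0 powr \<alpha>) > 0"
    using \<alpha> powser_zero[of "\<lambda>n. inverse (Gamma (\<alpha> * real n + \<alpha>))"] by (simp add: mittag_leffler_def)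
  ultimately have "eventually (\<lambda>t. mittag_leffler \<alpha> \<alpha> (- lam * t powr \<alpha>) > 0) (at_right 0)"
    by (rule order_tendstoD(1))
  then obtain \<delta> where \<delta>: "\<delta> > 0" "\<And>t. 0 < t \<Longrightarrow> t < \<delta> \<Longrightarrow> mittag_leffler \<alpha> \<alpha> (- lam * t powr \<alpha>) > 0"
    by (auto simp: eventually_at_right_field)
  have Z\<delta>: "t \<ge> \<delta>" if "t \<in> Z" for t
  proof (rule ccontr)
    assume "\<not> t \<ge> \<delta>"
    moreover have "t > 0" using that by (simp add: Z_def)
    ultimately have "?k t > 0" unfolding relaxation_rate_eq[OF \<open>t > 0\<close>]
      using lam \<delta>(2)[of t] by (intro mult_pos_pos) auto
    then show False using that by (simp add: Z_def)
  qed
  have bdd: "bdd_below Z" using Z\<delta> by (intro bdd_belowI) auto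
  define t0 where "t0 = Inf Z"
  have t0\<delta>: "t0 \<ge> \<delta>" unfolding t0_def using xZ Z\<delta> by (intro cInf_greatest) auto
  then have t0: "t0 > 0" using \<delta> by simp
  have below: "?k t > 0" if "0 < t" "t < t0" for t
  proof (rule ccontr)
    assume "\<not> ?k t > 0"
    then have "t \<in> Z" using that by (simp add: Z_def)
    then show False using cInf_lower[OF _ bdd, of t] that by (simp add: t0_def)
  qed
  have "t0 \<in> Z"
  proof -
    have "closed (Z)"
    proof -
      have "Z = {\<delta>..} \<inter> ?k -` {..0}" using Z\<delta> \<delta> by (auto simp: Z_def)
      moreover have "closed ({\<delta>..} \<inter> ?k -` {..0})"
        using \<delta> by (intro continuous_closed_preimage continuous_on_subset[OF continuous_on_relaxation_rate]) auto
      ultimately show ?thesis by simp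
    qed
    then show ?thesis unfolding t0_def using closed_contains_Inf[of Z] xZ bdd by auto
  qed
  then have kt0: "?k t0 \<le> 0" by (simp add: Z_def)
  \<comment> \<open>The second argument makes the integral of the kernel over a time span \<open>\<eta>\<close> at most \<open>1 / (4 * lam)\<close>; the first one gives \<open>t0 / 2 \<le> t\<close>.\<close>
  define \<eta> where "\<eta> = min (t0 / 2) ((Gamma (\<alpha> + 1) / (4 * lam)) powr (1 / \<alpha>))"
  have G1: "Gamma (\<alpha> + 1) > 0" using \<alpha> by auto
  have \<eta>: "\<eta> > 0" "\<eta> \<le> t0 / 2" using t0 G1 lam by (auto simp: \<eta>_def)
  have \<eta>a: "d powr \<alpha> \<le> Gamma (\<alpha> + 1) / (4 * lam)" if "0 \<le> d" "d \<le> \<eta>" for d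
  proof -
    have "d powr \<alpha> \<le> ((Gamma (\<alpha> + 1) / (4 * lam)) powr (1 / \<alpha>)) powr \<alpha>"
      using that \<alpha> by (intro powr_mono2) (auto simp: \<eta>_def)
    then show ?thesis using \<alpha> G1 lam by (simp add: powr_powr)
  qed
  obtain t where t: "t \<in> {t0 - \<eta>..t0}" and tmax: "\<And>s. s \<in> {t0 - \<eta>..t0} \<Longrightarrow> ?k s \<le> ?k t"
    using continuous_attains_sup[of "{t0 - \<eta>..t0}" ?k] \<eta> t0
      continuous_on_subset[OF continuous_on_relaxation_rate, of "{t0 - \<eta>..t0}"] by fastforce
  have kt: "?k t > 0" using tmax[of "t0 - \<eta>"] below[of "t0 - \<eta>"] \<eta> t0 by auto
  then have tt: "0 < t" "t < t0" "t0 / 2 \<le> t" "t0 - t \<le> \<eta>" using t kt0 \<eta> t0 by (auto simp: order.order_iff_strict)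
  let ?f = "\<lambda>s. ?w (t0 - s) * ?k s"
  have If: "(?f has_integral (?w t0 - ?k t0 / lam)) {0..t0}"
    by (rule frac_kernel_convolution_relaxation_rate[OF t0])
  have spl: "integral {0..t0} ?f = integral {0..t} ?f + integral {t..t0} ?f"
       "?f integrable_on {0..t}" "?f integrable_on {t..t0}"
    using integrable_on_split_left[of ?f 0 t0 t] If tt by (auto simp: has_integral_iff)
  define q where "q = (t0 / t) powr (\<alpha> - 1)"
  have powr_le: "?w (t0 - s) \<le> q * ?w (t - s)" if "0 \<le> s" "s < t" for s
  proof -
    have "t * s \<le> t0 * s" using that tt by (intro mult_right_mono) auto
    then have "(t0 / t) * (t - s) \<le> t0 - s" using tt by (simp add: field_simps)
    then have "(t0 - s) powr (\<alpha> - 1) \<le> ((t0 / t) * (t - s)) powr (\<alpha> - 1)"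
      using that tt t0 \<alpha> by (intro powr_mono2') auto
    also have "\<dots> = q * (t - s) powr (\<alpha> - 1)"
      unfolding q_def by (rule powr_mult)
    finally show ?thesis using \<alpha> by (simp add: frac_kernel_def divide_right_mono)
  qed
  have "integral {0..t} ?f = integral {0..t} (\<lambda>s. if s = t then 0 else ?f s)"
    by (rule integral_spike[of "{t}"]) auto
  also have "\<dots> \<le> integral {0..t} (\<lambda>s. q * (?w (t - s) * ?k s))"
  proof (rule integral_le)
    show "(\<lambda>s. if s = t then 0 else ?f s) integrable_on {0..t}"
      using spl(2) by (rule integrable_spike[of _ _ "{t}"]) auto
    show "(\<lambda>s. q * (?w (t - s) * ?k s)) integrable_on {0..t}"
      using frac_kernel_convolution_relaxation_rate[OF tt(1)] by (intro integrable_on_mult_right) auto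
    fix s assume s: "s \<in> {0..t}"
    show "(if s = t then 0 else ?f s) \<le> q * (?w (t - s) * ?k s)"
    proof (cases "s = t \<or> s = 0")
      case True
      then show ?thesis by (auto simp: frac_kernel_def relaxation_rate_def ml_kernel_def)
    next
      case False
      then show ?thesis
        using mult_right_mono[OF powr_le[of s], of "?k s"] below[of s] s tt by auto
    qed
  qed
  also have "\<dots> = q * (?w t - ?k t / lam)"
    using frac_kernel_convolution_relaxation_rate[OF tt(1)] by (simp add: integral_unique)
  also have "\<dots> = ?w t0 - q * ?k t / lam"
    using tt t0 by (simp add: q_def frac_kernel_def powr_divide right_diff_distrib)
  finally have 1: "integral {0..t} ?f \<le> ?w t0 - q * ?k t / lam" .
  have "integral {t..t0} ?f \<le> integral {t..t0} (\<lambda>s. ?w (t0 - s) * ?k t)"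
    using spl(3) has_integral_frac_kernel_shifted[OF \<alpha>(1), of t t0] tt tmax frac_kernel_nonneg[OF \<alpha>(1)]
    by (intro integral_le integrable_on_mult_left mult_left_mono) auto
  also have "\<dots> = frac_kernel (\<alpha> + 1) (t0 - t) * ?k t"
    using has_integral_frac_kernel_shifted[OF \<alpha>(1), of t t0] tt by (simp add: integral_unique)
  also have "frac_kernel (\<alpha> + 1) (t0 - t) \<le> 1 / (4 * lam)"
    using \<eta>a[of "t0 - t"] tt G1 lam by (simp add: frac_kernel_def field_simps)
  then have "frac_kernel (\<alpha> + 1) (t0 - t) * ?k t \<le> 1 / (4 * lam) * ?k t"
    using kt by (intro mult_right_mono) auto
  finally have 2: "integral {t..t0} ?f \<le> 1 / (4 * lam) * ?k t" .
  have "1 / 2 \<le> t / t0" using tt t0 by (simp add: field_simps)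
  also have "\<dots> \<le> (t / t0) powr (1 - \<alpha>)"
    using powr_mono'[of "1 - \<alpha>" 1 "t / t0"] tt t0 \<alpha> by simp
  also have "\<dots> = q" using tt t0 by (simp add: q_def powr_divide powr_diff field_simps)
  finally have "q \<ge> 1 / 2" .
  then have "1 / 2 * (?k t / lam) \<le> q * (?k t / lam)" using kt lam by (intro mult_right_mono) auto
  moreover have "?w t0 - ?k t0 / lam = integral {0..t0} ?f" using If by (simp add: integral_unique)
  moreover have "?k t0 / lam \<le> 0" using kt0 lam by (simp add: divide_nonpos_pos)
  moreover have "?k t / lam > 0" using kt lam by simp
  ultimately show False using 1 2 spl(1) by simp
qed

lemma relaxation_rate_nonneg: "t \<ge> 0 \<Longrightarrow> relaxation_rate \<alpha> lam t \<ge> 0"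
  using relaxation_rate_pos[of t] by (cases "t = 0") (auto simp: relaxation_rate_def ml_kernel_def)

text \<open>Convolving \<open>k \<ge> 0\<close> with the complementary fractional kernel gives \<open>lam * E\<close>.\<close>

lemma relaxation_nonneg:
  assumes "t \<ge> 0" shows "relaxation \<alpha> lam t \<ge> 0"
proof (cases "t = 0")
  case False
  then have t: "t > 0" using assms by simp
  have "0 \<le> lam * relaxation \<alpha> lam t"
    using \<alpha> by (intro has_integral_nonneg[OF frac_kernel_complement_convolution_relaxation_rate[OF t]]
      mult_nonneg_nonneg relaxation_rate_nonneg frac_kernel_nonneg) auto
  then show ?thesis using lam by (simp add: zero_le_mult_iff)
qed simp

lemma has_integral_relaxation_rate_between:
  assumes "0 \<le> s" "s \<le> t"
  shows "(relaxation_rate \<alpha> lam has_integral (relaxation \<alpha> lam s - relaxation \<alpha> lam t)) {s..t}"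
proof -
  have "relaxation_rate \<alpha> lam integrable_on {0..t}"
    using has_integral_relaxation_rate[of t] assms by auto
  from integrable_on_split_left[OF this assms] show ?thesis
    using has_integral_relaxation_rate[of t] has_integral_relaxation_rate[of s] assms
    by (simp add: has_integral_iff)
qed

lemma relaxation_antimono:
  assumes "0 \<le> s" "s \<le> t"
  shows "relaxation \<alpha> lam t \<le> relaxation \<alpha> lam s"
  using has_integral_nonneg[OF has_integral_relaxation_rate_between[OF assms]] relaxation_rate_nonneg assms by auto

lemma relaxation_le_1: "t \<ge> 0 \<Longrightarrow> relaxation \<alpha> lam t \<le> 1"
  using relaxation_antimono[of 0 t] by simp

text \<open>In the identity \<open>E + lam * (\<omega> * E) = 1\<close>, with \<open>\<omega> * E\<close> the fractional integral of
order \<open>\<alpha>\<close>, replace the decreasing function \<open>E\<close> under the integral by its smallest value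
\<open>E t\<close>.\<close>

lemma relaxation_decay:
  assumes "t > 0"
  shows "lam * t powr \<alpha> * relaxation \<alpha> lam t \<le> Gamma (\<alpha> + 1)"
proof -
  have "frac_kernel (\<alpha> + 1) (t - 0) * relaxation \<alpha> lam t \<le> (1 - relaxation \<alpha> lam t) / lam"
    using assms \<alpha> relaxation_antimono frac_kernel_nonneg[OF \<alpha>(1)]
    by (intro has_integral_le[OF has_integral_mult_left[OF has_integral_frac_kernel_shifted[OF \<alpha>(1), of 0 t]]
      frac_kernel_convolution_relaxation[OF assms]] mult_left_mono) auto
  also have "\<dots> \<le> 1 / lam" using relaxation_nonneg[of t] assms lam by (simp add: divide_right_mono)
  finally have "t powr \<alpha> / Gamma (\<alpha> + 1) * relaxation \<alpha> lam t \<le> 1 / lam" by (simp add: frac_kernel_def)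
  moreover have "Gamma (\<alpha> + 1) > 0" using \<alpha> by auto
  ultimately show ?thesis using lam by (simp add: field_simps)
qed

text \<open>The convolution of \<open>k\<close> and \<open>E\<close> is \<open>t * k t / \<alpha>\<close>. Since \<open>E \<le>
1\<close>, it is at most the integral of \<open>k\<close>, that is, at most \<open>1 - E t \<le> 1\<close>.\<close>

lemma relaxation_rate_le:
  assumes "t > 0"
  shows "relaxation_rate \<alpha> lam t \<le> \<alpha> / t"
proof -
  have "t * relaxation_rate \<alpha> lam t / \<alpha> \<le> 1 - relaxation \<alpha> lam t"
  proof (rule has_integral_le[OF relaxation_rate_convolution_relaxation[OF assms]])
    show "((\<lambda>s. relaxation_rate \<alpha> lam (t - s)) has_integral 1 - relaxation \<alpha> lam t) {0..t}"
      using has_integral_reflect_real[THEN iffD2, OF has_integral_relaxation_rate[of t]] assms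
        has_integral_affinity'[where m="1" and c="-t" and a="-t" and b=0 and f="\<lambda>x. relaxation_rate \<alpha> lam (-x)"] by simp
    show "relaxation_rate \<alpha> lam (t - s) * relaxation \<alpha> lam s \<le> relaxation_rate \<alpha> lam (t - s)" if "s \<in> {0..t}" for s
      using that relaxation_le_1[of s] relaxation_rate_nonneg[of "t - s"] by (simp add: mult_left_le)
  qed
  also have "\<dots> \<le> 1" using relaxation_nonneg[of t] assms by simp
  finally show ?thesis using \<alpha> assms by (simp add: field_simps)
qed

text \<open>The convolution of \<open>k\<close> and \<open>E\<close> is \<open>t * k t / \<alpha>\<close>. It is split at \<open>t /
2\<close>: before, \<open>k\<close> is at most \<open>2 * \<alpha> / t\<close> and the decay of \<open>E\<close> is
integrated; after, the decay of \<open>E\<close> gives a factor and \<open>k\<close> has mass at most 1.\<close>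

lemma relaxation_rate_decay:
  assumes t: "t > 0"
  shows "lam * t powr \<alpha> * (t * relaxation_rate \<alpha> lam t) \<le> \<alpha> * Gamma (\<alpha> + 1) * 2 powr \<alpha> / (1 - \<alpha>)"
proof -
  let ?k = "relaxation_rate \<alpha> lam" and ?E = "relaxation \<alpha> lam" and ?G = "Gamma (\<alpha> + 1)"
  let ?f = "\<lambda>s. ?k (t - s) * ?E s"
  have G: "?G > 0" using \<alpha> by auto
  have k_int: "((\<lambda>s. ?k (t - s)) has_integral 1 - ?E t) {0..t}"
    using has_integral_reflect_real[THEN iffD2, OF has_integral_relaxation_rate[of t]] t
      has_integral_affinity'[where m="1" and c="-t" and a="-t" and b=0 and f="\<lambda>x. ?k (-x)"] by simp
  have spl: "integral {0..t} ?f = integral {0..t/2} ?f + integral {t/2..t} ?f"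
       "?f integrable_on {0..t/2}" "?f integrable_on {t/2..t}"
    using integrable_on_split_left[of ?f 0 t "t/2"] relaxation_rate_convolution_relaxation[OF t] t
    by (auto simp: has_integral_iff)
  have bE: "?E s \<le> ?G / lam * s powr (- \<alpha>)" if "s > 0" for s
    using relaxation_decay[OF that] that lam by (simp add: field_simps powr_minus)
  have pw: "((\<lambda>s. s powr (- \<alpha>)) has_integral (t/2) powr (1 - \<alpha>) / (1 - \<alpha>)) {0..t/2}"
    using has_integral_powr_from_0[of "- \<alpha>" "t/2"] \<alpha> t by simp
  have "integral {0..t/2} ?f = integral {0..t/2} (\<lambda>s. if s = 0 then 0 else ?f s)"
    by (rule integral_spike[of "{0}"]) auto
  also have "\<dots> \<le> integral {0..t/2} (\<lambda>s. (2 * \<alpha> / t * (?G / lam)) * s powr (- \<alpha>))"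
  proof (rule integral_le)
    show "(\<lambda>s. if s = 0 then 0 else ?f s) integrable_on {0..t/2}"
      using spl(2) by (rule integrable_spike[of _ _ "{0}"]) auto
    show "(\<lambda>s. (2 * \<alpha> / t * (?G / lam)) * s powr (- \<alpha>)) integrable_on {0..t/2}"
      using pw by (intro integrable_on_mult_right) auto
    fix s assume s: "s \<in> {0..t/2}"
    show "(if s = 0 then 0 else ?f s) \<le> (2 * \<alpha> / t * (?G / lam)) * s powr (- \<alpha>)"
    proof (cases "s = 0")
      case False
      have "?k (t - s) \<le> \<alpha> / (t - s)" using s t by (intro relaxation_rate_le) auto
      also have "\<dots> \<le> 2 * \<alpha> / t" using s t \<alpha> by (simp add: field_simps)
      finally have "?f s \<le> (2 * \<alpha> / t) * (?G / lam * s powr (- \<alpha>))"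
        using s t False \<alpha> by (intro mult_mono bE relaxation_nonneg) auto
      then show ?thesis using False by (simp add: mult_ac)
    qed simp
  qed
  also have "\<dots> = (2 * \<alpha> / t * (?G / lam)) * ((t/2) powr (1 - \<alpha>) / (1 - \<alpha>))"
    using pw by (simp add: integral_unique)
  also have "(t/2) powr (1 - \<alpha>) = t / 2 * (t/2) powr (- \<alpha>)"
    using t powr_mult_base[of "t/2" "-\<alpha>"] by simp
  also have "(2 * \<alpha> / t * (?G / lam)) * (t / 2 * (t/2) powr (- \<alpha>) / (1 - \<alpha>))
      = ?G / lam * (t/2) powr (- \<alpha>) * (\<alpha> / (1 - \<alpha>))"
  proof -
    have "(2 * \<alpha> / t * X) * (t / 2 * Y / Z) = X * Y * (\<alpha> / Z)" for X Y Z :: real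
      using t by simp
    then show ?thesis .
  qed
  finally have 1: "integral {0..t/2} ?f \<le> ?G / lam * (t/2) powr (- \<alpha>) * (\<alpha> / (1 - \<alpha>))" .
  have kspl: "integral {0..t} (\<lambda>s. ?k (t - s)) = integral {0..t/2} (\<lambda>s. ?k (t - s)) + integral {t/2..t} (\<lambda>s. ?k (t - s))"
      "(\<lambda>s. ?k (t - s)) integrable_on {0..t/2}" "(\<lambda>s. ?k (t - s)) integrable_on {t/2..t}"
    using integrable_on_split_left[of "\<lambda>s. ?k (t - s)" 0 t "t/2"] k_int t by (auto simp: has_integral_iff)
  have "integral {0..t/2} (\<lambda>s. ?k (t - s)) \<ge> 0"
    using kspl t by (intro Henstock_Kurzweil_Integration.integral_nonneg relaxation_rate_nonneg) auto
  then have k1: "integral {t/2..t} (\<lambda>s. ?k (t - s)) \<le> 1"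
    using kspl(1) k_int relaxation_nonneg[of t] t by (simp add: integral_unique)
  have "integral {t/2..t} ?f \<le> integral {t/2..t} (\<lambda>s. ?k (t - s) * (?G / lam * (t/2) powr (- \<alpha>)))"
  proof (rule integral_le[OF spl(3)])
    show "(\<lambda>s. ?k (t - s) * (?G / lam * (t/2) powr (- \<alpha>))) integrable_on {t/2..t}"
      using kspl by (intro integrable_on_mult_left)
    fix s assume s: "s \<in> {t/2..t}"
    have "?E s \<le> ?E (t/2)" using s t by (intro relaxation_antimono) auto
    also have "\<dots> \<le> ?G / lam * (t/2) powr (- \<alpha>)" using t by (intro bE) auto
    finally show "?f s \<le> ?k (t - s) * (?G / lam * (t/2) powr (- \<alpha>))"
      using s by (intro mult_left_mono relaxation_rate_nonneg) auto
  qed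
  also have "\<dots> = integral {t/2..t} (\<lambda>s. ?k (t - s)) * (?G / lam * (t/2) powr (- \<alpha>))"
    by simp
  also have "\<dots> \<le> 1 * (?G / lam * (t/2) powr (- \<alpha>))"
    using k1 G lam by (intro mult_right_mono) auto
  finally have "t * ?k t / \<alpha> \<le> ?G / lam * (t/2) powr (- \<alpha>) * (\<alpha> / (1 - \<alpha>) + 1)"
    using 1 spl(1) relaxation_rate_convolution_relaxation[OF t] by (simp add: integral_unique distrib_left)
  also have "\<alpha> / (1 - \<alpha>) + 1 = 1 / (1 - \<alpha>)" using \<alpha> by (simp add: field_simps)
  also have "(t/2) powr (- \<alpha>) = 2 powr \<alpha> / t powr \<alpha>" using t by (simp add: powr_minus powr_divide)
  finally have "lam * t powr \<alpha> * \<alpha> * (t * ?k t / \<alpha>) \<le> lam * t powr \<alpha> * \<alpha> * (?G / lam * (2 powr \<alpha> / t powr \<alpha>) * (1 / (1 - \<alpha>)))"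
    using lam \<alpha> by (intro mult_left_mono) auto
  then show ?thesis using \<alpha> lam t by simp
qed

lemma relaxation_has_real_derivative:
  assumes "t > 0"
  shows "(relaxation \<alpha> lam has_real_derivative - relaxation_rate \<alpha> lam t) (at t)"
proof -
  have "((\<lambda>x. integral {t/2..x} (relaxation_rate \<alpha> lam)) has_real_derivative relaxation_rate \<alpha> lam t) (at t within {t/2..2*t})"
    using assms by (intro integral_has_real_derivative continuous_on_subset[OF continuous_on_relaxation_rate]) auto
  then have "((\<lambda>x. relaxation \<alpha> lam (t/2) - integral {t/2..x} (relaxation_rate \<alpha> lam)) has_real_derivative - relaxation_rate \<alpha> lam t) (at t within {t/2..2*t})"
    by (auto intro!: derivative_eq_intros)
  then have "(relaxation \<alpha> lam has_real_derivative - relaxation_rate \<alpha> lam t) (at t within {t/2..2*t})"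
  proof (rule has_field_derivative_transform_within[of _ _ _ _ 1])
    fix x assume "x \<in> {t/2..2*t}"
    then show "relaxation \<alpha> lam (t/2) - integral {t/2..x} (relaxation_rate \<alpha> lam) = relaxation \<alpha> lam x"
      using has_integral_relaxation_rate_between[of "t/2" x] assms by (simp add: integral_unique)
  qed (use assms in auto)
  moreover have "at t within {t/2..2*t} = at t"
    using assms by (intro at_within_interior) auto
  ultimately show ?thesis by simp
qed

end

text \<open>The sum of the bounds for \<open>E\<close>, \<open>lam * t powr \<alpha> * E t\<close>, \<open>t * k t\<close> and \<open>lam
* t powr \<alpha> * (t * k t)\<close>, so that one constant serves for both smoothing estimates.\<close>

definition smoothing_const :: "real \<Rightarrow> real" where
  "smoothing_const \<alpha> = 1 + Gamma (\<alpha> + 1) + \<alpha> + \<alpha> * Gamma (\<alpha> + 1) * 2 powr \<alpha> / (1 - \<alpha>)"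

lemma smoothing_const_ge_1: "0 < \<alpha> \<Longrightarrow> \<alpha> < 1 \<Longrightarrow> smoothing_const \<alpha> \<ge> 1"
  unfolding smoothing_const_def using Gamma_real_pos[of "\<alpha> + 1"] by simp

lemma powr_le_1_plus:
  assumes "x > (0::real)" "0 \<le> \<theta>" "\<theta> \<le> 1"
  shows "x powr \<theta> \<le> 1 + x"
proof (cases "x \<le> 1")
  case True
  then show ?thesis using powr_le1[of \<theta> x] assms by simp
next
  case False
  then show ?thesis using powr_mono[of \<theta> 1 x] assms by simp
qed

text \<open>With \<open>x = lam * t powr \<alpha>\<close>, the power \<open>x powr \<theta>\<close> is at most \<open>1 + x\<close>, and
both \<open>E\<close> and \<open>x * E\<close> are bounded uniformly in \<open>lam\<close>.\<close>

lemma relaxation_smoothing: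
  assumes "0 < \<alpha>" "\<alpha> < 1" "lam > 0" "t > 0" "0 \<le> \<theta>" "\<theta> \<le> 1"
  shows "lam powr \<theta> * relaxation \<alpha> lam t \<le> smoothing_const \<alpha> * t powr (- \<alpha> * \<theta>)"
proof -
  have E0: "relaxation \<alpha> lam t \<ge> 0" using assms by (intro relaxation_nonneg) auto
  have "(lam * t powr \<alpha>) powr \<theta> * relaxation \<alpha> lam t \<le> (1 + lam * t powr \<alpha>) * relaxation \<alpha> lam t"
    using assms by (intro mult_right_mono powr_le_1_plus E0) auto
  also have "\<dots> = relaxation \<alpha> lam t + lam * t powr \<alpha> * relaxation \<alpha> lam t" by (simp add: algebra_simps)
  also have "\<dots> \<le> 1 + Gamma (\<alpha> + 1)"
    using assms by (intro add_mono relaxation_decay relaxation_le_1) auto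
  also have "\<dots> \<le> smoothing_const \<alpha>"
    unfolding smoothing_const_def using assms Gamma_real_pos[of "\<alpha> + 1"] by simp
  finally show ?thesis using assms
    by (simp add: powr_mult powr_powr powr_minus field_simps)
qed

text \<open>The same interpolation, now for the integral of \<open>k\<close> over \<open>{s..t}\<close>: both \<open>\<sigma> * k
\<sigma>\<close> and its product with \<open>lam * \<sigma> powr \<alpha>\<close> are bounded uniformly in
\<open>lam\<close>.\<close>

lemma relaxation_difference_smoothing:
  assumes \<alpha>: "0 < \<alpha>" "\<alpha> < 1" and lam: "lam > 0" and s: "s > 0" "s \<le> t" and \<theta>: "0 \<le> \<theta>" "\<theta> \<le> 1"
  shows "lam powr \<theta> * \<bar>relaxation \<alpha> lam s - relaxation \<alpha> lam t\<bar>
    \<le> smoothing_const \<alpha> * ((t - s) / s) * s powr (- \<alpha> * \<theta>)"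
proof -
  let ?k = "relaxation_rate \<alpha> lam" and ?x = "lam * s powr \<alpha>"
  have bound: "(1 + ?x) * ?k \<sigma> \<le> smoothing_const \<alpha> / s" if "\<sigma> \<in> {s..t}" for \<sigma>
  proof -
    have \<sigma>: "\<sigma> > 0" "s \<le> \<sigma>" using that s by auto
    have k0: "?k \<sigma> \<ge> 0" using \<sigma> \<alpha> lam by (intro relaxation_rate_nonneg) auto
    have "(1 + ?x) * (\<sigma> * ?k \<sigma>) \<le> (1 + lam * \<sigma> powr \<alpha>) * (\<sigma> * ?k \<sigma>)"
      using \<sigma> s \<alpha> lam k0 by (intro mult_right_mono add_left_mono mult_left_mono powr_mono2) auto
    also have "\<dots> = \<sigma> * ?k \<sigma> + lam * \<sigma> powr \<alpha> * (\<sigma> * ?k \<sigma>)" by (simp add: algebra_simps)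
    also have "\<dots> \<le> \<alpha> + \<alpha> * Gamma (\<alpha> + 1) * 2 powr \<alpha> / (1 - \<alpha>)"
      using relaxation_rate_le[OF \<alpha> lam \<sigma>(1)] \<sigma> by (intro add_mono relaxation_rate_decay \<alpha> lam) (auto simp: field_simps)
    also have "\<dots> \<le> smoothing_const \<alpha>"
      unfolding smoothing_const_def using Gamma_real_pos[of "\<alpha> + 1"] \<alpha> by simp
    finally have "(1 + ?x) * ?k \<sigma> \<le> smoothing_const \<alpha> / \<sigma>" using \<sigma> by (simp add: field_simps)
    also have "\<dots> \<le> smoothing_const \<alpha> / s"
      using \<sigma> s smoothing_const_ge_1[OF \<alpha>] by (intro divide_left_mono) auto
    finally show ?thesis .
  qed
  have "(1 + ?x) * (relaxation \<alpha> lam s - relaxation \<alpha> lam t) \<le> (t - s) * (smoothing_const \<alpha> / s)"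
    using has_integral_le[OF has_integral_mult_right[OF has_integral_relaxation_rate_between[OF \<alpha> lam, of s t]]
        has_integral_const_real[of "smoothing_const \<alpha> / s" s t], of "1 + ?x"] bound s by simp
  moreover have E: "relaxation \<alpha> lam s - relaxation \<alpha> lam t \<ge> 0"
    using relaxation_antimono[OF \<alpha> lam, of s t] s by simp
  moreover have "?x powr \<theta> * (relaxation \<alpha> lam s - relaxation \<alpha> lam t) \<le> (1 + ?x) * (relaxation \<alpha> lam s - relaxation \<alpha> lam t)"
    using E s lam \<theta> by (intro mult_right_mono powr_le_1_plus) auto
  ultimately have "?x powr \<theta> * \<bar>relaxation \<alpha> lam s - relaxation \<alpha> lam t\<bar> \<le> smoothing_const \<alpha> * ((t - s) / s)"
    by (simp add: mult_ac)
  then show ?thesis using s lam by (simp add: powr_mult powr_powr powr_minus field_simps)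
qed

section \<open>Scalar Caputo equations\<close>

lemma has_integral_reflect_shift:
  fixes f :: "real \<Rightarrow> 'a::real_normed_vector"
  assumes "(f has_integral I) {a..b}"
  shows "((\<lambda>s. f (t - s)) has_integral I) {t-b..t-a}"
proof -
  have "((\<lambda>s. f (- s)) has_integral I) (cbox (-b) (-a))"
    using has_integral_reflect_real[THEN iffD2, OF assms] by simp
  from has_integral_affinity'[OF this, of 1 "-t"] show ?thesis by (simp add: algebra_simps)
qed

lemma lborel_integral_of_nonneg_has_integral:
  fixes h :: "real \<Rightarrow> real"
  assumes m: "(\<lambda>x. indicator S x * h x) \<in> borel_measurable borel"
    and I: "(h has_integral I) S" and nonneg: "\<And>x. x \<in> S \<Longrightarrow> h x \<ge> 0"
  shows "integrable lborel (\<lambda>x. indicator S x * h x)" "(LINT x|lborel. indicator S x * h x) = I"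
proof -
  have "h absolutely_integrable_on S"
    using I nonneg by (intro nonnegative_absolutely_integrable_1) auto
  then have *: "integrable lebesgue (\<lambda>x. indicator S x * h x)"
      "(LINT x|lebesgue. indicator S x * h x) = integral S h"
    using set_lebesgue_integral_eq_integral(2)[of S h] by (auto simp: set_integrable_def set_lebesgue_integral_def)
  show "integrable lborel (\<lambda>x. indicator S x * h x)"
    using * m by (simp add: integrable_completion)
  show "(LINT x|lborel. indicator S x * h x) = I"
    using * m I by (simp add: integral_completion integral_unique)
qed

lemma borel_measurable_ml_kernel:
  assumes "0 < \<alpha>" "\<alpha> < 1" "b > 0"
  shows "ml_kernel \<alpha> lam b \<in> borel_measurable borel"
proof -
  have "mittag_leffler \<alpha> b \<in> borel_measurable borel"
    by (intro borel_measurable_continuous_onI continuous_on_mittag_leffler assms)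
  then show ?thesis unfolding ml_kernel_def
    by (intro borel_measurable_times measurable_compose[where f="\<lambda>t. - lam * t powr \<alpha>" and g="mittag_leffler \<alpha> b"]) auto
qed

lemma has_caputo_derivative_unfold:
  fixes y :: "real \<Rightarrow> real"
  shows "has_caputo_derivative \<alpha> T y w t \<longleftrightarrow>
   ((\<lambda>r. integral {0..r} (\<lambda>s. frac_kernel (1 - \<alpha>) (r - s) * (y s - y 0))) has_vector_derivative w) (at t within {0..T})"
  by (simp add: has_caputo_derivative_def)

context
  fixes \<alpha> lam :: real
  assumes \<alpha>: "0 < \<alpha>" "\<alpha> < 1" and lam: "lam > 0"
begin

text \<open>Exchanging the order of integration turns the left-hand side into the integral of \<open>z\<close> against the convolution of
\<open>k\<close> with the fractional kernel of order \<open>1 - \<alpha>\<close>, which is \<open>lam * E\<close>. Both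
kernels are nonnegative and \<open>z\<close> is bounded, so Tonelli's theorem provides the integrability needed for Fubini's.\<close>

lemma relaxation_rate_convolution_fractional_integral:
  fixes z :: "real \<Rightarrow> real"
  assumes t: "t > 0" and z: "continuous_on {0..t} z"
  shows "((\<lambda>s. relaxation_rate \<alpha> lam (t - s) * integral {0..s} (\<lambda>r. frac_kernel (1 - \<alpha>) (s - r) * z r))
     has_integral lam * integral {0..t} (\<lambda>r. relaxation \<alpha> lam (t - r) * z r)) {0..t}"
proof -
  let ?k = "relaxation_rate \<alpha> lam" and ?E = "relaxation \<alpha> lam" and ?w = "frac_kernel (1 - \<alpha>)"
  define z' where "z' r = indicator {0..t} r * z r" for r
  have z'm[measurable]: "z' \<in> borel_measurable borel"
    unfolding z'_def using borel_measurable_continuous_on_indicator[OF _ z] by simp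
  have km[measurable]: "?k \<in> borel_measurable borel"
    unfolding relaxation_rate_def using borel_measurable_ml_kernel[OF \<alpha> \<alpha>(1)] by simp
  have wm[measurable]: "?w \<in> borel_measurable borel"
    unfolding frac_kernel_def by simp
  obtain M where M: "\<And>r. \<bar>z' r\<bar> \<le> M"
  proof -
    have "bounded (z ` {0..t})" by (intro compact_imp_bounded compact_continuous_image z) auto
    then obtain M where "\<forall>r\<in>{0..t}. \<bar>z r\<bar> \<le> M" unfolding bounded_iff by auto
    then have "\<bar>z' r\<bar> \<le> \<bar>M\<bar>" for r by (cases "r \<in> {0..t}") (auto simp: z'_def intro: order_trans[OF _ abs_ge_self])
    then show ?thesis using that by blast
  qed
  \<comment> \<open>The product of the two singular kernels on the triangle \<open>0 \<le> r \<le> s \<le> t\<close>.\<close>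
  define P where "P r s = (if 0 \<le> r \<and> r \<le> s \<and> s \<le> t then ?k (t - s) * ?w (s - r) else 0)" for r s
  define Hf where "Hf = (\<lambda>(r, s). P r s * z' r)"
  have Pm[measurable]: "(\<lambda>(r, s). P r s) \<in> borel_measurable (borel \<Otimes>\<^sub>M borel)"
    unfolding P_def by measurable
  have Hm: "Hf \<in> borel_measurable (lborel \<Otimes>\<^sub>M lborel)"
    unfolding Hf_def by measurable
  have P0: "P r s \<ge> 0" for r s
    using relaxation_rate_nonneg[OF \<alpha> lam, of "t - s"] frac_kernel_nonneg[of "1 - \<alpha>"] \<alpha> by (auto simp: P_def)
  have inner_s: "integrable lborel (P r)" "(LINT s|lborel. P r s) = lam * ?E (t - r)" if "r \<in> {0..<t}" for r
  proof -
    have "((\<lambda>s. ?w (t - r - (t - s)) * ?k (t - s)) has_integral lam * ?E (t - r)) {t-(t - r)..t-0}"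
      using that by (intro has_integral_reflect_shift[where f="\<lambda>s. ?w (t - r - s) * ?k s"]
        frac_kernel_complement_convolution_relaxation_rate \<alpha> lam) auto
    then have *: "((\<lambda>s. ?k (t - s) * ?w (s - r)) has_integral lam * ?E (t - r)) {r..t}"
      by (simp add: mult_ac)
    have eq: "P r = (\<lambda>s. indicator {r..t} s * (?k (t - s) * ?w (s - r)))"
      using that by (auto simp: P_def fun_eq_iff indicator_def)
    show "integrable lborel (P r)" "(LINT s|lborel. P r s) = lam * ?E (t - r)"
      unfolding eq using lborel_integral_of_nonneg_has_integral[OF _ *]
        relaxation_rate_nonneg[OF \<alpha> lam] frac_kernel_nonneg[of "1 - \<alpha>"] \<alpha> by auto
  qed
  have outside: "P r s = 0" if "r \<notin> {0..<t}" "r \<noteq> t" for r s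
    using that by (auto simp: P_def)
  have ae: "AE r in lborel. r \<noteq> t" by (rule AE_lborel_singleton)
  have outer: "AE r in lborel. (LINT s|lborel. Hf (r, s)) = indicator {0..t} r * (lam * ?E (t - r) * z r)"
    using ae
  proof eventually_elim
    case (elim r)
    show ?case
    proof (cases "r \<in> {0..<t}")
      case True
      then show ?thesis using inner_s[OF True] by (simp add: Hf_def z'_def)
    next
      case False
      then show ?thesis using outside[OF False elim] elim by (auto simp: Hf_def indicator_def)
    qed
  qed
  have Econt: "continuous_on {0..t} (\<lambda>r. ?E (t - r))"
    by (intro continuous_on_compose2[OF continuous_on_relaxation[OF \<alpha> lam]] continuous_intros) auto
  have Eint: "integrable lborel (\<lambda>r. indicator {0..t} r * (lam * ?E (t - r) * c r))" if "continuous_on {0..t} c" for c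
  proof -
    have "continuous_on {0..t} (\<lambda>r. lam * ?E (t - r) * c r)" by (intro continuous_intros Econt that)
    then show ?thesis
      using borel_integrable_atLeastAtMost'[of 0 t "\<lambda>r. lam * ?E (t - r) * c r"]
      by (simp add: set_integrable_def)
  qed
  have int: "integrable (lborel \<Otimes>\<^sub>M lborel) Hf"
  proof (rule lborel_pair.Fubini_integrable[OF Hm])
    show "AE r in lborel. integrable lborel (\<lambda>s. Hf (r, s))"
      using ae
    proof eventually_elim
      case (elim r)
      show ?case using inner_s(1)[of r] outside[OF _ elim] by (cases "r \<in> {0..<t}") (auto simp: Hf_def)
    qed
    have "integrable lborel (\<lambda>r. indicator {0..t} r * (lam * ?E (t - r) * M))"
      by (rule Eint) simp
    then show "integrable lborel (\<lambda>r. LINT s|lborel. norm (Hf (r, s)))"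
    proof (rule Bochner_Integration.integrable_bound)
      show "AE r in lborel. norm (LINT s|lborel. norm (Hf (r, s))) \<le> norm (indicator {0..t} r * (lam * ?E (t - r) * M))"
        using ae
      proof eventually_elim
        case (elim r)
        show ?case
        proof (cases "r \<in> {0..<t}")
          case True
          have E0: "?E (t - r) \<ge> 0" using True by (intro relaxation_nonneg \<alpha> lam) auto
          have "(LINT s|lborel. norm (Hf (r, s))) = lam * ?E (t - r) * \<bar>z' r\<bar>"
            using inner_s[OF True] P0 by (simp add: Hf_def abs_mult)
          moreover have "lam * ?E (t - r) * \<bar>z' r\<bar> \<le> lam * ?E (t - r) * M"
            using lam E0 M by (intro mult_left_mono) auto
          moreover have "M \<ge> 0" using M[of 0] by linarith
          ultimately show ?thesis using True lam E0 by (simp add: abs_mult)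
        next
          case False
          then show ?thesis using outside[OF False elim] by (simp add: Hf_def)
        qed
      qed
      show "(\<lambda>r. LINT s|lborel. norm (Hf (r, s))) \<in> borel_measurable lborel"
        using Hm by measurable
    qed
  qed
  have inner_r: "(LINT r|lborel. Hf (r, s)) = indicator {0..t} s * (?k (t - s) * integral {0..s} (\<lambda>r. ?w (s - r) * z r))" for s
  proof (cases "s \<in> {0..t}")
    case True
    have wi: "(\<lambda>r. ?w (s - r)) absolutely_integrable_on {0..s}"
      using has_integral_frac_kernel_shifted[of "1 - \<alpha>" 0 s] \<alpha> True frac_kernel_nonneg[of "1 - \<alpha>"]
      by (intro nonnegative_absolutely_integrable_1) auto
    have zs: "continuous_on {0..s} z" using z by (rule continuous_on_subset) (use True in auto)
    have zb: "bounded (z ` {0..s})" by (intro compact_imp_bounded compact_continuous_image zs) auto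
    have "(\<lambda>r. z r * ?w (s - r)) absolutely_integrable_on {0..s}"
      using wi zb by (intro absolutely_integrable_bounded_measurable_product_real
        continuous_imp_measurable_on_sets_lebesgue zs) auto
    from set_lebesgue_integral_eq_integral(2)[OF this]
    have "(LINT r|lebesgue. indicator {0..s} r * (z r * ?w (s - r))) = integral {0..s} (\<lambda>r. ?w (s - r) * z r)"
      by (simp add: set_lebesgue_integral_def mult_ac)
    moreover have eq: "indicator {0..s} r * (z r * ?w (s - r)) = indicator {0..s} r * (z' r * ?w (s - r))" for r
      using True by (auto simp: z'_def indicator_def)
    moreover have "(LINT r|lebesgue. indicator {0..s} r * (z' r * ?w (s - r))) = (LINT r|lborel. indicator {0..s} r * (z' r * ?w (s - r)))"
      by (intro integral_completion) measurable
    moreover have "Hf (r, s) = ?k (t - s) * (indicator {0..s} r * (z' r * ?w (s - r)))" for r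
      using True by (auto simp: Hf_def P_def indicator_def)
    ultimately show ?thesis using True by simp
  next
    case False
    then have "Hf (r, s) = 0" for r by (auto simp: Hf_def P_def)
    then show ?thesis using False by simp
  qed
  have "(LINT s|lborel. LINT r|lborel. Hf (r, s)) = (LINT r|lborel. LINT s|lborel. Hf (r, s))"
    using lborel_pair.Fubini_integral[of "\<lambda>r s. Hf (r, s)"] int by simp
  also have "\<dots> = (LINT r|lborel. indicator {0..t} r * (lam * ?E (t - r) * z r))"
  proof (rule integral_cong_AE[OF _ _ outer])
    show "(\<lambda>r. LINT s|lborel. Hf (r, s)) \<in> borel_measurable lborel" using Hm by measurable
    show "(\<lambda>r. indicator {0..t} r * (lam * ?E (t - r) * z r)) \<in> borel_measurable lborel"
      using Eint[OF z] by (rule borel_measurable_integrable)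
  qed
  also have "\<dots> = integral {0..t} (\<lambda>r. lam * (?E (t - r) * z r))"
    using set_borel_integral_eq_integral(2)[of "{0..t}" "\<lambda>r. lam * ?E (t - r) * z r"] Eint[OF z]
    by (simp add: set_integrable_def set_lebesgue_integral_def mult_ac)
  also have "\<dots> = lam * integral {0..t} (\<lambda>r. ?E (t - r) * z r)" by simp
  finally have val: "(LINT s|lborel. LINT r|lborel. Hf (r, s)) = lam * integral {0..t} (\<lambda>r. ?E (t - r) * z r)" .
  have "integrable lborel (\<lambda>s. LINT r|lborel. Hf (r, s))"
    using lborel_pair.integrable_snd[of "\<lambda>r s. Hf (r, s)"] int by simp
  from has_integral_integral_lborel[OF this]
  have "((\<lambda>s. indicator {0..t} s * (?k (t - s) * integral {0..s} (\<lambda>r. ?w (s - r) * z r)))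
     has_integral lam * integral {0..t} (\<lambda>r. ?E (t - r) * z r)) UNIV"
    unfolding val unfolding inner_r .
  moreover have "(\<lambda>s. indicator {0..t} s * (?k (t - s) * integral {0..s} (\<lambda>r. ?w (s - r) * z r)))
      = (\<lambda>s. if s \<in> {0..t} then ?k (t - s) * integral {0..s} (\<lambda>r. ?w (s - r) * z r) else 0)"
    by (auto simp: fun_eq_iff)
  ultimately show ?thesis by (simp only: has_integral_restrict_UNIV)
qed

text \<open>As \<open>r\<close> tends to 0, this shows that the fractional integral of a bounded function vanishes at 0, which removes
one boundary term in the integration by parts below.\<close>

lemma fractional_integral_bound:
  fixes z :: "real \<Rightarrow> real"
  assumes r: "0 \<le> r" and z: "continuous_on {0..r} z" and M: "\<And>s. s \<in> {0..r} \<Longrightarrow> \<bar>z s\<bar> \<le> M"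
  shows "\<bar>integral {0..r} (\<lambda>s. frac_kernel (1 - \<alpha>) (r - s) * z s)\<bar> \<le> frac_kernel (2 - \<alpha>) r * M"
proof -
  have I: "((\<lambda>s. frac_kernel (1 - \<alpha>) (r - s)) has_integral frac_kernel (2 - \<alpha>) r) {0..r}"
    using has_integral_frac_kernel_shifted[of "1 - \<alpha>" 0 r] \<alpha> r by simp
  have wi: "(\<lambda>s. frac_kernel (1 - \<alpha>) (r - s)) absolutely_integrable_on {0..r}"
    using I \<alpha> frac_kernel_nonneg[of "1 - \<alpha>"] by (intro nonnegative_absolutely_integrable_1) auto
  have zb: "bounded (z ` {0..r})" by (intro compact_imp_bounded compact_continuous_image z) auto
  have "(\<lambda>s. z s * frac_kernel (1 - \<alpha>) (r - s)) absolutely_integrable_on {0..r}"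
    using wi zb by (intro absolutely_integrable_bounded_measurable_product_real
        continuous_imp_measurable_on_sets_lebesgue z) auto
  then have zi: "(\<lambda>s. frac_kernel (1 - \<alpha>) (r - s) * z s) integrable_on {0..r}"
    by (simp add: mult.commute set_lebesgue_integral_eq_integral(1))
  have "norm (integral {0..r} (\<lambda>s. frac_kernel (1 - \<alpha>) (r - s) * z s))
      \<le> integral {0..r} (\<lambda>s. frac_kernel (1 - \<alpha>) (r - s) * M)"
    using I M frac_kernel_nonneg[of "1 - \<alpha>"] \<alpha>
    by (intro integral_norm_bound_integral zi integrable_on_mult_left) (auto simp: abs_mult intro!: mult_left_mono)
  then show ?thesis using I by (simp add: integral_unique)
qed

text \<open>The variation of constants formula for \<open>\<partial>\<^sup>\<alpha> y + lam * y = f\<close>, integrated once in time. The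
equation is \<open>g' = f - lam * y\<close> for the fractional integral \<open>g\<close> of order \<open>1 - \<alpha>\<close>
of \<open>y - y 0\<close>. Integrate the derivative of \<open>(1 - E (t - s)) * g s\<close> over \<open>{0..t}\<close>: the
boundary terms vanish because \<open>E 0 = 1\<close> and \<open>g 0 = 0\<close>, and the term \<open>k (t - s) * g s\<close>
is evaluated by the preceding convolution identity. As \<open>f\<close> may be singular at 0, the integrability of its
product with the kernel is part of the conclusion.\<close>

lemma caputo_solution_integrated:
  fixes y f :: "real \<Rightarrow> real"
  assumes t: "0 < t" "t \<le> T" and y: "continuous_on {0..t} y"
    and cap: "\<And>r. 0 < r \<Longrightarrow> r \<le> t \<Longrightarrow> has_caputo_derivative \<alpha> T y (f r - lam * y r) r"
  shows "((\<lambda>s. (1 - relaxation \<alpha> lam (t - s)) * f s) has_integral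
     (lam * integral {0..t} y - lam * y 0 * integral {0..t} (relaxation \<alpha> lam))) {0..t}"
proof -
  let ?k = "relaxation_rate \<alpha> lam" and ?E = "relaxation \<alpha> lam" and ?w = "frac_kernel (1 - \<alpha>)"
  define z where "z s = y s - y 0" for s
  define g where "g r = integral {0..r} (\<lambda>s. ?w (r - s) * z s)" for r
  have z: "continuous_on {0..t} z" unfolding z_def by (intro continuous_intros y)
  have g': "(g has_vector_derivative (f r - lam * y r)) (at r within {0..T})" if "0 < r" "r \<le> t" for r
    using cap[OF that] unfolding has_caputo_derivative_unfold g_def z_def .
  obtain M where M: "\<forall>r\<in>{0..t}. \<bar>z r\<bar> \<le> M"
    using compact_imp_bounded[OF compact_continuous_image[OF z compact_Icc]] by (auto simp: bounded_iff)
  have g0: "g 0 = 0" by (simp add: g_def)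
  have gc: "continuous_on {0..t} g"
    unfolding continuous_on_def
  proof
    fix r assume r: "r \<in> {0..t}"
    show "(g \<longlongrightarrow> g r) (at r within {0..t})"
    proof (cases "r = 0")
      case True
      have "((\<lambda>r. frac_kernel (2 - \<alpha>) r * M) \<longlongrightarrow> frac_kernel (2 - \<alpha>) 0 * M) (at 0 within {0..t})"
      proof -
        have "(\<lambda>r. frac_kernel (2 - \<alpha>) r * M) = (\<lambda>r. r powr (1 - \<alpha>) * (M / Gamma (2 - \<alpha>)))"
          by (simp add: frac_kernel_def)
        moreover have "continuous_on {0..t} (\<lambda>r. r powr (1 - \<alpha>) * (M / Gamma (2 - \<alpha>)))"
          using \<alpha> by (intro continuous_on_mult_right continuous_on_powr' continuous_on_id continuous_on_const) auto
        ultimately have "continuous_on {0..t} (\<lambda>r. frac_kernel (2 - \<alpha>) r * M)" by (simp only:)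
        then show ?thesis unfolding continuous_on_def using t by (elim bspec) auto
      qed
      then have "((\<lambda>r. frac_kernel (2 - \<alpha>) r * M) \<longlongrightarrow> 0) (at 0 within {0..t})"
        by (simp add: frac_kernel_def)
      then have "(g \<longlongrightarrow> 0) (at 0 within {0..t})"
      proof (rule Lim_null_comparison[rotated])
        show "\<forall>\<^sub>F r in at 0 within {0..t}. norm (g r) \<le> frac_kernel (2 - \<alpha>) r * M"
          unfolding eventually_at_filter
        proof (intro always_eventually allI impI)
          fix r assume "r \<noteq> 0" "r \<in> {0..t}"
          then show "norm (g r) \<le> frac_kernel (2 - \<alpha>) r * M"
            unfolding g_def real_norm_def using M
            by (intro fractional_integral_bound continuous_on_subset[OF z]) auto
        qed
      qed
      then show ?thesis using True g0 by simp
    next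
      case False
      have "(g \<longlongrightarrow> g r) (at r within {0..T})"
        using has_vector_derivative_continuous[OF g'[of r]] False r by (simp add: continuous_within)
      then show ?thesis by (rule tendsto_within_subset) (use t in auto)
    qed
  qed
  have Ec: "continuous_on {0..t} (\<lambda>s. ?E (t - s))"
    by (intro continuous_on_compose2[OF continuous_on_relaxation[OF \<alpha> lam]] continuous_intros) auto
  have "((\<lambda>s. (1 - ?E (t - s)) * (f s - lam * y s) - ?k (t - s) * g s) has_integral
      (1 - ?E (t - t)) * g t - (1 - ?E (t - 0)) * g 0) {0..t}"
  proof (rule fundamental_theorem_of_calculus_interior)
    show "continuous_on {0..t} (\<lambda>s. (1 - ?E (t - s)) * g s)"
      by (intro continuous_intros Ec gc)
    fix s assume s: "s \<in> {0<..<t}"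
    have "at s within {0..T} = at s"
      using s t by (intro at_within_interior) auto
    then have gd: "(g has_real_derivative (f s - lam * y s)) (at s)"
      using g'[of s] s by (simp add: has_real_derivative_iff_has_vector_derivative)
    have "((\<lambda>s. ?E (t - s)) has_real_derivative (- ?k (t - s)) * (-1)) (at s)"
      using s by (intro DERIV_chain2[OF relaxation_has_real_derivative[OF \<alpha> lam]]) (auto intro!: derivative_eq_intros)
    then have "((\<lambda>s. (1 - ?E (t - s)) * g s) has_real_derivative
        (1 - ?E (t - s)) * (f s - lam * y s) - ?k (t - s) * g s) (at s)"
      using gd by (auto intro!: derivative_eq_intros simp: algebra_simps)
    then show "((\<lambda>s. (1 - ?E (t - s)) * g s) has_vector_derivative
        (1 - ?E (t - s)) * (f s - lam * y s) - ?k (t - s) * g s) (at s)"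
      by (simp add: has_real_derivative_iff_has_vector_derivative)
  qed (use t in auto)
  then have 1: "((\<lambda>s. (1 - ?E (t - s)) * (f s - lam * y s) - ?k (t - s) * g s) has_integral 0) {0..t}"
    by (simp add: g0 relaxation_0[OF \<alpha> lam])
  have 2: "((\<lambda>s. ?k (t - s) * g s) has_integral lam * integral {0..t} (\<lambda>r. ?E (t - r) * z r)) {0..t}"
    unfolding g_def by (rule relaxation_rate_convolution_fractional_integral[OF t(1) z])
  have 3: "((\<lambda>s. (1 - ?E (t - s)) * (lam * y s)) has_integral
      integral {0..t} (\<lambda>s. (1 - ?E (t - s)) * (lam * y s))) {0..t}"
    by (intro integrable_integral integrable_continuous_real continuous_intros Ec y)
  from has_integral_add[OF has_integral_add[OF 1 2] 3]
  have 4: "((\<lambda>s. (1 - ?E (t - s)) * f s) has_integral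
      (lam * integral {0..t} (\<lambda>r. ?E (t - r) * z r) + integral {0..t} (\<lambda>s. (1 - ?E (t - s)) * (lam * y s)))) {0..t}"
    by (simp add: algebra_simps)
  have Ey: "(\<lambda>s. ?E (t - s) * y s) integrable_on {0..t}" and yi: "y integrable_on {0..t}" and Ei: "(\<lambda>s. ?E (t - s)) integrable_on {0..t}"
    by (intro integrable_continuous_real continuous_intros Ec y)+
  have "integral {0..t} (\<lambda>r. ?E (t - r) * z r) = integral {0..t} (\<lambda>s. ?E (t - s) * y s) - integral {0..t} (\<lambda>s. ?E (t - s) * y 0)"
    unfolding z_def right_diff_distrib by (intro integral_diff Ey integrable_on_mult_left Ei)
  moreover have "integral {0..t} (\<lambda>s. ?E (t - s) * y 0) = integral {0..t} (\<lambda>s. ?E (t - s)) * y 0" by simp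
  moreover have "integral {0..t} (\<lambda>s. ?E (t - s)) = integral {0..t} ?E"
  proof -
    have "(?E has_integral integral {0..t} ?E) {0..t}"
      by (intro integrable_integral integrable_continuous_real continuous_on_subset[OF continuous_on_relaxation[OF \<alpha> lam]]) auto
    from has_integral_reflect_shift[OF this, of t] show ?thesis by (simp add: integral_unique)
  qed
  moreover have "integral {0..t} (\<lambda>s. (1 - ?E (t - s)) * (lam * y s)) = lam * integral {0..t} y - lam * integral {0..t} (\<lambda>s. ?E (t - s) * y s)"
  proof -
    have "integral {0..t} (\<lambda>s. (1 - ?E (t - s)) * (lam * y s)) = integral {0..t} (\<lambda>s. lam * y s - lam * (?E (t - s) * y s))"
      by (intro arg_cong[where f="integral {0..t}"]) (auto simp: algebra_simps)
    also have "\<dots> = integral {0..t} (\<lambda>s. lam * y s) - integral {0..t} (\<lambda>s. lam * (?E (t - s) * y s))"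
      by (intro integral_diff integrable_on_mult_right Ey yi)
    finally show ?thesis by simp
  qed
  ultimately have "lam * integral {0..t} (\<lambda>r. ?E (t - r) * z r) + integral {0..t} (\<lambda>s. (1 - ?E (t - s)) * (lam * y s))
     = lam * integral {0..t} y - lam * y 0 * integral {0..t} ?E"
    by (simp only:) (simp add: algebra_simps)
  then show ?thesis using 4 by simp
qed

text \<open>For \<open>f = 0\<close> the integrated formula says that \<open>y\<close> and \<open>y 0 * E\<close> have the same integral
over every interval \<open>{0..x}\<close>; differentiate in \<open>x\<close>.\<close>

lemma caputo_homogeneous_solution:
  fixes y :: "real \<Rightarrow> real"
  assumes y: "continuous_on {0..T} y"
    and cap: "\<And>r. 0 < r \<Longrightarrow> r \<le> T \<Longrightarrow> has_caputo_derivative \<alpha> T y (- lam * y r) r"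
    and t: "t \<in> {0..T}"
  shows "y t = relaxation \<alpha> lam t * y 0"
proof (cases "t = 0")
  case True
  then show ?thesis by (simp add: relaxation_0[OF \<alpha> lam])
next
  case False
  then have t0: "0 < t" "t \<le> T" using t by auto
  let ?E = "relaxation \<alpha> lam"
  have eq: "integral {0..x} y = y 0 * integral {0..x} ?E" if x: "x \<in> {0..T}" for x
  proof (cases "x = 0")
    case False
    then have "((\<lambda>s. (1 - ?E (x - s)) * 0) has_integral
       (lam * integral {0..x} y - lam * y 0 * integral {0..x} ?E)) {0..x}"
      using x cap by (intro caputo_solution_integrated[where T=T and f="\<lambda>_. 0"] continuous_on_subset[OF y]) auto
    then show ?thesis using lam by (simp add: has_integral_iff)
  qed simp
  have Ec: "continuous_on {0..T} ?E"
    by (rule continuous_on_subset[OF continuous_on_relaxation[OF \<alpha> lam]]) auto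
  have 1: "((\<lambda>x. integral {0..x} y) has_vector_derivative y t) (at t within {0..T})"
    by (rule integral_has_vector_derivative[OF y t])
  have "((\<lambda>x. y 0 * integral {0..x} ?E) has_vector_derivative y 0 * ?E t) (at t within {0..T})"
    by (intro has_vector_derivative_mult_right integral_has_vector_derivative[OF Ec t])
  then have 2: "((\<lambda>x. integral {0..x} y) has_vector_derivative y 0 * ?E t) (at t within {0..T})"
    by (rule has_vector_derivative_transform[OF t, rotated]) (simp add: eq)
  have "y t = y 0 * ?E t"
    using vector_derivative_unique_within_closed_interval[of 0 T t _ "y t" "y 0 * ?E t"] 1 2 t0 by auto
  then show ?thesis by (simp add: mult.commute)
qed

end

section \<open>Completeness of the space of square-integrable classes\<close>

lemma L2_rel_rep: "L2_rel (rep_L2 f) (rep_L2 f)"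
  using Quotient3_rep_reflp[OF Quotient3_L2] .

lemma sq_integrable_rep: "sq_integrable (rep_L2 f)"
  using L2_rel_rep[of f] by (simp add: L2_rel_def)

lemma abs_rep_L2: "abs_L2 (rep_L2 f) = f"
  using Quotient3_abs_rep[OF Quotient3_L2] .

lemma abs_L2_eq_iff:
  assumes "sq_integrable f" "sq_integrable g"
  shows "abs_L2 f = abs_L2 g \<longleftrightarrow> (AE x in lebesgue. f x = g x)"
  using Quotient3_rel[OF Quotient3_L2, of f g] assms by (auto simp: L2_rel_def)

lemma rep_abs_L2:
  assumes "sq_integrable f"
  shows "AE x in lebesgue. rep_L2 (abs_L2 f) x = f x"
  using abs_L2_eq_iff[of "rep_L2 (abs_L2 f)" f] assms sq_integrable_rep abs_rep_L2 by auto

lemma inner_abs_L2: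
  assumes "sq_integrable f" "sq_integrable g"
  shows "abs_L2 f \<bullet> abs_L2 g = (LINT x|lebesgue. f x \<bullet> g x)"
  using assms by (intro inner_L2.abs_eq) (auto simp: L2_rel_def)

lemma inner_L2_eq: "f \<bullet> g = (LINT x|lebesgue. rep_L2 f x \<bullet> rep_L2 g x)"
  using inner_abs_L2[OF sq_integrable_rep sq_integrable_rep, of f g] by (simp add: abs_rep_L2)

lemma norm_L2_eq: "(norm f)\<^sup>2 = (LINT x|lebesgue. (norm (rep_L2 f x))\<^sup>2)"
  by (simp add: power2_norm_eq_inner inner_L2_eq)

lemma rep_L2_diff: "AE x in lebesgue. rep_L2 (f - g) x = rep_L2 f x - rep_L2 g x"
  for f g :: "('a::euclidean_space, 'b::euclidean_space) L2"
proof -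
  have "abs_L2 (\<lambda>x. rep_L2 f x - rep_L2 g x) = abs_L2 (rep_L2 f) - abs_L2 (rep_L2 g)"
    using L2_rel_rep by (intro minus_L2.abs_eq[symmetric]) auto
  then have "f - g = abs_L2 (\<lambda>x. rep_L2 f x - rep_L2 g x)" by (simp add: abs_rep_L2)
  then show ?thesis
    using rep_abs_L2[OF sq_integrable_diff[OF sq_integrable_rep sq_integrable_rep], of f g] by simp
qed

lemma rep_L2_add: "AE x in lebesgue. rep_L2 (f + g) x = rep_L2 f x + rep_L2 g x"
  for f g :: "('a::euclidean_space, 'b::euclidean_space) L2"
proof -
  have "abs_L2 (\<lambda>x. rep_L2 f x + rep_L2 g x) = abs_L2 (rep_L2 f) + abs_L2 (rep_L2 g)"
    using L2_rel_rep by (intro plus_L2.abs_eq[symmetric]) auto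
  then have "f + g = abs_L2 (\<lambda>x. rep_L2 f x + rep_L2 g x)" by (simp add: abs_rep_L2)
  then show ?thesis
    using rep_abs_L2[OF sq_integrable_add[OF sq_integrable_rep sq_integrable_rep], of f g] by simp
qed

lemma rep_L2_scaleR: "AE x in lebesgue. rep_L2 (r *\<^sub>R f) x = r *\<^sub>R rep_L2 f x"
  for f :: "('a::euclidean_space, 'b::euclidean_space) L2"
proof -
  have "abs_L2 (\<lambda>x. r *\<^sub>R rep_L2 f x) = r *\<^sub>R abs_L2 (rep_L2 f)"
    using L2_rel_rep by (intro scaleR_L2.abs_eq[symmetric]) auto
  then have "r *\<^sub>R f = abs_L2 (\<lambda>x. r *\<^sub>R rep_L2 f x)" by (simp add: abs_rep_L2)
  then show ?thesis
    using rep_abs_L2[OF sq_integrable_scaleR[OF sq_integrable_rep], of r f] by simp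
qed

lemma nn_integral_sq_norm_rep:
  "(\<integral>\<^sup>+x. ennreal ((norm (rep_L2 f x))\<^sup>2) \<partial>lebesgue) = ennreal ((norm f)\<^sup>2)"
  unfolding norm_L2_eq using sq_integrable_rep[of f]
  by (intro nn_integral_eq_integral) (auto simp: sq_integrable_def)

text \<open>A weighted arithmetic-geometric mean inequality. It turns square-integrability of rapidly decreasing differences into
pointwise absolute convergence of their sum.\<close>

lemma sq_summable_imp_summable:
  fixes a :: "nat \<Rightarrow> real"
  assumes "\<And>k. a k \<ge> 0" "summable (\<lambda>k. 2 ^ k * (a k)\<^sup>2)"
  shows "summable a"
proof (rule summable_comparison_test')
  show "summable (\<lambda>k. 2 ^ k * (a k)\<^sup>2 + (1/2) ^ k)"
    using assms by (intro summable_add summable_geometric) auto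
  fix k :: nat
  have "2 * ((2::real) ^ k * (1/2)^k * a k) \<le> 2 ^ k * ((a k)\<^sup>2 + ((1/2) ^ k)\<^sup>2)"
    using mult_left_mono[OF sum_squares_bound[of "a k" "(1/2)^k"], of "2^k"] by (simp add: algebra_simps)
  also have "\<dots> = 2 ^ k * (a k)\<^sup>2 + (1/2) ^ k"
    by (simp add: power2_eq_square distrib_left power_mult_distrib[symmetric])
  also have "2 * ((2::real) ^ k * (1/2)^k * a k) = 2 * a k"
    by (simp add: power_one_over)
  finally show "norm (a k) \<le> 2 ^ k * (a k)\<^sup>2 + (1/2) ^ k" using assms(1)[of k] by simp
qed

text \<open>The Riesz-Fischer theorem. A subsequence whose successive distances are below \<open>(1/2) ^ k\<close> converges almost
everywhere, because the integral of the sum of \<open>2 ^ k\<close> times the squared differences is finite. By Fatou's lemma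
the pointwise limit is within \<open>(1/2) ^ k\<close> of the tails of the sequence, so it is square-integrable and the limit
in the norm.\<close>

instance L2 :: (euclidean_space, euclidean_space) complete_space
proof
  fix X :: "nat \<Rightarrow> ('a, 'b) L2"
  assume X: "Cauchy X"
  have "\<exists>N. \<forall>m\<ge>N. \<forall>n\<ge>N. norm (X m - X n) < (1/2) ^ k" for k :: nat
    using X by (auto simp: Cauchy_def dist_norm)
  then obtain N where N: "\<And>k m n. m \<ge> N k \<Longrightarrow> n \<ge> N k \<Longrightarrow> norm (X m - X n) < (1/2) ^ k"
    by metis
  define M where "M k = Max (N ` {..k})" for k
  have M: "M k \<ge> N j" if "j \<le> k" for j k unfolding M_def using that by (intro Max_ge) auto
  define g where "g k = rep_L2 (X (M k))" for k
  have gm[measurable]: "g k \<in> borel_measurable lebesgue" for k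
    using sq_integrable_rep[of "X (M k)"] by (simp add: g_def sq_integrable_def)
  have diff_int: "(\<integral>\<^sup>+x. ennreal ((norm (g m x - rep_L2 (X n) x))\<^sup>2) \<partial>lebesgue) = ennreal ((norm (X (M m) - X n))\<^sup>2)" for m n
    unfolding nn_integral_sq_norm_rep[symmetric] g_def
  proof (rule nn_integral_cong_AE)
    show "AE x in lebesgue. ennreal ((norm (rep_L2 (X (M m)) x - rep_L2 (X n) x))\<^sup>2) = ennreal ((norm (rep_L2 (X (M m) - X n) x))\<^sup>2)"
      using rep_L2_diff[of "X (M m)" "X n"] by eventually_elim simp
  qed
  have step: "(norm (X (M (Suc k)) - X (M k)))\<^sup>2 \<le> (1/4) ^ k" for k
  proof -
    have "norm (X (M (Suc k)) - X (M k)) \<le> (1/2) ^ k"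
      by (intro less_imp_le[OF N] M) auto
    then have "(norm (X (M (Suc k)) - X (M k)))\<^sup>2 \<le> ((1/2) ^ k)\<^sup>2" by (intro power_mono) auto
    then show ?thesis by (simp add: power2_eq_square power_mult_distrib[symmetric])
  qed
  have "(\<integral>\<^sup>+x. (\<Sum>k. ennreal (2 ^ k * (norm (g (Suc k) x - g k x))\<^sup>2)) \<partial>lebesgue)
      = (\<Sum>k. \<integral>\<^sup>+x. ennreal (2 ^ k * (norm (g (Suc k) x - g k x))\<^sup>2) \<partial>lebesgue)"
    by (intro nn_integral_suminf) measurable
  also have "\<dots> \<le> (\<Sum>k. ennreal ((1/2) ^ k))"
  proof (intro suminf_le summableI)
    fix k
    have "(\<integral>\<^sup>+x. ennreal (2 ^ k * (norm (g (Suc k) x - g k x))\<^sup>2) \<partial>lebesgue)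
        = ennreal (2 ^ k) * (\<integral>\<^sup>+x. ennreal ((norm (g (Suc k) x - g k x))\<^sup>2) \<partial>lebesgue)"
      by (subst nn_integral_cmult[symmetric]) (auto simp: ennreal_mult)
    also have "\<dots> = ennreal (2 ^ k * (norm (X (M (Suc k)) - X (M k)))\<^sup>2)"
      using diff_int[of "Suc k" "M k"] by (simp add: g_def ennreal_mult)
    also have "\<dots> \<le> ennreal (2 ^ k * (1/4) ^ k)"
      by (intro ennreal_leI mult_left_mono step) auto
    also have "(2::real) ^ k * (1/4) ^ k = (1/2) ^ k" by (simp add: power_mult_distrib[symmetric])
    finally show "(\<integral>\<^sup>+x. ennreal (2 ^ k * (norm (g (Suc k) x - g k x))\<^sup>2) \<partial>lebesgue) \<le> ennreal ((1/2) ^ k)" .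
  qed
  also have "\<dots> < top"
  proof -
    have "(\<Sum>k. ennreal ((1/2::real) ^ k)) = ennreal (\<Sum>k. (1/2::real) ^ k)"
      by (rule suminf_ennreal2) (auto intro: summable_geometric)
    then show ?thesis by simp
  qed
  finally have "AE x in lebesgue. (\<Sum>k. ennreal (2 ^ k * (norm (g (Suc k) x - g k x))\<^sup>2)) \<noteq> \<infinity>"
    by (intro nn_integral_PInf_AE) auto
  then have "AE x in lebesgue. convergent (\<lambda>k. g k x)"
  proof eventually_elim
    case (elim x)
    then have "summable (\<lambda>k. 2 ^ k * (norm (g (Suc k) x - g k x))\<^sup>2)"
      using summable_suminf_not_top[of "\<lambda>k. 2 ^ k * (norm (g (Suc k) x - g k x))\<^sup>2"] by simp
    then have "summable (\<lambda>k. norm (g (Suc k) x - g k x))"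
      by (rule sq_summable_imp_summable[rotated]) auto
    then have "summable (\<lambda>k. g (Suc k) x - g k x)" by (rule summable_norm_cancel)
    then have "convergent (\<lambda>m. g m x - g 0 x)"
      by (simp add: summable_iff_convergent sum_lessThan_telescope[of "\<lambda>k. g k x"])
    then show ?case by (simp add: convergent_diff_const_right_iff)
  qed
  define G where "G x = lim (\<lambda>k. g k x)" for x
  have Gm[measurable]: "G \<in> borel_measurable lebesgue" unfolding G_def by (rule borel_measurable_lim_metric) simp
  have lim: "AE x in lebesgue. (\<lambda>k. g k x) \<longlonglongrightarrow> G x"
    using \<open>AE x in lebesgue. convergent (\<lambda>k. g k x)\<close> by eventually_elim (simp add: G_def convergent_LIMSEQ_iff)
  have fatou: "(\<integral>\<^sup>+x. ennreal ((norm (G x - rep_L2 (X n) x))\<^sup>2) \<partial>lebesgue) \<le> ennreal (((1/2) ^ k)\<^sup>2)" if n: "n \<ge> N k" for k n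
  proof -
    have rm[measurable]: "rep_L2 (X n) \<in> borel_measurable lebesgue"
      using sq_integrable_rep[of "X n"] by (simp add: sq_integrable_def)
    have "(\<integral>\<^sup>+x. ennreal ((norm (G x - rep_L2 (X n) x))\<^sup>2) \<partial>lebesgue)
        = (\<integral>\<^sup>+x. liminf (\<lambda>m. ennreal ((norm (g m x - rep_L2 (X n) x))\<^sup>2)) \<partial>lebesgue)"
    proof (rule nn_integral_cong_AE)
      show "AE x in lebesgue. ennreal ((norm (G x - rep_L2 (X n) x))\<^sup>2) = liminf (\<lambda>m. ennreal ((norm (g m x - rep_L2 (X n) x))\<^sup>2))"
        using lim
      proof eventually_elim
        case (elim x)
        have "(\<lambda>m. ennreal ((norm (g m x - rep_L2 (X n) x))\<^sup>2)) \<longlonglongrightarrow> ennreal ((norm (G x - rep_L2 (X n) x))\<^sup>2)"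
          by (intro tendsto_ennrealI tendsto_intros elim)
        then show ?case by (intro lim_imp_Liminf[symmetric]) auto
      qed
    qed
    also have "\<dots> \<le> liminf (\<lambda>m. \<integral>\<^sup>+x. ennreal ((norm (g m x - rep_L2 (X n) x))\<^sup>2) \<partial>lebesgue)"
      by (rule nn_integral_liminf) measurable
    also have "\<dots> \<le> ennreal (((1/2) ^ k)\<^sup>2)"
      unfolding diff_int
    proof (rule Liminf_le)
      show "\<forall>\<^sub>F m in sequentially. ennreal ((norm (X (M m) - X n))\<^sup>2) \<le> ennreal (((1/2) ^ k)\<^sup>2)"
        using eventually_ge_at_top[of k]
        by eventually_elim (intro ennreal_leI power_mono less_imp_le[OF N] M n, auto)
    qed simp
    finally show ?thesis .
  qed
  have sq: "sq_integrable (\<lambda>x. G x - rep_L2 (X n) x)" if "n \<ge> N 0" for n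
  proof -
    have rm[measurable]: "rep_L2 (X n) \<in> borel_measurable lebesgue"
      using sq_integrable_rep[of "X n"] by (simp add: sq_integrable_def)
    have "(\<integral>\<^sup>+x. ennreal ((norm (G x - rep_L2 (X n) x))\<^sup>2) \<partial>lebesgue) < \<infinity>"
      using fatou[OF that] by (rule order.strict_trans1) simp
    then show ?thesis unfolding sq_integrable_def by (auto intro!: integrableI_bounded)
  qed
  have GQ: "sq_integrable G"
    using sq_integrable_add[OF sq[of "N 0"] sq_integrable_rep[of "X (N 0)"]] by simp
  define L where "L = abs_L2 G"
  have close: "norm (L - X n) \<le> (1/2) ^ k" if n: "n \<ge> N k" for k n
  proof -
    have rm[measurable]: "rep_L2 (X n) \<in> borel_measurable lebesgue"
      using sq_integrable_rep[of "X n"] by (simp add: sq_integrable_def)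
    have "ennreal ((norm (L - X n))\<^sup>2) = (\<integral>\<^sup>+x. ennreal ((norm (G x - rep_L2 (X n) x))\<^sup>2) \<partial>lebesgue)"
      unfolding nn_integral_sq_norm_rep[symmetric]
    proof (rule nn_integral_cong_AE)
      show "AE x in lebesgue. ennreal ((norm (rep_L2 (L - X n) x))\<^sup>2) = ennreal ((norm (G x - rep_L2 (X n) x))\<^sup>2)"
        using rep_L2_diff[of L "X n"] rep_abs_L2[OF GQ] by eventually_elim (simp add: L_def)
    qed
    also have "\<dots> \<le> ennreal (((1/2) ^ k)\<^sup>2)" by (rule fatou[OF n])
    finally have "(norm (L - X n))\<^sup>2 \<le> ((1/2) ^ k)\<^sup>2" by (simp add: ennreal_le_iff)
    then show ?thesis by (rule power2_le_imp_le) simp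
  qed
  have "X \<longlonglongrightarrow> L"
  proof (rule LIMSEQ_I)
    fix r :: real assume "r > 0"
    then obtain k where "(1/2::real) ^ k < r" using real_arch_pow_inv[of r "1/2"] by auto
    then show "\<exists>no. \<forall>n\<ge>no. norm (X n - L) < r"
      using close by (intro exI[of _ "N k"]) (force simp: norm_minus_commute intro: le_less_trans)
  qed
  then show "convergent X" by (auto simp: convergent_def)
qed

instance L2 :: (euclidean_space, euclidean_space) banach ..

section \<open>Dominated approximation of vector-valued integrals\<close>

text \<open>The integrals in the Caputo derivative have an unbounded integrand with values in an infinite-dimensional space; their
existence is obtained by approximation. Here \<open>f\<close> is approximated by integrable functions with an error whose
norm has an integrable bound of small integral. Riemann sums of \<open>f\<close> then differ from those of the approximation
by at most Riemann sums of the bound, and the Cauchy criterion carries over to \<open>f\<close>.\<close>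

lemma integrable_on_norm_approx:
  fixes f :: "real \<Rightarrow> 'a::banach"
  assumes fn: "\<And>n. fn n integrable_on {a..b}" and hn: "\<And>n. hn n integrable_on {a..b}"
    and bound: "\<And>n x. x \<in> {a..b} \<Longrightarrow> norm (f x - fn n x) \<le> hn n x"
    and lim: "(\<lambda>n. integral {a..b} (hn n)) \<longlonglongrightarrow> 0"
  shows "f integrable_on {a..b}"
proof -
  have "f integrable_on cbox a b"
    unfolding integrable_Cauchy
  proof (intro allI impI)
    fix e :: real assume e: "e > 0"
    then obtain n where n: "\<bar>integral {a..b} (hn n)\<bar> < e / 5"
      using LIMSEQ_D[OF lim, of "e/5"] by auto
    have e5: "e / 5 > 0" using e by simp
    have fi: "fn n integrable_on cbox a b" using fn[of n] by simp
    define S where "S F D = (\<Sum>(x,K)\<in>D. measure lborel K *\<^sub>R (F x :: 'a))" for F :: "real \<Rightarrow> 'a" and D :: "(real \<times> real set) set"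
    have "\<exists>g1. gauge g1 \<and> (\<forall>D1 D2. D1 tagged_division_of cbox a b \<and> g1 fine D1 \<and>
        D2 tagged_division_of cbox a b \<and> g1 fine D2 \<longrightarrow> norm (S (fn n) D1 - S (fn n) D2) < e / 5)"
      using fi[unfolded integrable_Cauchy, rule_format, OF e5] unfolding S_def .
    then obtain g1 where g1: "gauge g1 \<and> (\<forall>D1 D2. D1 tagged_division_of cbox a b \<and> g1 fine D1 \<and>
        D2 tagged_division_of cbox a b \<and> g1 fine D2 \<longrightarrow> norm (S (fn n) D1 - S (fn n) D2) < e / 5)" ..
    have hi: "(hn n has_integral integral {a..b} (hn n)) (cbox a b)"
      using integrable_integral[OF hn[of n]] by simp
    obtain g2 where g2: "gauge g2 \<and> (\<forall>D. D tagged_division_of cbox a b \<and> g2 fine D \<longrightarrow>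
        norm ((\<Sum>(x,K)\<in>D. measure lborel K *\<^sub>R hn n x) - integral {a..b} (hn n)) < e / 5)"
      using hi[unfolded has_integral, rule_format, OF e5] by (elim exE) (rule that)
    have near: "norm (S f D - S (fn n) D) < 2 * e / 5"
      if D: "D tagged_division_of cbox a b" "g2 fine D" for D
    proof -
      have "norm (S f D - S (fn n) D) = norm (\<Sum>(x,K)\<in>D. measure lborel K *\<^sub>R (f x - fn n x))"
        unfolding S_def by (simp add: sum_subtractf[symmetric] case_prod_unfold scaleR_diff_right)
      also have "\<dots> \<le> (\<Sum>(x,K)\<in>D. measure lborel K *\<^sub>R hn n x)"
      proof (rule sum_norm_le)
        fix p assume "p \<in> D"
        then obtain x K where p: "p = (x, K)" "x \<in> cbox a b" using D(1) by (cases p) (auto dest: tag_in_interval)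
        then have "norm (f x - fn n x) \<le> hn n x" using bound[of x n] by simp
        then show "norm (case p of (x, K) \<Rightarrow> measure lborel K *\<^sub>R (f x - fn n x)) \<le> (case p of (x, K) \<Rightarrow> measure lborel K *\<^sub>R hn n x)"
          using p by (auto intro!: mult_left_mono)
      qed
      also have "\<dots> < integral {a..b} (hn n) + e / 5"
      proof -
        have "norm ((\<Sum>(x,K)\<in>D. measure lborel K *\<^sub>R hn n x) - integral {a..b} (hn n)) < e / 5"
          by (rule g2[THEN conjunct2, rule_format]) (use D in auto)
        then show ?thesis unfolding real_norm_def by linarith
      qed
      also have "\<dots> < 2 * e / 5" using n by linarith
      finally show ?thesis .
    qed
    have "norm (S f D1 - S f D2) < e"
      if as: "D1 tagged_division_of cbox a b \<and> (\<lambda>x. g1 x \<inter> g2 x) fine D1 \<and>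
        D2 tagged_division_of cbox a b \<and> (\<lambda>x. g1 x \<inter> g2 x) fine D2" for D1 D2
    proof -
      have fine: "g1 fine D1" "g2 fine D1" "g1 fine D2" "g2 fine D2" using as by (auto simp: fine_Int)
      have "norm (S f D1 - S (fn n) D1) < 2 * e / 5" "norm (S f D2 - S (fn n) D2) < 2 * e / 5"
        by (rule near; use as fine in auto)+
      moreover have "norm (S (fn n) D1 - S (fn n) D2) < e / 5"
        by (rule g1[THEN conjunct2, rule_format]) (use as fine in auto)
      moreover have eq: "S f D1 - S f D2 = (S f D1 - S (fn n) D1) - (S f D2 - S (fn n) D2) + (S (fn n) D1 - S (fn n) D2)"
        by simp
      have "norm (S f D1 - S f D2) \<le> norm (S f D1 - S (fn n) D1) + norm (S f D2 - S (fn n) D2) + norm (S (fn n) D1 - S (fn n) D2)"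
        by (subst eq, rule order_trans[OF norm_triangle_ineq add_right_mono[OF norm_triangle_ineq4]])
      ultimately show ?thesis by linarith
    qed
    moreover have "gauge (\<lambda>x. g1 x \<inter> g2 x)" using g1 g2 by (intro gauge_Int) auto
    ultimately show "\<exists>\<gamma>. gauge \<gamma> \<and> (\<forall>\<D>1 \<D>2. \<D>1 tagged_division_of cbox a b \<and> \<gamma> fine \<D>1 \<and>
        \<D>2 tagged_division_of cbox a b \<and> \<gamma> fine \<D>2 \<longrightarrow>
        norm ((\<Sum>(x,K)\<in>\<D>1. measure lborel K *\<^sub>R f x) - (\<Sum>(x,K)\<in>\<D>2. measure lborel K *\<^sub>R f x)) < e)"
      unfolding S_def by (intro exI[of _ "\<lambda>x. g1 x \<inter> g2 x"] conjI allI impI)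
  qed
  then show ?thesis by simp
qed

section \<open>Bump functions and the fundamental lemma of the calculus of variations\<close>

lemma Ck_on_Suc_imp: "Ck_on (Suc k) U f \<Longrightarrow> Ck_on k U f"
proof (induction k arbitrary: f)
  case 0
  then show ?case by (auto intro!: continuous_at_imp_continuous_on differentiable_imp_continuous_within)
next
  case (Suc k)
  show ?case unfolding Ck_on.simps(2)
  proof (intro conjI ballI)
    fix x assume "x \<in> U" then show "f differentiable at x" using Suc.prems by simp
  next
    fix i :: 'a assume "i \<in> Basis"
    then have "Ck_on (Suc k) U (\<lambda>x. frechet_derivative f (at x) i)" using Suc.prems unfolding Ck_on.simps(2) by blast
    then show "Ck_on k U (\<lambda>x. frechet_derivative f (at x) i)" by (rule Suc.IH)
  qed
qed

text \<open>The definition speaks about \<open>frechet_derivative\<close>; this introduction rule allows any explicit formula for the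
derivative.\<close>

lemma Ck_on_SucI:
  fixes f :: "'a::euclidean_space \<Rightarrow> 'b::real_normed_vector"
  assumes "\<And>x. (f has_derivative D x) (at x)" "\<And>i. i \<in> Basis \<Longrightarrow> Ck_on k UNIV (\<lambda>x. D x i)"
  shows "Ck_on (Suc k) UNIV f"
proof -
  have "D x = frechet_derivative f (at x)" for x by (rule frechet_derivative_at[OF assms(1)])
  then show ?thesis using assms by (auto simp: differentiable_def)
qed

lemma Ck_on_SucD:
  assumes "Ck_on (Suc k) UNIV f"
  shows "(f has_derivative frechet_derivative f (at x)) (at x)"
    "i \<in> Basis \<Longrightarrow> Ck_on k UNIV (\<lambda>x. frechet_derivative f (at x) i)"
  using assms frechet_derivative_works[of f "at x"] unfolding Ck_on.simps(2) by blast+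

lemma Ck_on_const: "Ck_on k UNIV (\<lambda>x. c)"
proof (induction k arbitrary: c)
  case (Suc k)
  show ?case by (rule Ck_on_SucI[where D="\<lambda>x i. 0"]) (rule has_derivative_const, rule Suc.IH)
qed simp

lemma Ck_on_add:
  "Ck_on k UNIV f \<Longrightarrow> Ck_on k UNIV g \<Longrightarrow> Ck_on k UNIV (\<lambda>x. f x + g x)"
proof (induction k arbitrary: f g)
  case (Suc k)
  show ?case
    by (rule Ck_on_SucI[where D="\<lambda>x i. frechet_derivative f (at x) i + frechet_derivative g (at x) i"])
      (intro has_derivative_add Ck_on_SucD(1)[OF Suc.prems(1)] Ck_on_SucD(1)[OF Suc.prems(2)],
       intro Suc.IH Ck_on_SucD(2)[OF Suc.prems(1)] Ck_on_SucD(2)[OF Suc.prems(2)])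
qed (auto intro: continuous_intros)

lemma Ck_on_mult:
  fixes f g :: "'a::euclidean_space \<Rightarrow> real"
  shows "Ck_on k UNIV f \<Longrightarrow> Ck_on k UNIV g \<Longrightarrow> Ck_on k UNIV (\<lambda>x. f x * g x)"
proof (induction k arbitrary: f g)
  case (Suc k)
  show ?case
  proof (rule Ck_on_SucI[where D="\<lambda>x i. f x * frechet_derivative g (at x) i + frechet_derivative f (at x) i * g x"])
    show "((\<lambda>x. f x * g x) has_derivative (\<lambda>i. f x * frechet_derivative g (at x) i + frechet_derivative f (at x) i * g x)) (at x)" for x
      by (intro has_derivative_mult Ck_on_SucD(1)[OF Suc.prems(1)] Ck_on_SucD(1)[OF Suc.prems(2)])
    fix i :: 'a assume "i \<in> Basis"
    then show "Ck_on k UNIV (\<lambda>x. f x * frechet_derivative g (at x) i + frechet_derivative f (at x) i * g x)"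
      by (intro Ck_on_add Suc.IH Ck_on_Suc_imp[OF Suc.prems(1)] Ck_on_Suc_imp[OF Suc.prems(2)]
          Ck_on_SucD(2)[OF Suc.prems(1)] Ck_on_SucD(2)[OF Suc.prems(2)])
  qed
qed (auto intro: continuous_intros)

lemma Ck_on_sum:
  "finite I \<Longrightarrow> (\<And>n. n \<in> I \<Longrightarrow> Ck_on k UNIV (f n)) \<Longrightarrow> Ck_on k UNIV (\<lambda>x. \<Sum>n\<in>I. f n x)"
  by (induction I rule: finite_induct) (auto intro!: Ck_on_const Ck_on_add)

lemma Ck_on_cmult: "Ck_on k UNIV f \<Longrightarrow> Ck_on k UNIV (\<lambda>x. c * (f x :: real))"
  by (intro Ck_on_mult Ck_on_const)

lemma Ck_on_diff:
  fixes f g :: "'a::euclidean_space \<Rightarrow> real"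
  shows "Ck_on k UNIV f \<Longrightarrow> Ck_on k UNIV g \<Longrightarrow> Ck_on k UNIV (\<lambda>x. f x - g x)"
  using Ck_on_add[of k f "\<lambda>x. -1 * g x"] Ck_on_cmult[of k g "-1"] by simp

lemma Ck_on_affine: "Ck_on k UNIV (\<lambda>x. (x - a) \<bullet> i)"
proof (cases k)
  case (Suc n)
  show ?thesis unfolding Suc
    by (rule Ck_on_SucI[where D="\<lambda>x d. d \<bullet> i"]) (auto intro!: Ck_on_const derivative_eq_intros)
qed (auto intro!: continuous_intros)

lemma Ck_on_quadratic: "Ck_on k UNIV (\<lambda>x. r - (x - a) \<bullet> (x - a))"
proof -
  have "(x - a) \<bullet> (x - a) = (\<Sum>i\<in>Basis. ((x - a) \<bullet> i) * ((x - a) \<bullet> i))" for x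
    by (rule euclidean_inner)
  moreover have "Ck_on k UNIV (\<lambda>x. r - (\<Sum>i\<in>Basis. ((x - a) \<bullet> i) * ((x - a) \<bullet> i)))"
    by (intro Ck_on_diff Ck_on_const Ck_on_sum Ck_on_mult Ck_on_affine finite_Basis)
  ultimately show ?thesis by (simp only:)
qed

text \<open>The function \<open>exp (- 1 / y)\<close> extended by 0 is \<open>flat_exp 0\<close>. The factors \<open>(1 / y) ^ m\<close>
make the family closed under differentiation up to linear combinations, so that smoothness is an induction over the order.\<close>

definition flat_exp :: "nat \<Rightarrow> real \<Rightarrow> real" where
  "flat_exp m y = (if y > 0 then (1 / y) ^ m / exp (1 / y) else 0)"

lemma flat_exp_has_derivative:
  "(flat_exp m has_real_derivative (flat_exp (m + 2) y - real m * flat_exp (m + 1) y)) (at y)"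
proof -
  consider "y > 0" | "y < 0" | "y = 0" by linarith
  then show ?thesis
  proof cases
    case 1
    have pw: "((\<lambda>y. (1 / y) ^ m) has_real_derivative - real m * (1 / y) ^ (m + 1)) (at y)" for m
    proof (induction m)
      case (Suc m)
      have "((\<lambda>y::real. 1 / y) has_real_derivative - ((1 / y) ^ 2)) (at y)"
        using 1 by (auto intro!: derivative_eq_intros simp: power2_eq_square)
      from DERIV_mult[OF this Suc.IH] show ?case
        by (simp add: power2_eq_square algebra_simps diff_divide_distrib)
    qed simp
    have "((\<lambda>y. (1 / y) ^ m / exp (1 / y)) has_real_derivative (flat_exp (m + 2) y - real m * flat_exp (m + 1) y)) (at y)"
    proof -
      have "((\<lambda>y. exp (1 / y)) has_real_derivative exp (1 / y) * - (1 / y)\<^sup>2) (at y)"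
        using 1 by (auto intro!: derivative_eq_intros simp: power2_eq_square)
      from DERIV_divide[OF pw[of m] this] show ?thesis
        by (rule DERIV_cong) (use 1 in \<open>simp_all add: flat_exp_def field_simps power2_eq_square\<close>)
    qed
    moreover have "\<forall>\<^sub>F z in nhds y. (1 / z) ^ m / exp (1 / z) = flat_exp m z"
      using eventually_nhds_in_open[of "{0<..}" y] 1 by (auto simp: flat_exp_def elim!: eventually_mono)
    ultimately show ?thesis by (rule DERIV_cong_ev[THEN iffD1, rotated 3, OF _ refl _ refl])
  next
    case 2
    have "((\<lambda>y. 0) has_real_derivative 0) (at y)" by simp
    moreover have "\<forall>\<^sub>F z in nhds y. 0 = flat_exp m z"
      using eventually_nhds_in_open[of "{..<0}" y] 2 by (auto simp: flat_exp_def elim!: eventually_mono)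
    moreover have "flat_exp (m + 2) y - real m * flat_exp (m + 1) y = 0" using 2 by (simp add: flat_exp_def)
    ultimately show ?thesis using DERIV_cong_ev[of y y "\<lambda>y. 0" "flat_exp m" 0] by simp
  next
    case 3
    have R: "((\<lambda>h. flat_exp m h / h) \<longlongrightarrow> 0) (at_right 0)"
    proof -
      have "((\<lambda>h::real. (inverse h) ^ (m + 1) / exp (inverse h)) \<longlongrightarrow> 0) (at_right 0)"
        by (rule filterlim_compose[OF tendsto_power_div_exp_0 filterlim_inverse_at_top_right])
      then show ?thesis
        by (rule Lim_transform_eventually)
          (auto simp: flat_exp_def eventually_at_right_field field_simps intro!: exI[of _ 1])
    qed
    have L: "((\<lambda>h. flat_exp m h / h) \<longlongrightarrow> 0) (at_left 0)"
      by (rule Lim_transform_eventually[of "\<lambda>_. 0"])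
        (auto simp: flat_exp_def eventually_at_left_field intro!: exI[of _ "-1"])
    have "((\<lambda>h. flat_exp m h / h) \<longlongrightarrow> 0) (at 0)"
      using R L by (simp add: filterlim_split_at_real)
    then show ?thesis using 3 by (simp add: DERIV_def flat_exp_def)
  qed
qed

lemma Ck_on_flat_exp:
  assumes q: "\<And>k. Ck_on k UNIV q"
  shows "Ck_on k UNIV (\<lambda>x. flat_exp m (q x))"
proof (induction k arbitrary: m)
  case 0
  have "continuous_on UNIV (flat_exp m)"
    using flat_exp_has_derivative by (intro continuous_at_imp_continuous_on) (auto intro: DERIV_isCont)
  then show ?case using q[of 0] by (auto intro: continuous_on_compose2)
next
  case (Suc k)
  show ?case
  proof (rule Ck_on_SucI[where D="\<lambda>x i. (flat_exp (m + 2) (q x) - real m * flat_exp (m + 1) (q x)) * frechet_derivative q (at x) i"])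
    fix x
    have "(flat_exp m has_derivative (*) (flat_exp (m + 2) (q x) - real m * flat_exp (m + 1) (q x))) (at (q x))"
      using flat_exp_has_derivative by (simp add: has_field_derivative_def)
    from has_derivative_compose[OF Ck_on_SucD(1)[OF q] this]
    show "((\<lambda>x. flat_exp m (q x)) has_derivative (\<lambda>i. (flat_exp (m + 2) (q x) - real m * flat_exp (m + 1) (q x)) * frechet_derivative q (at x) i)) (at x)" .
  next
    fix i :: 'a assume "i \<in> Basis"
    then show "Ck_on k UNIV (\<lambda>x. (flat_exp (m + 2) (q x) - real m * flat_exp (m + 1) (q x)) * frechet_derivative q (at x) i)"
      by (intro Ck_on_mult Ck_on_diff Ck_on_cmult Suc.IH Ck_on_SucD(2)[OF q])
  qed
qed

text \<open>Open sets form an intersection-stable generator of the Borel sets, and the Borel sets over which \<open>f\<close> (or rather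
a Borel version of it) has integral 0 form a Dynkin system. Take the set where \<open>f\<close> is positive, and the one
where it is negative.\<close>

lemma integral_over_open_zero_imp_AE_zero:
  fixes f :: "'a::euclidean_space \<Rightarrow> real"
  assumes f: "integrable lebesgue f"
    and 0: "\<And>U. open U \<Longrightarrow> (LINT x|lebesgue. indicator U x * f x) = 0"
  shows "AE x in lebesgue. f x = 0"
proof -
  obtain f' where f': "f' \<in> borel_measurable lborel" "AE x in lborel. f x = f' x"
    using completion_ex_borel_measurable_real[of f lborel] f by auto
  then have m[measurable]: "f' \<in> borel_measurable borel" by simp
  have ae: "AE x in lebesgue. f x = f' x" using f'(2) by (rule AE_completion)
  have fm: "f \<in> borel_measurable lebesgue" using f by (rule borel_measurable_integrable)
  have f'm: "f' \<in> borel_measurable lebesgue" using m by (intro measurable_completion) simp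
  have Um: "UNIV \<in> sets lebesgue" by simp
  have f'i: "integrable lborel f'"
  proof -
    have "integrable lebesgue f'"
    proof (rule integrable_cong_AE_imp[OF f])
      show "f' \<in> borel_measurable lebesgue" using m by (intro measurable_completion) simp
      show "AE x in lebesgue. f x = f' x" by (rule ae)
    qed
    then show ?thesis using m by (simp add: integrable_completion)
  qed
  have iA: "integrable lborel (\<lambda>x. indicator A x * f' x)" if "A \<in> sets borel" for A
    using integrable_mult_indicator[of A lborel f'] f'i that by simp
  have all0: "(LINT x|lborel. indicator A x * f' x) = 0" if A: "A \<in> sets borel" for A
  proof -
    have st: "Int_stable {S :: 'a set. open S}" by (auto simp: Int_stable_def)
    have sub: "{S :: 'a set. open S} \<subseteq> Pow UNIV" by simp
    have "A \<in> sigma_sets UNIV {S. open S}" using A by (simp add: borel_def)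
    from st sub this show ?thesis
    proof (induction rule: sigma_sets_induct_disjoint)
      case (basic A)
      then have "(LINT x|lborel. indicator A x * f' x) = (LINT x|lebesgue. indicator A x * f' x)"
        by (intro integral_completion[symmetric]) auto
      also have "\<dots> = (LINT x|lebesgue. indicator A x * f x)"
      proof (rule integral_cong_AE)
        show "AE x in lebesgue. indicator A x * f' x = indicator A x * f x" using ae by eventually_elim simp
        have "A \<in> sets lebesgue" using basic by simp
        then show "(\<lambda>x. indicator A x * f x) \<in> borel_measurable lebesgue"
          using f by (intro borel_measurable_times) auto
        show "(\<lambda>x. indicator A x * f' x) \<in> borel_measurable lebesgue"
          using \<open>A \<in> sets lebesgue\<close> m
          by (intro borel_measurable_times borel_measurable_indicator measurable_completion[of f']) auto
      qed
      also have "\<dots> = 0" using basic 0 by simp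
      finally show ?case .
    next
      case (compl A)
      have A: "A \<in> sets borel" using compl(1) by (simp add: borel_def)
      have "(LINT x|lborel. indicator (UNIV - A) x * f' x) = (LINT x|lborel. indicator UNIV x * f' x - indicator A x * f' x)"
        by (intro Bochner_Integration.integral_cong) (auto simp: indicator_def)
      also have "\<dots> = (LINT x|lborel. indicator UNIV x * f' x) - (LINT x|lborel. indicator A x * f' x)"
        using A by (intro Bochner_Integration.integral_diff iA) auto
      also have "(LINT x|lborel. indicator UNIV x * f' x) = (LINT x|lebesgue. indicator UNIV x * f' x)"
        by (intro integral_completion[symmetric]) auto
      also have "\<dots> = (LINT x|lebesgue. indicator UNIV x * f x)"
      proof (rule integral_cong_AE)
        show "AE x in lebesgue. indicator UNIV x * f' x = indicator UNIV x * f x" using ae by eventually_elim simp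
        show "(\<lambda>x. indicator UNIV x * f x) \<in> borel_measurable lebesgue"
          by (rule borel_measurable_times[OF borel_measurable_indicator[OF Um] fm])
        show "(\<lambda>x. indicator UNIV x * f' x) \<in> borel_measurable lebesgue"
          by (rule borel_measurable_times[OF borel_measurable_indicator[OF Um] f'm])
      qed
      also have "\<dots> = 0" by (rule 0) simp
      finally show ?case using compl.IH by simp
    next
      case (union A)
      have A: "A i \<in> sets borel" for i using union(2) by (auto simp: borel_def)
      have "(\<Sum>i. LINT x:(A i)|lborel. f' x) = (LINT x:(\<Union>i. A i)|lborel. f' x)"
        using union(1) A iA[of "\<Union>i. A i"]
        by (intro lebesgue_integral_countable_add[symmetric]) (auto simp: set_integrable_def disjoint_family_on_def)
      then show ?case using union.IH by (simp add: set_lebesgue_integral_def)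
    qed simp
  qed
  have pos: "AE x in lborel. g x \<le> 0" if g: "g \<in> borel_measurable borel" "integrable lborel g"
      and "\<And>A. A \<in> sets borel \<Longrightarrow> (LINT x|lborel. indicator A x * g x) = 0" for g :: "'a \<Rightarrow> real"
  proof -
    define A where "A = {x. g x > 0}"
    have A: "A \<in> sets borel" unfolding A_def using g by measurable
    have "(LINT x|lborel. indicator A x * g x) = 0" using that A by blast
    moreover have "integrable lborel (\<lambda>x. indicator A x * g x)"
      using integrable_mult_indicator[of A lborel g] g A by simp
    moreover have "indicator A x * g x \<ge> 0" for x by (auto simp: A_def indicator_def)
    ultimately have "AE x in lborel. indicator A x * g x = 0"
      using integral_nonneg_eq_0_iff_AE[of lborel "\<lambda>x. indicator A x * g x"] by simp
    then show ?thesis by eventually_elim (auto simp: A_def indicator_def split: if_splits)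
  qed
  have "AE x in lborel. f' x \<le> 0" by (rule pos[OF m f'i all0])
  moreover have "AE x in lborel. - f' x \<le> 0" using all0 by (intro pos) (use f'i in auto)
  ultimately have "AE x in lborel. f' x = 0" by eventually_elim simp
  then have "AE x in lebesgue. f' x = 0" by (rule AE_completion)
  then show ?thesis using ae by eventually_elim simp
qed

text \<open>Cover \<open>U\<close> by countably many balls whose closures lie in \<open>U\<close> and let \<open>b k\<close> be a bump
that is positive exactly on the ball number \<open>k\<close>. The partial sums \<open>S n\<close> are eventually positive at
each point of \<open>U\<close>, and \<open>exp (- 1 / (n * S n))\<close> then tends to 1.\<close>

lemma open_approximation_by_test_functions:
  assumes U: "open U" "U \<noteq> {}"
  shows "\<exists>\<Phi>. (\<forall>n. \<Phi> n \<in> test_functions U) \<and> (\<forall>n x. \<bar>\<Phi> n x\<bar> \<le> 1) \<and> (\<forall>n x. x \<notin> U \<longrightarrow> \<Phi> n x = 0)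
    \<and> (\<forall>x\<in>U. (\<lambda>n. \<Phi> n x) \<longlonglongrightarrow> 1)"
proof -
  define F where "F = {ball a r | a r. cball a r \<subseteq> U}"
  obtain F' where F': "F' \<subseteq> F" "countable F'" "\<Union>F' = \<Union>F"
    by (rule Lindelof[of F]) (auto simp: F_def)
  have UF: "\<Union>F = U"
  proof
    show "\<Union>F \<subseteq> U" unfolding F_def using ball_subset_cball by blast
    show "U \<subseteq> \<Union>F"
    proof
      fix x assume "x \<in> U"
      then obtain e where "e > 0" "cball x e \<subseteq> U" using U(1) open_contains_cball by blast
      then show "x \<in> \<Union>F" unfolding F_def by (intro UnionI[of "ball x e"]) auto
    qed
  qed
  have "F' \<noteq> {}" using F'(3) UF U(2) by auto
  define B where "B = from_nat_into F'"
  have rB: "range B = F'" unfolding B_def by (rule range_from_nat_into[OF \<open>F' \<noteq> {}\<close> F'(2)])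
  have "\<forall>k. \<exists>p. B k = ball (fst p) (snd p) \<and> cball (fst p) (snd p) \<subseteq> U"
  proof
    fix k
    have "B k \<in> F" using rB F'(1) by blast
    then obtain a r where "B k = ball a r" "cball a r \<subseteq> U" by (auto simp: F_def)
    then show "\<exists>p. B k = ball (fst p) (snd p) \<and> cball (fst p) (snd p) \<subseteq> U" by (intro exI[of _ "(a, r)"]) simp
  qed
  from choice[OF this] obtain p where "\<forall>k. B k = ball (fst (p k)) (snd (p k)) \<and> cball (fst (p k)) (snd (p k)) \<subseteq> U" ..
  then have p: "B k = ball (fst (p k)) (snd (p k))" "cball (fst (p k)) (snd (p k)) \<subseteq> U" for k by blast+
  \<comment> \<open>The case distinction treats the empty ball: for a negative radius its square would produce a nonzero bump.\<close>
  define b where "b k x = (if snd (p k) > 0 then flat_exp 0 ((snd (p k))\<^sup>2 - (x - fst (p k)) \<bullet> (x - fst (p k))) else 0)" for k x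
  have b0: "b k x \<ge> 0" for k x by (simp add: b_def flat_exp_def)
  have bpos: "b k x > 0 \<longleftrightarrow> x \<in> B k" for k x
  proof (cases "snd (p k) > 0")
    case True
    have "(x - fst (p k)) \<bullet> (x - fst (p k)) < (snd (p k))\<^sup>2 \<longleftrightarrow> norm (x - fst (p k)) < snd (p k)"
      unfolding power2_norm_eq_inner[symmetric] using True
      by (metis norm_ge_zero less_imp_le power2_less_imp_less power_strict_mono zero_less_numeral)
    then show ?thesis using True by (simp add: b_def flat_exp_def p dist_norm norm_minus_commute)
  next
    case False
    then show ?thesis using order_trans[OF _ zero_le_dist[of "fst (p k)" x], of "snd (p k)"] by (simp add: b_def p not_less)
  qed
  define S where "S n x = (\<Sum>k\<le>n. b k x)" for n x
  define \<Phi> where "\<Phi> n x = flat_exp 0 (real n * S n x)" for n x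
  have Cb: "Ck_on j UNIV (b k)" for j k
    unfolding b_def by (cases "snd (p k) > 0") (simp_all add: Ck_on_const Ck_on_flat_exp Ck_on_quadratic)
  have CS: "Ck_on j UNIV (\<lambda>x. real n * S n x)" for j n
    unfolding S_def by (intro Ck_on_cmult Ck_on_sum Cb) auto
  have C\<Phi>: "smooth_on UNIV (\<Phi> n)" for n
    unfolding \<Phi>_def smooth_on_def by (intro allI Ck_on_flat_exp CS)
  have out: "\<Phi> n x = 0" if x: "x \<notin> (\<Union>k\<le>n. cball (fst (p k)) (snd (p k)))" for n x
  proof -
    have "b k x = 0" if "k \<le> n" for k
    proof -
      have "x \<notin> cball (fst (p k)) (snd (p k))" using that x by simp
      then have "x \<notin> B k" unfolding p(1) by simp
      then show ?thesis using bpos[of k x] b0[of k x] by linarith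
    qed
    then show ?thesis by (simp add: \<Phi>_def S_def flat_exp_def)
  qed
  have sub: "(\<Union>k\<le>n. cball (fst (p k)) (snd (p k))) \<subseteq> U" for n
    by (rule UN_least) (rule p(2))
  show ?thesis
  proof (intro exI[of _ \<Phi>] conjI allI ballI impI)
    show "\<Phi> n \<in> test_functions U" for n
      unfolding test_functions_def
    proof (intro CollectI conjI exI[of _ "\<Union>k\<le>n. cball (fst (p k)) (snd (p k))"] allI impI)
      show "compact (\<Union>k\<le>n. cball (fst (p k)) (snd (p k)))" by (intro compact_UN) auto
    qed (fact C\<Phi> sub out)+
    show "\<bar>\<Phi> n x\<bar> \<le> 1" for n x by (simp add: \<Phi>_def flat_exp_def)
    show "\<Phi> n x = 0" if "x \<notin> U" for n x
      by (rule out) (use subsetD[OF sub, of x n] that in auto)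
    fix x assume "x \<in> U"
    then have "x \<in> \<Union> (range B)" unfolding rB F'(3) UF .
    then obtain k where k: "x \<in> B k" by auto
    have Sge: "S n x \<ge> b k x" if "n \<ge> k" for n
      unfolding S_def using b0 that by (intro member_le_sum) auto
    have bk: "b k x > 0" using k bpos[of k x] by simp
    have "(\<lambda>n. 1 / real n * (1 / b k x)) \<longlonglongrightarrow> 0 * (1 / b k x)" by (intro tendsto_intros lim_const_over_n)
    then have "(\<lambda>n. 1 / (real n * b k x)) \<longlonglongrightarrow> 0"
      by simp
    then have "(\<lambda>n. exp (- (1 / (real n * b k x)))) \<longlonglongrightarrow> exp (- 0)" by (intro tendsto_intros)
    then have L: "(\<lambda>n. exp (- (1 / (real n * b k x)))) \<longlonglongrightarrow> 1" by simp
    show "(\<lambda>n. \<Phi> n x) \<longlonglongrightarrow> 1"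
    proof (rule tendsto_sandwich[OF _ _ L tendsto_const])
      show "\<forall>\<^sub>F n in sequentially. exp (- (1 / (real n * b k x))) \<le> \<Phi> n x"
        using eventually_ge_at_top[of "Suc k"]
      proof eventually_elim
        case (elim n)
        have "real n * b k x \<le> real n * S n x" using Sge[of n] elim by (intro mult_left_mono) auto
        moreover have "0 < real n * b k x" using elim bk by simp
        ultimately have pos: "real n * S n x > 0" and le: "1 / (real n * S n x) \<le> 1 / (real n * b k x)"
          using frac_le[of 1 1 "real n * b k x" "real n * S n x"] by auto
        have "exp (- (1 / (real n * b k x))) \<le> exp (- (1 / (real n * S n x)))" using le by simp
        also have "\<dots> = \<Phi> n x" using pos by (simp only: \<Phi>_def flat_exp_def if_True power_0 exp_minus inverse_eq_divide)
        finally show ?case .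
      qed
      show "\<forall>\<^sub>F n in sequentially. \<Phi> n x \<le> 1" by (simp add: \<Phi>_def flat_exp_def)
    qed
  qed
qed

lemma test_functions_mono: "U \<subseteq> \<Omega> \<Longrightarrow> test_functions U \<subseteq> test_functions \<Omega>"
  unfolding test_functions_def by blast

lemma test_function_measurable:
  assumes "\<psi> \<in> test_functions \<Omega>"
  shows "continuous_on UNIV \<psi>" "\<psi> \<in> borel_measurable borel" "\<psi> \<in> borel_measurable lebesgue"
proof -
  have "Ck_on 0 UNIV \<psi>" using assms unfolding test_functions_def smooth_on_def by blast
  then show c: "continuous_on UNIV \<psi>" by simp
  then show "\<psi> \<in> borel_measurable borel" by (rule borel_measurable_continuous_onI)
  then show "\<psi> \<in> borel_measurable lebesgue" by (intro measurable_completion) simp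
qed

text \<open>The fundamental lemma of the calculus of variations. Testing with smooth approximations of the indicator function of \<open>V
\<inter> \<Omega>\<close> shows by dominated convergence that \<open>f\<close> has integral 0 over every open set
\<open>V\<close>.\<close>

lemma fundamental_lemma:
  fixes f :: "plane \<Rightarrow> real"
  assumes \<Omega>: "open \<Omega>" and f: "integrable lebesgue f" and out: "AE x in lebesgue. x \<notin> \<Omega> \<longrightarrow> f x = 0"
    and 0: "\<And>\<psi>. \<psi> \<in> test_functions \<Omega> \<Longrightarrow> (LINT x|lebesgue. f x * \<psi> x) = 0"
  shows "AE x in lebesgue. f x = 0"
proof (rule integral_over_open_zero_imp_AE_zero[OF f])
  fix V :: "plane set" assume V: "open V"
  have Vm: "V \<in> sets lebesgue" using V by simp
  show "(LINT x|lebesgue. indicator V x * f x) = 0"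
  proof (cases "V \<inter> \<Omega> = {}")
    case True
    have "AE x in lebesgue. indicator V x * f x = 0"
      using out by eventually_elim (use True in \<open>auto simp: indicator_def\<close>)
    then show ?thesis by (rule integral_eq_zero_AE)
  next
    case False
    obtain \<Phi> :: "nat \<Rightarrow> plane \<Rightarrow> real" where *: "(\<forall>n. \<Phi> n \<in> test_functions (V \<inter> \<Omega>)) \<and> (\<forall>n x. \<bar>\<Phi> n x\<bar> \<le> 1)
        \<and> (\<forall>n x. x \<notin> V \<inter> \<Omega> \<longrightarrow> \<Phi> n x = 0) \<and> (\<forall>x\<in>V \<inter> \<Omega>. (\<lambda>n. \<Phi> n x) \<longlonglongrightarrow> 1)"
      using open_approximation_by_test_functions[OF open_Int[OF V \<Omega>] False] ..
    note \<Phi> = *[THEN conjunct1, rule_format] *[THEN conjunct2, THEN conjunct1, rule_format]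
      *[THEN conjunct2, THEN conjunct2, THEN conjunct1, rule_format]
      *[THEN conjunct2, THEN conjunct2, THEN conjunct2, rule_format]
    have "(\<lambda>n. LINT x|lebesgue. f x * \<Phi> n x) \<longlonglongrightarrow> (LINT x|lebesgue. indicator V x * f x)"
    proof (rule integral_dominated_convergence[where w="\<lambda>x. \<bar>f x\<bar>"])
      show "(\<lambda>x. indicator V x * f x) \<in> borel_measurable lebesgue"
        using f Vm by (intro borel_measurable_times) auto
      show "(\<lambda>x. f x * \<Phi> n x) \<in> borel_measurable lebesgue" for n
        using f test_function_measurable[OF \<Phi>(1)] by (intro borel_measurable_times) auto
      show "integrable lebesgue (\<lambda>x. \<bar>f x\<bar>)" using f by simp
      show "AE x in lebesgue. norm (f x * \<Phi> n x) \<le> \<bar>f x\<bar>" for n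
        using \<Phi>(2) by (intro AE_I2) (simp add: abs_mult mult_left_le)
      show "AE x in lebesgue. (\<lambda>n. f x * \<Phi> n x) \<longlonglongrightarrow> indicator V x * f x"
        using out
      proof eventually_elim
        case (elim x)
        show ?case
        proof (cases "x \<in> V \<inter> \<Omega>")
          case True
          have "(\<lambda>n. f x * \<Phi> n x) \<longlonglongrightarrow> f x * 1" by (intro tendsto_intros \<Phi>(4) True)
          then show ?thesis using True by simp
        next
          case False
          then show ?thesis using \<Phi>(3) elim by (auto simp: indicator_def)
        qed
      qed
    qed
    moreover have "(LINT x|lebesgue. f x * \<Phi> n x) = 0" for n
      using 0 \<Phi>(1) test_functions_mono[of "V \<inter> \<Omega>" \<Omega>] by blast
    ultimately show ?thesis by (simp add: LIMSEQ_const_iff)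
  qed
qed

section \<open>Weak gradients of Lipschitz functions\<close>

lemma L2_eq_0I:
  assumes "AE x in lebesgue. rep_L2 d x = 0" shows "d = 0"
proof -
  have "(norm d)\<^sup>2 = (LINT x|lebesgue. (norm (rep_L2 d x))\<^sup>2)" by (rule norm_L2_eq)
  also have "\<dots> = 0" using assms by (intro integral_eq_zero_AE) (auto elim: eventually_mono)
  finally show ?thesis by simp
qed

lemma inner_self_le_power2: "\<bar>h\<bar> \<le> k \<Longrightarrow> h \<bullet> h \<le> k\<^sup>2" for h k :: real
  using mult_mono[of "\<bar>h\<bar>" k "\<bar>h\<bar>" k] by (simp add: power2_eq_square)

lemma rep_L2_measurable: "rep_L2 d \<in> borel_measurable lebesgue"
  using sq_integrable_rep[of d] by (simp add: sq_integrable_def)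

lemma inner_abs_L2_right:
  assumes "sq_integrable h" shows "u \<bullet> abs_L2 h = (LINT x|lebesgue. rep_L2 u x \<bullet> h x)"
  using inner_abs_L2[OF sq_integrable_rep assms, of u] by (simp add: abs_rep_L2)

lemma L2_on_diff: "f \<in> L2_on \<Omega> \<Longrightarrow> g \<in> L2_on \<Omega> \<Longrightarrow> f - g \<in> L2_on \<Omega>"
proof -
  assume "f \<in> L2_on \<Omega>" "g \<in> L2_on \<Omega>"
  then have "AE x in lebesgue. x \<notin> \<Omega> \<longrightarrow> rep_L2 f x = 0" "AE x in lebesgue. x \<notin> \<Omega> \<longrightarrow> rep_L2 g x = 0"
    by (auto simp: L2_on_def)
  then have "AE x in lebesgue. x \<notin> \<Omega> \<longrightarrow> rep_L2 (f - g) x = 0"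
    using rep_L2_diff[of f g] by eventually_elim auto
  then show ?thesis by (simp add: L2_on_def)
qed

lemma continuous_bounded_on_cball:
  fixes F :: "'a::euclidean_space \<Rightarrow> real"
  assumes F: "continuous_on UNIV F"
  shows "\<exists>M. 0 \<le> M \<and> (\<forall>x\<in>cball 0 R. \<bar>F x\<bar> \<le> M)"
proof -
  have "bounded (F ` cball 0 R)" by (intro compact_imp_bounded compact_continuous_image continuous_on_subset[OF F]) auto
  then obtain M where "\<forall>x\<in>cball 0 R. \<bar>F x\<bar> \<le> M" unfolding bounded_iff by auto
  then have "\<forall>x\<in>cball 0 R. \<bar>F x\<bar> \<le> \<bar>M\<bar>" by (auto intro: order_trans[OF _ abs_ge_self])
  then show ?thesis by (intro exI[of _ "\<bar>M\<bar>"]) simp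
qed

lemma L2_on_add: "f \<in> L2_on \<Omega> \<Longrightarrow> g \<in> L2_on \<Omega> \<Longrightarrow> f + g \<in> L2_on \<Omega>"
proof -
  assume "f \<in> L2_on \<Omega>" "g \<in> L2_on \<Omega>"
  then have "AE x in lebesgue. x \<notin> \<Omega> \<longrightarrow> rep_L2 f x = 0" "AE x in lebesgue. x \<notin> \<Omega> \<longrightarrow> rep_L2 g x = 0"
    by (auto simp: L2_on_def)
  then have "AE x in lebesgue. x \<notin> \<Omega> \<longrightarrow> rep_L2 (f + g) x = 0"
    using rep_L2_add[of f g] by eventually_elim auto
  then show ?thesis by (simp add: L2_on_def)
qed

lemma L2_on_scaleR: "f \<in> L2_on \<Omega> \<Longrightarrow> r *\<^sub>R f \<in> L2_on \<Omega>"
proof -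
  assume "f \<in> L2_on \<Omega>"
  then have "AE x in lebesgue. x \<notin> \<Omega> \<longrightarrow> rep_L2 f x = 0" by (auto simp: L2_on_def)
  then have "AE x in lebesgue. x \<notin> \<Omega> \<longrightarrow> rep_L2 (r *\<^sub>R f) x = 0"
    using rep_L2_scaleR[of r f] by eventually_elim auto
  then show ?thesis by (simp add: L2_on_def)
qed

lemma L2_on_L2_class:
  assumes "sq_integrable (\<lambda>x. indicator \<Omega> x *\<^sub>R f x)" shows "L2_class \<Omega> f \<in> L2_on \<Omega>"
  using rep_abs_L2[OF assms] unfolding L2_on_def L2_class_def mem_Collect_eq by eventually_elim auto

lemma integrable_indicator_bounded:
  fixes S :: "'a::euclidean_space set"
  assumes "S \<in> sets borel" "bounded S"
  shows "integrable lborel (\<lambda>x. indicator S x * (c::real))" "integrable lebesgue (\<lambda>x. indicator S x * (c::real))"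
proof -
  have m: "(\<lambda>x. indicator S x * c) \<in> borel_measurable lborel"
    using assms by (intro borel_measurable_times borel_measurable_indicator) auto
  have "integrable lborel (indicator S :: 'a \<Rightarrow> real)"
    using emeasure_bounded_finite[OF assms(2)] assms(1) by (intro integrable_real_indicator) auto
  then show *: "integrable lborel (\<lambda>x. indicator S x * c)" by (intro integrable_mult_left) auto
  show "integrable lebesgue (\<lambda>x. indicator S x * c)" by (rule integrable_completion[THEN iffD2, OF m *])
qed

lemma sq_integrable_bounded:
  fixes f :: "'a::euclidean_space \<Rightarrow> 'b::euclidean_space"
  assumes m: "f \<in> borel_measurable lebesgue" and b: "AE x in lebesgue. norm (f x) \<le> M"
    and out: "\<And>x. x \<notin> cball 0 R \<Longrightarrow> f x = 0"
  shows "sq_integrable f"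
  unfolding sq_integrable_def
proof (rule conjI[OF m], rule Bochner_Integration.integrable_bound[where f="\<lambda>x. indicator (cball 0 R) x * M\<^sup>2"])
  show "integrable lebesgue (\<lambda>x::'a. indicator (cball 0 R) x * M\<^sup>2)" by (rule integrable_indicator_bounded) auto
  show "(\<lambda>x. (norm (f x))\<^sup>2) \<in> borel_measurable lebesgue" using m by measurable
  show "AE x in lebesgue. norm ((norm (f x))\<^sup>2) \<le> norm (indicator (cball 0 R) x * M\<^sup>2)"
    using b
  proof eventually_elim
    case (elim x)
    then show ?case using out[of x] power_mono[OF elim, of 2] by (cases "x \<in> cball 0 R") auto
  qed
qed

text \<open>The difference of two weak gradients is orthogonal to all test vector fields; apply the fundamental lemma to each of its
components. Boundedness of \<open>\<Omega>\<close> makes square-integrable functions integrable. Uniqueness gives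
\<^const>\<open>weak_gradient\<close>, a definite description, its meaning.\<close>

lemma has_weak_gradient_unique:
  assumes \<Omega>: "open \<Omega>" "bounded \<Omega>" and g: "has_weak_gradient \<Omega> v g" and g': "has_weak_gradient \<Omega> v g'"
  shows "g = g'"
proof -
  define d where "d = g - g'"
  have dL: "d \<in> L2_on \<Omega>"     unfolding d_def using g[unfolded has_weak_gradient_def, THEN conjunct2, THEN conjunct1]
      g'[unfolded has_weak_gradient_def, THEN conjunct2, THEN conjunct1] by (rule L2_on_diff)
  have z: "d \<bullet> L2_class \<Omega> (\<lambda>x. \<psi> x *\<^sub>R i) = 0" if "\<psi> \<in> test_functions \<Omega>" "i \<in> Basis" for \<psi> i
    using g[unfolded has_weak_gradient_def, THEN conjunct2, THEN conjunct2, rule_format, OF that]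
      g'[unfolded has_weak_gradient_def, THEN conjunct2, THEN conjunct2, rule_format, OF that]
    unfolding d_def inner_diff_left by linarith
  obtain R where "\<forall>x\<in>\<Omega>. norm x \<le> R" using \<Omega>(2) unfolding bounded_iff ..
  then have R: "\<Omega> \<subseteq> cball 0 R" by auto
  have \<Omega>m: "\<Omega> \<in> sets lebesgue" using \<Omega> by simp
  have \<Omega>i: "integrable lebesgue (indicator \<Omega> :: plane \<Rightarrow> real)"
    using integrable_indicator_bounded(2)[of \<Omega> 1] \<Omega> by simp
  have comp: "AE x in lebesgue. indicator \<Omega> x * (rep_L2 d x \<bullet> i) = 0" if i: "i \<in> Basis" for i
  proof (rule fundamental_lemma[OF \<Omega>(1)])
    have fm: "(\<lambda>x. indicator \<Omega> x * (rep_L2 d x \<bullet> i)) \<in> borel_measurable lebesgue"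
      using \<Omega>m rep_L2_measurable[of d] by (intro borel_measurable_times borel_measurable_indicator borel_measurable_inner) auto
    show "integrable lebesgue (\<lambda>x. indicator \<Omega> x * (rep_L2 d x \<bullet> i))"
    proof (rule Bochner_Integration.integrable_bound[OF _ fm])
      show "integrable lebesgue (\<lambda>x. indicator \<Omega> x + (norm (rep_L2 d x))\<^sup>2)"
        using \<Omega>i sq_integrable_rep[of d] by (intro Bochner_Integration.integrable_add) (auto simp: sq_integrable_def)
      show "AE x in lebesgue. norm (indicator \<Omega> x * (rep_L2 d x \<bullet> i)) \<le> norm (indicator \<Omega> x + (norm (rep_L2 d x))\<^sup>2)"
      proof (rule AE_I2)
        fix x
        have "\<bar>rep_L2 d x \<bullet> i\<bar> \<le> norm (rep_L2 d x)" using i by (rule Basis_le_norm)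
        also have "\<dots> \<le> 1 + (norm (rep_L2 d x))\<^sup>2"
        proof -
          have "2 * norm (rep_L2 d x) \<le> 1 + (norm (rep_L2 d x))\<^sup>2"
            using sum_squares_bound[of 1 "norm (rep_L2 d x)"] by simp
          then show ?thesis using norm_ge_zero[of "rep_L2 d x"] by linarith
        qed
        finally show "norm (indicator \<Omega> x * (rep_L2 d x \<bullet> i)) \<le> norm (indicator \<Omega> x + (norm (rep_L2 d x))\<^sup>2)"
          by (cases "x \<in> \<Omega>") auto
      qed
    qed
    show "AE x in lebesgue. x \<notin> \<Omega> \<longrightarrow> indicator \<Omega> x * (rep_L2 d x \<bullet> i) = 0" by simp
    fix \<psi> assume \<psi>: "\<psi> \<in> test_functions \<Omega>"
    obtain M where "0 \<le> M \<and> (\<forall>x\<in>cball 0 R. \<bar>\<psi> x\<bar> \<le> M)"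
      using continuous_bounded_on_cball[OF test_function_measurable(1)[OF \<psi>]] ..
    then have M: "M \<ge> 0" "\<And>x. x \<in> cball 0 R \<Longrightarrow> \<bar>\<psi> x\<bar> \<le> M" by auto
    have "sq_integrable (\<lambda>x. indicator \<Omega> x *\<^sub>R (\<psi> x *\<^sub>R i))"
    proof (rule sq_integrable_bounded)
      show "(\<lambda>x. indicator \<Omega> x *\<^sub>R \<psi> x *\<^sub>R i) \<in> borel_measurable lebesgue"
        using \<Omega>m test_function_measurable(3)[OF \<psi>] by (intro borel_measurable_scaleR borel_measurable_indicator) auto
      show "AE x in lebesgue. norm (indicator \<Omega> x *\<^sub>R \<psi> x *\<^sub>R i) \<le> \<bar>M\<bar>"
      proof (rule AE_I2)
        fix x show "norm (indicator \<Omega> x *\<^sub>R \<psi> x *\<^sub>R i) \<le> \<bar>M\<bar>"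
          using R M(2)[of x] i by (cases "x \<in> \<Omega>") auto
      qed
      show "\<And>x. x \<notin> cball 0 R \<Longrightarrow> indicator \<Omega> x *\<^sub>R \<psi> x *\<^sub>R i = 0" using R by (auto simp: indicator_def)
    qed
    from inner_abs_L2_right[OF this, of d] z[OF \<psi> i]
    have "(LINT x|lebesgue. rep_L2 d x \<bullet> (indicator \<Omega> x *\<^sub>R \<psi> x *\<^sub>R i)) = 0" by (simp add: L2_class_def)
    then show "(LINT x|lebesgue. indicator \<Omega> x * (rep_L2 d x \<bullet> i) * \<psi> x) = 0"
      by (simp add: mult_ac)
  qed
  have "AE x in lebesgue. \<forall>i\<in>Basis. indicator \<Omega> x * (rep_L2 d x \<bullet> i) = 0"
    using comp by (intro AE_finite_allI) auto
  moreover have "AE x in lebesgue. x \<notin> \<Omega> \<longrightarrow> rep_L2 d x = 0" using dL by (simp add: L2_on_def)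
  ultimately have "AE x in lebesgue. rep_L2 d x = 0"
    by eventually_elim (auto simp: indicator_def euclidean_all_zero_iff split: if_splits)
  then have "d = 0" by (rule L2_eq_0I)
  then show ?thesis by (simp add: d_def)
qed

lemma weak_gradient_eqI:
  assumes "open \<Omega>" "bounded \<Omega>" "has_weak_gradient \<Omega> v g"
  shows "weak_gradient \<Omega> v = g"
  unfolding weak_gradient_def using assms has_weak_gradient_unique by (intro the_equality) auto

lemma has_weak_gradient_add:
  "has_weak_gradient \<Omega> u g \<Longrightarrow> has_weak_gradient \<Omega> v h \<Longrightarrow> has_weak_gradient \<Omega> (u + v) (g + h)"
  unfolding has_weak_gradient_def by (simp add: L2_on_add inner_add_left)

lemma has_weak_gradient_scaleR:
  "has_weak_gradient \<Omega> u g \<Longrightarrow> has_weak_gradient \<Omega> (r *\<^sub>R u) (r *\<^sub>R g)"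
  by (simp add: has_weak_gradient_def L2_on_scaleR)

text \<open>Forward difference quotients with step \<open>1 / (m + 1)\<close>. They replace derivatives because their integrals vanish
exactly, by translation invariance, for any function of compact support.\<close>

definition dq :: "'a::euclidean_space \<Rightarrow> nat \<Rightarrow> ('a \<Rightarrow> real) \<Rightarrow> 'a \<Rightarrow> real" where
  "dq e m F x = real (Suc m) * (F (x + e /\<^sub>R real (Suc m)) - F x)"

lemma dq_mult: "dq e m (\<lambda>x. F x * G x) x = dq e m F x * G (x + e /\<^sub>R real (Suc m)) + F x * dq e m G x"
  by (simp add: dq_def algebra_simps)

lemma shift_tendsto: "(\<lambda>m. x + e /\<^sub>R real (Suc m)) \<longlonglongrightarrow> (x :: 'a::real_normed_vector)"
proof -
  have "(\<lambda>m. x + inverse (real (Suc m)) *\<^sub>R e) \<longlonglongrightarrow> x + 0 *\<^sub>R e"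
    by (intro tendsto_intros LIMSEQ_inverse_real_of_nat)
  then show ?thesis by simp
qed

text \<open>The integral of a derivative of a compactly supported Lipschitz function is 0: the integrals of its difference quotients are
0 since Lebesgue measure is invariant under translations, and the Lipschitz bound allows dominated convergence. All
integrations by parts below come from this fact.\<close>

lemma integral_derivative_eq_0:
  fixes F D :: "'a::euclidean_space \<Rightarrow> real"
  assumes F: "continuous_on UNIV F" and out: "\<And>x. x \<notin> cball 0 R \<Longrightarrow> F x = 0" and e: "norm e \<le> 1"
    and L: "\<And>m x. \<bar>dq e m F x\<bar> \<le> L" and D: "D \<in> borel_measurable lebesgue"
    and lim: "AE x in lebesgue. (\<lambda>m. dq e m F x) \<longlonglongrightarrow> D x"
  shows "(LINT x|lebesgue. D x) = 0"
proof -
  have Fm[measurable]: "F \<in> borel_measurable borel" by (rule borel_measurable_continuous_onI[OF F])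
  obtain M where M: "\<And>x. \<bar>F x\<bar> \<le> M"
  proof -
    obtain M where "0 \<le> M \<and> (\<forall>x\<in>cball 0 R. \<bar>F x\<bar> \<le> M)"
      using continuous_bounded_on_cball[OF F] ..
    then have M: "M \<ge> 0" "\<And>x. x \<in> cball 0 R \<Longrightarrow> \<bar>F x\<bar> \<le> M" by auto
    have "\<bar>F x\<bar> \<le> M" for x using out[of x] M by (cases "x \<in> cball 0 R") auto
    then show ?thesis by (rule that)
  qed
  have ci: "integrable lborel (\<lambda>x::'a. indicator (cball 0 r) x * c)" for r c :: real
    by (rule integrable_indicator_bounded) auto
  have Fi: "integrable lborel F"
  proof (rule Bochner_Integration.integrable_bound[OF ci[of R M]])
    show "AE x in lborel. norm (F x) \<le> norm (indicator (cball 0 R) x * M)"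
    proof (rule AE_I2)
      fix x show "norm (F x) \<le> norm (indicator (cball 0 R) x * M)"
        using out[of x] M[of x] by (cases "x \<in> cball 0 R") auto
    qed
  qed simp
  have shift: "integrable lborel (\<lambda>x. F (x + c))" "(LINT x|lborel. F (x + c)) = (LINT x|lborel. F x)" for c
  proof -
    have "integrable (distr lborel borel ((+) c)) F" using Fi by (simp add: lborel_distr_plus)
    then show "integrable lborel (\<lambda>x. F (x + c))" by (subst (asm) integrable_distr_eq) (auto simp: add.commute)
    have "(LINT x|distr lborel borel ((+) c). F x) = (LINT x|lborel. F (c + x))" by (rule integral_distr) auto
    then show "(LINT x|lborel. F (x + c)) = (LINT x|lborel. F x)" by (simp add: lborel_distr_plus add.commute)
  qed
  have z: "(LINT x|lebesgue. dq e m F x) = 0" for m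
  proof -
    have "(LINT x|lebesgue. dq e m F x) = (LINT x|lborel. dq e m F x)"
      unfolding dq_def by (intro integral_completion) simp
    also have "\<dots> = 0" unfolding dq_def using shift Fi by simp
    finally show ?thesis .
  qed
  have "(\<lambda>m. LINT x|lebesgue. dq e m F x) \<longlonglongrightarrow> (LINT x|lebesgue. D x)"
  proof (rule integral_dominated_convergence[where w="\<lambda>x. indicator (cball 0 (R + 1)) x * L"])
    show "integrable lebesgue (\<lambda>x. indicator (cball (0::'a) (R + 1)) x * L)"
      by (rule integrable_indicator_bounded) auto
    show "(\<lambda>x. dq e m F x) \<in> borel_measurable lebesgue" for m
      unfolding dq_def by (intro measurable_completion) simp
    fix m
    show "AE x in lebesgue. norm (dq e m F x) \<le> indicator (cball 0 (R + 1)) x * L"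
    proof (rule AE_I2)
      fix x
      show "norm (dq e m F x) \<le> indicator (cball 0 (R + 1)) x * L"
      proof (cases "x \<in> cball 0 (R + 1)")
        case False
        have "norm (e /\<^sub>R real (Suc m)) \<le> 1" using e by (simp add: field_simps)
        then have "x + e /\<^sub>R real (Suc m) \<notin> cball 0 R"
          using False norm_triangle_ineq2[of x "- (e /\<^sub>R real (Suc m))"] by auto
        then have "F (x + e /\<^sub>R real (Suc m)) = 0" "F x = 0" using False out by auto
        then show ?thesis using False by (simp add: dq_def)
      qed (use L in auto)
    qed
  qed (use D lim in auto)
  then show ?thesis unfolding z by (simp add: LIMSEQ_const_iff)
qed

text \<open>Lipschitz continuity in the coordinate directions together with the almost everywhere differentiability that Rademacher's
theorem would provide. Both finite element functions and test functions have these properties for elementary reasons, and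
they suffice for integration by parts.\<close>

definition Lipschitz_gradient :: "('a::euclidean_space \<Rightarrow> real) \<Rightarrow> ('a \<Rightarrow> 'a) \<Rightarrow> bool" where
  "Lipschitz_gradient v G \<longleftrightarrow> continuous_on UNIV v \<and> G \<in> borel_measurable lebesgue \<and>
     (\<exists>L. \<forall>e\<in>Basis. \<forall>m x. \<bar>dq e m v x\<bar> \<le> L) \<and>
     (\<forall>e\<in>Basis. AE x in lebesgue. (\<lambda>m. dq e m v x) \<longlonglongrightarrow> G x \<bullet> e)"

lemma test_function_zero_outside:
  assumes "\<psi> \<in> test_functions \<Omega>" "x \<notin> \<Omega>" shows "\<psi> x = 0"
  using assms unfolding test_functions_def by blast

lemma test_function_Ck: "\<psi> \<in> test_functions \<Omega> \<Longrightarrow> Ck_on k UNIV \<psi>"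
  unfolding test_functions_def smooth_on_def by blast

lemma test_function_derivative:
  assumes "\<psi> \<in> test_functions \<Omega>"
  shows "(\<psi> has_derivative frechet_derivative \<psi> (at x)) (at x)"
    and "i \<in> Basis \<Longrightarrow> continuous_on UNIV (\<lambda>x. frechet_derivative \<psi> (at x) i)"
    and "x \<notin> \<Omega> \<Longrightarrow> frechet_derivative \<psi> (at x) = (\<lambda>i. 0)"
proof -
  have C: "Ck_on (Suc 0) UNIV \<psi>" by (rule test_function_Ck[OF assms])
  show "(\<psi> has_derivative frechet_derivative \<psi> (at x)) (at x)" by (rule Ck_on_SucD(1)[OF C])
  show "continuous_on UNIV (\<lambda>x. frechet_derivative \<psi> (at x) i)" if "i \<in> Basis"
    using Ck_on_SucD(2)[OF C that] by simp
  assume x: "x \<notin> \<Omega>"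
  obtain K where K: "compact K" "K \<subseteq> \<Omega>" "\<And>y. y \<notin> K \<Longrightarrow> \<psi> y = 0"
    using assms unfolding test_functions_def by blast
  have "((\<lambda>y. 0) has_derivative (\<lambda>i. 0)) (at x)" by simp
  then have "(\<psi> has_derivative (\<lambda>i. 0)) (at x)"
  proof (rule has_derivative_transform_within_open)
    show "open (- K)" using K(1) compact_imp_closed by blast
    show "x \<in> - K" using x K(2) by blast
    show "\<And>y. y \<in> - K \<Longrightarrow> 0 = \<psi> y" using K(3) by simp
  qed
  from frechet_derivative_at[OF this] show "frechet_derivative \<psi> (at x) = (\<lambda>i. 0)" by simp
qed

lemma directional_field_derivative:
  fixes \<psi> :: "'a::euclidean_space \<Rightarrow> real"
  assumes "\<And>x. (\<psi> has_derivative D x) (at x)"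
  shows "((\<lambda>t. \<psi> (x + t *\<^sub>R e)) has_real_derivative D (x + t *\<^sub>R e) e) (at t)"
proof -
  have "((\<lambda>t. x + t *\<^sub>R e) has_derivative (\<lambda>h. h *\<^sub>R e)) (at t)" by (auto intro!: derivative_eq_intros)
  from has_derivative_compose[OF this assms]
  have "((\<lambda>t. \<psi> (x + t *\<^sub>R e)) has_derivative (\<lambda>h. D (x + t *\<^sub>R e) (h *\<^sub>R e))) (at t)" .
  moreover have "D (x + t *\<^sub>R e) (h *\<^sub>R e) = D (x + t *\<^sub>R e) e * h" for h
    using linear_scale[OF has_derivative_linear[OF assms[of "x + t *\<^sub>R e"]]] by simp
  ultimately show ?thesis by (simp add: has_field_derivative_def)
qed

lemma dq_tendsto_derivative:
  fixes \<psi> :: "'a::euclidean_space \<Rightarrow> real"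
  assumes "\<And>x. (\<psi> has_derivative D x) (at x)"
  shows "(\<lambda>m. dq e m \<psi> x) \<longlonglongrightarrow> D x e"
proof -
  have "((\<lambda>t. \<psi> (x + t *\<^sub>R e)) has_real_derivative D (x + 0 *\<^sub>R e) e) (at 0)"
    by (rule directional_field_derivative[OF assms])
  then have "((\<lambda>h. (\<psi> (x + h *\<^sub>R e) - \<psi> x) / h) \<longlongrightarrow> D x e) (at 0)"
    by (simp add: DERIV_def)
  moreover have "filterlim (\<lambda>m. inverse (real (Suc m))) (at 0) sequentially"
    using LIMSEQ_inverse_real_of_nat by (auto simp: filterlim_at)
  ultimately have "(\<lambda>m. (\<psi> (x + inverse (real (Suc m)) *\<^sub>R e) - \<psi> x) / inverse (real (Suc m))) \<longlonglongrightarrow> D x e"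
    by (rule filterlim_compose)
  then show ?thesis by (simp add: dq_def divide_inverse mult.commute)
qed

lemma dq_bound_derivative:
  fixes \<psi> :: "'a::euclidean_space \<Rightarrow> real"
  assumes D: "\<And>x. (\<psi> has_derivative D x) (at x)" and M: "\<And>x. \<bar>D x e\<bar> \<le> M"
  shows "\<bar>dq e m \<psi> x\<bar> \<le> M"
proof -
  define h where "h = inverse (real (Suc m))"
  have h: "h > 0" by (simp add: h_def)
  have "\<exists>z. 0 < z \<and> z < h \<and> \<psi> (x + h *\<^sub>R e) - \<psi> (x + 0 *\<^sub>R e) = (h - 0) * D (x + z *\<^sub>R e) e"
    by (rule MVT2[OF h]) (rule directional_field_derivative[OF D])
  then obtain z where "\<psi> (x + h *\<^sub>R e) - \<psi> x = h * D (x + z *\<^sub>R e) e" by auto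
  then have "dq e m \<psi> x = D (x + z *\<^sub>R e) e" unfolding dq_def h_def[symmetric] by (simp add: h_def field_simps)
  then show ?thesis using M by simp
qed

lemma test_function_Lipschitz_gradient:
  assumes \<psi>: "\<psi> \<in> test_functions \<Omega>" and \<Omega>: "bounded \<Omega>"
  shows "Lipschitz_gradient \<psi> (\<lambda>x. \<Sum>i\<in>Basis. frechet_derivative \<psi> (at x) i *\<^sub>R i)"
proof -
  let ?D = "\<lambda>x. frechet_derivative \<psi> (at x)"
  obtain R where "\<forall>x\<in>\<Omega>. norm x \<le> R" using \<Omega> unfolding bounded_iff ..
  then have R: "\<Omega> \<subseteq> cball 0 R" by auto
  have comp: "(\<Sum>i\<in>Basis. ?D x i *\<^sub>R i) \<bullet> e = ?D x e" if "e \<in> Basis" for e x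
    using that by simp
  have "\<exists>M. \<forall>x. \<bar>?D x e\<bar> \<le> M" if e: "e \<in> Basis" for e
  proof -
    obtain M where "0 \<le> M \<and> (\<forall>x\<in>cball 0 R. \<bar>?D x e\<bar> \<le> M)"
      using continuous_bounded_on_cball[OF test_function_derivative(2)[OF \<psi> e]] ..
    then have M: "M \<ge> 0" "\<And>x. x \<in> cball 0 R \<Longrightarrow> \<bar>?D x e\<bar> \<le> M" by auto
    have "\<bar>?D x e\<bar> \<le> M" for x
    proof (cases "x \<in> \<Omega>")
      case True then show ?thesis using M(2) R by auto
    next
      case False then show ?thesis using test_function_derivative(3)[OF \<psi> False] M(1) by simp
    qed
    then show ?thesis by auto
  qed
  then have "\<forall>e\<in>Basis. \<exists>M. \<forall>x. \<bar>?D x e\<bar> \<le> M" by simp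
  from bchoice[OF this] obtain M where "\<forall>e\<in>Basis. \<forall>x. \<bar>?D x e\<bar> \<le> M e" ..
  then have M: "\<And>e x. e \<in> Basis \<Longrightarrow> \<bar>?D x e\<bar> \<le> M e" by simp
  have "\<bar>dq e m \<psi> x\<bar> \<le> Max (M ` Basis)" if e: "e \<in> Basis" for e m x
  proof -
    have "\<bar>dq e m \<psi> x\<bar> \<le> M e"
      by (rule dq_bound_derivative[OF test_function_derivative(1)[OF \<psi>] M[OF e]])
    also have "\<dots> \<le> Max (M ` Basis)" using e by (intro Max_ge) auto
    finally show ?thesis .
  qed
  moreover have "(\<lambda>x. \<Sum>i\<in>Basis. ?D x i *\<^sub>R i) \<in> borel_measurable lebesgue"
  proof (intro measurable_completion)
    have "continuous_on UNIV (\<lambda>x. \<Sum>i\<in>Basis. ?D x i *\<^sub>R i)"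
      by (intro continuous_intros test_function_derivative(2)[OF \<psi>])
    then show "(\<lambda>x. \<Sum>i\<in>Basis. ?D x i *\<^sub>R i) \<in> borel_measurable lborel"
      by (simp add: borel_measurable_continuous_onI)
  qed
  moreover have "AE x in lebesgue. (\<lambda>m. dq e m \<psi> x) \<longlonglongrightarrow> (\<Sum>i\<in>Basis. ?D x i *\<^sub>R i) \<bullet> e" if e: "e \<in> Basis" for e
    unfolding comp[OF e] by (intro AE_I2 dq_tendsto_derivative test_function_derivative(1)[OF \<psi>])
  ultimately show ?thesis
    unfolding Lipschitz_gradient_def using test_function_measurable(1)[OF \<psi>] by (intro conjI ballI exI[of _ "Max (M ` Basis)"] allI) simp_all
qed

lemma Lipschitz_gradientD:
  assumes "Lipschitz_gradient v G"
  shows "continuous_on UNIV v" "G \<in> borel_measurable lebesgue"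
    "e \<in> Basis \<Longrightarrow> AE x in lebesgue. (\<lambda>m. dq e m v x) \<longlonglongrightarrow> G x \<bullet> e"
  using assms unfolding Lipschitz_gradient_def by simp_all

lemma Lipschitz_gradient_comp_bound:
  assumes v: "Lipschitz_gradient v G"
  shows "\<exists>L. 0 \<le> L \<and> (\<forall>e\<in>Basis. \<forall>m x. \<bar>dq e m v x\<bar> \<le> L) \<and> (\<forall>e\<in>Basis. AE x in lebesgue. \<bar>G x \<bullet> e\<bar> \<le> L)"
proof -
  have "\<exists>L. \<forall>e\<in>Basis. \<forall>m x. \<bar>dq e m v x\<bar> \<le> L" using v unfolding Lipschitz_gradient_def by simp
  then obtain L where L: "\<forall>e\<in>Basis. \<forall>m x. \<bar>dq e m v x\<bar> \<le> L" ..
  have ae: "AE x in lebesgue. \<bar>G x \<bullet> e\<bar> \<le> L" if e: "e \<in> Basis" for e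
    using Lipschitz_gradientD(3)[OF v e]
  proof eventually_elim
    case (elim x)
    have "(\<lambda>m. \<bar>dq e m v x\<bar>) \<longlonglongrightarrow> \<bar>G x \<bullet> e\<bar>" by (intro tendsto_intros elim)
    then show ?case by (rule LIMSEQ_le_const2) (use L e in auto)
  qed
  have "\<bar>dq (SOME e. e \<in> Basis) 0 v 0\<bar> \<le> L" by (rule L[rule_format, OF SOME_Basis])
  then have "0 \<le> L" by linarith
  then show ?thesis using L ae by (intro exI[of _ L]) simp
qed

lemma Lipschitz_gradient_bound:
  assumes v: "Lipschitz_gradient v G"
  shows "\<exists>B. AE x in lebesgue. norm (G x) \<le> B"
proof -
  obtain L where L: "0 \<le> L \<and> (\<forall>e\<in>Basis. \<forall>m x. \<bar>dq e m v x\<bar> \<le> L) \<and> (\<forall>e\<in>Basis. AE x in lebesgue. \<bar>G x \<bullet> e\<bar> \<le> L)"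
    using Lipschitz_gradient_comp_bound[OF v] ..
  have "AE x in lebesgue. \<forall>e\<in>Basis. \<bar>G x \<bullet> e\<bar> \<le> L" using L by (intro AE_finite_allI) auto
  then have "AE x in lebesgue. norm (G x) \<le> (\<Sum>e\<in>(Basis :: 'a set). L)"
  proof eventually_elim
    case (elim x)
    have "norm (G x) \<le> (\<Sum>e\<in>Basis. \<bar>G x \<bullet> e\<bar>)" by (rule norm_le_l1)
    also have "\<dots> \<le> (\<Sum>e\<in>(Basis :: 'a set). L)" using elim by (intro sum_mono) auto
    finally show ?case .
  qed
  then show ?thesis ..
qed

context
  fixes \<Omega> :: "plane set" and R :: real
  assumes \<Omega>: "open \<Omega>" and R: "\<Omega> \<subseteq> cball 0 R"
begin

lemma sq_integrable_indicator_bounded: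
  fixes f :: "plane \<Rightarrow> 'b::euclidean_space"
  assumes "f \<in> borel_measurable lebesgue" "AE x in lebesgue. x \<in> \<Omega> \<longrightarrow> norm (f x) \<le> M"
  shows "sq_integrable (\<lambda>x. indicator \<Omega> x *\<^sub>R f x)"
proof (rule sq_integrable_bounded)
  show "(\<lambda>x. indicator \<Omega> x *\<^sub>R f x) \<in> borel_measurable lebesgue"
    using assms(1) \<Omega> by (intro borel_measurable_scaleR borel_measurable_indicator) auto
  show "AE x in lebesgue. norm (indicator \<Omega> x *\<^sub>R f x) \<le> \<bar>M\<bar>"
    using assms(2) by eventually_elim (auto simp: indicator_def)
  show "\<And>x. x \<notin> cball 0 R \<Longrightarrow> indicator \<Omega> x *\<^sub>R f x = 0" using R by (auto simp: indicator_def)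
qed

lemma sq_integrable_indicator_continuous:
  fixes f :: "plane \<Rightarrow> real"
  assumes f: "continuous_on UNIV f"
  shows "sq_integrable (\<lambda>x. indicator \<Omega> x *\<^sub>R f x)"
proof -
  obtain M where "0 \<le> M \<and> (\<forall>x\<in>cball 0 R. \<bar>f x\<bar> \<le> M)"
    using continuous_bounded_on_cball[OF f] ..
  then have M: "M \<ge> 0" "\<And>x. x \<in> cball 0 R \<Longrightarrow> \<bar>f x\<bar> \<le> M" by auto
  show ?thesis
  proof (rule sq_integrable_indicator_bounded)
    show "f \<in> borel_measurable lebesgue"
      using borel_measurable_continuous_onI[OF f] by (intro measurable_completion) simp
    show "AE x in lebesgue. x \<in> \<Omega> \<longrightarrow> norm (f x) \<le> M" using M(2) R by (intro AE_I2) auto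
  qed
qed

lemma inner_L2_class:
  assumes "sq_integrable (\<lambda>x. indicator \<Omega> x *\<^sub>R f x)" "sq_integrable (\<lambda>x. indicator \<Omega> x *\<^sub>R g x)"
  shows "L2_class \<Omega> f \<bullet> L2_class \<Omega> g = (LINT x|lebesgue. indicator \<Omega> x * (f x \<bullet> g x))"
  unfolding L2_class_def inner_abs_L2[OF assms] by (intro Bochner_Integration.integral_cong) (auto simp: indicator_def)

text \<open>Integration by parts for a product \<open>v \<psi>\<close> in which only \<open>v\<close> vanishes outside
\<open>\<Omega>\<close>; the difference quotients of \<open>\<psi>\<close> need only be bounded near \<open>\<Omega>\<close>.
It is applied to a test function \<open>\<psi>\<close>, which yields weak gradients, and to \<open>(x \<bullet> e) *
v\<close>, which yields the Poincare inequality.\<close>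

lemma integral_product_derivative_eq_0:
  assumes v: "Lipschitz_gradient v G" "\<And>x. x \<notin> \<Omega> \<Longrightarrow> v x = 0"
    and \<psi>: "continuous_on UNIV \<psi>" "\<psi>' \<in> borel_measurable lebesgue"
       "AE x in lebesgue. (\<lambda>m. dq e m \<psi> x) \<longlonglongrightarrow> \<psi>' x"
       "\<And>m x. x \<in> cball 0 (R + 1) \<Longrightarrow> \<bar>dq e m \<psi> x\<bar> \<le> L"
    and e: "e \<in> Basis"
  shows "(LINT x|lebesgue. (G x \<bullet> e) * \<psi> x + v x * \<psi>' x) = 0"
proof -
  have vc: "continuous_on UNIV v" and Gm: "G \<in> borel_measurable lebesgue"
    and vl: "AE x in lebesgue. (\<lambda>m. dq e m v x) \<longlonglongrightarrow> G x \<bullet> e"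
    by (rule Lipschitz_gradientD[OF v(1)])+ (rule e)
  obtain L1 where "0 \<le> L1 \<and> (\<forall>e\<in>Basis. \<forall>m x. \<bar>dq e m v x\<bar> \<le> L1) \<and> (\<forall>e\<in>Basis. AE x in lebesgue. \<bar>G x \<bullet> e\<bar> \<le> L1)"
    using Lipschitz_gradient_comp_bound[OF v(1)] ..
  then have L1: "L1 \<ge> 0" "\<And>m x. \<bar>dq e m v x\<bar> \<le> L1" using e by simp_all
  obtain M where "0 \<le> M \<and> (\<forall>x\<in>cball 0 R. \<bar>v x\<bar> \<le> M)"
    using continuous_bounded_on_cball[OF vc] ..
  then have M: "M \<ge> 0" "\<And>x. x \<in> cball 0 R \<Longrightarrow> \<bar>v x\<bar> \<le> M" by auto
  obtain N where "0 \<le> N \<and> (\<forall>x\<in>cball 0 (R+2). \<bar>\<psi> x\<bar> \<le> N)"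
    using continuous_bounded_on_cball[OF \<psi>(1)] ..
  then have N: "N \<ge> 0" "\<And>x. x \<in> cball 0 (R+2) \<Longrightarrow> \<bar>\<psi> x\<bar> \<le> N" by auto
  have e1: "norm e \<le> 1" using e by simp
  have small: "norm (e /\<^sub>R real (Suc m)) \<le> 1" for m using e1 by (simp add: field_simps)
  have v0: "v x = 0" if "x \<notin> cball 0 R" for x by (rule v(2)) (use R that in auto)
  have far: "x + e /\<^sub>R real (Suc m) \<notin> cball 0 R" if "x \<notin> cball 0 (R + 1)" for x m
    using that small[of m] norm_triangle_ineq2[of x "- (e /\<^sub>R real (Suc m))"] by auto
  have near: "x + e /\<^sub>R real (Suc m) \<in> cball 0 (R + 2)" if "x \<in> cball 0 (R + 1)" for x m
    using that small[of m] norm_triangle_ineq[of x "e /\<^sub>R real (Suc m)"] by auto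
  show ?thesis
  proof (rule integral_derivative_eq_0[where F="\<lambda>x. v x * \<psi> x" and e=e and R=R and L="L1 * N + M * \<bar>L\<bar>"])
    show "continuous_on UNIV (\<lambda>x. v x * \<psi> x)" by (intro continuous_intros vc \<psi>(1))
    show "v x * \<psi> x = 0" if "x \<notin> cball 0 R" for x using v0[OF that] by simp
    show "norm e \<le> 1" by (rule e1)
    have \<psi>m: "\<psi> \<in> borel_measurable lebesgue" and vm: "v \<in> borel_measurable lebesgue"
      using borel_measurable_continuous_onI[OF \<psi>(1)] borel_measurable_continuous_onI[OF vc] by (auto intro!: measurable_completion)
    show "(\<lambda>x. (G x \<bullet> e) * \<psi> x + v x * \<psi>' x) \<in> borel_measurable lebesgue"
      by (intro borel_measurable_add borel_measurable_times borel_measurable_inner Gm \<psi>m vm \<psi>(2)) simp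
    show "\<bar>dq e m (\<lambda>x. v x * \<psi> x) x\<bar> \<le> L1 * N + M * \<bar>L\<bar>" for m x
    proof (cases "x \<in> cball 0 (R + 1)")
      case True
      have "\<bar>dq e m v x * \<psi> (x + e /\<^sub>R real (Suc m))\<bar> \<le> L1 * N"
        unfolding abs_mult using L1 N(2)[OF near[OF True]] by (intro mult_mono) auto
      moreover have "\<bar>v x * dq e m \<psi> x\<bar> \<le> M * \<bar>L\<bar>"
      proof -
        have "\<bar>v x\<bar> \<le> M" using M v0[of x] by (cases "x \<in> cball 0 R") auto
        moreover have "\<bar>dq e m \<psi> x\<bar> \<le> \<bar>L\<bar>" using \<psi>(4)[OF True, of m] by linarith
        ultimately show ?thesis unfolding abs_mult using M(1) by (intro mult_mono) auto
      qed
      ultimately show ?thesis unfolding dq_mult by linarith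
    next
      case False
      have "dq e m (\<lambda>x. v x * \<psi> x) x = 0"
        using v0[OF far[OF False, of m]] v0[of x] False by (simp add: dq_def)
      then show ?thesis using L1(1) N(1) M(1) by simp
    qed
    show "AE x in lebesgue. (\<lambda>m. dq e m (\<lambda>x. v x * \<psi> x) x) \<longlonglongrightarrow> (G x \<bullet> e) * \<psi> x + v x * \<psi>' x"
      using vl \<psi>(3)
    proof eventually_elim
      case (elim x)
      have "isCont \<psi> x" using \<psi>(1) by (simp add: continuous_on_eq_continuous_at)
      then have "(\<lambda>m. \<psi> (x + e /\<^sub>R real (Suc m))) \<longlonglongrightarrow> \<psi> x"
        by (rule isCont_tendsto_compose[OF _ shift_tendsto])
      then show ?case unfolding dq_mult by (intro tendsto_intros elim)
    qed
  qed
qed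

lemma Lipschitz_gradient_sq_integrable:
  assumes v: "Lipschitz_gradient v G"
  shows "sq_integrable (\<lambda>x. indicator \<Omega> x *\<^sub>R v x)" "sq_integrable (\<lambda>x. indicator \<Omega> x *\<^sub>R G x)"
proof -
  show "sq_integrable (\<lambda>x. indicator \<Omega> x *\<^sub>R v x)"
    by (rule sq_integrable_indicator_continuous[OF Lipschitz_gradientD(1)[OF v]])
  obtain B where B: "AE x in lebesgue. norm (G x) \<le> B" using Lipschitz_gradient_bound[OF v] ..
  show "sq_integrable (\<lambda>x. indicator \<Omega> x *\<^sub>R G x)"
  proof (rule sq_integrable_indicator_bounded)
    show "G \<in> borel_measurable lebesgue" by (rule Lipschitz_gradientD(2)[OF v])
    show "AE x in lebesgue. x \<in> \<Omega> \<longrightarrow> norm (G x) \<le> B" using B by eventually_elim simp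
  qed
qed

lemma Lipschitz_gradient_has_weak_gradient:
  assumes v: "Lipschitz_gradient v G" and out: "\<And>x. x \<notin> \<Omega> \<Longrightarrow> v x = 0"
  shows "has_weak_gradient \<Omega> (L2_class \<Omega> v) (L2_class \<Omega> G)"
  unfolding has_weak_gradient_def
proof (intro conjI ballI)
  note sq = Lipschitz_gradient_sq_integrable[OF v]
  show "L2_class \<Omega> v \<in> L2_on \<Omega>" "L2_class \<Omega> G \<in> L2_on \<Omega>" using sq by (auto intro: L2_on_L2_class)
  fix \<psi> i assume \<psi>: "\<psi> \<in> test_functions \<Omega>" and i: "(i::plane) \<in> Basis"
  let ?D = "\<lambda>x. frechet_derivative \<psi> (at x) i"
  have b\<Omega>: "bounded \<Omega>" by (rule bounded_subset[OF bounded_cball R])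
  have Dc: "continuous_on UNIV ?D" by (rule test_function_derivative(2)[OF \<psi> i])
  obtain B where B: "AE x in lebesgue. norm (G x) \<le> B" using Lipschitz_gradient_bound[OF v] ..
  have \<psi>L: "Lipschitz_gradient \<psi> (\<lambda>x. \<Sum>i\<in>Basis. frechet_derivative \<psi> (at x) i *\<^sub>R i)"
    by (rule test_function_Lipschitz_gradient[OF \<psi> b\<Omega>])
  obtain L where "0 \<le> L \<and> (\<forall>e\<in>Basis. \<forall>m x. \<bar>dq e m \<psi> x\<bar> \<le> L) \<and> (\<forall>e\<in>Basis. AE x in lebesgue. \<bar>(\<Sum>i\<in>Basis. frechet_derivative \<psi> (at x) i *\<^sub>R i) \<bullet> e\<bar> \<le> L)"
    using Lipschitz_gradient_comp_bound[OF \<psi>L] ..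
  then have L: "\<And>m x. \<bar>dq i m \<psi> x\<bar> \<le> L" using i by simp
  have Dm: "?D \<in> borel_measurable lebesgue"
    using borel_measurable_continuous_onI[OF Dc] by (intro measurable_completion) simp
  have z: "(LINT x|lebesgue. (G x \<bullet> i) * \<psi> x + v x * ?D x) = 0"
    by (rule integral_product_derivative_eq_0[OF v out test_function_measurable(1)[OF \<psi>] Dm _ L i])
      (auto intro!: AE_I2 dq_tendsto_derivative test_function_derivative(1)[OF \<psi>])
  have sqD: "sq_integrable (\<lambda>x. indicator \<Omega> x *\<^sub>R ?D x)" by (rule sq_integrable_indicator_continuous[OF Dc])
  have sq\<psi>: "sq_integrable (\<lambda>x. indicator \<Omega> x *\<^sub>R (\<psi> x *\<^sub>R i))"
  proof -
    have "sq_integrable (\<lambda>x. indicator \<Omega> x *\<^sub>R \<psi> x)"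
      by (rule sq_integrable_indicator_continuous[OF test_function_measurable(1)[OF \<psi>]])
    then show ?thesis using i
      by (auto simp: sq_integrable_def mult.assoc[symmetric] intro!: borel_measurable_scaleR)
  qed
  have I1: "integrable lebesgue (\<lambda>x. v x * ?D x)"
    using sq_integrable_inner[OF sq(1) sqD]
    by (rule Bochner_Integration.integrable_cong[THEN iffD1, rotated -1]) (auto simp: indicator_def out)
  have I2: "integrable lebesgue (\<lambda>x. (G x \<bullet> i) * \<psi> x)"
    using sq_integrable_inner[OF sq(2) sq\<psi>]
    by (rule Bochner_Integration.integrable_cong[THEN iffD1, rotated -1])
      (auto simp: indicator_def test_function_zero_outside[OF \<psi>])
  have "L2_class \<Omega> v \<bullet> L2_class \<Omega> ?D = (LINT x|lebesgue. v x * ?D x)"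
    unfolding inner_L2_class[OF sq(1) sqD]
    by (intro Bochner_Integration.integral_cong) (auto simp: indicator_def out)
  also have "\<dots> = - (LINT x|lebesgue. (G x \<bullet> i) * \<psi> x)"
    using z I1 I2 by simp
  also have "(LINT x|lebesgue. (G x \<bullet> i) * \<psi> x) = L2_class \<Omega> G \<bullet> L2_class \<Omega> (\<lambda>x. \<psi> x *\<^sub>R i)"
    unfolding inner_L2_class[OF sq(2) sq\<psi>]
    by (intro Bochner_Integration.integral_cong) (auto simp: indicator_def test_function_zero_outside[OF \<psi>])
  finally show "L2_class \<Omega> v \<bullet> L2_class \<Omega> ?D = - (L2_class \<Omega> G \<bullet> L2_class \<Omega> (\<lambda>x. \<psi> x *\<^sub>R i))" .
qed

text \<open>Integrating the derivative of \<open>(x \<bullet> e) * v\<^sup>2\<close> in a coordinate direction \<open>e\<close> gives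
\<open>\<parallel>v\<parallel>\<^sup>2 = - 2 \<integral> (x \<bullet> e) v (G \<bullet> e)\<close>. Since \<open>\<bar>x
\<bullet> e\<bar> \<le> R\<close> on \<open>\<Omega>\<close>, the Cauchy-Schwarz inequality finishes the proof. Working with
the product \<open>v * ((x \<bullet> e) * v)\<close> keeps this within the preceding integration by parts.\<close>

lemma Poincare_Lipschitz:
  assumes v: "Lipschitz_gradient v G" and out: "\<And>x. x \<notin> \<Omega> \<Longrightarrow> v x = 0" and R0: "R \<ge> 0"
  shows "norm (L2_class \<Omega> v) \<le> 2 * R * norm (L2_class \<Omega> G)"
proof -
  note sq = Lipschitz_gradient_sq_integrable[OF v]
  define e :: plane where "e = (SOME e. e \<in> Basis)"
  have e: "e \<in> Basis" unfolding e_def by (rule SOME_Basis)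
  have vc: "continuous_on UNIV v" and Gm: "G \<in> borel_measurable lebesgue"
    and vl: "AE x in lebesgue. (\<lambda>m. dq e m v x) \<longlonglongrightarrow> G x \<bullet> e"
    by (rule Lipschitz_gradientD[OF v])+ (rule e)
  obtain L where "0 \<le> L \<and> (\<forall>e\<in>Basis. \<forall>m x. \<bar>dq e m v x\<bar> \<le> L) \<and> (\<forall>e\<in>Basis. AE x in lebesgue. \<bar>G x \<bullet> e\<bar> \<le> L)"
    using Lipschitz_gradient_comp_bound[OF v] ..
  then have L: "L \<ge> 0" "\<And>m x. \<bar>dq e m v x\<bar> \<le> L" using e by simp_all
  obtain B where B: "AE x in lebesgue. norm (G x) \<le> B" using Lipschitz_gradient_bound[OF v] ..
  obtain M where "0 \<le> M \<and> (\<forall>x\<in>cball 0 (R+2). \<bar>v x\<bar> \<le> M)"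
    using continuous_bounded_on_cball[OF vc] ..
  then have M: "M \<ge> 0" "\<And>x. x \<in> cball 0 (R+2) \<Longrightarrow> \<bar>v x\<bar> \<le> M" by auto
  have dqx: "dq e m (\<lambda>x. x \<bullet> e) x = 1" for m x
    using e by (simp add: dq_def inner_add_left)
  have small: "norm (e /\<^sub>R real (Suc m)) \<le> 1" for m using e by (simp add: field_simps)
  have near: "x + e /\<^sub>R real (Suc m) \<in> cball 0 (R + 2)" if "x \<in> cball 0 (R + 1)" for x m
    using that small[of m] norm_triangle_ineq[of x "e /\<^sub>R real (Suc m)"] by auto
  let ?w' = "\<lambda>x. v x + (x \<bullet> e) * (G x \<bullet> e)"
  have vm: "v \<in> borel_measurable lebesgue"
    using borel_measurable_continuous_onI[OF vc] by (auto intro!: measurable_completion)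
  have xm: "(\<lambda>x::plane. x \<bullet> e) \<in> borel_measurable lebesgue" by (intro measurable_completion) simp
  have z: "(LINT x|lebesgue. (G x \<bullet> e) * ((x \<bullet> e) * v x) + v x * ?w' x) = 0"
  proof (rule integral_product_derivative_eq_0[OF v out, where L="M + (R + 1) * L"])
    show "continuous_on UNIV (\<lambda>x. (x \<bullet> e) * v x)" by (intro continuous_intros vc)
    show "?w' \<in> borel_measurable lebesgue"
      by (intro borel_measurable_add borel_measurable_times borel_measurable_inner vm xm Gm) simp
    show "AE x in lebesgue. (\<lambda>m. dq e m (\<lambda>x. (x \<bullet> e) * v x) x) \<longlonglongrightarrow> ?w' x"
      using vl
    proof eventually_elim
      case (elim x)
      have "isCont v x" using vc by (simp add: continuous_on_eq_continuous_at)
      then have "(\<lambda>m. v (x + e /\<^sub>R real (Suc m))) \<longlonglongrightarrow> v x"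
        by (rule isCont_tendsto_compose[OF _ shift_tendsto])
      then have "(\<lambda>m. 1 * v (x + e /\<^sub>R real (Suc m)) + (x \<bullet> e) * dq e m v x) \<longlonglongrightarrow> 1 * v x + (x \<bullet> e) * (G x \<bullet> e)"
        by (intro tendsto_intros elim)
      then show ?case unfolding dq_mult dqx by simp
    qed
    show "\<bar>dq e m (\<lambda>x. (x \<bullet> e) * v x) x\<bar> \<le> M + (R + 1) * L" if x: "x \<in> cball 0 (R + 1)" for m x
    proof -
      have "\<bar>x \<bullet> e\<bar> \<le> R + 1" using x Basis_le_norm[OF e, of x] by simp
      then have "\<bar>(x \<bullet> e) * dq e m v x\<bar> \<le> (R + 1) * L"
        unfolding abs_mult using L R0 by (intro mult_mono) auto
      then show ?thesis unfolding dq_mult dqx using M(2)[OF near[OF x, of m]] by linarith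
    qed
  qed (use e in auto)
  have Ge: "(\<lambda>x. G x \<bullet> e) \<in> borel_measurable lebesgue" by (rule borel_measurable_inner[OF Gm]) simp
  let ?H = "\<lambda>x. - 2 * (x \<bullet> e) * (G x \<bullet> e)"
  have sqH: "sq_integrable (\<lambda>x. indicator \<Omega> x *\<^sub>R ?H x)"
  proof (rule sq_integrable_indicator_bounded)
    show "?H \<in> borel_measurable lebesgue"
      by (intro borel_measurable_times xm Ge borel_measurable_const)
    show "AE x in lebesgue. x \<in> \<Omega> \<longrightarrow> norm (?H x) \<le> 2 * R * B"
      using B
    proof eventually_elim
      case (elim x)
      show ?case
      proof
        assume "x \<in> \<Omega>"
        then have "\<bar>x \<bullet> e\<bar> \<le> R" using R Basis_le_norm[OF e, of x] by auto
        moreover have "\<bar>G x \<bullet> e\<bar> \<le> B" using Basis_le_norm[OF e, of "G x"] elim by simp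
        ultimately have "\<bar>x \<bullet> e\<bar> * \<bar>G x \<bullet> e\<bar> \<le> R * B" using R0 by (intro mult_mono) auto
        then show "norm (?H x) \<le> 2 * R * B" by (simp add: abs_mult)
      qed
    qed
  qed
  have Ivv: "integrable lebesgue (\<lambda>x. indicator \<Omega> x * (v x * v x))"
    using sq_integrable_inner[OF sq(1) sq(1)]
    by (rule Bochner_Integration.integrable_cong[THEN iffD1, rotated -1]) (auto simp: indicator_def)
  have IvH: "integrable lebesgue (\<lambda>x. indicator \<Omega> x * (v x * ?H x))"
    using sq_integrable_inner[OF sq(1) sqH]
    by (rule Bochner_Integration.integrable_cong[THEN iffD1, rotated -1]) (auto simp: indicator_def)
  have "(LINT x|lebesgue. indicator \<Omega> x * (v x * v x) - indicator \<Omega> x * (v x * ?H x)) = 0"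
  proof -
    have "(G x \<bullet> e) * ((x \<bullet> e) * v x) + v x * ?w' x = indicator \<Omega> x * (v x * v x) - indicator \<Omega> x * (v x * ?H x)" for x
      using out[of x] by (cases "x \<in> \<Omega>") (auto simp: algebra_simps)
    then show ?thesis using z by simp
  qed
  then have "(LINT x|lebesgue. indicator \<Omega> x * (v x * v x)) = (LINT x|lebesgue. indicator \<Omega> x * (v x * ?H x))"
    using Ivv IvH by simp
  then have "L2_class \<Omega> v \<bullet> L2_class \<Omega> v = L2_class \<Omega> v \<bullet> L2_class \<Omega> ?H"
    unfolding inner_L2_class[OF sq(1) sq(1)] inner_L2_class[OF sq(1) sqH] by simp
  also have "\<dots> \<le> norm (L2_class \<Omega> v) * norm (L2_class \<Omega> ?H)" by (rule norm_cauchy_schwarz)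
  finally have 1: "norm (L2_class \<Omega> v) * norm (L2_class \<Omega> v) \<le> norm (L2_class \<Omega> v) * norm (L2_class \<Omega> ?H)"
    by (simp add: power2_norm_eq_inner[symmetric] power2_eq_square)
  have "(norm (L2_class \<Omega> ?H))\<^sup>2 \<le> (2 * R * norm (L2_class \<Omega> G))\<^sup>2"
  proof -
    have IHH: "integrable lebesgue (\<lambda>x. indicator \<Omega> x * (?H x \<bullet> ?H x))"
      using sq_integrable_inner[OF sqH sqH]
      by (rule Bochner_Integration.integrable_cong[THEN iffD1, rotated -1]) (auto simp: indicator_def)
    have IGG: "integrable lebesgue (\<lambda>x. indicator \<Omega> x * (G x \<bullet> G x))"
      using sq_integrable_inner[OF sq(2) sq(2)]
      by (rule Bochner_Integration.integrable_cong[THEN iffD1, rotated -1]) (auto simp: indicator_def)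
    have "(norm (L2_class \<Omega> ?H))\<^sup>2 = (LINT x|lebesgue. indicator \<Omega> x * (?H x \<bullet> ?H x))"
      unfolding power2_norm_eq_inner by (rule inner_L2_class[OF sqH sqH])
    also have "\<dots> \<le> (LINT x|lebesgue. (2 * R)\<^sup>2 * (indicator \<Omega> x * (G x \<bullet> G x)))"
    proof (rule integral_mono[OF IHH])
      show "integrable lebesgue (\<lambda>x. (2 * R)\<^sup>2 * (indicator \<Omega> x * (G x \<bullet> G x)))" using IGG by (intro integrable_mult_right) auto
      fix x
      show "indicator \<Omega> x * (?H x \<bullet> ?H x) \<le> (2 * R)\<^sup>2 * (indicator \<Omega> x * (G x \<bullet> G x))"
      proof (cases "x \<in> \<Omega>")
        case True
        then have "\<bar>x \<bullet> e\<bar> \<le> R" using R Basis_le_norm[OF e, of x] by auto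
        then have "\<bar>?H x\<bar> \<le> 2 * R * norm (G x)"
          using Basis_le_norm[OF e, of "G x"] R0 mult_mono[of "\<bar>x \<bullet> e\<bar>" R "\<bar>G x \<bullet> e\<bar>" "norm (G x)"] by (simp add: abs_mult)
        then have "?H x \<bullet> ?H x \<le> (2 * R * norm (G x))\<^sup>2" by (rule inner_self_le_power2)
        moreover have "(2 * R * norm (G x))\<^sup>2 = (2 * R)\<^sup>2 * (G x \<bullet> G x)"
          unfolding power_mult_distrib[of "2 * R" "norm (G x)"] power2_norm_eq_inner ..
        ultimately have le: "?H x \<bullet> ?H x \<le> (2 * R)\<^sup>2 * (G x \<bullet> G x)" by (rule ord_le_eq_trans)
        have ind: "indicator \<Omega> x = (1::real)" using True by simp
        show ?thesis unfolding ind mult_1 by (rule le)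
      qed simp
    qed
    also have "\<dots> = (2 * R)\<^sup>2 * (norm (L2_class \<Omega> G))\<^sup>2"
      unfolding power2_norm_eq_inner inner_L2_class[OF sq(2) sq(2)] by simp
    finally show ?thesis by (simp add: power_mult_distrib)
  qed
  then have 2: "norm (L2_class \<Omega> ?H) \<le> 2 * R * norm (L2_class \<Omega> G)"
    by (rule power2_le_imp_le) (use R0 in simp)
  show ?thesis
  proof (cases "norm (L2_class \<Omega> v) = 0")
    case False
    then have "norm (L2_class \<Omega> v) > 0" by simp
    then have "norm (L2_class \<Omega> v) \<le> norm (L2_class \<Omega> ?H)" using 1 by (simp only: mult_le_cancel_left_pos)
    then show ?thesis using 2 by linarith
  qed (use R0 in simp)
qed

end

section \<open>Finite element functions\<close>

text \<open>Restrict the function to the segment from \<open>x\<close> to \<open>y\<close>. The preimages of the finitely many closed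
pieces and of the complement of \<open>\<Omega>\<close> cover the parameter interval by closed sets on each of which the
restriction has the asserted Lipschitz constant, and a function that is Lipschitz on each set of a finite closed cover of an
interval is Lipschitz.\<close>

lemma piecewise_affine_Lipschitz:
  fixes v0 :: "'a::euclidean_space \<Rightarrow> real" and a :: "'a set \<Rightarrow> 'a"
  assumes T: "finite T" "\<And>K. K \<in> T \<Longrightarrow> closed K" and \<Omega>: "open \<Omega>" "\<Omega> \<subseteq> \<Union>T"
    and aff: "\<And>K x. K \<in> T \<Longrightarrow> x \<in> K \<Longrightarrow> v0 x = a K \<bullet> x + b K"
    and out: "\<And>x. x \<notin> \<Omega> \<Longrightarrow> v0 x = 0"
  shows "\<bar>v0 y - v0 x\<bar> \<le> (\<Sum>K\<in>T. norm (a K)) * norm (y - x)"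
proof -
  define L where "L = (\<Sum>K\<in>T. norm (a K))"
  have L0: "L \<ge> 0" unfolding L_def by (intro sum_nonneg) auto
  have aL: "norm (a K) \<le> L" if "K \<in> T" for K unfolding L_def using that T(1) by (intro member_le_sum) auto
  define g where "g t = x + t *\<^sub>R (y - x)" for t :: real
  have gc: "continuous_on UNIV g" unfolding g_def by (intro continuous_intros)
  have "(L * norm (y - x))-lipschitz_on {0..1} (\<lambda>t. v0 (g t))"
  proof (rule lipschitz_on_closed_Union[where I="insert (- \<Omega>) T" and U="\<lambda>S. g -` S"])
    show "0 \<le> L * norm (y - x)" using L0 by simp
    show "finite (insert (- \<Omega>) T)" using T by simp
    show "{0..1} \<subseteq> (\<Union>S\<in>insert (- \<Omega>) T. g -` S)"
    proof
      fix t show "t \<in> (\<Union>S\<in>insert (- \<Omega>) T. g -` S)" using \<Omega>(2) by (cases "g t \<in> \<Omega>") auto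
    qed
    fix S assume S: "S \<in> insert (- \<Omega>) T"
    have "closed S" using S T(2) \<Omega>(1) by auto
    then show "closed (g -` S)" using gc by (rule closed_vimage)
    show "(L * norm (y - x))-lipschitz_on (g -` S) (\<lambda>t. v0 (g t))"
    proof (rule lipschitz_onI)
      fix t t' assume t: "t \<in> g -` S" "t' \<in> g -` S"
      show "dist (v0 (g t)) (v0 (g t')) \<le> L * norm (y - x) * dist t t'"
      proof (cases "S \<in> T")
        case True
        have "v0 (g t) - v0 (g t') = (t - t') * (a S \<bullet> (y - x))"
          using aff[OF True] t by (simp add: g_def inner_add_right algebra_simps)
        also have "\<bar>\<dots>\<bar> = \<bar>t - t'\<bar> * \<bar>a S \<bullet> (y - x)\<bar>" by (simp add: abs_mult)
        also have "\<dots> \<le> \<bar>t - t'\<bar> * (norm (a S) * norm (y - x))"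
          by (intro mult_left_mono Cauchy_Schwarz_ineq2) auto
        also have "\<dots> \<le> \<bar>t - t'\<bar> * (L * norm (y - x))"
          by (intro mult_left_mono mult_right_mono aL True) auto
        finally show ?thesis by (simp add: dist_real_def mult_ac)
      next
        case False
        then have "v0 (g t) = 0" "v0 (g t') = 0" using S t out by auto
        then show ?thesis using L0 by simp
      qed
    qed (use L0 in simp)
  qed
  from lipschitz_onD[OF this, of 1 0] show ?thesis by (simp add: g_def L_def dist_real_def)
qed

lemma negligible_AE_not_in: "negligible N \<Longrightarrow> AE x in lebesgue. x \<notin> N"
  using AE_not_in[of N lebesgue] by (simp add: negligible_iff_null_sets)

text \<open>Off the frontiers of the pieces, which are negligible because the pieces are convex, the function is affine or zero near
\<open>x\<close>, and its difference quotients are eventually constant.\<close>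

lemma piecewise_affine_Lipschitz_gradient:
  fixes v0 :: "'a::euclidean_space \<Rightarrow> real" and a :: "'a set \<Rightarrow> 'a"
  assumes T: "finite T" "\<And>K. K \<in> T \<Longrightarrow> closed K" "\<And>K. K \<in> T \<Longrightarrow> convex K" and \<Omega>: "open \<Omega>" "\<Omega> \<subseteq> \<Union>T"
    and aff: "\<And>K x. K \<in> T \<Longrightarrow> x \<in> K \<Longrightarrow> v0 x = a K \<bullet> x + b K"
    and out: "\<And>x. x \<notin> \<Omega> \<Longrightarrow> v0 x = 0"
  shows "\<exists>G. Lipschitz_gradient v0 G"
proof -
  define L where "L = (\<Sum>K\<in>T. norm (a K))"
  have L0: "L \<ge> 0" unfolding L_def by (intro sum_nonneg) auto
  have lip: "\<bar>v0 y - v0 x\<bar> \<le> L * norm (y - x)" for x y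
    unfolding L_def by (rule piecewise_affine_Lipschitz[OF T(1,2) \<Omega> aff out])
  have c: "continuous_on UNIV v0"
  proof (rule lipschitz_on_continuous_on)
    show "L-lipschitz_on UNIV v0"
      by (rule lipschitz_onI) (use lip L0 in \<open>auto simp: dist_norm\<close>)
  qed
  have dqb: "\<bar>dq e m v0 x\<bar> \<le> L" if "e \<in> Basis" for e m x
  proof -
    have "\<bar>v0 (x + e /\<^sub>R real (Suc m)) - v0 x\<bar> \<le> L * (1 / real (Suc m))"
      using lip[of "x + e /\<^sub>R real (Suc m)" x] that by (simp add: divide_inverse)
    then have "real (Suc m) * \<bar>v0 (x + e /\<^sub>R real (Suc m)) - v0 x\<bar> \<le> real (Suc m) * (L * (1 / real (Suc m)))"
      by (intro mult_left_mono) auto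
    then show ?thesis by (simp add: dq_def abs_mult)
  qed
  define N where "N = (\<Union>K\<in>T. frontier K)"
  have "negligible N" unfolding N_def
    using T(1,3) by (intro negligible_Union) (auto intro: negligible_convex_frontier)
  then have N: "AE x in lebesgue. x \<notin> N" by (rule negligible_AE_not_in)
  have conv: "convergent (\<lambda>m. dq e m v0 x)" if x: "x \<notin> N" for e x
  proof (cases "\<exists>K\<in>T. x \<in> interior K")
    case True
    then obtain K where K: "K \<in> T" "x \<in> interior K" by auto
    have "eventually (\<lambda>m. x + e /\<^sub>R real (Suc m) \<in> interior K) sequentially"
      by (rule topological_tendstoD[OF shift_tendsto open_interior K(2)])
    then have "eventually (\<lambda>m. a K \<bullet> e = dq e m v0 x) sequentially"
    proof eventually_elim
      case (elim m)
      have "x + e /\<^sub>R real (Suc m) \<in> K" "x \<in> K" using elim K(2) interior_subset by auto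
      then have "v0 (x + e /\<^sub>R real (Suc m)) - v0 x = (a K \<bullet> e) / real (Suc m)"
        using aff[OF K(1)] by (simp add: inner_add_right divide_inverse mult.commute)
      then show ?case by (simp add: dq_def)
    qed
    then have "(\<lambda>m. dq e m v0 x) \<longlonglongrightarrow> a K \<bullet> e" by (rule Lim_transform_eventually[OF tendsto_const])
    then show ?thesis by (rule convergentI)
  next
    case False
    have xT: "x \<notin> \<Union>T"
    proof
      assume "x \<in> \<Union>T"
      then obtain K where K: "K \<in> T" "x \<in> K" by auto
      then have "x \<in> frontier K" using False closure_subset[of K] by (auto simp: frontier_def)
      then show False using K(1) x by (auto simp: N_def)
    qed
    have "open (- \<Union>T)" using T(1,2) by (intro open_Compl closed_Union) auto
    from topological_tendstoD[OF shift_tendsto this, of x e] xT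
    have "eventually (\<lambda>m. x + e /\<^sub>R real (Suc m) \<in> - \<Union>T) sequentially" by simp
    then have "eventually (\<lambda>m. 0 = dq e m v0 x) sequentially"
    proof eventually_elim
      case (elim m)
      have "x + e /\<^sub>R real (Suc m) \<notin> \<Omega>" "x \<notin> \<Omega>" using elim xT \<Omega>(2) by auto
      then show ?case using out by (simp add: dq_def)
    qed
    then have "(\<lambda>m. dq e m v0 x) \<longlonglongrightarrow> 0" by (rule Lim_transform_eventually[OF tendsto_const])
    then show ?thesis by (rule convergentI)
  qed
  define G where "G x = (\<Sum>e\<in>Basis. lim (\<lambda>m. dq e m v0 x) *\<^sub>R e)" for x
  have v0m: "v0 \<in> borel_measurable borel" by (rule borel_measurable_continuous_onI[OF c])
  have dqm: "(\<lambda>x. dq e m v0 x) \<in> borel_measurable lebesgue" for e m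
    unfolding dq_def using v0m by (intro measurable_completion) simp
  have Gm: "G \<in> borel_measurable lebesgue"
    unfolding G_def by (intro borel_measurable_sum borel_measurable_scaleR borel_measurable_lim_metric dqm borel_measurable_const)
  have lim: "AE x in lebesgue. (\<lambda>m. dq e m v0 x) \<longlonglongrightarrow> G x \<bullet> e" if e: "e \<in> Basis" for e
    using N
  proof eventually_elim
    case (elim x)
    have "G x \<bullet> e = lim (\<lambda>m. dq e m v0 x)" using e by (simp add: G_def)
    then show ?case using conv[OF elim] convergent_LIMSEQ_iff by auto
  qed
  have "Lipschitz_gradient v0 G"
    unfolding Lipschitz_gradient_def
    by (intro conjI c Gm exI[of _ L] ballI allI dqb lim)
  then show ?thesis by (rule exI[of _ G])
qed

text \<open>The representative is extended by zero outside \<open>\<Omega>\<close>; as it vanishes on the frontier, it stays affine on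
the closed triangles.\<close>

lemma fe_space_Lipschitz_gradient:
  assumes \<Omega>: "open \<Omega>" and mesh: "triangular_mesh \<Omega> T" and w: "w \<in> fe_space \<Omega> T"
  shows "\<exists>v G. w = L2_class \<Omega> v \<and> Lipschitz_gradient v G \<and> (\<forall>x. x \<notin> \<Omega> \<longrightarrow> v x = 0)
    \<and> (\<forall>K\<in>T. \<exists>a b. \<forall>x\<in>K. v x = a \<bullet> x + b)"
proof -
  have T: "finite T" "\<And>K. K \<in> T \<Longrightarrow> 2 simplex K" "\<Union>T = closure \<Omega>"
    using mesh by (auto simp: triangular_mesh_def triangulation_def)
  obtain v where v: "w = L2_class \<Omega> v" "\<forall>K\<in>T. \<exists>a b. \<forall>x\<in>K. v x = a \<bullet> x + b" "\<forall>x\<in>frontier \<Omega>. v x = 0"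
    using w unfolding fe_space_def by auto
  define v0 where "v0 x = indicator \<Omega> x * v x" for x
  have w0: "w = L2_class \<Omega> v0"
  proof -
    have "(\<lambda>x. indicator \<Omega> x *\<^sub>R v x) = (\<lambda>x. indicator \<Omega> x *\<^sub>R v0 x)" by (auto simp: v0_def indicator_def)
    then show ?thesis unfolding v(1) L2_class_def by simp
  qed
  have eq: "v0 x = v x" if "x \<in> closure \<Omega>" for x
    using that v(3) \<Omega> by (cases "x \<in> \<Omega>") (auto simp: v0_def frontier_def interior_open)
  have "\<forall>K\<in>T. \<exists>p. \<forall>x\<in>K. v0 x = fst p \<bullet> x + snd p"
  proof
    fix K assume K: "K \<in> T"
    obtain a b where "\<forall>x\<in>K. v x = a \<bullet> x + b" using bspec[OF v(2) K] by (elim exE) (rule that)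
    moreover have "K \<subseteq> closure \<Omega>" using K T(3) by auto
    ultimately have "\<forall>x\<in>K. v0 x = a \<bullet> x + b" using eq by auto
    then show "\<exists>p. \<forall>x\<in>K. v0 x = fst p \<bullet> x + snd p" by (intro exI[of _ "(a, b)"]) simp
  qed
  from bchoice[OF this] obtain p where p: "\<forall>K\<in>T. \<forall>x\<in>K. v0 x = fst (p K) \<bullet> x + snd (p K)" ..
  have out: "v0 x = 0" if "x \<notin> \<Omega>" for x using that by (simp add: v0_def)
  have "\<exists>G. Lipschitz_gradient v0 G"
  proof (rule piecewise_affine_Lipschitz_gradient[where a="\<lambda>K. fst (p K)" and b="\<lambda>K. snd (p K)" and T=T and \<Omega>=\<Omega>])
    show "K \<in> T \<Longrightarrow> closed K" "K \<in> T \<Longrightarrow> convex K" for K using closed_simplex[OF T(2)] convex_simplex[OF T(2)] by auto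
    show "\<Omega> \<subseteq> \<Union>T" using T(3) closure_subset by auto
  qed (use T \<Omega> p out in auto)
  then obtain G where "Lipschitz_gradient v0 G" ..
  moreover have "\<forall>K\<in>T. \<exists>a b. \<forall>x\<in>K. v0 x = a \<bullet> x + b" using p by auto
  ultimately show ?thesis using w0 out by (intro exI[of _ v0] exI[of _ G]) simp
qed

lemma abs_L2_add: "sq_integrable f \<Longrightarrow> sq_integrable g \<Longrightarrow> abs_L2 f + abs_L2 g = abs_L2 (\<lambda>x. f x + g x)"
  by (intro plus_L2.abs_eq) (auto simp: L2_rel_def)

lemma abs_L2_scaleR: "sq_integrable f \<Longrightarrow> r *\<^sub>R abs_L2 f = abs_L2 (\<lambda>x. r *\<^sub>R f x)"
  by (intro scaleR_L2.abs_eq) (auto simp: L2_rel_def)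

lemma abs_L2_zero: "abs_L2 (\<lambda>x. 0) = 0"
  by (simp add: zero_L2_def)

lemma sq_integrable_sum:
  "finite I \<Longrightarrow> (\<And>i. i \<in> I \<Longrightarrow> sq_integrable (f i)) \<Longrightarrow> sq_integrable (\<lambda>x. \<Sum>i\<in>I. f i x)"
  by (induction I rule: finite_induct) (auto simp: sq_integrable_zero intro: sq_integrable_add)

lemma abs_L2_sum:
  "finite I \<Longrightarrow> (\<And>i. i \<in> I \<Longrightarrow> sq_integrable (f i)) \<Longrightarrow> abs_L2 (\<lambda>x. \<Sum>i\<in>I. f i x) = (\<Sum>i\<in>I. abs_L2 (f i))"
proof (induction I rule: finite_induct)
  case (insert i I)
  then show ?case using abs_L2_add[of "f i" "\<lambda>x. \<Sum>i\<in>I. f i x"] sq_integrable_sum[of I f] by simp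
qed (simp add: abs_L2_zero)

lemma L2_class_add:
  assumes "sq_integrable (\<lambda>x. indicator \<Omega> x *\<^sub>R f x)" "sq_integrable (\<lambda>x. indicator \<Omega> x *\<^sub>R g x)"
  shows "L2_class \<Omega> f + L2_class \<Omega> g = L2_class \<Omega> (\<lambda>x. f x + g x)"
  unfolding L2_class_def abs_L2_add[OF assms] by (simp add: scaleR_add_right)

lemma L2_class_scaleR:
  assumes "sq_integrable (\<lambda>x. indicator \<Omega> x *\<^sub>R f x)"
  shows "r *\<^sub>R L2_class \<Omega> f = L2_class \<Omega> (\<lambda>x. r *\<^sub>R f x)"
  unfolding L2_class_def abs_L2_scaleR[OF assms] by (simp add: mult.commute)

lemma subspace_fe_space:
  assumes \<Omega>: "open \<Omega>" and R: "\<Omega> \<subseteq> cball 0 R" and mesh: "triangular_mesh \<Omega> T"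
  shows "subspace (fe_space \<Omega> T)"
proof -
  have T: "\<Union>T = closure \<Omega>" using mesh by (auto simp: triangular_mesh_def)
  have mem: "L2_class \<Omega> v \<in> fe_space \<Omega> T"
    if "continuous_on UNIV v" "\<And>x. x \<notin> \<Omega> \<Longrightarrow> v x = 0" "\<forall>K\<in>T. \<exists>a b. \<forall>x\<in>K. v x = a \<bullet> x + b" for v
  proof -
    have "\<forall>x\<in>frontier \<Omega>. v x = 0" using that(2) \<Omega> by (auto simp: frontier_def interior_open)
    moreover have "continuous_on (closure \<Omega>) v" using that(1) by (rule continuous_on_subset) simp
    ultimately show ?thesis using that(3) unfolding fe_space_def by auto
  qed
  show ?thesis
  proof (rule subspaceI)
    have "L2_class \<Omega> (\<lambda>x. 0) \<in> fe_space \<Omega> T"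
      by (rule mem) (auto intro!: exI[of _ 0])
    then show "0 \<in> fe_space \<Omega> T" by (simp add: L2_class_def abs_L2_zero)
  next
    fix x y assume "x \<in> fe_space \<Omega> T" "y \<in> fe_space \<Omega> T"
    from fe_space_Lipschitz_gradient[OF \<Omega> mesh this(1)] fe_space_Lipschitz_gradient[OF \<Omega> mesh this(2)]
    obtain v G v' G' where v: "x = L2_class \<Omega> v" "Lipschitz_gradient v G" "\<forall>x. x \<notin> \<Omega> \<longrightarrow> v x = 0" "\<forall>K\<in>T. \<exists>a b. \<forall>x\<in>K. v x = a \<bullet> x + b"
      and v': "y = L2_class \<Omega> v'" "Lipschitz_gradient v' G'" "\<forall>x. x \<notin> \<Omega> \<longrightarrow> v' x = 0" "\<forall>K\<in>T. \<exists>a b. \<forall>x\<in>K. v' x = a \<bullet> x + b"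
      by (elim exE conjE)
    have "x + y = L2_class \<Omega> (\<lambda>x. v x + v' x)"
      unfolding v(1) v'(1)
      by (rule L2_class_add[OF Lipschitz_gradient_sq_integrable(1)[OF \<Omega> R v(2)] Lipschitz_gradient_sq_integrable(1)[OF \<Omega> R v'(2)]])
    also have "\<dots> \<in> fe_space \<Omega> T"
    proof (rule mem)
      show "continuous_on UNIV (\<lambda>x. v x + v' x)"
        by (intro continuous_on_add Lipschitz_gradientD(1)[OF v(2)] Lipschitz_gradientD(1)[OF v'(2)])
      show "\<forall>K\<in>T. \<exists>a b. \<forall>x\<in>K. v x + v' x = a \<bullet> x + b"
      proof
        fix K assume K: "K \<in> T"
        obtain a b where 1: "\<forall>x\<in>K. v x = a \<bullet> x + b" using bspec[OF v(4) K] by (elim exE) (rule that)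
        obtain a' b' where "\<forall>x\<in>K. v' x = a' \<bullet> x + b'" using bspec[OF v'(4) K] by (elim exE) (rule that)
        with 1 have "\<forall>x\<in>K. v x + v' x = (a + a') \<bullet> x + (b + b')" by (simp add: inner_add_left)
        then show "\<exists>a b. \<forall>x\<in>K. v x + v' x = a \<bullet> x + b" by blast
      qed
    qed (use v(3) v'(3) in simp)
    finally show "x + y \<in> fe_space \<Omega> T" .
  next
    fix x and c :: real assume "x \<in> fe_space \<Omega> T"
    from fe_space_Lipschitz_gradient[OF \<Omega> mesh this]
    obtain v G where v: "x = L2_class \<Omega> v" "Lipschitz_gradient v G" "\<forall>x. x \<notin> \<Omega> \<longrightarrow> v x = 0" "\<forall>K\<in>T. \<exists>a b. \<forall>x\<in>K. v x = a \<bullet> x + b"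
      by (elim exE conjE)
    have "c *\<^sub>R x = L2_class \<Omega> (\<lambda>x. c *\<^sub>R v x)"
      unfolding v(1) by (rule L2_class_scaleR[OF Lipschitz_gradient_sq_integrable(1)[OF \<Omega> R v(2)]])
    also have "\<dots> \<in> fe_space \<Omega> T"
    proof (rule mem)
      show "continuous_on UNIV (\<lambda>x. c *\<^sub>R v x)"
        by (intro continuous_intros Lipschitz_gradientD(1)[OF v(2)])
      show "\<forall>K\<in>T. \<exists>a b. \<forall>x\<in>K. c *\<^sub>R v x = a \<bullet> x + b"
      proof
        fix K assume K: "K \<in> T"
        obtain a b where "\<forall>x\<in>K. v x = a \<bullet> x + b" using bspec[OF v(4) K] by (elim exE) (rule that)
        then have "\<forall>x\<in>K. c *\<^sub>R v x = (c *\<^sub>R a) \<bullet> x + c * b" by (simp add: algebra_simps)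
        then show "\<exists>a b. \<forall>x\<in>K. c *\<^sub>R v x = a \<bullet> x + b" by blast
      qed
    qed (use v(3) in simp)
    finally show "c *\<^sub>R x \<in> fe_space \<Omega> T" .
  qed
qed

text \<open>The functions 1 and \<open>x \<bullet> i\<close>, restricted to the pieces of a disjoint decomposition of
\<open>\<Omega>\<close> into parts of triangles, span a finite-dimensional space of discontinuous functions that contains the
finite element space.\<close>

lemma fe_space_finite_span:
  assumes \<Omega>: "open \<Omega>" and R: "\<Omega> \<subseteq> cball 0 R" and mesh: "triangular_mesh \<Omega> T"
  shows "\<exists>B. finite B \<and> fe_space \<Omega> T \<subseteq> span B"
proof -
  have T: "finite T" "\<And>K. K \<in> T \<Longrightarrow> 2 simplex K" "\<Union>T = closure \<Omega>"
    using mesh by (auto simp: triangular_mesh_def triangulation_def)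
  obtain K :: "nat \<Rightarrow> plane set" where K: "bij_betw K {0..<card T} T"
    using ex_bij_betw_nat_finite[OF T(1)] ..
  define n where "n = card T"
  have KT: "K k \<in> T" if "k < n" for k using K that by (auto simp: bij_betw_def n_def)
  have TK: "\<exists>k<n. x \<in> K k" if "x \<in> \<Omega>" for x
  proof -
    have "x \<in> \<Union>T" using that T(3) closure_subset by auto
    then obtain S where S: "S \<in> T" "x \<in> S" by auto
    then have "S \<in> K ` {0..<card T}" using K by (simp add: bij_betw_def)
    then show ?thesis using S by (auto simp: n_def)
  qed
  \<comment> \<open>A point that belongs to several triangles is assigned to the first one, which makes the pieces disjoint.\<close>
  define D where "D k = \<Omega> \<inter> (K k - (\<Union>j<k. K j))" for k
  have Dm: "D k \<in> sets lebesgue" if "k < n" for k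
  proof -
    have "closed (K j)" if "j < n" for j using closed_simplex[OF T(2)[OF KT[OF that]]] .
    then have "K j \<in> sets lebesgue" if "j < n" for j using that by simp
    then show ?thesis using \<Omega> that unfolding D_def by (intro sets.Int sets.Diff sets.finite_UN) auto
  qed
  \<comment> \<open>The index \<open>(k, None)\<close> stands for the constant function 1 on the piece \<open>D k\<close>, and \<open>(k, Some i)\<close> for \<open>x \<bullet> i\<close> on it.\<close>
  define P where "P = {..<n} \<times> insert None (Some ` (Basis :: plane set))"
  define f where "f p x = indicator (D (fst p)) x * (case snd p of None \<Rightarrow> 1 | Some i \<Rightarrow> x \<bullet> i)" for p and x :: plane
  have Pf: "finite P" by (simp add: P_def)
  have sqf: "sq_integrable (f p)" if p: "p \<in> P" for p
  proof (rule sq_integrable_bounded)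
    have d: "D (fst p) \<in> sets lebesgue" using p Dm by (auto simp: P_def)
    have "(\<lambda>x::plane. case snd p of None \<Rightarrow> 1 | Some i \<Rightarrow> x \<bullet> i) \<in> borel_measurable lebesgue"
      by (cases "snd p") (auto intro!: measurable_completion)
    then show "f p \<in> borel_measurable lebesgue"
      unfolding f_def by (intro borel_measurable_times borel_measurable_indicator d)
    show "AE x in lebesgue. norm (f p x) \<le> 1 + \<bar>R\<bar>"
    proof (rule AE_I2)
      fix x
      have "norm x \<le> R" if "x \<in> D (fst p)" using that R by (auto simp: D_def)
      moreover have "\<bar>x \<bullet> i\<bar> \<le> norm x" if "snd p = Some i" for i
        using p that Basis_le_norm by (auto simp: P_def)
      ultimately show "norm (f p x) \<le> 1 + \<bar>R\<bar>"
        by (cases "x \<in> D (fst p)"; cases "snd p") (force simp: f_def)+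
    qed
    show "f p x = 0" if "x \<notin> cball 0 R" for x using that R by (auto simp: f_def D_def indicator_def)
  qed
  have "fe_space \<Omega> T \<subseteq> span ((\<lambda>p. abs_L2 (f p)) ` P)"
  proof
    fix w assume "w \<in> fe_space \<Omega> T"
    from fe_space_Lipschitz_gradient[OF \<Omega> mesh this]
    obtain v G where v: "w = L2_class \<Omega> v" "Lipschitz_gradient v G" "\<forall>x. x \<notin> \<Omega> \<longrightarrow> v x = 0" "\<forall>K\<in>T. \<exists>a b. \<forall>x\<in>K. v x = a \<bullet> x + b"
      by (elim exE conjE)
    have "\<forall>K\<in>T. \<exists>p. \<forall>x\<in>K. v x = fst p \<bullet> x + snd p"
    proof
      fix K assume K: "K \<in> T"
      obtain a b where "\<forall>x\<in>K. v x = a \<bullet> x + b" using bspec[OF v(4) K] by (elim exE) (rule that)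
      then show "\<exists>p. \<forall>x\<in>K. v x = fst p \<bullet> x + snd p" by (intro exI[of _ "(a, b)"]) simp
    qed
    from bchoice[OF this] obtain q where q: "\<forall>K\<in>T. \<forall>x\<in>K. v x = fst (q K) \<bullet> x + snd (q K)" ..
    define c where "c p = (case snd p of None \<Rightarrow> snd (q (K (fst p))) | Some i \<Rightarrow> fst (q (K (fst p))) \<bullet> i)" for p
    have ins: "(\<Sum>o'\<in>insert None (Some ` (Basis::plane set)). g o') = g None + (\<Sum>i\<in>Basis. g (Some i))" for g :: "plane option \<Rightarrow> real"
      by (subst sum.insert) (auto simp: sum.reindex)
    have "indicator \<Omega> x *\<^sub>R v x = (\<Sum>p\<in>P. c p *\<^sub>R f p x)" for x
    proof -
      have "(\<Sum>p\<in>P. c p *\<^sub>R f p x) = (\<Sum>k<n. \<Sum>o'\<in>insert None (Some ` (Basis::plane set)). c (k, o') * f (k, o') x)"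
        unfolding P_def real_scaleR_def sum.cartesian_product by (simp only: case_prod_unfold prod.collapse)
      also have "\<dots> = (\<Sum>k<n. indicator (D k) x * v x)"
      proof (intro sum.cong refl)
        fix k assume k: "k \<in> {..<n}"
        have "(\<Sum>o'\<in>insert None (Some ` (Basis::plane set)). c (k, o') * f (k, o') x)
            = indicator (D k) x * (snd (q (K k)) + (\<Sum>i\<in>Basis. (fst (q (K k)) \<bullet> i) * (x \<bullet> i)))"
          unfolding ins by (simp add: c_def f_def sum_distrib_left distrib_left mult_ac)
        also have "(\<Sum>i\<in>Basis. (fst (q (K k)) \<bullet> i) * (x \<bullet> i)) = fst (q (K k)) \<bullet> x" by (rule euclidean_inner[symmetric])
        also have "indicator (D k) x * (snd (q (K k)) + fst (q (K k)) \<bullet> x) = indicator (D k) x * v x"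
          using q KT[of k] k by (cases "x \<in> D k") (auto simp: D_def)
        finally show "(\<Sum>o'\<in>insert None (Some ` (Basis::plane set)). c (k, o') * f (k, o') x) = indicator (D k) x * v x" .
      qed
      also have "\<dots> = indicator \<Omega> x * v x"
      proof (cases "x \<in> \<Omega>")
        case True
        define k where "k = (LEAST k. x \<in> K k)"
        obtain k' where k': "k' < n" "x \<in> K k'" using TK[OF True] by auto
        have k: "x \<in> K k" "k < n" unfolding k_def using LeastI[of "\<lambda>k. x \<in> K k", OF k'(2)] Least_le[of "\<lambda>k. x \<in> K k", OF k'(2)] k'(1) by auto
        have "x \<in> D j \<longleftrightarrow> j = k" for j
        proof
          assume "x \<in> D j"
          then have "x \<in> K j" "\<And>i. i < j \<Longrightarrow> x \<notin> K i" by (auto simp: D_def)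
          then show "j = k" using k(1) Least_le[of "\<lambda>k. x \<in> K k" j] unfolding k_def[symmetric]
            by (metis nat_less_le not_less_iff_gr_or_eq)
        next
          assume "j = k"
          then show "x \<in> D j" using True k(1) not_less_Least[of _ "\<lambda>k. x \<in> K k"] unfolding k_def[symmetric] by (auto simp: D_def)
        qed
        then have "(\<Sum>k<n. indicator (D k) x * v x) = (\<Sum>j<n. if j = k then v x else 0)"
          by (intro sum.cong) (auto simp: indicator_def)
        then show ?thesis using k True by simp
      next
        case False
        then show ?thesis by (simp add: D_def)
      qed
      finally show ?thesis by simp
    qed
    then have "w = abs_L2 (\<lambda>x. \<Sum>p\<in>P. c p *\<^sub>R f p x)" unfolding v(1) L2_class_def by simp
    also have "\<dots> = (\<Sum>p\<in>P. abs_L2 (\<lambda>x. c p *\<^sub>R f p x))"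
      using sqf by (intro abs_L2_sum[OF Pf] sq_integrable_scaleR) auto
    also have "\<dots> = (\<Sum>p\<in>P. c p *\<^sub>R abs_L2 (f p))"
      using sqf by (intro sum.cong refl abs_L2_scaleR[symmetric]) auto
    also have "\<dots> \<in> span ((\<lambda>p. abs_L2 (f p)) ` P)"
      by (intro span_sum span_scale span_base) auto
    finally show "w \<in> span ((\<lambda>p. abs_L2 (f p)) ` P)" .
  qed
  then show ?thesis using Pf by (intro exI[of _ "(\<lambda>p. abs_L2 (f p)) ` P"]) simp
qed

section \<open>Eigenbases of forms on finite-dimensional spaces\<close>

text \<open>The unit sphere of a finite-dimensional subspace of an arbitrary inner product space is a closed subset of such a box, hence
compact.\<close>

lemma compact_coefficient_box:
  fixes C :: "'a::real_normed_vector set"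
  assumes "finite C"
  shows "compact {\<Sum>c\<in>C. a c *\<^sub>R c | a. \<forall>c\<in>C. a c \<in> {-1..1::real}}"
  using assms
proof (induction C rule: finite_induct)
  case empty
  have "{\<Sum>c\<in>{}. a c *\<^sub>R c | a. \<forall>c\<in>{}. a c \<in> {-1..1::real}} = {0::'a}" by auto
  then show ?case by simp
next
  case (insert d C)
  let ?S = "{\<Sum>c\<in>C. a c *\<^sub>R c | a. \<forall>c\<in>C. a c \<in> {-1..1::real}}"
  have "{\<Sum>c\<in>insert d C. a c *\<^sub>R c | a. \<forall>c\<in>insert d C. a c \<in> {-1..1::real}}
      = (\<lambda>(r, x). r *\<^sub>R d + x) ` ({-1..1} \<times> ?S)" (is "?L = ?R")
  proof
    show "?L \<subseteq> ?R"
    proof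
      fix x assume "x \<in> ?L"
      then obtain a where a: "x = (\<Sum>c\<in>insert d C. a c *\<^sub>R c)" "\<forall>c\<in>insert d C. a c \<in> {-1..1::real}" by blast
      then have "x = (\<lambda>(r, x). r *\<^sub>R d + x) (a d, \<Sum>c\<in>C. a c *\<^sub>R c)" using insert by simp
      moreover have "(a d, \<Sum>c\<in>C. a c *\<^sub>R c) \<in> {-1..1} \<times> ?S" using a(2) by blast
      ultimately show "x \<in> ?R" by (rule image_eqI)
    qed
    show "?R \<subseteq> ?L"
    proof
      fix x assume "x \<in> ?R"
      then obtain r a where ra: "x = r *\<^sub>R d + (\<Sum>c\<in>C. a c *\<^sub>R c)" "r \<in> {-1..1}" "\<forall>c\<in>C. a c \<in> {-1..1::real}" by auto
      have "(\<Sum>c\<in>C. (a(d := r)) c *\<^sub>R c) = (\<Sum>c\<in>C. a c *\<^sub>R c)"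
        using insert by (intro sum.cong) auto
      then have "x = (\<Sum>c\<in>insert d C. (a(d := r)) c *\<^sub>R c)" using ra insert by simp
      moreover have "\<forall>c\<in>insert d C. (a(d := r)) c \<in> {-1..1}" using ra by auto
      ultimately show "x \<in> ?L" by blast
    qed
  qed
  moreover have "compact ((\<lambda>(r, x). r *\<^sub>R d + x) ` ({-1..1::real} \<times> ?S))"
    using insert by (intro compact_continuous_image compact_Times)
      (auto simp: case_prod_unfold intro!: continuous_intros)
  ultimately show ?case by simp
qed

text \<open>The form is only required to be bilinear on \<open>V\<close>, because the elliptic form is defined through weak gradients and
is additive only where these exist. The finite set \<open>B\<close> expresses that \<open>V\<close> has finite dimension.\<close>

locale symmetric_form =
  fixes V :: "'a::real_inner set" and b :: "'a \<Rightarrow> 'a \<Rightarrow> real" and B :: "'a set"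
  assumes V: "subspace V" and VB: "V \<subseteq> span B" and B: "finite B"
    and add: "\<And>x y z. x \<in> V \<Longrightarrow> y \<in> V \<Longrightarrow> z \<in> V \<Longrightarrow> b (x + y) z = b x z + b y z"
    and scale: "\<And>r x z. x \<in> V \<Longrightarrow> z \<in> V \<Longrightarrow> b (r *\<^sub>R x) z = r * b x z"
    and sym: "\<And>x y. x \<in> V \<Longrightarrow> y \<in> V \<Longrightarrow> b x y = b y x"
    and pos: "\<And>x. x \<in> V \<Longrightarrow> x \<noteq> 0 \<Longrightarrow> b x x > 0"
begin

lemma zero_left: "z \<in> V \<Longrightarrow> b 0 z = 0"
  using scale[of 0 z 0] subspace_0[OF V] by simp

lemma add_right: "x \<in> V \<Longrightarrow> y \<in> V \<Longrightarrow> z \<in> V \<Longrightarrow> b z (x + y) = b z x + b z y"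
  using add[of x y z] sym[of z "x + y"] sym[of z x] sym[of z y] subspace_add[OF V, of x y] by simp

lemma scale_right: "x \<in> V \<Longrightarrow> z \<in> V \<Longrightarrow> b z (r *\<^sub>R x) = r * b z x"
  using scale[of x z r] sym[of z "r *\<^sub>R x"] sym[of z x] subspace_scale[OF V, of x r] by simp

lemma sum_left:
  assumes "finite I" "\<And>i. i \<in> I \<Longrightarrow> x i \<in> V" "z \<in> V"
  shows "b (\<Sum>i\<in>I. r i *\<^sub>R x i) z = (\<Sum>i\<in>I. r i * b (x i) z)"
  using assms
proof (induction I rule: finite_induct)
  case (insert i I)
  have "(\<Sum>i\<in>I. r i *\<^sub>R x i) \<in> V" using insert by (intro subspace_sum[OF V] subspace_scale[OF V]) auto
  moreover have "r i *\<^sub>R x i \<in> V" using insert by (intro subspace_scale[OF V]) auto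
  ultimately show ?case using insert by (simp add: add scale)
qed (simp add: zero_left)

lemma sum_right:
  assumes "finite I" "\<And>i. i \<in> I \<Longrightarrow> x i \<in> V" "z \<in> V"
  shows "b z (\<Sum>i\<in>I. r i *\<^sub>R x i) = (\<Sum>i\<in>I. r i * b z (x i))"
proof -
  have "(\<Sum>i\<in>I. r i *\<^sub>R x i) \<in> V" using assms by (intro subspace_sum[OF V] subspace_scale[OF V]) auto
  then have "b z (\<Sum>i\<in>I. r i *\<^sub>R x i) = b (\<Sum>i\<in>I. r i *\<^sub>R x i) z" using assms sym by blast
  also have "\<dots> = (\<Sum>i\<in>I. r i * b (x i) z)" by (rule sum_left[OF assms])
  also have "\<dots> = (\<Sum>i\<in>I. r i * b z (x i))" using assms sym by (intro sum.cong) auto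
  finally show ?thesis .
qed

text \<open>A minimiser \<open>\<psi>\<close> of the Rayleigh quotient on the unit sphere of \<open>W\<close> exists by compactness, and
the first variation of \<open>b u u - \<Lambda> * (u \<bullet> u)\<close> vanishes at it. Here \<open>W\<close> is a subspace
of \<open>V\<close> so that the lemma also applies to the orthogonal complement of eigenvectors already found.\<close>

lemma eigenvector_exists:
  assumes W: "subspace W" "W \<subseteq> V" and w: "w \<in> W" "w \<noteq> 0"
  shows "\<exists>\<psi>\<in>W. norm \<psi> = 1 \<and> (\<forall>v\<in>W. b \<psi> v = b \<psi> \<psi> * (\<psi> \<bullet> v))"
proof -
  obtain B' where B': "B' \<subseteq> W" "independent B'" "W \<subseteq> span B'" by (rule maximal_independent_subset[of W])
  have "finite B'"
    using independent_span_bound[OF B B'(2)] B'(1) W(2) VB by (meson order_trans)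
  then obtain C0 where C0: "finite C0" "span C0 = span B'" "pairwise orthogonal C0"
    using basis_orthogonal[of B'] by blast
  have spW: "span B' = W" using B' W(1) by (intro subset_antisym span_minimal) auto
  define C where "C = (\<lambda>c. c /\<^sub>R norm c) ` (C0 - {0})"
  have Cf: "finite C" using C0 by (simp add: C_def)
  have C1: "norm c = 1" if "c \<in> C" for c
  proof -
    obtain d where "c = d /\<^sub>R norm d" "d \<noteq> 0" using \<open>c \<in> C\<close> by (auto simp: C_def)
    then show ?thesis by simp
  qed
  have Co: "pairwise orthogonal C"
    using C0(3) unfolding C_def pairwise_def orthogonal_def by (auto simp: inverse_eq_divide)
  have Csp: "span C = W"
  proof (rule subset_antisym)
    have "C \<subseteq> span C0" unfolding C_def using span_scale[OF span_base] by blast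
    then show "span C \<subseteq> W" using C0(2) spW span_minimal[OF _ subspace_span] by blast
    have "C0 \<subseteq> span C"
    proof
      fix c assume c: "c \<in> C0"
      show "c \<in> span C"
      proof (cases "c = 0")
        case True then show ?thesis by (simp add: span_zero)
      next
        case False
        then have "c /\<^sub>R norm c \<in> span C" using c by (intro span_base) (auto simp: C_def)
        then have "norm c *\<^sub>R (c /\<^sub>R norm c) \<in> span C" by (rule span_scale)
        then show ?thesis using False by simp
      qed
    qed
    then have "span C0 \<subseteq> span C" by (rule span_minimal[OF _ subspace_span])
    then show "W \<subseteq> span C" using C0(2) spW by simp
  qed
  have CW: "C \<subseteq> W" using Csp span_superset by blast
  have expand: "(\<Sum>c\<in>C. (v \<bullet> c) *\<^sub>R c) = v" if "v \<in> W" for v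
    using orthonormal_basis_expand[OF Co C1 _ Cf] that Csp by blast
  define S where "S = {\<Sum>c\<in>C. a c *\<^sub>R c | a. \<forall>c\<in>C. a c \<in> {-1..1::real}} \<inter> {v. norm v = 1}"
  have "compact S" unfolding S_def
    by (intro compact_Int_closed compact_coefficient_box Cf closed_Collect_eq continuous_intros)
  have S_iff: "v \<in> S \<longleftrightarrow> v \<in> W \<and> norm v = 1" for v
  proof
    assume "v \<in> S"
    then obtain a where "v = (\<Sum>c\<in>C. a c *\<^sub>R c)" "norm v = 1" unfolding S_def by blast
    moreover have "(\<Sum>c\<in>C. a c *\<^sub>R c) \<in> W" using CW by (intro subspace_sum[OF W(1)] subspace_scale[OF W(1)]) auto
    ultimately show "v \<in> W \<and> norm v = 1" by simp
  next
    assume v: "v \<in> W \<and> norm v = 1"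
    have "v = (\<Sum>c\<in>C. (v \<bullet> c) *\<^sub>R c)" using expand v by simp
    moreover have "\<forall>c\<in>C. v \<bullet> c \<in> {-1..1}"
    proof
      fix c assume "c \<in> C"
      then have "\<bar>v \<bullet> c\<bar> \<le> 1" using Cauchy_Schwarz_ineq2[of v c] C1 v by simp
      then show "v \<bullet> c \<in> {-1..1}" by auto
    qed
    ultimately have "v \<in> {\<Sum>c\<in>C. a c *\<^sub>R c | a. \<forall>c\<in>C. a c \<in> {-1..1::real}}"
      by (intro CollectI exI[of _ "\<lambda>c. v \<bullet> c"] conjI)
    then show "v \<in> S" using v by (simp add: S_def)
  qed
  \<comment> \<open>In coordinates the quadratic form of \<open>b\<close> is visibly continuous, as \<open>b\<close> itself is not known to be.\<close>
  define q where "q v = (\<Sum>c\<in>C. (v \<bullet> c) * (\<Sum>d\<in>C. (v \<bullet> d) * b c d))" for v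
  have q: "q v = b v v" if "v \<in> W" for v
  proof -
    have vV: "v \<in> V" and CV: "c \<in> C \<Longrightarrow> c \<in> V" for c using that CW W(2) by auto
    have "b v v = b (\<Sum>c\<in>C. (v \<bullet> c) *\<^sub>R c) v" using expand[OF that] by simp
    also have "\<dots> = (\<Sum>c\<in>C. (v \<bullet> c) * b c v)" by (rule sum_left[OF Cf CV vV])
    also have "\<dots> = (\<Sum>c\<in>C. (v \<bullet> c) * (\<Sum>d\<in>C. (v \<bullet> d) * b c d))"
    proof (intro sum.cong refl)
      fix c assume "c \<in> C"
      then have "b c (\<Sum>d\<in>C. (v \<bullet> d) *\<^sub>R d) = (\<Sum>d\<in>C. (v \<bullet> d) * b c d)" by (intro sum_right Cf CV)
      then show "(v \<bullet> c) * b c v = (v \<bullet> c) * (\<Sum>d\<in>C. (v \<bullet> d) * b c d)" using expand[OF that] by simp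
    qed
    finally show ?thesis unfolding q_def by simp
  qed
  have "continuous_on S q" unfolding q_def by (intro continuous_intros)
  moreover have "S \<noteq> {}"
  proof -
    have "w /\<^sub>R norm w \<in> S" unfolding S_iff using w subspace_scale[OF W(1)] by simp
    then show ?thesis by blast
  qed
  ultimately obtain \<psi> where \<psi>: "\<psi> \<in> S" "\<forall>y\<in>S. q \<psi> \<le> q y"
    using continuous_attains_inf[OF \<open>compact S\<close>] by blast
  define \<Lambda> where "\<Lambda> = b \<psi> \<psi>"
  have \<psi>W: "\<psi> \<in> W" "norm \<psi> = 1" using \<psi>(1) S_iff by auto
  have WV: "v \<in> W \<Longrightarrow> v \<in> V" for v using W(2) by blast
  have low: "\<Lambda> * (u \<bullet> u) \<le> b u u" if u: "u \<in> W" for u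
  proof (cases "u = 0")
    case True then show ?thesis using zero_left[of 0] subspace_0[OF V] by simp
  next
    case False
    then have nu: "norm u > 0" by simp
    have u': "u /\<^sub>R norm u \<in> W" using u subspace_scale[OF W(1)] by blast
    then have "u /\<^sub>R norm u \<in> S" unfolding S_iff using nu by simp
    then have "\<Lambda> \<le> b (u /\<^sub>R norm u) (u /\<^sub>R norm u)" using \<psi>(2) q[OF \<psi>W(1)] q[OF u'] by (auto simp: \<Lambda>_def)
    also have "\<dots> = b u u / (norm u)\<^sup>2"
      using WV[OF u] WV[OF u'] by (simp add: scale scale_right subspace_scale[OF V] power2_eq_square divide_inverse)
    finally show ?thesis using nu by (simp add: power2_norm_eq_inner[symmetric] field_simps)
  qed
  have "b \<psi> v = \<Lambda> * (\<psi> \<bullet> v)" if v: "v \<in> W" for v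
  proof (rule ccontr)
    define X where "X = b \<psi> v - \<Lambda> * (\<psi> \<bullet> v)"
    define Y where "Y = b v v - \<Lambda> * (v \<bullet> v)"
    assume "b \<psi> v \<noteq> \<Lambda> * (\<psi> \<bullet> v)"
    then have X: "X \<noteq> 0" by (simp add: X_def)
    \<comment> \<open>A step against the first variation \<open>X\<close> that is short enough to dominate the quadratic term \<open>t\<^sup>2 * Y\<close>.\<close>
    define t where "t = - X / (\<bar>Y\<bar> + 1)"
    have tv: "t *\<^sub>R v \<in> W" using v subspace_scale[OF W(1)] by blast
    have "\<psi> + t *\<^sub>R v \<in> W" using subspace_add[OF W(1) \<psi>W(1) tv] .
    from low[OF this] have ge: "0 \<le> b (\<psi> + t *\<^sub>R v) (\<psi> + t *\<^sub>R v) - \<Lambda> * ((\<psi> + t *\<^sub>R v) \<bullet> (\<psi> + t *\<^sub>R v))" by simp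
    have VV: "\<psi> \<in> V" "v \<in> V" "t *\<^sub>R v \<in> V" "\<psi> + t *\<^sub>R v \<in> V"
      using WV \<psi>W(1) v tv \<open>\<psi> + t *\<^sub>R v \<in> W\<close> by auto
    have "b (\<psi> + t *\<^sub>R v) (\<psi> + t *\<^sub>R v) = b \<psi> \<psi> + 2 * t * b \<psi> v + t\<^sup>2 * b v v"
      using VV by (simp add: add add_right scale scale_right sym[of v \<psi>] power2_eq_square algebra_simps)
    moreover have "(\<psi> + t *\<^sub>R v) \<bullet> (\<psi> + t *\<^sub>R v) = 1 + 2 * t * (\<psi> \<bullet> v) + t\<^sup>2 * (v \<bullet> v)"
      using \<psi>W(2) by (simp add: inner_add_left inner_add_right inner_commute power2_eq_square norm_eq_1)
    ultimately have ge2: "0 \<le> 2 * t * X + t\<^sup>2 * Y"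
      using ge by (simp add: X_def Y_def \<Lambda>_def algebra_simps)
    define D where "D = \<bar>Y\<bar> + 1"
    have D: "D > 0" "Y \<le> D" by (auto simp: D_def)
    have "2 * t * X + t\<^sup>2 * Y \<le> 2 * t * X + t\<^sup>2 * D" using D by (intro add_left_mono mult_left_mono) auto
    also have "\<dots> = - (X\<^sup>2 / D)"
      using D(1) unfolding t_def D_def[symmetric] by (simp add: power2_eq_square field_simps)
    also have "\<dots> < 0" using X D by simp
    finally show False using ge2 by simp
  qed
  then show ?thesis using \<psi>W unfolding \<Lambda>_def by blast
qed

definition eigensystem :: "nat \<Rightarrow> (nat \<Rightarrow> 'a) \<Rightarrow> (nat \<Rightarrow> real) \<Rightarrow> bool" where
  "eigensystem N \<psi> \<Lambda> \<longleftrightarrow> (\<forall>i<N. \<psi> i \<in> V \<and> \<Lambda> i > 0) \<and> (\<forall>i<N. \<forall>j<N. \<psi> i \<bullet> \<psi> j = (if i = j then 1 else 0)) \<and>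
     (\<forall>i<N. \<forall>v\<in>V. b (\<psi> i) v = \<Lambda> i * (\<psi> i \<bullet> v))"

lemma eigensystem_size: assumes "eigensystem N \<psi> \<Lambda>" shows "N \<le> card B"
proof -
  have on: "\<psi> i \<bullet> \<psi> j = (if i = j then 1 else 0)" if "i < N" "j < N" for i j
    using assms that by (simp add: eigensystem_def)
  have inj: "inj_on \<psi> {..<N}"
  proof (rule inj_onI)
    fix i j assume ij: "i \<in> {..<N}" "j \<in> {..<N}" "\<psi> i = \<psi> j"
    then have "\<psi> i \<bullet> \<psi> j = 1" using on[of j j] by simp
    then show "i = j" using on[of i j] ij by (simp split: if_splits)
  qed
  have "independent (\<psi> ` {..<N})"
  proof (rule pairwise_orthogonal_independent)
    show "pairwise orthogonal (\<psi> ` {..<N})" using on by (auto simp: pairwise_def orthogonal_def)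
    show "0 \<notin> \<psi> ` {..<N}"
    proof
      assume "0 \<in> \<psi> ` {..<N}"
      then obtain i where "i < N" "\<psi> i = 0" by auto
      then show False using on[of i i] by simp
    qed
  qed
  moreover have "\<psi> ` {..<N} \<subseteq> span B" using assms VB by (auto simp: eigensystem_def)
  ultimately have "card (\<psi> ` {..<N}) \<le> card B" using independent_span_bound[OF B] by blast
  then show ?thesis using card_image[OF inj] by simp
qed

text \<open>Take an orthonormal system of eigenvectors of maximal length, which exists because independent vectors in \<open>V\<close>
are at most \<open>card B\<close> many. If it did not span \<open>V\<close>, its orthogonal complement would contain a
further eigenvector.\<close>

lemma eigenbasis_exists:
  "\<exists>N \<psi> \<Lambda>. eigensystem N \<psi> \<Lambda> \<and> (\<forall>v\<in>V. v = (\<Sum>i<N. (v \<bullet> \<psi> i) *\<^sub>R \<psi> i))"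
proof -
  define P where "P N \<longleftrightarrow> (\<exists>\<psi> \<Lambda>. eigensystem N \<psi> \<Lambda>)" for N
  have P0: "P 0" by (simp add: P_def eigensystem_def)
  have Pb: "N \<le> card B" if "P N" for N using that eigensystem_size unfolding P_def by blast
  define N where "N = (GREATEST n. P n)"
  have "P N" unfolding N_def by (rule GreatestI_nat[where b="card B"]) (use P0 Pb in auto)
  then obtain \<psi> \<Lambda> where es: "eigensystem N \<psi> \<Lambda>" unfolding P_def by blast
  have notS: "\<not> P (Suc N)"
  proof
    assume "P (Suc N)"
    then have "Suc N \<le> N" unfolding N_def by (rule Greatest_le_nat[where b="card B"]) (rule Pb)
    then show False by simp
  qed
  have \<psi>V: "\<psi> i \<in> V" and \<Lambda>0: "\<Lambda> i > 0" if "i < N" for i using es that by (auto simp: eigensystem_def)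
  have on: "\<psi> i \<bullet> \<psi> j = (if i = j then 1 else 0)" if "i < N" "j < N" for i j
    using es that by (simp add: eigensystem_def)
  have ei: "b (\<psi> i) v = \<Lambda> i * (\<psi> i \<bullet> v)" if "i < N" "v \<in> V" for i v using es that by (simp add: eigensystem_def)
  define pr where "pr v = (\<Sum>i<N. (v \<bullet> \<psi> i) *\<^sub>R \<psi> i)" for v
  have prV: "pr v \<in> V" for v unfolding pr_def by (intro subspace_sum[OF V] subspace_scale[OF V] \<psi>V) auto
  have pr\<psi>: "pr v \<bullet> \<psi> i = v \<bullet> \<psi> i" if "i < N" for v i
  proof -
    have "pr v \<bullet> \<psi> i = (\<Sum>j<N. (v \<bullet> \<psi> j) * (\<psi> j \<bullet> \<psi> i))" by (simp add: pr_def inner_sum_left)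
    also have "\<dots> = (\<Sum>j<N. if j = i then v \<bullet> \<psi> i else 0)" using that on by (intro sum.cong) auto
    finally show ?thesis using that by simp
  qed
  define W where "W = {v \<in> V. \<forall>i<N. v \<bullet> \<psi> i = 0}"
  have W: "subspace W" "W \<subseteq> V"
    unfolding W_def using V by (auto simp: subspace_def inner_add_left)
  have res: "v - pr v \<in> W" if "v \<in> V" for v
    using that prV[of v] pr\<psi>[of _ v] subspace_diff[OF V] by (auto simp: W_def inner_diff_left)
  have "v = pr v" if v: "v \<in> V" for v
  proof (rule ccontr)
    assume "v \<noteq> pr v"
    then obtain p where p: "p \<in> W" "norm p = 1" "\<forall>u\<in>W. b p u = b p p * (p \<bullet> u)"
      using eigenvector_exists[OF W res[OF v]] by auto
    have pV: "p \<in> V" using p W by blast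
    have p\<psi>: "p \<bullet> \<psi> i = 0" if "i < N" for i using p(1) that by (simp add: W_def)
    have bp\<psi>: "b p (\<psi> i) = 0" if "i < N" for i
      using sym[OF pV \<psi>V[OF that]] ei[OF that pV] p\<psi>[OF that] by (simp add: inner_commute)
    have bp: "b p u = b p p * (p \<bullet> u)" if u: "u \<in> V" for u
    proof -
      have "b p (pr u) = (\<Sum>i<N. (u \<bullet> \<psi> i) * b p (\<psi> i))" unfolding pr_def by (rule sum_right) (use \<psi>V pV in auto)
      then have "b p (pr u) = 0" using bp\<psi> by simp
      moreover have "p \<bullet> pr u = 0" using p\<psi> by (simp add: pr_def inner_sum_right)
      moreover have "b p (pr u + (u - pr u)) = b p (pr u) + b p (u - pr u)"
        using prV[of u] res[OF u] W(2) pV by (intro add_right) auto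
      moreover have "b p (u - pr u) = b p p * (p \<bullet> (u - pr u))" using p(3) res[OF u] by blast
      ultimately show ?thesis by (simp add: inner_diff_right)
    qed
    have "p \<noteq> 0" using p(2) by auto
    have "eigensystem (Suc N) (\<psi>(N := p)) (\<Lambda>(N := b p p))"
      unfolding eigensystem_def
    proof (intro conjI allI impI ballI)
      fix i j assume "i < Suc N" "j < Suc N"
      then show "(\<psi>(N := p)) i \<bullet> (\<psi>(N := p)) j = (if i = j then 1 else 0)"
        using on[of i j] p\<psi>[of i] p\<psi>[of j] p(2) by (auto simp: less_Suc_eq inner_commute norm_eq_1)
    next
      fix i assume i: "i < Suc N"
      show "(\<psi>(N := p)) i \<in> V" using i \<psi>V pV by (auto simp: less_Suc_eq)
      show "0 < (\<Lambda>(N := b p p)) i" using i \<Lambda>0 pos[OF pV \<open>p \<noteq> 0\<close>] by (auto simp: less_Suc_eq)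
      fix u assume "u \<in> V"
      then show "b ((\<psi>(N := p)) i) u = (\<Lambda>(N := b p p)) i * ((\<psi>(N := p)) i \<bullet> u)"
        using i ei bp by (auto simp: less_Suc_eq)
    qed
    then have "P (Suc N)" unfolding P_def by blast
    then show False using notS by blast
  qed
  then show ?thesis using es unfolding pr_def by blast
qed

end

section \<open>The elliptic bilinear form\<close>

lemma matrix_vector_mult_norm_le:
  fixes M :: "real^'n^'m"
  shows "norm (M *v y) \<le> (real CARD('m) * norm M) * norm y"
proof -
  have "norm (M *v y) \<le> (\<Sum>i\<in>UNIV. \<bar>(M *v y) $ i\<bar>)" by (rule norm_le_l1_cart)
  also have "\<dots> \<le> (\<Sum>i\<in>(UNIV::'m set). norm M * norm y)"
  proof (rule sum_mono)
    fix i
    have "(M *v y) $ i = M $ i \<bullet> y" by (simp add: matrix_vector_mult_def inner_vec_def)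
    then have "\<bar>(M *v y) $ i\<bar> \<le> norm (M $ i) * norm y" using Cauchy_Schwarz_ineq2[of "M $ i" y] by simp
    also have "\<dots> \<le> norm M * norm y" by (intro mult_right_mono Finite_Cartesian_Product.norm_nth_le) auto
    finally show "\<bar>(M *v y) $ i\<bar> \<le> norm M * norm y" .
  qed
  finally show ?thesis by (simp add: mult.assoc)
qed

lemma continuous_on_matrix_vector_mult: "continuous_on UNIV (\<lambda>p :: (real^'n^'m) \<times> (real^'n). fst p *v snd p)"
  unfolding matrix_vector_mult_def by (intro continuous_intros)

lemma measurable_lebesgue_on: "f \<in> borel_measurable lebesgue \<Longrightarrow> f \<in> borel_measurable (lebesgue_on S)"
  by (rule measurable_restrict_space1)

locale elliptic_problem =
  fixes \<Omega> :: "plane set" and A :: "plane \<Rightarrow> real^2^2" and c :: "plane \<Rightarrow> real"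
  assumes \<Omega>: "open \<Omega>" "bounded \<Omega>" and coeff: "elliptic_coefficients \<Omega> A c"
begin

lemma \<Omega>_meas: "\<Omega> \<in> sets lebesgue" using \<Omega> by simp

lemma AE_on: "AE x in lebesgue. P x \<Longrightarrow> AE x in lebesgue_on \<Omega>. P x"
  using \<Omega>_meas by (subst AE_restrict_space_iff) (auto elim: eventually_mono)

lemma integrable_on_\<Omega>:
  fixes f :: "plane \<Rightarrow> real"
  assumes "integrable lebesgue f" shows "integrable (lebesgue_on \<Omega>) f"
  using integrable_mult_indicator[OF \<Omega>_meas assms] \<Omega>_meas by (subst integrable_restrict_space) auto

lemma A_bound: "\<exists>M\<ge>0. \<forall>x\<in>\<Omega>. norm (A x) \<le> M" and A_meas: "A \<in> borel_measurable (lebesgue_on \<Omega>)"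
proof -
  obtain U where U: "open U" "closure \<Omega> \<subseteq> U" "smooth_on U A" using coeff unfolding elliptic_coefficients_def by blast
  have "Ck_on 0 U A" using U(3) unfolding smooth_on_def by blast
  then have cU: "continuous_on U A" by simp
  have "compact (closure \<Omega>)" using \<Omega>(2) by simp
  then have "bounded (A ` closure \<Omega>)"
    by (intro compact_imp_bounded compact_continuous_image continuous_on_subset[OF cU U(2)])
  then obtain M where M: "\<forall>x\<in>closure \<Omega>. norm (A x) \<le> M" unfolding bounded_iff by auto
  have "norm (A x) \<le> \<bar>M\<bar>" if "x \<in> \<Omega>" for x
    using M closure_subset[of \<Omega>] that by (auto intro: order_trans[OF _ abs_ge_self])
  then show "\<exists>M\<ge>0. \<forall>x\<in>\<Omega>. norm (A x) \<le> M" by (intro exI[of _ "\<bar>M\<bar>"]) simp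
  have "continuous_on \<Omega> A" by (rule continuous_on_subset[OF cU]) (use U(2) closure_subset in auto)
  then show "A \<in> borel_measurable (lebesgue_on \<Omega>)"
    by (rule continuous_imp_measurable_on_sets_lebesgue) (rule \<Omega>_meas)
qed

lemma c_meas: "c \<in> borel_measurable (lebesgue_on \<Omega>)"
  and c_bound: "\<exists>M. AE x in lebesgue_on \<Omega>. \<bar>c x\<bar> \<le> M"
  and c_nonneg: "AE x in lebesgue_on \<Omega>. 0 \<le> c x"
proof -
  show "c \<in> borel_measurable (lebesgue_on \<Omega>)" and n: "AE x in lebesgue_on \<Omega>. 0 \<le> c x"
    using coeff unfolding elliptic_coefficients_def by simp_all
  obtain M where M: "AE x in lebesgue_on \<Omega>. c x \<le> M" using coeff unfolding elliptic_coefficients_def by blast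
  have "AE x in lebesgue_on \<Omega>. \<bar>c x\<bar> \<le> M" using M n by eventually_elim simp
  then show "\<exists>M. AE x in lebesgue_on \<Omega>. \<bar>c x\<bar> \<le> M" ..
qed

lemma A_sym: "x \<in> \<Omega> \<Longrightarrow> (A x *v y) \<bullet> z = (A x *v z) \<bullet> y"
proof -
  assume "x \<in> \<Omega>"
  then have t: "transpose (A x) = A x" using coeff unfolding elliptic_coefficients_def by blast
  have "(A x *v y) \<bullet> z = (transpose (A x) *v y) \<bullet> z" by (simp add: t)
  also have "\<dots> = (y v* A x) \<bullet> z" by simp
  also have "\<dots> = y \<bullet> (A x *v z)" by (rule dot_lmul_matrix)
  finally show ?thesis by (simp add: inner_commute)
qed

text \<open>The two summands of the elliptic form. The first is a function of the gradients alone, so that it is bilinear on all of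
\<open>L\<^sup>2\<close>; only \<^const>\<open>weak_gradient\<close> restricts the bilinearity of the sum.\<close>

definition A_form :: "(plane, plane) L2 \<Rightarrow> (plane, plane) L2 \<Rightarrow> real" where
  "A_form g h = (LINT x|lebesgue_on \<Omega>. (A x *v rep_L2 g x) \<bullet> rep_L2 h x)"

definition c_form :: "(plane, real) L2 \<Rightarrow> (plane, real) L2 \<Rightarrow> real" where
  "c_form u v = (LINT x|lebesgue_on \<Omega>. c x * rep_L2 u x * rep_L2 v x)"

lemma bilinear_form_eq: "bilinear_form \<Omega> A c u v = A_form (weak_gradient \<Omega> u) (weak_gradient \<Omega> v) + c_form u v"
  by (simp add: bilinear_form_def A_form_def c_form_def)

lemma product_bound: "\<bar>p\<bar> * \<bar>q\<bar> \<le> p\<^sup>2 + q\<^sup>2" for p q :: real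
proof -
  have "2 * (\<bar>p\<bar> * \<bar>q\<bar>) \<le> p\<^sup>2 + q\<^sup>2" using sum_squares_bound[of "\<bar>p\<bar>" "\<bar>q\<bar>"] by (simp add: mult.assoc)
  moreover have "0 \<le> \<bar>p\<bar> * \<bar>q\<bar>" by simp
  ultimately show ?thesis by linarith
qed

lemma A_form_integrable: "integrable (lebesgue_on \<Omega>) (\<lambda>x. (A x *v rep_L2 g x) \<bullet> rep_L2 h x)"
proof -
  obtain M where M: "M \<ge> 0" "\<forall>x\<in>\<Omega>. norm (A x) \<le> M" using A_bound by blast
  have gm: "rep_L2 g \<in> borel_measurable (lebesgue_on \<Omega>)" and hm: "rep_L2 h \<in> borel_measurable (lebesgue_on \<Omega>)"
    by (intro measurable_lebesgue_on rep_L2_measurable)+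
  have m: "(\<lambda>x. A x *v rep_L2 g x) \<in> borel_measurable (lebesgue_on \<Omega>)"
    by (rule borel_measurable_continuous_Pair[OF A_meas gm continuous_on_matrix_vector_mult])
  show ?thesis
  proof (rule Bochner_Integration.integrable_bound)
    show "integrable (lebesgue_on \<Omega>) (\<lambda>x. 2 * M * ((norm (rep_L2 g x))\<^sup>2 + (norm (rep_L2 h x))\<^sup>2))"
      using sq_integrable_rep[of g] sq_integrable_rep[of h]
      by (intro integrable_on_\<Omega> integrable_mult_right Bochner_Integration.integrable_add) (auto simp: sq_integrable_def)
    show "(\<lambda>x. (A x *v rep_L2 g x) \<bullet> rep_L2 h x) \<in> borel_measurable (lebesgue_on \<Omega>)"
      by (rule borel_measurable_inner[OF m hm])
    show "AE x in lebesgue_on \<Omega>. norm ((A x *v rep_L2 g x) \<bullet> rep_L2 h x)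
        \<le> norm (2 * M * ((norm (rep_L2 g x))\<^sup>2 + (norm (rep_L2 h x))\<^sup>2))"
    proof (rule AE_I2)
      fix x assume "x \<in> space (lebesgue_on \<Omega>)"
      then have x: "x \<in> \<Omega>" by (simp add: space_restrict_space)
      let ?g = "norm (rep_L2 g x)" and ?h = "norm (rep_L2 h x)"
      have "\<bar>(A x *v rep_L2 g x) \<bullet> rep_L2 h x\<bar> \<le> norm (A x *v rep_L2 g x) * ?h" by (rule Cauchy_Schwarz_ineq2)
      also have "\<dots> \<le> ((2 * M) * ?g) * ?h"
      proof (intro mult_right_mono)
        have "norm (A x *v rep_L2 g x) \<le> (2 * norm (A x)) * ?g" using matrix_vector_mult_norm_le[of "A x" "rep_L2 g x"] by simp
        also have "\<dots> \<le> (2 * M) * ?g" using M x by (intro mult_right_mono mult_left_mono) auto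
        finally show "norm (A x *v rep_L2 g x) \<le> (2 * M) * ?g" .
      qed simp
      also have "\<dots> = 2 * M * (?g * ?h)" by simp
      also have "\<dots> \<le> 2 * M * (?g\<^sup>2 + ?h\<^sup>2)" using M(1) product_bound[of ?g ?h] by (intro mult_left_mono) auto
      also have "\<dots> \<le> norm (2 * M * (?g\<^sup>2 + ?h\<^sup>2))" by simp
      finally show "norm ((A x *v rep_L2 g x) \<bullet> rep_L2 h x) \<le> norm (2 * M * (?g\<^sup>2 + ?h\<^sup>2))" by simp
    qed
  qed
qed

lemma c_form_integrable: "integrable (lebesgue_on \<Omega>) (\<lambda>x. c x * rep_L2 u x * rep_L2 v x)"
proof -
  obtain M where M: "AE x in lebesgue_on \<Omega>. \<bar>c x\<bar> \<le> M" using c_bound by blast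
  have um: "rep_L2 u \<in> borel_measurable (lebesgue_on \<Omega>)" and vm: "rep_L2 v \<in> borel_measurable (lebesgue_on \<Omega>)"
    by (intro measurable_lebesgue_on rep_L2_measurable)+
  show ?thesis
  proof (rule Bochner_Integration.integrable_bound)
    show "integrable (lebesgue_on \<Omega>) (\<lambda>x. M * ((norm (rep_L2 u x))\<^sup>2 + (norm (rep_L2 v x))\<^sup>2))"
      using sq_integrable_rep[of u] sq_integrable_rep[of v]
      by (intro integrable_on_\<Omega> integrable_mult_right Bochner_Integration.integrable_add) (auto simp: sq_integrable_def)
    show "(\<lambda>x. c x * rep_L2 u x * rep_L2 v x) \<in> borel_measurable (lebesgue_on \<Omega>)"
      by (intro borel_measurable_times c_meas um vm)
    show "AE x in lebesgue_on \<Omega>. norm (c x * rep_L2 u x * rep_L2 v x)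
        \<le> norm (M * ((norm (rep_L2 u x))\<^sup>2 + (norm (rep_L2 v x))\<^sup>2))"
      using M
    proof eventually_elim
      case (elim x)
      let ?u = "rep_L2 u x" and ?v = "rep_L2 v x"
      have M0: "M \<ge> 0" using elim by linarith
      have "\<bar>c x * ?u * ?v\<bar> = \<bar>c x\<bar> * (\<bar>?u\<bar> * \<bar>?v\<bar>)" by (simp add: abs_mult)
      also have "\<dots> \<le> M * (?u\<^sup>2 + ?v\<^sup>2)" using elim M0 product_bound[of ?u ?v] by (intro mult_mono) auto
      finally have "\<bar>c x * ?u * ?v\<bar> \<le> M * (?u\<^sup>2 + ?v\<^sup>2)" .
      moreover have "\<bar>M * (?u\<^sup>2 + ?v\<^sup>2)\<bar> = M * (?u\<^sup>2 + ?v\<^sup>2)" using M0 by simp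
      ultimately show ?case by simp
    qed
  qed
qed

lemma A_form_add: "A_form (g + g') h = A_form g h + A_form g' h"
proof -
  have "A_form (g + g') h = (LINT x|lebesgue_on \<Omega>. (A x *v rep_L2 g x) \<bullet> rep_L2 h x + (A x *v rep_L2 g' x) \<bullet> rep_L2 h x)"
    unfolding A_form_def
  proof (rule integral_cong_AE)
    show "AE x in lebesgue_on \<Omega>. (A x *v rep_L2 (g + g') x) \<bullet> rep_L2 h x = (A x *v rep_L2 g x) \<bullet> rep_L2 h x + (A x *v rep_L2 g' x) \<bullet> rep_L2 h x"
      using AE_on[OF rep_L2_add[of g g']]
      by eventually_elim (simp add: matrix_vector_right_distrib inner_add_left)
  qed (intro borel_measurable_add borel_measurable_integrable A_form_integrable)+
  also have "\<dots> = A_form g h + A_form g' h"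
    unfolding A_form_def by (rule Bochner_Integration.integral_add[OF A_form_integrable A_form_integrable])
  finally show ?thesis .
qed

lemma A_form_scaleR: "A_form (r *\<^sub>R g) h = r * A_form g h"
proof -
  have "A_form (r *\<^sub>R g) h = (LINT x|lebesgue_on \<Omega>. r * ((A x *v rep_L2 g x) \<bullet> rep_L2 h x))"
    unfolding A_form_def
  proof (rule integral_cong_AE)
    show "AE x in lebesgue_on \<Omega>. (A x *v rep_L2 (r *\<^sub>R g) x) \<bullet> rep_L2 h x = r * ((A x *v rep_L2 g x) \<bullet> rep_L2 h x)"
      using AE_on[OF rep_L2_scaleR[of r g]]
      by eventually_elim (simp add: matrix_vector_mult_scaleR)
  qed (intro borel_measurable_times borel_measurable_const borel_measurable_integrable A_form_integrable)+
  then show ?thesis unfolding A_form_def by simp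
qed

lemma A_form_sym: "A_form g h = A_form h g"
  unfolding A_form_def
  by (intro Bochner_Integration.integral_cong refl) (simp add: space_restrict_space A_sym)

lemma c_form_add: "c_form (u + u') v = c_form u v + c_form u' v"
proof -
  have "c_form (u + u') v = (LINT x|lebesgue_on \<Omega>. c x * rep_L2 u x * rep_L2 v x + c x * rep_L2 u' x * rep_L2 v x)"
    unfolding c_form_def
  proof (rule integral_cong_AE)
    show "AE x in lebesgue_on \<Omega>. c x * rep_L2 (u + u') x * rep_L2 v x = c x * rep_L2 u x * rep_L2 v x + c x * rep_L2 u' x * rep_L2 v x"
      using AE_on[OF rep_L2_add[of u u']] by eventually_elim (simp add: algebra_simps)
  qed (intro borel_measurable_add borel_measurable_integrable c_form_integrable)+
  also have "\<dots> = c_form u v + c_form u' v"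
    unfolding c_form_def by (rule Bochner_Integration.integral_add[OF c_form_integrable c_form_integrable])
  finally show ?thesis .
qed

lemma c_form_scaleR: "c_form (r *\<^sub>R u) v = r * c_form u v"
proof -
  have "c_form (r *\<^sub>R u) v = (LINT x|lebesgue_on \<Omega>. r * (c x * rep_L2 u x * rep_L2 v x))"
    unfolding c_form_def
  proof (rule integral_cong_AE)
    show "AE x in lebesgue_on \<Omega>. c x * rep_L2 (r *\<^sub>R u) x * rep_L2 v x = r * (c x * rep_L2 u x * rep_L2 v x)"
      using AE_on[OF rep_L2_scaleR[of r u]] by eventually_elim simp
  qed (intro borel_measurable_times borel_measurable_const borel_measurable_integrable c_form_integrable)+
  then show ?thesis unfolding c_form_def by simp
qed

lemma c_form_sym: "c_form u v = c_form v u"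
  unfolding c_form_def by (simp add: mult_ac)

lemma c_form_nonneg: "c_form u u \<ge> 0"
  unfolding c_form_def
proof (rule integral_nonneg_AE)
  show "AE x in lebesgue_on \<Omega>. 0 \<le> c x * rep_L2 u x * rep_L2 u x"
    using c_nonneg by eventually_elim (simp add: mult.assoc)
qed

lemma A_form_coercive: "\<exists>a>0. \<forall>g\<in>L2_on \<Omega>. a * (norm g)\<^sup>2 \<le> A_form g g"
proof -
  obtain a where a: "a > 0" "\<forall>x\<in>\<Omega>. \<forall>\<xi>. a * (norm \<xi>)\<^sup>2 \<le> \<xi> \<bullet> (A x *v \<xi>)"
    using coeff unfolding elliptic_coefficients_def by blast
  have "a * (norm g)\<^sup>2 \<le> A_form g g" if g: "g \<in> L2_on \<Omega>" for g
  proof -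
    have i: "integrable lebesgue (\<lambda>x. (norm (rep_L2 g x))\<^sup>2)" using sq_integrable_rep[of g] by (simp add: sq_integrable_def)
    have "(norm g)\<^sup>2 = (LINT x|lebesgue. (norm (rep_L2 g x))\<^sup>2)" by (rule norm_L2_eq)
    also have "\<dots> = (LINT x|lebesgue. indicator \<Omega> x *\<^sub>R (norm (rep_L2 g x))\<^sup>2)"
    proof (rule integral_cong_AE)
      show "AE x in lebesgue. (norm (rep_L2 g x))\<^sup>2 = indicator \<Omega> x *\<^sub>R (norm (rep_L2 g x))\<^sup>2"
        using g unfolding L2_on_def mem_Collect_eq by eventually_elim (auto simp: indicator_def)
    qed (use i integrable_mult_indicator[OF \<Omega>_meas i] in \<open>auto intro: borel_measurable_integrable\<close>)
    also have "\<dots> = (LINT x|lebesgue_on \<Omega>. (norm (rep_L2 g x))\<^sup>2)"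
      using \<Omega>_meas by (subst integral_restrict_space) auto
    finally have "a * (norm g)\<^sup>2 = (LINT x|lebesgue_on \<Omega>. a * (norm (rep_L2 g x))\<^sup>2)" by simp
    also have "\<dots> \<le> A_form g g" unfolding A_form_def
    proof (rule integral_mono)
      show "integrable (lebesgue_on \<Omega>) (\<lambda>x. a * (norm (rep_L2 g x))\<^sup>2)"
        using integrable_on_\<Omega>[OF i] by simp
      fix x assume "x \<in> space (lebesgue_on \<Omega>)"
      then show "a * (norm (rep_L2 g x))\<^sup>2 \<le> (A x *v rep_L2 g x) \<bullet> rep_L2 g x"
        using a(2) by (simp add: space_restrict_space inner_commute)
    qed (rule A_form_integrable)
    finally show ?thesis .
  qed
  then show ?thesis using a(1) by blast
qed

lemma weak_gradient_add:
  assumes "has_weak_gradient \<Omega> u g" "has_weak_gradient \<Omega> v h"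
  shows "weak_gradient \<Omega> (u + v) = weak_gradient \<Omega> u + weak_gradient \<Omega> v"
  using weak_gradient_eqI[OF \<Omega>] assms has_weak_gradient_add[OF assms] by simp

lemma weak_gradient_scaleR:
  assumes "has_weak_gradient \<Omega> u g"
  shows "weak_gradient \<Omega> (r *\<^sub>R u) = r *\<^sub>R weak_gradient \<Omega> u"
  using weak_gradient_eqI[OF \<Omega>] assms has_weak_gradient_scaleR[OF assms] by simp

lemma form_add:
  assumes "has_weak_gradient \<Omega> u g" "has_weak_gradient \<Omega> v h"
  shows "bilinear_form \<Omega> A c (u + v) w = bilinear_form \<Omega> A c u w + bilinear_form \<Omega> A c v w"
  unfolding bilinear_form_eq weak_gradient_add[OF assms] A_form_add c_form_add by simp

lemma form_scaleR:
  assumes "has_weak_gradient \<Omega> u g"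
  shows "bilinear_form \<Omega> A c (r *\<^sub>R u) w = r * bilinear_form \<Omega> A c u w"
  unfolding bilinear_form_eq weak_gradient_scaleR[OF assms] A_form_scaleR c_form_scaleR by (simp add: distrib_left)

lemma form_sym: "bilinear_form \<Omega> A c u v = bilinear_form \<Omega> A c v u"
  unfolding bilinear_form_eq using A_form_sym c_form_sym by simp

lemma form_coercive:
  "\<exists>a>0. \<forall>u g. has_weak_gradient \<Omega> u g \<longrightarrow> a * (norm (weak_gradient \<Omega> u))\<^sup>2 \<le> bilinear_form \<Omega> A c u u"
proof -
  obtain a where a: "a > 0" "\<forall>g\<in>L2_on \<Omega>. a * (norm g)\<^sup>2 \<le> A_form g g" using A_form_coercive by blast
  have "a * (norm (weak_gradient \<Omega> u))\<^sup>2 \<le> bilinear_form \<Omega> A c u u" if h: "has_weak_gradient \<Omega> u g" for u g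
  proof -
    have "weak_gradient \<Omega> u \<in> L2_on \<Omega>" using weak_gradient_eqI[OF \<Omega> h] h by (simp add: has_weak_gradient_def)
    then have "a * (norm (weak_gradient \<Omega> u))\<^sup>2 \<le> A_form (weak_gradient \<Omega> u) (weak_gradient \<Omega> u)" using a(2) by blast
    then show ?thesis unfolding bilinear_form_eq using c_form_nonneg[of u] by linarith
  qed
  then show ?thesis using a(1) by blast
qed

text \<open>A Poincare inequality for \<open>u\<close> is taken as a hypothesis, as it is obtained in different ways for the finite
element space and for \<^const>\<open>H10\<close>.\<close>

lemma form_pos:
  assumes h: "has_weak_gradient \<Omega> u g" and P: "norm u \<le> C * norm (weak_gradient \<Omega> u)" and u: "u \<noteq> 0"
  shows "bilinear_form \<Omega> A c u u > 0"
proof -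
  obtain a where a: "a > 0" "\<forall>u g. has_weak_gradient \<Omega> u g \<longrightarrow> a * (norm (weak_gradient \<Omega> u))\<^sup>2 \<le> bilinear_form \<Omega> A c u u"
    using form_coercive by blast
  have "weak_gradient \<Omega> u \<noteq> 0" using P u by auto
  then have "0 < a * (norm (weak_gradient \<Omega> u))\<^sup>2" using a(1) by simp
  also have "\<dots> \<le> bilinear_form \<Omega> A c u u" using a(2) h by blast
  finally show ?thesis .
qed

lemma Lipschitz_weak_gradient:
  assumes R: "\<Omega> \<subseteq> cball 0 R" "R \<ge> 0" and v: "Lipschitz_gradient v G" "\<And>x. x \<notin> \<Omega> \<Longrightarrow> v x = 0"
  shows "has_weak_gradient \<Omega> (L2_class \<Omega> v) (L2_class \<Omega> G)"
    "norm (L2_class \<Omega> v) \<le> 2 * R * norm (weak_gradient \<Omega> (L2_class \<Omega> v))"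
proof -
  show h: "has_weak_gradient \<Omega> (L2_class \<Omega> v) (L2_class \<Omega> G)"
    by (rule Lipschitz_gradient_has_weak_gradient[OF \<Omega>(1) R(1) v])
  show "norm (L2_class \<Omega> v) \<le> 2 * R * norm (weak_gradient \<Omega> (L2_class \<Omega> v))"
    unfolding weak_gradient_eqI[OF \<Omega> h] by (rule Poincare_Lipschitz[OF \<Omega>(1) R(1) v R(2)])
qed

lemma test_function_weak_gradient:
  assumes R: "\<Omega> \<subseteq> cball 0 R" "R \<ge> 0" and \<psi>: "\<psi> \<in> test_functions \<Omega>"
  shows "\<exists>g. has_weak_gradient \<Omega> (L2_class \<Omega> \<psi>) g"
    "norm (L2_class \<Omega> \<psi>) \<le> 2 * R * norm (weak_gradient \<Omega> (L2_class \<Omega> \<psi>))"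
    "sq_integrable (\<lambda>x. indicator \<Omega> x *\<^sub>R \<psi> x)"
  using Lipschitz_weak_gradient[OF R test_function_Lipschitz_gradient[OF \<psi> \<Omega>(2)] test_function_zero_outside[OF \<psi>]]
    Lipschitz_gradient_sq_integrable(1)[OF \<Omega>(1) R(1) test_function_Lipschitz_gradient[OF \<psi> \<Omega>(2)]]
  by auto

lemma H10_weak_gradient: "v \<in> H10 \<Omega> \<Longrightarrow> has_weak_gradient \<Omega> v (weak_gradient \<Omega> v)"
proof -
  assume "v \<in> H10 \<Omega>"
  then obtain g where g: "has_weak_gradient \<Omega> v g" unfolding H10_def by blast
  then show ?thesis using weak_gradient_eqI[OF \<Omega> g] by simp
qed

lemma H10_L2_on: "v \<in> H10 \<Omega> \<Longrightarrow> v \<in> L2_on \<Omega>"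
  using H10_weak_gradient[of v] by (simp add: has_weak_gradient_def)

lemma radius: "\<exists>R\<ge>0. \<Omega> \<subseteq> cball 0 R"
proof -
  obtain R where R: "\<forall>x\<in>\<Omega>. norm x \<le> R" using \<Omega>(2) unfolding bounded_iff ..
  have "\<Omega> \<subseteq> cball 0 \<bar>R\<bar>" using R by (auto intro: order_trans[OF _ abs_ge_self])
  then show ?thesis by (intro exI[of _ "\<bar>R\<bar>"]) simp
qed

text \<open>The inequality for test functions passes to their closure.\<close>

lemma Poincare_H10: "\<exists>C. \<forall>v\<in>H10 \<Omega>. norm v \<le> C * norm (weak_gradient \<Omega> v)"
proof -
  obtain R where R: "R \<ge> 0" "\<Omega> \<subseteq> cball 0 R" using radius by blast
  have "norm v \<le> 2 * R * norm (weak_gradient \<Omega> v)" if v: "v \<in> H10 \<Omega>" for v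
  proof (rule field_le_epsilon)
    fix e :: real assume e: "e > 0"
    \<comment> \<open>The distance to the approximating test function enters once directly and once, times \<open>2 * R\<close>, through its gradient.\<close>
    define d where "d = e / (1 + 2 * R)"
    have d: "d > 0" "(1 + 2 * R) * d = e" using e R(1) by (auto simp: d_def)
    obtain \<psi> where \<psi>: "\<psi> \<in> test_functions \<Omega>" "norm (v - L2_class \<Omega> \<psi>) < d"
        "norm (weak_gradient \<Omega> v - weak_gradient \<Omega> (L2_class \<Omega> \<psi>)) < d"
      using v d(1) unfolding H10_def by blast
    let ?p = "L2_class \<Omega> \<psi>"
    have "norm v \<le> norm (v - ?p) + norm ?p" using norm_triangle_ineq[of "v - ?p" ?p] by simp
    also have "norm ?p \<le> 2 * R * norm (weak_gradient \<Omega> ?p)" by (rule test_function_weak_gradient(2)[OF R(2,1) \<psi>(1)])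
    also have "norm (weak_gradient \<Omega> ?p) \<le> norm (weak_gradient \<Omega> v) + d"
      using \<psi>(3) norm_triangle_sub[of "weak_gradient \<Omega> ?p" "weak_gradient \<Omega> v"] by (simp add: norm_minus_commute)
    finally have "norm v \<le> norm (v - ?p) + 2 * R * (norm (weak_gradient \<Omega> v) + d)"
      using R(1) by (simp add: mult_left_mono)
    then show "norm v \<le> 2 * R * norm (weak_gradient \<Omega> v) + e"
      using \<psi>(2) d(2) by (simp add: algebra_simps)
  qed
  then show ?thesis by blast
qed

lemma H10_diff:
  assumes u: "u \<in> H10 \<Omega>" and v: "v \<in> H10 \<Omega>"
  shows "u - v \<in> H10 \<Omega>"
proof -
  obtain R where R: "R \<ge> 0" "\<Omega> \<subseteq> cball 0 R" using radius by blast
  have minus: "p - q = p + (-1) *\<^sub>R q" for p q :: "(plane, 'b::euclidean_space) L2" by simp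
  have wd: "weak_gradient \<Omega> (p - q) = weak_gradient \<Omega> p - weak_gradient \<Omega> q"
    if "has_weak_gradient \<Omega> p g" "has_weak_gradient \<Omega> q h" for p q g h
    unfolding minus using weak_gradient_add[OF that(1) has_weak_gradient_scaleR[OF that(2)], of "-1"]
      weak_gradient_scaleR[OF that(2), of "-1"] by simp
  note hu = H10_weak_gradient[OF u] and hv = H10_weak_gradient[OF v]
  have "has_weak_gradient \<Omega> (u - v) (weak_gradient \<Omega> u + (-1) *\<^sub>R weak_gradient \<Omega> v)"
    unfolding minus[of u v] by (intro has_weak_gradient_add has_weak_gradient_scaleR hu hv)
  moreover have "\<exists>\<psi>\<in>test_functions \<Omega>. norm (u - v - L2_class \<Omega> \<psi>) < e \<and>
      norm (weak_gradient \<Omega> (u - v) - weak_gradient \<Omega> (L2_class \<Omega> \<psi>)) < e" if e: "e > 0" for e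
  proof -
    have e2: "e / 2 > 0" using e by simp
    obtain p where p: "p \<in> test_functions \<Omega>" "norm (u - L2_class \<Omega> p) < e/2"
        "norm (weak_gradient \<Omega> u - weak_gradient \<Omega> (L2_class \<Omega> p)) < e/2"
      using u e2 unfolding H10_def by blast
    obtain q where q: "q \<in> test_functions \<Omega>" "norm (v - L2_class \<Omega> q) < e/2"
        "norm (weak_gradient \<Omega> v - weak_gradient \<Omega> (L2_class \<Omega> q)) < e/2"
      using v e2 unfolding H10_def by blast
    have pq: "(\<lambda>x. p x - q x) \<in> test_functions \<Omega>"
    proof -
      obtain K where K: "compact K" "K \<subseteq> \<Omega>" "\<forall>x. x \<notin> K \<longrightarrow> p x = 0" using p(1) unfolding test_functions_def by blast
      obtain K' where K': "compact K'" "K' \<subseteq> \<Omega>" "\<forall>x. x \<notin> K' \<longrightarrow> q x = 0" using q(1) unfolding test_functions_def by blast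
      have "smooth_on UNIV (\<lambda>x. p x - q x)"
        unfolding smooth_on_def by (intro allI Ck_on_diff test_function_Ck[OF p(1)] test_function_Ck[OF q(1)])
      moreover have "compact (K \<union> K')" "K \<union> K' \<subseteq> \<Omega>" "\<forall>x. x \<notin> K \<union> K' \<longrightarrow> p x - q x = 0"
        using K K' by auto
      ultimately show ?thesis unfolding test_functions_def by blast
    qed
    obtain gp where gp: "has_weak_gradient \<Omega> (L2_class \<Omega> p) gp" using test_function_weak_gradient(1)[OF R(2,1) p(1)] ..
    obtain gq where gq: "has_weak_gradient \<Omega> (L2_class \<Omega> q) gq" using test_function_weak_gradient(1)[OF R(2,1) q(1)] ..
    have cl: "L2_class \<Omega> (\<lambda>x. p x - q x) = L2_class \<Omega> p - L2_class \<Omega> q"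
    proof -
      have "abs_L2 (\<lambda>x. indicator \<Omega> x *\<^sub>R p x) - abs_L2 (\<lambda>x. indicator \<Omega> x *\<^sub>R q x)
          = abs_L2 (\<lambda>x. indicator \<Omega> x *\<^sub>R p x - indicator \<Omega> x *\<^sub>R q x)"
        using test_function_weak_gradient(3)[OF R(2,1) p(1)] test_function_weak_gradient(3)[OF R(2,1) q(1)]
        by (intro minus_L2.abs_eq) (auto simp: L2_rel_def)
      then show ?thesis by (simp add: L2_class_def scaleR_diff_right right_diff_distrib)
    qed
    have "norm ((u - v) - (L2_class \<Omega> p - L2_class \<Omega> q)) < e"
      using norm_triangle_ineq4[of "u - L2_class \<Omega> p" "v - L2_class \<Omega> q"] p(2) q(2) by (simp add: algebra_simps)
    moreover have "norm ((weak_gradient \<Omega> u - weak_gradient \<Omega> v) - (weak_gradient \<Omega> (L2_class \<Omega> p) - weak_gradient \<Omega> (L2_class \<Omega> q))) < e"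
      using norm_triangle_ineq4[of "weak_gradient \<Omega> u - weak_gradient \<Omega> (L2_class \<Omega> p)" "weak_gradient \<Omega> v - weak_gradient \<Omega> (L2_class \<Omega> q)"] p(3) q(3)
      by (simp add: algebra_simps)
    ultimately show ?thesis
      using pq unfolding cl[symmetric] wd[OF hu hv, symmetric] wd[OF gp gq, symmetric] by blast
  qed
  ultimately show ?thesis unfolding H10_def by blast
qed

lemma form_diff:
  assumes "has_weak_gradient \<Omega> u g" "has_weak_gradient \<Omega> v h"
  shows "bilinear_form \<Omega> A c (u - v) w = bilinear_form \<Omega> A c u w - bilinear_form \<Omega> A c v w"
  using form_add[OF assms(1) has_weak_gradient_scaleR[OF assms(2), of "-1"], of w] form_scaleR[OF assms(2), of "-1" w] by simp

end

section \<open>Convolution with the resolvent kernels\<close>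

lemma weighted_sum_bound:
  fixes \<xi> \<rho> m :: "nat \<Rightarrow> real"
  assumes "\<And>i. i \<in> I \<Longrightarrow> 0 \<le> m i" "\<And>i. i \<in> I \<Longrightarrow> m i \<le> M" "M \<ge> 0"
  shows "\<bar>\<Sum>i\<in>I. \<xi> i * (m i * \<rho> i)\<bar> \<le> M * (L2_set \<xi> I * L2_set \<rho> I)"
proof -
  have "\<bar>\<Sum>i\<in>I. \<xi> i * (m i * \<rho> i)\<bar> \<le> (\<Sum>i\<in>I. \<bar>\<xi> i * (m i * \<rho> i)\<bar>)" by (rule sum_abs)
  also have "\<dots> \<le> (\<Sum>i\<in>I. M * (\<bar>\<xi> i\<bar> * \<bar>\<rho> i\<bar>))"
  proof (rule sum_mono)
    fix i assume i: "i \<in> I"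
    have "\<bar>\<xi> i * (m i * \<rho> i)\<bar> = m i * (\<bar>\<xi> i\<bar> * \<bar>\<rho> i\<bar>)" using assms(1)[OF i] by (simp add: abs_mult)
    also have "\<dots> \<le> M * (\<bar>\<xi> i\<bar> * \<bar>\<rho> i\<bar>)" using assms(2)[OF i] by (intro mult_right_mono) auto
    finally show "\<bar>\<xi> i * (m i * \<rho> i)\<bar> \<le> M * (\<bar>\<xi> i\<bar> * \<bar>\<rho> i\<bar>)" .
  qed
  also have "\<dots> = M * (\<Sum>i\<in>I. \<bar>\<xi> i\<bar> * \<bar>\<rho> i\<bar>)" by (simp add: sum_distrib_left)
  also have "\<dots> \<le> M * (L2_set \<xi> I * L2_set \<rho> I)" using assms(3) by (intro mult_left_mono L2_set_mult_ineq)
  finally show ?thesis .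
qed

lemma has_integral_abs_le:
  fixes f g :: "real \<Rightarrow> real"
  assumes f: "(f has_integral I) S" and g: "(g has_integral J) S" and le: "\<And>s. s \<in> S \<Longrightarrow> \<bar>f s\<bar> \<le> g s"
  shows "\<bar>I\<bar> \<le> J"
proof -
  have "I \<le> J" by (rule has_integral_le[OF f g]) (use le in force)
  moreover have "- I \<le> J" by (rule has_integral_le[OF has_integral_neg[OF f] g]) (use le in force)
  ultimately show ?thesis by linarith
qed

text \<open>With \<open>K = 1 - E\<close>, this is \<open>K \<tau> - K (\<tau> - \<eta>)\<close>, where \<open>K\<close> is continued by
zero to negative arguments: \<open>\<eta>\<close> times the average of the resolvent kernel \<open>k\<close> over
\<open>{\<tau> - \<eta>..\<tau>}\<close>. The three lemmas that follow say that it is nonnegative, bounded by a multiple of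
\<open>\<eta> / \<tau>\<close> and of mass at most \<open>\<eta>\<close>, just as \<open>k\<close> is nonnegative, bounded by
\<open>\<alpha> / \<tau>\<close> and of mass at most 1.\<close>

definition relaxation_increment :: "real \<Rightarrow> real \<Rightarrow> real \<Rightarrow> real \<Rightarrow> real" where
  "relaxation_increment \<alpha> lam \<eta> \<tau> = (1 - relaxation \<alpha> lam \<tau>) - (if \<tau> \<ge> \<eta> then 1 - relaxation \<alpha> lam (\<tau> - \<eta>) else 0)"

context
  fixes \<alpha> lam :: real
  assumes \<alpha>: "0 < \<alpha>" "\<alpha> < 1" and lam: "lam > 0"
begin

lemma relaxation_increment_nonneg: "0 \<le> \<eta> \<Longrightarrow> 0 \<le> \<tau> \<Longrightarrow> 0 \<le> relaxation_increment \<alpha> lam \<eta> \<tau>"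
  unfolding relaxation_increment_def
  using relaxation_le_1[OF \<alpha> lam, of \<tau>] relaxation_antimono[OF \<alpha> lam, of "\<tau> - \<eta>" \<tau>] by auto

text \<open>For \<open>\<tau> \<ge> 2 * \<eta>\<close> the bound \<open>k \<sigma> \<le> \<alpha> / \<sigma>\<close> is used on
\<open>{\<tau> - \<eta>..\<tau>}\<close>, where \<open>\<sigma> \<ge> \<tau> / 2\<close>; for smaller \<open>\<tau>\<close>
the right-hand side exceeds 1.\<close>

lemma relaxation_increment_le:
  assumes "0 < \<eta>" "0 < \<tau>"
  shows "relaxation_increment \<alpha> lam \<eta> \<tau> \<le> 2 * \<eta> / \<tau>"
proof (cases "\<tau> \<ge> 2 * \<eta>")
  case False
  have "relaxation_increment \<alpha> lam \<eta> \<tau> \<le> 1"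
    unfolding relaxation_increment_def
    using relaxation_nonneg[OF \<alpha> lam, of \<tau>] relaxation_le_1[OF \<alpha> lam, of "\<tau> - \<eta>"] assms by auto
  also have "1 \<le> 2 * \<eta> / \<tau>" using False assms by (simp add: field_simps)
  finally show ?thesis .
next
  case True
  have "relaxation \<alpha> lam (\<tau> - \<eta>) - relaxation \<alpha> lam \<tau> \<le> (2 / \<tau>) * (\<tau> - (\<tau> - \<eta>))"
  proof (rule has_integral_le[OF has_integral_relaxation_rate_between[OF \<alpha> lam]])
    show "((\<lambda>_. 2 / \<tau>) has_integral 2 / \<tau> * (\<tau> - (\<tau> - \<eta>))) {\<tau> - \<eta>..\<tau>}"
      using has_integral_const_real[of "2 / \<tau>" "\<tau> - \<eta>" \<tau>] assms by (simp add: mult.commute)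
    fix s assume s: "s \<in> {\<tau> - \<eta>..\<tau>}"
    then have s2: "\<tau> / 2 \<le> s" "0 < s" using True assms by auto
    have "relaxation_rate \<alpha> lam s \<le> \<alpha> / s" by (rule relaxation_rate_le[OF \<alpha> lam s2(2)])
    also have "\<dots> \<le> 1 / s" using \<alpha> s2 by (simp add: divide_right_mono)
    also have "\<dots> \<le> 2 / \<tau>" using s2 assms by (simp add: field_simps)
    finally show "relaxation_rate \<alpha> lam s \<le> 2 / \<tau>" .
  qed (use True assms in auto)
  then show ?thesis using True assms by (simp add: relaxation_increment_def)
qed

text \<open>The integral telescopes to that of \<open>1 - E\<close> over \<open>{a - \<eta>..a}\<close>, and \<open>1 - E\<close> has
values between 0 and 1.\<close>

lemma relaxation_increment_integral:
  assumes "0 < \<eta>" "\<eta> < a"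
  shows "\<exists>J. ((\<lambda>s. relaxation_increment \<alpha> lam \<eta> (t - s)) has_integral J) {t - a..t} \<and> 0 \<le> J \<and> J \<le> \<eta>"
proof -
  let ?K = "\<lambda>\<tau>. 1 - relaxation \<alpha> lam \<tau>"
  have Kc: "continuous_on {0..} ?K" by (intro continuous_intros continuous_on_relaxation[OF \<alpha> lam])
  have Ki: "(?K has_integral integral {x..y} ?K) {x..y}" if "0 \<le> x" for x y
    using that by (intro integrable_integral integrable_continuous_real continuous_on_subset[OF Kc]) auto
  have 1: "((\<lambda>s. ?K (t - s)) has_integral integral {0..a} ?K) {t - a..t - 0}"
    by (rule has_integral_reflect_shift[OF Ki]) simp
  have "((\<lambda>s. ?K (t - \<eta> - s)) has_integral integral {0..a - \<eta>} ?K) {t - \<eta> - (a - \<eta>)..t - \<eta> - 0}"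
    by (rule has_integral_reflect_shift[OF Ki]) simp
  then have "((\<lambda>s. if s \<in> {t - a..t - \<eta>} then ?K (t - \<eta> - s) else 0) has_integral integral {0..a - \<eta>} ?K) {t - a..t}"
    using assms by (subst has_integral_restrict) auto
  from has_integral_diff[OF _ this] 1
  have "((\<lambda>s. ?K (t - s) - (if s \<in> {t - a..t - \<eta>} then ?K (t - \<eta> - s) else 0)) has_integral
      integral {0..a} ?K - integral {0..a - \<eta>} ?K) {t - a..t}" by simp
  then have I: "((\<lambda>s. relaxation_increment \<alpha> lam \<eta> (t - s)) has_integral integral {0..a} ?K - integral {0..a - \<eta>} ?K) {t - a..t}"
    by (rule has_integral_eq[rotated]) (auto simp: relaxation_increment_def algebra_simps)
  have "integral {0..a} ?K = integral {0..a - \<eta>} ?K + integral {a - \<eta>..a} ?K"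
    using integrable_on_split_left(1)[of ?K 0 a "a - \<eta>"] Ki[of 0 a] assms by (auto simp: has_integral_iff)
  moreover have "0 \<le> integral {a - \<eta>..a} ?K"
    using has_integral_nonneg[OF Ki[of "a - \<eta>" a]] relaxation_le_1[OF \<alpha> lam] assms by auto
  moreover have "integral {a - \<eta>..a} ?K \<le> \<eta>"
    using has_integral_le[OF Ki[of "a - \<eta>" a] has_integral_const_real[of 1 "a - \<eta>" a]] relaxation_nonneg[OF \<alpha> lam] assms by auto
  ultimately show ?thesis using I by auto
qed

end

definition convolution_const :: "real \<Rightarrow> real" where
  "convolution_const \<alpha> = 4 / (1 - \<alpha>) + 5"

text \<open>The components \<open>e i\<close> are convolutions of \<open>\<rho> i\<close> with resolvent kernels that differ from
component to component. To bound them together, pair \<open>e\<close> with the fixed vector \<open>\<xi> = e t\<close>: with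
\<open>f s = (\<Sum>i. \<xi> i * e i s)\<close> the value \<open>f t\<close> is the square of the quantity \<open>X\<close>
to be estimated, so it suffices to show \<open>f t \<le> C * P * X\<close>.

As \<open>f\<close> is continuous, \<open>f t\<close> is the limit of the averages of \<open>f\<close> over \<open>{t -
\<eta>..t}\<close>, and \<open>\<eta>\<close> times such an average is the integral of \<open>\<xi> i * \<rho> i\<close>
against the increments of the integrated kernel. On \<open>{0..t/2}\<close> these increments are at most \<open>4 * \<eta> /
t\<close> and the singularity of \<open>\<rho>\<close> is integrated; here \<open>\<gamma> \<le> \<alpha> < 1\<close> enters.
On \<open>{t/2..t}\<close> the function \<open>\<rho>\<close> is compared with its value at \<open>t\<close>: the constant
part is controlled by the mass of the increments, and the factor \<open>t - s\<close> in the bound of \<open>\<rho> i s -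
\<rho> i t\<close> cancels the singularity of the increments at \<open>s = t\<close>. Averages with \<open>\<eta> > 0\<close>
are needed because no convolution formula for \<open>e i t\<close> itself is assumed, only one for its primitive.\<close>

lemma convolution_error_bound:
  fixes \<Lambda> :: "nat \<Rightarrow> real" and e \<rho> :: "nat \<Rightarrow> real \<Rightarrow> real"
  assumes \<alpha>: "0 < \<alpha>" "\<alpha> < 1" and \<Lambda>: "\<And>i. i < N \<Longrightarrow> \<Lambda> i > 0"
    and t: "0 < t" "t \<le> T" and e: "\<And>i. i < N \<Longrightarrow> continuous_on {0..T} (e i)"
    and id: "\<And>i x. i < N \<Longrightarrow> 0 < x \<Longrightarrow> x \<le> T \<Longrightarrow>
        ((\<lambda>s. (1 - relaxation \<alpha> (\<Lambda> i) (x - s)) * \<rho> i s) has_integral integral {0..x} (e i)) {0..x}"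
    and \<gamma>: "0 \<le> \<gamma>" "\<gamma> \<le> \<alpha>" and B: "B \<ge> 0"
    and b1: "\<And>s. 0 < s \<Longrightarrow> s \<le> t \<Longrightarrow> L2_set (\<lambda>i. \<rho> i s) {..<N} \<le> B * s powr (- \<gamma>)"
    and b2: "\<And>s. 0 < s \<Longrightarrow> s \<le> t \<Longrightarrow> L2_set (\<lambda>i. \<rho> i s - \<rho> i t) {..<N} \<le> B * ((t - s) / s) * s powr (- \<gamma>)"
  shows "L2_set (\<lambda>i. e i t) {..<N} \<le> convolution_const \<alpha> * B * t powr (- \<gamma>)"
proof -
  define X where "X = L2_set (\<lambda>i. e i t) {..<N}"
  define \<xi> where "\<xi> i = e i t" for i
  have X0: "X \<ge> 0" by (simp add: X_def L2_set_nonneg)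
  have X\<xi>: "X = L2_set \<xi> {..<N}" by (simp add: X_def \<xi>_def[abs_def])
  define f where "f s = (\<Sum>i<N. \<xi> i * e i s)" for s
  have fc: "continuous_on {0..T} f" unfolding f_def by (intro continuous_intros e) auto
  define G where "G x = integral {0..x} f" for x
  define m where "m i \<eta> s = relaxation_increment \<alpha> (\<Lambda> i) \<eta> (t - s)" for i \<eta> s
  define P where "P = B * t powr (- \<gamma>)"
  have P0: "P \<ge> 0" using B by (simp add: P_def)
  have Gdiff: "\<bar>G t - G (t - \<eta>)\<bar> \<le> convolution_const \<alpha> * P * X * \<eta>" if \<eta>: "0 < \<eta>" "\<eta> \<le> t / 4" for \<eta>
  proof -
    have Gx: "((\<lambda>s. \<Sum>i<N. \<xi> i * ((1 - relaxation \<alpha> (\<Lambda> i) (x - s)) * \<rho> i s)) has_integral G x) {0..x}"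
      if x: "0 < x" "x \<le> T" for x
    proof -
      have ei: "(e i has_integral integral {0..x} (e i)) {0..x}" if "i < N" for i
        using e[OF that] x by (intro integrable_integral integrable_continuous_real) (auto intro: continuous_on_subset)
      have "(f has_integral (\<Sum>i<N. \<xi> i * integral {0..x} (e i))) {0..x}"
        unfolding f_def by (intro has_integral_sum has_integral_mult_right ei) auto
      then have "G x = (\<Sum>i<N. \<xi> i * integral {0..x} (e i))" by (simp add: G_def integral_unique)
      then show ?thesis by (simp only:) (intro has_integral_sum has_integral_mult_right id x, auto)
    qed
    define g where "g s = (\<Sum>i<N. \<xi> i * (m i \<eta> s * \<rho> i s))" for s
    have "((\<lambda>s. if s \<in> {0..t - \<eta>} then \<Sum>i<N. \<xi> i * ((1 - relaxation \<alpha> (\<Lambda> i) (t - \<eta> - s)) * \<rho> i s) else 0) has_integral G (t - \<eta>)) {0..t}"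
      using Gx[of "t - \<eta>"] t \<eta> by (subst has_integral_restrict) auto
    from has_integral_diff[OF Gx[OF t] this]
    have gI: "(g has_integral G t - G (t - \<eta>)) {0..t}"
    proof (rule has_integral_eq[rotated])
      fix s assume s: "s \<in> {0..t}"
      show "(\<Sum>i<N. \<xi> i * ((1 - relaxation \<alpha> (\<Lambda> i) (t - s)) * \<rho> i s)) -
          (if s \<in> {0..t - \<eta>} then \<Sum>i<N. \<xi> i * ((1 - relaxation \<alpha> (\<Lambda> i) (t - \<eta> - s)) * \<rho> i s) else 0) = g s"
      proof (cases "s \<le> t - \<eta>")
        case True
        have m: "m i \<eta> s = (1 - relaxation \<alpha> (\<Lambda> i) (t - s)) - (1 - relaxation \<alpha> (\<Lambda> i) (t - \<eta> - s))" if "i < N" for i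
          using True by (simp add: m_def relaxation_increment_def algebra_simps)
        have "g s = (\<Sum>i<N. \<xi> i * ((1 - relaxation \<alpha> (\<Lambda> i) (t - s)) * \<rho> i s) - \<xi> i * ((1 - relaxation \<alpha> (\<Lambda> i) (t - \<eta> - s)) * \<rho> i s))"
          unfolding g_def by (intro sum.cong refl) (simp add: m algebra_simps)
        then show ?thesis using True s by (simp add: sum_subtractf)
      next
        case False
        then have "m i \<eta> s = 1 - relaxation \<alpha> (\<Lambda> i) (t - s)" for i by (simp add: m_def relaxation_increment_def)
        then show ?thesis using False by (simp add: g_def)
      qed
    qed
    have m0: "0 \<le> m i \<eta> s" if "i < N" "s \<le> t" for i s
      unfolding m_def using relaxation_increment_nonneg[OF \<alpha> \<Lambda>[OF that(1)]] \<eta> that by auto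
    have m1: "m i \<eta> s \<le> 2 * \<eta> / (t - s)" if "i < N" "s < t" for i s
      unfolding m_def using relaxation_increment_le[OF \<alpha> \<Lambda>[OF that(1)]] \<eta> that by auto
    have spl: "integral {0..t} g = integral {0..t/2} g + integral {t/2..t} g" "g integrable_on {0..t/2}" "g integrable_on {t/2..t}"
      using integrable_on_split_left[of g 0 t "t/2"] gI t by (auto simp: has_integral_iff)
    \<comment> \<open>Far from \<open>t\<close> the increments are small, and the singularity of \<open>\<rho>\<close> at 0 is integrable.\<close>
    have first: "\<bar>integral {0..t/2} g\<bar> \<le> 4 / (1 - \<alpha>) * P * X * \<eta>"
    proof -
      have pw: "((\<lambda>s. s powr (- \<gamma>)) has_integral (t/2) powr (1 - \<gamma>) / (1 - \<gamma>)) {0..t/2}"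
        using has_integral_powr_from_0[of "- \<gamma>" "t/2"] \<alpha> \<gamma> t by simp
      define c where "c = 4 * \<eta> / t * X * B"
      have c0: "c \<ge> 0" using \<eta> t X0 B by (simp add: c_def)
      have gi: "((\<lambda>s. if s = 0 then 0 else g s) has_integral integral {0..t/2} g) {0..t/2}"
        by (rule has_integral_spike[of "{0}", OF _ _ integrable_integral[OF spl(2)]]) auto
      have "\<bar>integral {0..t/2} g\<bar> \<le> c * ((t/2) powr (1 - \<gamma>) / (1 - \<gamma>))"
      proof (rule has_integral_abs_le[OF gi has_integral_mult_right[OF pw, of c]])
        fix s assume s: "s \<in> {0..t/2}"
        show "\<bar>if s = 0 then 0 else g s\<bar> \<le> c * s powr (- \<gamma>)"
        proof (cases "s = 0")
          case False
          then have s0: "0 < s" "s \<le> t/2" "s < t" using s t by auto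
          have "\<bar>g s\<bar> \<le> (4 * \<eta> / t) * (L2_set \<xi> {..<N} * L2_set (\<lambda>i. \<rho> i s) {..<N})"
            unfolding g_def
          proof (rule weighted_sum_bound)
            fix i assume i: "i \<in> {..<N}"
            show "0 \<le> m i \<eta> s" using m0 i s0 by auto
            have "m i \<eta> s \<le> 2 * \<eta> / (t - s)" using m1 i s0 by auto
            also have "\<dots> \<le> 2 * \<eta> / (t / 2)" using s0 \<eta> t by (intro divide_left_mono) auto
            finally show "m i \<eta> s \<le> 4 * \<eta> / t" by simp
          qed (use \<eta> t in simp)
          also have "\<dots> \<le> (4 * \<eta> / t) * (X * (B * s powr (- \<gamma>)))"
            unfolding X\<xi>[symmetric] using b1[of s] s0 X0 \<eta> t by (intro mult_left_mono) auto
          finally show ?thesis using False by (simp add: c_def mult_ac)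
        qed simp
      qed
      also have "\<dots> \<le> c * (t powr (1 - \<gamma>) / (1 - \<alpha>))"
        using \<alpha> \<gamma> t c0 by (intro mult_left_mono frac_le powr_mono2) auto
      also have "t powr (1 - \<gamma>) = t * t powr (- \<gamma>)" using powr_mult_base[of t "- \<gamma>"] t by simp
      also have "c * (t * t powr (- \<gamma>) / (1 - \<alpha>)) = 4 / (1 - \<alpha>) * P * X * \<eta>"
        using t by (simp add: c_def P_def)
      finally show ?thesis .
    qed
    \<comment> \<open>Near \<open>t\<close> the frozen value \<open>\<rho> i t\<close> contributes 1 and the remainder 4 to the constant 5.\<close>
    have second: "\<bar>integral {t/2..t} g\<bar> \<le> 5 * P * X * \<eta>"
    proof -
      have "\<exists>J. \<forall>i<N. ((\<lambda>s. m i \<eta> s) has_integral J i) {t/2..t} \<and> 0 \<le> J i \<and> J i \<le> \<eta>"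
      proof -
        have "\<exists>J. ((\<lambda>s. m i \<eta> s) has_integral J) {t/2..t} \<and> 0 \<le> J \<and> J \<le> \<eta>" if "i < N" for i
          unfolding m_def using relaxation_increment_integral[OF \<alpha> \<Lambda>[OF that], of \<eta> "t/2" t] \<eta> t by auto
        then show ?thesis by metis
      qed
      then obtain J where J: "\<forall>i<N. ((\<lambda>s. m i \<eta> s) has_integral J i) {t/2..t} \<and> 0 \<le> J i \<and> J i \<le> \<eta>" ..
      define g1 where "g1 s = (\<Sum>i<N. \<xi> i * (m i \<eta> s * \<rho> i t))" for s
      have g1I: "(g1 has_integral (\<Sum>i<N. \<xi> i * (J i * \<rho> i t))) {t/2..t}"
        unfolding g1_def using J by (intro has_integral_sum has_integral_mult_right has_integral_mult_left) auto
      have \<rho>t: "L2_set (\<lambda>i. \<rho> i t) {..<N} \<le> P" using b1[of t] t by (simp add: P_def)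
      have "\<bar>\<Sum>i<N. \<xi> i * (J i * \<rho> i t)\<bar> \<le> \<eta> * (L2_set \<xi> {..<N} * L2_set (\<lambda>i. \<rho> i t) {..<N})"
        by (rule weighted_sum_bound) (use J \<eta> in auto)
      also have "\<dots> \<le> \<eta> * (X * P)"
        unfolding X\<xi>[symmetric] using \<rho>t X0 \<eta> by (intro mult_left_mono) auto
      finally have part1: "\<bar>\<Sum>i<N. \<xi> i * (J i * \<rho> i t)\<bar> \<le> P * X * \<eta>" by (simp add: mult_ac)
      have gi: "((\<lambda>s. g s - g1 s) has_integral integral {t/2..t} g - (\<Sum>i<N. \<xi> i * (J i * \<rho> i t))) {t/2..t}"
        by (intro has_integral_diff integrable_integral spl(3) g1I)
      have "\<bar>integral {t/2..t} g - (\<Sum>i<N. \<xi> i * (J i * \<rho> i t))\<bar> \<le> measure lborel {t/2..t} *\<^sub>R (8 * \<eta> * X * P / t)"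
      proof (rule has_integral_abs_le[OF gi has_integral_const_real])
        fix s assume s: "s \<in> {t/2..t}"
        have gg: "g s - g1 s = (\<Sum>i<N. \<xi> i * (m i \<eta> s * (\<rho> i s - \<rho> i t)))"
          unfolding g_def g1_def by (simp add: sum_subtractf[symmetric] algebra_simps)
        show "\<bar>g s - g1 s\<bar> \<le> 8 * \<eta> * X * P / t"
        proof (cases "s = t")
          case True
          then show ?thesis unfolding gg using \<eta> X0 P0 t by simp
        next
          case False
          then have s0: "0 < s" "t/2 \<le> s" "s < t" using s t by auto
          have "\<bar>g s - g1 s\<bar> \<le> (2 * \<eta> / (t - s)) * (L2_set \<xi> {..<N} * L2_set (\<lambda>i. \<rho> i s - \<rho> i t) {..<N})"
            unfolding gg by (rule weighted_sum_bound) (use m0 m1 s0 \<eta> in auto)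
          also have "\<dots> \<le> (2 * \<eta> / (t - s)) * (X * (B * ((t - s) / s) * s powr (- \<gamma>)))"
            unfolding X\<xi>[symmetric] using b2[of s] s0 X0 \<eta> t by (intro mult_left_mono) auto
          also have "\<dots> = 2 * \<eta> * X * B * (s powr (- \<gamma>) / s)"
            using s0 by simp
          also have "\<dots> \<le> 2 * \<eta> * X * B * (4 * t powr (- \<gamma>) / t)"
          proof (intro mult_left_mono)
            have "s powr (- \<gamma>) \<le> (t / 2) powr (- \<gamma>)" using s0 t \<gamma> by (intro powr_mono2') auto
            also have "\<dots> = 2 powr \<gamma> * t powr (- \<gamma>)" using t by (simp add: powr_divide powr_minus divide_simps)
            also have "\<dots> \<le> 2 powr 1 * t powr (- \<gamma>)" using \<gamma> \<alpha> by (intro mult_right_mono powr_mono) auto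
            finally have "s powr (- \<gamma>) / s \<le> (2 * t powr (- \<gamma>)) / (t / 2)"
              using s0 t by (intro frac_le) auto
            then show "s powr (- \<gamma>) / s \<le> 4 * t powr (- \<gamma>) / t" by simp
          qed (use \<eta> X0 B in simp)
          also have "\<dots> = 8 * \<eta> * X * P / t" by (simp add: P_def)
          finally show ?thesis .
        qed
      qed
      also have "measure lborel {t/2..t} *\<^sub>R (8 * \<eta> * X * P / t) = 4 * P * X * \<eta>" using t by simp
      finally show ?thesis using part1 by linarith
    qed
    have "G t - G (t - \<eta>) = integral {0..t/2} g + integral {t/2..t} g" using spl(1) gI by (simp add: integral_unique)
    then have "\<bar>G t - G (t - \<eta>)\<bar> \<le> 4 / (1 - \<alpha>) * P * X * \<eta> + 5 * P * X * \<eta>" using first second by linarith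
    also have "\<dots> = convolution_const \<alpha> * P * X * \<eta>" by (simp add: convolution_const_def algebra_simps)
    finally show ?thesis .
  qed
  have "(G has_vector_derivative f t) (at t within {0..T})"
    unfolding G_def by (rule integral_has_vector_derivative[OF fc]) (use t in auto)
  then have "(G has_real_derivative f t) (at t within {3*t/4..<t})"
    unfolding has_real_derivative_iff_has_vector_derivative by (rule has_vector_derivative_within_subset) (use t in auto)
  then have lim: "((\<lambda>x. (G x - G t) / (x - t)) \<longlongrightarrow> f t) (at t within {3*t/4..<t})"
    by (simp add: has_field_derivative_iff)
  have "f t \<le> convolution_const \<alpha> * P * X"
  proof (rule tendsto_upperbound[OF lim])
    show "\<forall>\<^sub>F x in at t within {3*t/4..<t}. (G x - G t) / (x - t) \<le> convolution_const \<alpha> * P * X"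
      unfolding eventually_at_filter
    proof (intro always_eventually allI impI)
      fix x assume x: "x \<noteq> t" "x \<in> {3*t/4..<t}"
      then have "\<bar>G t - G (t - (t - x))\<bar> \<le> convolution_const \<alpha> * P * X * (t - x)" by (intro Gdiff) auto
      then have "G t - G x \<le> convolution_const \<alpha> * P * X * (t - x)" by simp
      then have "(G t - G x) / (t - x) \<le> convolution_const \<alpha> * P * X" using x by (simp add: divide_le_eq)
      moreover have "(G x - G t) / (x - t) = (G t - G x) / (t - x)"
        using minus_divide_divide[of "G t - G x" "t - x"] by simp
      ultimately show "(G x - G t) / (x - t) \<le> convolution_const \<alpha> * P * X" by simp
    qed
    show "at t within {3*t/4..<t} \<noteq> bot"
      using t by (simp add: at_within_eq_bot_iff)
  qed
  moreover have "f t = X * X"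
    by (simp add: f_def \<xi>_def X_def L2_set_def power2_eq_square[symmetric] sum_nonneg)
  ultimately have XX: "X * X \<le> convolution_const \<alpha> * P * X" by simp
  have "X \<le> convolution_const \<alpha> * P"
  proof (cases "X = 0")
    case True
    then show ?thesis using P0 \<alpha> by (simp add: convolution_const_def)
  next
    case False
    then show ?thesis using XX X0 by (simp add: mult_le_cancel_right)
  qed
  then show ?thesis by (simp add: X_def P_def mult.assoc)
qed

section \<open>Vector-valued Caputo derivatives and dual norms\<close>

text \<open>The integrand is continuous away from the singularity of the kernel at \<open>s = r\<close>. Cut off an interval of length
\<open>d n\<close> there; the error is at most \<open>M\<close> times the kernel on this interval, whose integral tends to 0
with \<open>d n\<close>.\<close>

lemma integrable_frac_kernel_scaleR:
  fixes v :: "real \<Rightarrow> 'a::banach"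
  assumes \<alpha>: "0 < \<alpha>" "\<alpha> < 1" and r: "0 \<le> r" and v: "continuous_on {0..r} v"
  shows "(\<lambda>s. frac_kernel (1 - \<alpha>) (r - s) *\<^sub>R v s) integrable_on {0..r}"
proof (cases "r = 0")
  case False
  then have r: "r > 0" using r by simp
  let ?w = "\<lambda>s. frac_kernel (1 - \<alpha>) (r - s)"
  have "bounded (v ` {0..r})" by (intro compact_imp_bounded compact_continuous_image v) simp
  then obtain M where M: "\<forall>s\<in>{0..r}. norm (v s) \<le> M" unfolding bounded_iff by auto
  have M0: "M \<ge> 0" using M[rule_format, of 0] r norm_ge_zero[of "v 0"] by (simp del: norm_ge_zero)
  define d where "d n = r / real (Suc n)" for n
  have d: "0 < d n" "d n \<le> r" for n using r by (auto simp: d_def field_simps)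
  define fn where "fn n s = (if s \<in> {0..r - d n} then ?w s *\<^sub>R v s else 0)" for n s
  define hn where "hn n s = (if s \<in> {r - d n..r} then M * ?w s else 0)" for n s
  have w0: "?w s \<ge> 0" for s using \<alpha> by (intro frac_kernel_nonneg) simp
  have hI: "(hn n has_integral M * frac_kernel (2 - \<alpha>) (d n)) {0..r}" for n
  proof -
    have "((\<lambda>s. M * ?w s) has_integral M * frac_kernel (1 - \<alpha> + 1) (r - (r - d n))) {r - d n..r}"
      using \<alpha> d[of n] by (intro has_integral_mult_right has_integral_frac_kernel_shifted) auto
    then show ?thesis unfolding hn_def using d[of n] by (subst has_integral_restrict) auto
  qed
  show ?thesis
  proof (rule integrable_on_norm_approx[where fn=fn and hn=hn])
    fix n
    have "1 - \<alpha> > 0" using \<alpha> by simp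
    from less_imp_neq[OF Gamma_real_pos[OF this]] have G: "Gamma (1 - \<alpha>) \<noteq> 0" by (rule not_sym)
    have "continuous_on {0..r - d n} (\<lambda>s. ?w s *\<^sub>R v s)"
      unfolding frac_kernel_def using d[of n] \<alpha>
      by (intro continuous_on_scaleR continuous_on_divide continuous_on_powr continuous_on_diff
          continuous_on_const continuous_on_id continuous_on_subset[OF v]) (auto simp: G)
    then have "(\<lambda>s. ?w s *\<^sub>R v s) integrable_on {0..r - d n}" by (rule integrable_continuous_real)
    then obtain I where "((\<lambda>s. ?w s *\<^sub>R v s) has_integral I) {0..r - d n}" unfolding integrable_on_def by (elim exE) (rule that)
    moreover have "{0..r - d n} \<subseteq> {0..r}" using d(1)[of n] by simp
    ultimately have "(fn n has_integral I) {0..r}"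
      unfolding fn_def by (subst has_integral_restrict)
    then show "fn n integrable_on {0..r}" by (rule has_integral_integrable)
    show "hn n integrable_on {0..r}" using hI by blast
    fix s assume s: "s \<in> {0..r}"
    show "norm (?w s *\<^sub>R v s - fn n s) \<le> hn n s"
    proof (cases "s \<le> r - d n")
      case True
      then show ?thesis using s w0[of s] M0 by (auto simp: fn_def hn_def)
    next
      case False
      have "?w s * norm (v s) \<le> ?w s * M" using M s w0 by (intro mult_left_mono) auto
      then show ?thesis using False s w0[of s] by (simp add: fn_def hn_def mult.commute)
    qed
  next
    have "(\<lambda>n. d n powr (1 - \<alpha>)) \<longlonglongrightarrow> 0 powr (1 - \<alpha>)"
    proof (rule tendsto_powr')
      have "(\<lambda>n. r * inverse (real (Suc n))) \<longlonglongrightarrow> r * 0" by (intro tendsto_intros LIMSEQ_inverse_real_of_nat)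
      then show "d \<longlonglongrightarrow> 0" by (simp add: d_def[abs_def] divide_inverse)
    qed (use \<alpha> d in \<open>auto simp: less_imp_le\<close>)
    then have "(\<lambda>n. M * (d n powr (1 - \<alpha>) / Gamma (2 - \<alpha>))) \<longlonglongrightarrow> M * (0 powr (1 - \<alpha>) / Gamma (2 - \<alpha>))"
      using \<alpha> less_imp_neq[OF Gamma_real_pos[of "2 - \<alpha>"]] by (intro tendsto_mult tendsto_divide tendsto_const) simp_all
    moreover have "integral {0..r} (hn n) = M * (d n powr (1 - \<alpha>) / Gamma (2 - \<alpha>))" for n
      using hI[of n] by (simp add: integral_unique frac_kernel_def)
    ultimately show "(\<lambda>n. integral {0..r} (hn n)) \<longlonglongrightarrow> 0" by simp
  qed
next
  case True
  then show ?thesis using integrable_on_refl[of _ "0::real"] by (simp only: cbox_interval)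
qed

text \<open>Inner products may be taken under the integral because the integrand is integrable; the integral would otherwise be 0 by
convention and nothing could be concluded about its components.\<close>

lemma has_caputo_derivative_inner:
  fixes u :: "real \<Rightarrow> 'a::{banach, real_inner}"
  assumes \<alpha>: "0 < \<alpha>" "\<alpha> < 1" and u: "continuous_on {0..T} u" and t: "t \<in> {0..T}"
    and cap: "has_caputo_derivative \<alpha> T u w t"
  shows "has_caputo_derivative \<alpha> T (\<lambda>s. u s \<bullet> v) (w \<bullet> v) t"
proof -
  have int: "(\<lambda>s. frac_kernel (1 - \<alpha>) (r - s) *\<^sub>R (u s - u 0)) integrable_on {0..r}" if "r \<in> {0..T}" for r
    using that by (intro integrable_frac_kernel_scaleR \<alpha> continuous_intros continuous_on_subset[OF u]) auto
  have "((\<lambda>r. integral {0..r} (\<lambda>s. frac_kernel (1 - \<alpha>) (r - s) *\<^sub>R (u s - u 0)) \<bullet> v) has_vector_derivative w \<bullet> v) (at t within {0..T})"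
    using bounded_linear.has_vector_derivative[OF bounded_linear_inner_left cap[unfolded has_caputo_derivative_def]] .
  then show ?thesis
    unfolding has_caputo_derivative_def
  proof (rule has_vector_derivative_transform[OF t, rotated])
    fix r assume r: "r \<in> {0..T}"
    have "integral {0..r} (\<lambda>s. (frac_kernel (1 - \<alpha>) (r - s) *\<^sub>R (u s - u 0)) \<bullet> v)
        = integral {0..r} (\<lambda>s. frac_kernel (1 - \<alpha>) (r - s) *\<^sub>R (u s - u 0)) \<bullet> v"
      using integral_linear[OF int[OF r] bounded_linear_inner_left[of v]] by (simp add: o_def)
    then show "integral {0..r} (\<lambda>s. frac_kernel (1 - \<alpha>) (r - s) *\<^sub>R (u s \<bullet> v - u 0 \<bullet> v))
        = integral {0..r} (\<lambda>s. frac_kernel (1 - \<alpha>) (r - s) *\<^sub>R (u s - u 0)) \<bullet> v"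
      by (simp add: inner_diff_left)
  qed
qed

lemma has_caputo_derivative_diff:
  fixes y z :: "real \<Rightarrow> 'a::banach"
  assumes \<alpha>: "0 < \<alpha>" "\<alpha> < 1" and y: "continuous_on {0..T} y" and z: "continuous_on {0..T} z" and t: "t \<in> {0..T}"
    and cy: "has_caputo_derivative \<alpha> T y w t" and cz: "has_caputo_derivative \<alpha> T z w' t"
  shows "has_caputo_derivative \<alpha> T (\<lambda>s. y s - z s) (w - w') t"
proof -
  have int: "(\<lambda>s. frac_kernel (1 - \<alpha>) (r - s) *\<^sub>R (x s - x 0)) integrable_on {0..r}"
    if "r \<in> {0..T}" "continuous_on {0..T} x" for r and x :: "real \<Rightarrow> 'a"
    using that(1) by (intro integrable_frac_kernel_scaleR \<alpha> continuous_intros continuous_on_subset[OF that(2)]) auto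
  show ?thesis
    unfolding has_caputo_derivative_def
  proof (rule has_vector_derivative_transform[OF t _ has_vector_derivative_diff[OF cy[unfolded has_caputo_derivative_def] cz[unfolded has_caputo_derivative_def]]])
    fix r assume r: "r \<in> {0..T}"
    show "integral {0..r} (\<lambda>s. frac_kernel (1 - \<alpha>) (r - s) *\<^sub>R (y s - z s - (y 0 - z 0)))
       = integral {0..r} (\<lambda>s. frac_kernel (1 - \<alpha>) (r - s) *\<^sub>R (y s - y 0)) - integral {0..r} (\<lambda>s. frac_kernel (1 - \<alpha>) (r - s) *\<^sub>R (z s - z 0))"
      unfolding Henstock_Kurzweil_Integration.integral_diff[OF int[OF r y] int[OF r z], symmetric]
      by (simp add: scaleR_diff_right algebra_simps)
  qed
qed

text \<open>Used to show that the Caputo derivative inherits orthogonality relations from the function.\<close>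

lemma has_caputo_derivative_zero:
  fixes y :: "real \<Rightarrow> real"
  assumes t: "0 < t" "t \<le> T" and y: "\<And>s. s \<in> {0..T} \<Longrightarrow> y s = 0" and cap: "has_caputo_derivative \<alpha> T y w t"
  shows "w = 0"
proof -
  have t': "t \<in> {0..T}" using t by simp
  have "((\<lambda>r. 0) has_vector_derivative w) (at t within {0..T})"
  proof (rule has_vector_derivative_transform[OF t' _ cap[unfolded has_caputo_derivative_def]])
    fix r assume "r \<in> {0..T}"
    then have "integral {0..r} (\<lambda>s. frac_kernel (1 - \<alpha>) (r - s) *\<^sub>R (y s - y 0)) = integral {0..r} (\<lambda>s. 0)"
      by (intro Henstock_Kurzweil_Integration.integral_cong) (auto simp: y)
    then show "0 = integral {0..r} (\<lambda>s. frac_kernel (1 - \<alpha>) (r - s) *\<^sub>R (y s - y 0))" by simp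
  qed
  then show ?thesis
    using vector_derivative_unique_within_closed_interval[of 0 T t "\<lambda>r. 0" w 0] t by simp
qed

text \<open>\<^term>\<open>L2_on \<Omega>\<close> is a closed subspace, with multiplication by the indicator function as orthogonal
projection. In this form the lemma shows that the Caputo derivative of a function with values in the subspace stays in it.\<close>

lemma L2_on_orthogonalI:
  fixes w :: "(plane, real) L2"
  assumes \<Omega>: "open \<Omega>" and w: "\<And>n. (\<And>f. f \<in> L2_on \<Omega> \<Longrightarrow> f \<bullet> n = 0) \<Longrightarrow> w \<bullet> n = 0"
  shows "w \<in> L2_on \<Omega>"
proof -
  have \<Omega>m: "\<Omega> \<in> sets lebesgue" using \<Omega> by simp
  have sq: "sq_integrable (\<lambda>x. indicator \<Omega> x *\<^sub>R rep_L2 w x)"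
    unfolding sq_integrable_def
  proof
    show m: "(\<lambda>x. indicator \<Omega> x *\<^sub>R rep_L2 w x) \<in> borel_measurable lebesgue"
      using \<Omega>m rep_L2_measurable[of w] by (intro borel_measurable_scaleR borel_measurable_indicator) auto
    have "integrable lebesgue (\<lambda>x. indicator \<Omega> x *\<^sub>R (norm (rep_L2 w x))\<^sup>2)"
      using sq_integrable_rep[of w] by (intro integrable_mult_indicator \<Omega>m) (simp add: sq_integrable_def)
    moreover have "(norm (indicator \<Omega> x *\<^sub>R rep_L2 w x))\<^sup>2 = indicator \<Omega> x *\<^sub>R (norm (rep_L2 w x))\<^sup>2" for x
      by (auto simp: indicator_def)
    ultimately show "integrable lebesgue (\<lambda>x. (norm (indicator \<Omega> x *\<^sub>R rep_L2 w x))\<^sup>2)" by simp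
  qed
  define p where "p = L2_class \<Omega> (rep_L2 w)"
  have p: "p \<in> L2_on \<Omega>" unfolding p_def by (rule L2_on_L2_class[OF sq])
  define n where "n = w - p"
  have nAE: "AE x in lebesgue. rep_L2 n x = (1 - indicator \<Omega> x) * rep_L2 w x"
    using rep_L2_diff[of w p] rep_abs_L2[OF sq]
    unfolding n_def p_def L2_class_def by eventually_elim (simp add: algebra_simps)
  have orth: "f \<bullet> n = 0" if f: "f \<in> L2_on \<Omega>" for f
  proof -
    have "f \<bullet> n = (LINT x|lebesgue. rep_L2 f x \<bullet> rep_L2 n x)" by (rule inner_L2_eq)
    also have "\<dots> = 0"
    proof (rule integral_eq_zero_AE)
      show "AE x in lebesgue. rep_L2 f x \<bullet> rep_L2 n x = 0"
        using f[unfolded L2_on_def mem_Collect_eq] nAE by eventually_elim (auto simp: indicator_def)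
    qed
    finally show ?thesis .
  qed
  have "n \<bullet> n = 0" using w[OF orth] orth[OF p] by (simp add: n_def[of] inner_diff_left)
  then show ?thesis using p by (simp add: n_def)
qed

text \<open>The Cauchy-Schwarz inequality for the eigenfunction expansion, with \<open>lam j powr r\<close> distributed evenly over the
two factors. Nonnegativity of the dual norm is part of the conclusion because it depends on the same bound: a supremum over
an unbounded set of reals has no specified value.\<close>

lemma dual_norm_bound:
  assumes es: "\<And>i j. \<phi> i \<bullet> \<phi> j = (if i = j then 1 else (0::real))"
    and exp: "\<And>v. v \<in> L2_on \<Omega> \<Longrightarrow> (\<lambda>j. (v \<bullet> \<phi> j) *\<^sub>R \<phi> j) sums v"
    and lam: "\<And>j. lam j > 0" and u0: "u0 \<in> Hdot \<Omega> lam \<phi> \<delta>" and B: "B \<ge> 0"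
    and f: "\<And>j. \<bar>f \<bullet> \<phi> j\<bar> \<le> lam j powr (r / 2) * (B * (lam j powr (\<delta> / 2) * \<bar>u0 \<bullet> \<phi> j\<bar>))"
  shows "0 \<le> Hdot_dual_norm \<Omega> lam \<phi> r f" "Hdot_dual_norm \<Omega> lam \<phi> r f \<le> B * Hdot_norm lam \<phi> \<delta> u0"
proof -
  define d where "d j = lam j powr (\<delta> / 2) * \<bar>u0 \<bullet> \<phi> j\<bar>" for j
  have sqp: "(lam j powr (a / 2))\<^sup>2 = lam j powr a" for j a
    using lam[of j] by (simp add: power2_eq_square flip: powr_add)
  have d2: "(d j)\<^sup>2 = lam j powr \<delta> * (u0 \<bullet> \<phi> j)\<^sup>2" for j by (simp add: d_def power_mult_distrib sqp)
  have sd: "summable (\<lambda>j. (d j)\<^sup>2)" using u0 unfolding d2 Hdot_def by simp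
  have nd: "Hdot_norm lam \<phi> \<delta> u0 = sqrt (\<Sum>j. (d j)\<^sup>2)" by (simp add: Hdot_norm_def d2)
  let ?S = "{w \<in> Hdot \<Omega> lam \<phi> r. Hdot_norm lam \<phi> r w \<le> 1}"
  let ?D = "B * Hdot_norm lam \<phi> \<delta> u0"
  have bound: "\<bar>f \<bullet> w\<bar> \<le> ?D" if w: "w \<in> ?S" for w
  proof -
    have wL: "w \<in> L2_on \<Omega>" and ws: "summable (\<lambda>j. lam j powr r * (w \<bullet> \<phi> j)\<^sup>2)" using w by (auto simp: Hdot_def)
    have w1: "(\<Sum>j. lam j powr r * (w \<bullet> \<phi> j)\<^sup>2) \<le> 1"
    proof -
      have "0 \<le> (\<Sum>j. lam j powr r * (w \<bullet> \<phi> j)\<^sup>2)" by (intro suminf_nonneg ws) auto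
      then show ?thesis using w by (simp add: Hdot_norm_def)
    qed
    define e where "e j = lam j powr (r / 2) * \<bar>w \<bullet> \<phi> j\<bar>" for j
    have e2: "(e j)\<^sup>2 = lam j powr r * (w \<bullet> \<phi> j)\<^sup>2" for j by (simp add: e_def power_mult_distrib sqp)
    have "(\<lambda>j. f \<bullet> ((w \<bullet> \<phi> j) *\<^sub>R \<phi> j)) sums (f \<bullet> w)"
      by (rule bounded_linear.sums[OF bounded_linear_inner_right exp[OF wL]])
    then have "(\<lambda>n. \<Sum>j<n. f \<bullet> ((w \<bullet> \<phi> j) *\<^sub>R \<phi> j)) \<longlonglongrightarrow> f \<bullet> w" by (simp add: sums_def)
    then have lim: "(\<lambda>n. \<bar>\<Sum>j<n. f \<bullet> ((w \<bullet> \<phi> j) *\<^sub>R \<phi> j)\<bar>) \<longlonglongrightarrow> \<bar>f \<bullet> w\<bar>" by (rule tendsto_rabs)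
    show ?thesis
    proof (rule LIMSEQ_le_const2[OF lim], intro exI allI impI)
      fix n :: nat
      have "\<bar>\<Sum>j<n. f \<bullet> ((w \<bullet> \<phi> j) *\<^sub>R \<phi> j)\<bar> \<le> (\<Sum>j<n. B * (\<bar>d j\<bar> * \<bar>e j\<bar>))"
      proof (rule order_trans[OF sum_abs], rule sum_mono)
        fix j
        have "\<bar>f \<bullet> ((w \<bullet> \<phi> j) *\<^sub>R \<phi> j)\<bar> = \<bar>w \<bullet> \<phi> j\<bar> * \<bar>f \<bullet> \<phi> j\<bar>" by (simp add: abs_mult)
        also have "\<dots> \<le> \<bar>w \<bullet> \<phi> j\<bar> * (lam j powr (r / 2) * (B * (lam j powr (\<delta> / 2) * \<bar>u0 \<bullet> \<phi> j\<bar>)))"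
          by (intro mult_left_mono f) simp
        also have "\<dots> = B * (\<bar>d j\<bar> * \<bar>e j\<bar>)" by (simp add: d_def e_def abs_mult)
        finally show "\<bar>f \<bullet> ((w \<bullet> \<phi> j) *\<^sub>R \<phi> j)\<bar> \<le> B * (\<bar>d j\<bar> * \<bar>e j\<bar>)" .
      qed
      also have "\<dots> = B * (\<Sum>j<n. \<bar>d j\<bar> * \<bar>e j\<bar>)" by (simp add: sum_distrib_left)
      also have "\<dots> \<le> B * (L2_set d {..<n} * L2_set e {..<n})" by (intro mult_left_mono L2_set_mult_ineq B)
      also have "\<dots> \<le> B * (sqrt (\<Sum>j. (d j)\<^sup>2) * 1)"
      proof (intro mult_left_mono mult_mono B)
        show "L2_set d {..<n} \<le> sqrt (\<Sum>j. (d j)\<^sup>2)"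
          unfolding L2_set_def by (intro real_sqrt_le_mono sum_le_suminf sd) auto
        have "(\<Sum>j<n. (e j)\<^sup>2) \<le> (\<Sum>j. (e j)\<^sup>2)" by (intro sum_le_suminf) (auto simp: e2 ws)
        then have "(\<Sum>j<n. (e j)\<^sup>2) \<le> 1" using w1 by (simp add: e2)
        then show "L2_set e {..<n} \<le> 1" unfolding L2_set_def by simp
      qed (auto simp: L2_set_nonneg intro!: suminf_nonneg sd)
      finally show "\<bar>\<Sum>j<n. f \<bullet> ((w \<bullet> \<phi> j) *\<^sub>R \<phi> j)\<bar> \<le> ?D" by (simp add: nd)
    qed
  qed
  have "0 \<in> Hdot \<Omega> lam \<phi> r"
  proof -
    have "rep_L2 0 \<in> {f. AE x in lebesgue. x \<notin> \<Omega> \<longrightarrow> f x = (0::real)}"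
      using rep_abs_L2[OF sq_integrable_zero] by (simp add: zero_L2_def) (auto elim: eventually_mono)
    then show ?thesis by (simp add: Hdot_def L2_on_def)
  qed
  then have z: "0 \<in> ?S" by (simp add: Hdot_norm_def)
  have bdd: "bdd_above ((\<lambda>w. \<bar>f \<bullet> w\<bar>) ` ?S)" by (rule bdd_aboveI2[OF bound])
  show "Hdot_dual_norm \<Omega> lam \<phi> r f \<le> ?D"
    unfolding Hdot_dual_norm_def by (rule cSUP_least) (use z bound in auto)
  have "\<bar>f \<bullet> 0\<bar> \<le> Hdot_dual_norm \<Omega> lam \<phi> r f"
    unfolding Hdot_dual_norm_def by (rule cSUP_upper[OF z bdd])
  then show "0 \<le> Hdot_dual_norm \<Omega> lam \<phi> r f" by simp
qed

section \<open>Galerkin solutions and the error estimate\<close>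

context symmetric_form
begin

text \<open>In an eigenbasis the discrete solution operator divides the coefficients by the eigenvalues.\<close>

lemma Galerkin_solution_eq:
  assumes es: "eigensystem N \<psi> \<Lambda>" and expand: "\<And>v. v \<in> V \<Longrightarrow> v = (\<Sum>i<N. (v \<bullet> \<psi> i) *\<^sub>R \<psi> i)"
  shows "(THE w. w \<in> V \<and> (\<forall>v\<in>V. b w v = f \<bullet> v)) = (\<Sum>i<N. (f \<bullet> \<psi> i / \<Lambda> i) *\<^sub>R \<psi> i)"
proof (rule the_equality)
  have \<psi>V: "\<psi> i \<in> V" and \<Lambda>0: "\<Lambda> i > 0" if "i < N" for i using es that by (auto simp: eigensystem_def)
  have ei: "b (\<psi> i) v = \<Lambda> i * (\<psi> i \<bullet> v)" if "i < N" "v \<in> V" for i v using es that by (simp add: eigensystem_def)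
  let ?w = "\<Sum>i<N. (f \<bullet> \<psi> i / \<Lambda> i) *\<^sub>R \<psi> i"
  show "?w \<in> V \<and> (\<forall>v\<in>V. b ?w v = f \<bullet> v)"
  proof (intro conjI ballI)
    show "?w \<in> V" by (intro subspace_sum[OF V] subspace_scale[OF V] \<psi>V) auto
    fix v assume v: "v \<in> V"
    have "b ?w v = (\<Sum>i<N. (f \<bullet> \<psi> i / \<Lambda> i) * b (\<psi> i) v)" by (rule sum_left) (use \<psi>V v in auto)
    also have "\<dots> = (\<Sum>i<N. (f \<bullet> \<psi> i) * (v \<bullet> \<psi> i))"
    proof (intro sum.cong refl)
      fix i assume i: "i \<in> {..<N}"
      show "(f \<bullet> \<psi> i / \<Lambda> i) * b (\<psi> i) v = (f \<bullet> \<psi> i) * (v \<bullet> \<psi> i)"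
        using ei[OF _ v, of i] \<Lambda>0[of i] i by (simp add: inner_commute)
    qed
    also have "\<dots> = f \<bullet> (\<Sum>i<N. (v \<bullet> \<psi> i) *\<^sub>R \<psi> i)" by (simp add: inner_sum_right mult.commute)
    also have "\<dots> = f \<bullet> v" using expand[OF v] by simp
    finally show "b ?w v = f \<bullet> v" .
  qed
  fix w assume w: "w \<in> V \<and> (\<forall>v\<in>V. b w v = f \<bullet> v)"
  have "w \<bullet> \<psi> i = f \<bullet> \<psi> i / \<Lambda> i" if i: "i < N" for i
  proof -
    have "f \<bullet> \<psi> i = b w (\<psi> i)" using w \<psi>V[OF i] by simp
    also have "\<dots> = b (\<psi> i) w" using w \<psi>V[OF i] by (intro sym) auto
    also have "\<dots> = \<Lambda> i * (w \<bullet> \<psi> i)" using ei[OF i] w by (simp add: inner_commute)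
    finally show ?thesis using \<Lambda>0[OF i] by simp
  qed
  then show "w = ?w" using expand[of w] w by simp
qed

lemma projection_eq:
  assumes es: "eigensystem N \<psi> \<Lambda>" and expand: "\<And>v. v \<in> V \<Longrightarrow> v = (\<Sum>i<N. (v \<bullet> \<psi> i) *\<^sub>R \<psi> i)"
  shows "(THE w. w \<in> V \<and> (\<forall>v\<in>V. (w - f) \<bullet> v = 0)) = (\<Sum>i<N. (f \<bullet> \<psi> i) *\<^sub>R \<psi> i)"
proof (rule the_equality)
  have \<psi>V: "\<psi> i \<in> V" if "i < N" for i using es that by (auto simp: eigensystem_def)
  have on: "\<psi> i \<bullet> \<psi> j = (if i = j then 1 else 0)" if "i < N" "j < N" for i j
    using es that by (simp add: eigensystem_def)
  let ?w = "\<Sum>i<N. (f \<bullet> \<psi> i) *\<^sub>R \<psi> i"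
  have "?w \<bullet> v = f \<bullet> v" if v: "v \<in> V" for v
  proof -
    have "?w \<bullet> v = (\<Sum>i<N. (f \<bullet> \<psi> i) * (v \<bullet> \<psi> i))" by (simp add: inner_sum_left inner_commute[of v])
    also have "\<dots> = f \<bullet> (\<Sum>i<N. (v \<bullet> \<psi> i) *\<^sub>R \<psi> i)" by (simp add: inner_sum_right mult.commute)
    finally show ?thesis using expand[OF v] by simp
  qed
  moreover have "?w \<in> V" by (intro subspace_sum[OF V] subspace_scale[OF V] \<psi>V) auto
  ultimately show "?w \<in> V \<and> (\<forall>v\<in>V. (?w - f) \<bullet> v = 0)" by (simp add: inner_diff_left)
  fix w assume w: "w \<in> V \<and> (\<forall>v\<in>V. (w - f) \<bullet> v = 0)"
  have "w \<bullet> \<psi> i = f \<bullet> \<psi> i" if i: "i < N" for i using w \<psi>V[OF i] by (simp add: inner_diff_left)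
  then show "w = ?w" using expand[of w] w by simp
qed

end

lemma orthonormal_sum_inner:
  assumes on: "\<And>i j. i < N \<Longrightarrow> j < N \<Longrightarrow> \<psi> i \<bullet> \<psi> j = (if i = j then 1 else (0::real))" and j: "j < (N::nat)"
  shows "(\<Sum>i<N. a i *\<^sub>R \<psi> i) \<bullet> \<psi> j = a j"
proof -
  have "(\<Sum>i<N. a i *\<^sub>R \<psi> i) \<bullet> \<psi> j = (\<Sum>i<N. a i * (\<psi> i \<bullet> \<psi> j))" by (simp add: inner_sum_left)
  also have "\<dots> = (\<Sum>i<N. if i = j then a j else 0)" using on j by (intro sum.cong) auto
  finally show ?thesis using j by simp
qed

lemma orthonormal_sum_norm:
  assumes on: "\<And>i j. i < N \<Longrightarrow> j < N \<Longrightarrow> \<psi> i \<bullet> \<psi> j = (if i = j then 1 else (0::real))"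
  shows "norm (\<Sum>i<N. a i *\<^sub>R \<psi> i) = L2_set a {..<N::nat}"
proof -
  have "(norm (\<Sum>i<N. a i *\<^sub>R \<psi> i))\<^sup>2 = (\<Sum>j<N. a j * ((\<Sum>i<N. a i *\<^sub>R \<psi> i) \<bullet> \<psi> j))"
    unfolding power2_norm_eq_inner by (simp add: inner_sum_right)
  also have "\<dots> = (\<Sum>j<N. (a j)\<^sup>2)"
    using orthonormal_sum_inner[OF on] by (intro sum.cong) (auto simp: power2_eq_square)
  finally have "sqrt (\<Sum>j<N. (a j)\<^sup>2) = norm (\<Sum>i<N. a i *\<^sub>R \<psi> i)" by (rule real_sqrt_unique[OF _ norm_ge_zero])
  then show ?thesis by (simp add: L2_set_def)
qed

text \<open>Pythagoras for \<open>x - v = (x - p) + (p - v)\<close>.\<close>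

lemma orthonormal_best_approximation:
  fixes x :: "'a::real_inner"
  assumes on: "\<And>i j. i < (N::nat) \<Longrightarrow> j < N \<Longrightarrow> \<psi> i \<bullet> \<psi> j = (if i = j then 1 else (0::real))"
  defines "p \<equiv> (\<Sum>i<N. (x \<bullet> \<psi> i) *\<^sub>R \<psi> i)"
  assumes v: "v = (\<Sum>i<N. (v \<bullet> \<psi> i) *\<^sub>R \<psi> i)"
  shows "norm (x - p) \<le> norm (x - v)"
proof -
  have "(x - p) \<bullet> \<psi> i = 0" if "i < N" for i
    using orthonormal_sum_inner[OF on that] by (simp add: p_def inner_diff_left)
  moreover have "p - v = (\<Sum>i<N. ((x - v) \<bullet> \<psi> i) *\<^sub>R \<psi> i)"
    by (subst v) (simp add: p_def inner_diff_left scaleR_diff_left sum_subtractf)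
  ultimately have o: "(x - p) \<bullet> (p - v) = 0" by (simp add: inner_sum_right)
  have "x - v = (x - p) + (p - v)" by simp
  then have "(norm (x - v))\<^sup>2 = (norm (x - p))\<^sup>2 + (norm (p - v))\<^sup>2"
    using o norm_add_Pythagorean[of "x - p" "p - v"] by (simp add: orthogonal_def)
  then have "(norm (x - p))\<^sup>2 \<le> (norm (x - v))\<^sup>2" by simp
  then show ?thesis by (rule power2_le_imp_le) simp
qed

lemma Bessel:
  fixes x :: "'a::real_inner"
  assumes on: "\<And>i j. i < N \<Longrightarrow> j < N \<Longrightarrow> \<psi> i \<bullet> \<psi> j = (if i = j then 1 else (0::real))"
  shows "L2_set (\<lambda>i. x \<bullet> \<psi> i) {..<N::nat} \<le> norm x"
proof -
  let ?p = "\<Sum>i<N. (x \<bullet> \<psi> i) *\<^sub>R \<psi> i"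
  have "(x - ?p) \<bullet> \<psi> i = 0" if "i < N" for i
    using orthonormal_sum_inner[OF on that] by (simp add: inner_diff_left)
  then have "(x - ?p) \<bullet> ?p = 0" by (simp add: inner_sum_right)
  then have "(norm x)\<^sup>2 = (norm (x - ?p))\<^sup>2 + (norm ?p)\<^sup>2"
    using norm_add_Pythagorean[of "x - ?p" ?p] by (simp add: orthogonal_def)
  then have "(norm ?p)\<^sup>2 \<le> (norm x)\<^sup>2" by simp
  then have "norm ?p \<le> norm x" by (rule power2_le_imp_le) simp
  then show ?thesis by (simp add: orthonormal_sum_norm[OF on])
qed

context elliptic_problem
begin

text \<open>The powers \<open>lam j powr r\<close> in the norms are meaningful only for positive eigenvalues; positivity comes from the
Poincare inequality and ellipticity.\<close>

lemma eigenvalue_pos: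
  assumes es: "dirichlet_eigensystem \<Omega> A c lam \<phi>"
  shows "lam j > 0"
proof -
  have \<phi>: "\<phi> j \<in> H10 \<Omega>" "bilinear_form \<Omega> A c (\<phi> j) (\<phi> j) = lam j * (\<phi> j \<bullet> \<phi> j)" "\<phi> j \<bullet> \<phi> j = 1"
    using es unfolding dirichlet_eigensystem_def by auto
  obtain C where C: "\<forall>v\<in>H10 \<Omega>. norm v \<le> C * norm (weak_gradient \<Omega> v)" using Poincare_H10 ..
  have "\<phi> j \<noteq> 0" using \<phi>(3) by auto
  then have "bilinear_form \<Omega> A c (\<phi> j) (\<phi> j) > 0"
    using form_pos[OF H10_weak_gradient[OF \<phi>(1)] bspec[OF C \<phi>(1)]] by simp
  then show ?thesis using \<phi> by simp
qed

lemma eigen_coefficient: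
  assumes es: "dirichlet_eigensystem \<Omega> A c lam \<phi>" and u: "u \<in> H10 \<Omega>"
  shows "bilinear_form \<Omega> A c u (\<phi> j) = lam j * (u \<bullet> \<phi> j)"
  using es u form_sym[of u "\<phi> j"] unfolding dirichlet_eigensystem_def by (simp add: inner_commute)

text \<open>Existence is given, and uniqueness follows by testing with eigenfunctions: this determines all coefficients of the solution.\<close>

lemma elliptic_solution_H10_eq:
  assumes es: "dirichlet_eigensystem \<Omega> A c lam \<phi>" and u: "u \<in> H10 \<Omega>" "\<And>v. v \<in> H10 \<Omega> \<Longrightarrow> bilinear_form \<Omega> A c u v = f \<bullet> v"
  shows "elliptic_solution \<Omega> A c (H10 \<Omega>) f = u"
  unfolding elliptic_solution_def
proof (rule the_equality)
  show "u \<in> H10 \<Omega> \<and> (\<forall>v\<in>H10 \<Omega>. bilinear_form \<Omega> A c u v = f \<bullet> v)" using u by simp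
  fix w assume w: "w \<in> H10 \<Omega> \<and> (\<forall>v\<in>H10 \<Omega>. bilinear_form \<Omega> A c w v = f \<bullet> v)"
  have \<phi>H: "\<phi> j \<in> H10 \<Omega>" for j using es unfolding dirichlet_eigensystem_def by simp
  have exp: "(\<lambda>j. (v \<bullet> \<phi> j) *\<^sub>R \<phi> j) sums v" if "v \<in> L2_on \<Omega>" for v
    using es that unfolding dirichlet_eigensystem_def by simp
  have eq: "w \<bullet> \<phi> j = u \<bullet> \<phi> j" for j
  proof -
    have "lam j * (w \<bullet> \<phi> j) = lam j * (u \<bullet> \<phi> j)"
      using eigen_coefficient[OF es, of w j] eigen_coefficient[OF es u(1), of j] w u(2)[OF \<phi>H] \<phi>H[of j] by auto
    then show ?thesis using eigenvalue_pos[OF es, of j] by simp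
  qed
  have "w \<in> L2_on \<Omega>" using w H10_L2_on by simp
  from exp[OF this] exp[OF H10_L2_on[OF u(1)]] show "w = u"
    unfolding eq by (rule sums_unique2)
qed

text \<open>Definiteness uses the Poincare inequality for Lipschitz functions vanishing outside \<open>\<Omega>\<close>, and linearity
uses the weak gradients of such functions.\<close>

lemma fe_symmetric_form:
  assumes mesh: "triangular_mesh \<Omega> \<T>"
  shows "\<exists>B. symmetric_form (fe_space \<Omega> \<T>) (bilinear_form \<Omega> A c) B"
proof -
  obtain R where R: "R \<ge> 0" "\<Omega> \<subseteq> cball 0 R" using radius by blast
  obtain B where B: "finite B \<and> fe_space \<Omega> \<T> \<subseteq> span B" using fe_space_finite_span[OF \<Omega>(1) R(2) mesh] ..
  have wg: "\<exists>g. has_weak_gradient \<Omega> v g \<and> norm v \<le> 2 * R * norm (weak_gradient \<Omega> v)" if v: "v \<in> fe_space \<Omega> \<T>" for v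
  proof -
    obtain v0 G where v0: "v = L2_class \<Omega> v0" "Lipschitz_gradient v0 G" "\<forall>x. x \<notin> \<Omega> \<longrightarrow> v0 x = 0"
      using fe_space_Lipschitz_gradient[OF \<Omega>(1) mesh v] by (elim exE conjE)
    then show ?thesis using Lipschitz_weak_gradient[OF R(2,1) v0(2)] by auto
  qed
  have "symmetric_form (fe_space \<Omega> \<T>) (bilinear_form \<Omega> A c) B"
  proof
    show "subspace (fe_space \<Omega> \<T>)" by (rule subspace_fe_space[OF \<Omega>(1) R(2) mesh])
    show "fe_space \<Omega> \<T> \<subseteq> span B" "finite B" using B by auto
    fix x y z and r :: real
    show "bilinear_form \<Omega> A c x y = bilinear_form \<Omega> A c y x" by (rule form_sym)
    assume x: "x \<in> fe_space \<Omega> \<T>"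
    obtain g where g: "has_weak_gradient \<Omega> x g" "norm x \<le> 2 * R * norm (weak_gradient \<Omega> x)" using wg[OF x] by auto
    show "bilinear_form \<Omega> A c (r *\<^sub>R x) z = r * bilinear_form \<Omega> A c x z" by (rule form_scaleR[OF g(1)])
    show "x \<noteq> 0 \<Longrightarrow> 0 < bilinear_form \<Omega> A c x x" by (rule form_pos[OF g])
    assume y: "y \<in> fe_space \<Omega> \<T>"
    obtain h where h: "has_weak_gradient \<Omega> y h" using wg[OF y] by auto
    show "bilinear_form \<Omega> A c (x + y) z = bilinear_form \<Omega> A c x z + bilinear_form \<Omega> A c y z"
      by (rule form_add[OF g(1) h])
  qed
  then show ?thesis ..
qed

text \<open>The error estimate on one mesh, given a bound \<open>K * D\<close> for the elliptic finite element error with data of dual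
norm at most \<open>D\<close>. The constant depends on \<open>\<alpha>\<close> only, so a uniform \<open>K\<close> gives a
uniform estimate.\<close>

lemma semidiscrete_error:
  assumes es: "dirichlet_eigensystem \<Omega> A c lam \<phi>" and T: "0 < T" and \<alpha>: "0 < \<alpha>" "\<alpha> < 1"
    and mesh: "triangular_mesh \<Omega> \<T>" and s: "s \<le> 1" and \<delta>: "0 \<le> \<delta>" "\<delta> \<le> 1 + s" and u0: "u0 \<in> Hdot \<Omega> lam \<phi> \<delta>"
    and u: "weak_solution \<Omega> A c lam \<phi> \<alpha> T u0 u"
    and uh: "semidiscrete_solution \<Omega> A c \<T> \<alpha> T u0 uh"
    and K: "K \<ge> 0" and fem: "\<And>f D. f \<in> L2_on \<Omega> \<Longrightarrow> 0 \<le> Hdot_dual_norm \<Omega> lam \<phi> (1 - s) f \<Longrightarrow> Hdot_dual_norm \<Omega> lam \<phi> (1 - s) f \<le> D \<Longrightarrow>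
      norm (elliptic_solution \<Omega> A c (fe_space \<Omega> \<T>) f - elliptic_solution \<Omega> A c (H10 \<Omega>) f) \<le> K * D"
    and t: "t \<in> {0<..T}"
  shows "norm (uh t - u t) \<le> (convolution_const \<alpha> + 1) * smoothing_const \<alpha> * K * t powr (- \<alpha> * (1 + s - \<delta>) / 2) * Hdot_norm lam \<phi> \<delta> u0"
proof -
  define V where "V = fe_space \<Omega> \<T>"
  define a where "a = bilinear_form \<Omega> A c"
  define \<theta> where "\<theta> = (1 + s - \<delta>) / 2"
  define S where "S = smoothing_const \<alpha>"
  define U where "U = Hdot_norm lam \<phi> \<delta> u0"
  have \<theta>: "0 \<le> \<theta>" "\<theta> \<le> 1" using s \<delta> by (auto simp: \<theta>_def)
  have S1: "S \<ge> 1" unfolding S_def by (rule smoothing_const_ge_1[OF \<alpha>])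
  have U0: "U \<ge> 0" unfolding U_def Hdot_norm_def using u0
    by (intro real_sqrt_ge_zero suminf_nonneg) (simp_all add: Hdot_def)
  have \<phi>H: "\<phi> j \<in> H10 \<Omega>" for j using es unfolding dirichlet_eigensystem_def by simp
  have \<phi>on: "\<phi> i \<bullet> \<phi> j = (if i = j then 1 else 0)" for i j using es unfolding dirichlet_eigensystem_def by simp
  have \<phi>exp: "(\<lambda>j. (v \<bullet> \<phi> j) *\<^sub>R \<phi> j) sums v" if "v \<in> L2_on \<Omega>" for v
    using es that unfolding dirichlet_eigensystem_def by simp
  note lam = eigenvalue_pos[OF es]
  have uc: "continuous_on {0..T} u" and uL: "\<And>t. t \<in> {0..T} \<Longrightarrow> u t \<in> L2_on \<Omega>" and u00: "u 0 = u0"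
    and uH: "\<And>t. t \<in> {0<..T} \<Longrightarrow> u t \<in> H10 \<Omega>"
    using u unfolding weak_solution_def by simp_all
  have "\<exists>w. \<forall>t\<in>{0<..T}. has_caputo_derivative \<alpha> T u (w t) t \<and> (\<forall>v\<in>H10 \<Omega>. w t \<bullet> v + a (u t) v = 0)"
    using u unfolding weak_solution_def a_def by (elim conjE exE) (rule exI, assumption)
  then obtain w where w: "\<forall>t\<in>{0<..T}. has_caputo_derivative \<alpha> T u (w t) t \<and> (\<forall>v\<in>H10 \<Omega>. w t \<bullet> v + a (u t) v = 0)" ..
  then have wc: "\<And>t. t \<in> {0<..T} \<Longrightarrow> has_caputo_derivative \<alpha> T u (w t) t"
    and wa: "\<And>t v. t \<in> {0<..T} \<Longrightarrow> v \<in> H10 \<Omega> \<Longrightarrow> a (u t) v = (- w t) \<bullet> v"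
    by (auto simp: algebra_simps add_eq_0_iff)
  have uhc: "continuous_on {0..T} uh" and uhV: "\<And>t. t \<in> {0<..T} \<Longrightarrow> uh t \<in> V" and uh0: "uh 0 = L2_projection V u0"
    and uhw: "\<And>t. t \<in> {0<..T} \<Longrightarrow> \<exists>wh. has_caputo_derivative \<alpha> T uh wh t \<and> (\<forall>v\<in>V. wh \<bullet> v + a (uh t) v = 0)"
    using uh unfolding semidiscrete_solution_def V_def a_def by simp_all
  \<comment> \<open>A vector orthogonal to \<open>L2_on \<Omega>\<close> is orthogonal to all values of \<open>u\<close>, hence to its Caputo derivative.\<close>
  have wL: "w t \<in> L2_on \<Omega>" if t: "t \<in> {0<..T}" for t
  proof (rule L2_on_orthogonalI[OF \<Omega>(1)])
    fix n :: "(plane, real) L2" assume n: "\<And>f. f \<in> L2_on \<Omega> \<Longrightarrow> f \<bullet> n = 0"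
    have t': "0 < t" "t \<le> T" "t \<in> {0..T}" using t by auto
    show "w t \<bullet> n = 0"
      by (rule has_caputo_derivative_zero[OF t'(1,2) n[OF uL] has_caputo_derivative_inner[OF \<alpha> uc t'(3) wc[OF t]]])
  qed
  have w\<phi>: "w t \<bullet> \<phi> j = - lam j * (u t \<bullet> \<phi> j)" if t: "t \<in> {0<..T}" for t j
    using wa[OF t \<phi>H[of j]] eigen_coefficient[OF es uH[OF t], of j] by (simp add: a_def)
  have u\<phi>: "u t \<bullet> \<phi> j = relaxation \<alpha> (lam j) t * (u0 \<bullet> \<phi> j)" if t: "t \<in> {0<..T}" for t j
  proof -
    have "u t \<bullet> \<phi> j = relaxation \<alpha> (lam j) t * (u 0 \<bullet> \<phi> j)"
    proof (rule caputo_homogeneous_solution[OF \<alpha> lam])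
      show "continuous_on {0..T} (\<lambda>t. u t \<bullet> \<phi> j)" by (intro continuous_intros uc)
      show "t \<in> {0..T}" using t by simp
      fix r assume r: "0 < r" "r \<le> T"
      then have "has_caputo_derivative \<alpha> T (\<lambda>s. u s \<bullet> \<phi> j) (w r \<bullet> \<phi> j) r"
        by (intro has_caputo_derivative_inner \<alpha> uc wc) auto
      then show "has_caputo_derivative \<alpha> T (\<lambda>s. u s \<bullet> \<phi> j) (- lam j * (u r \<bullet> \<phi> j)) r"
        using w\<phi>[of r j] r by simp
    qed
    then show ?thesis by (simp add: u00)
  qed
  obtain Bs where "symmetric_form (fe_space \<Omega> \<T>) (bilinear_form \<Omega> A c) Bs" using fe_symmetric_form[OF mesh] ..
  then interpret F: symmetric_form V a Bs unfolding V_def a_def .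
  obtain N \<psi> \<Lambda> where es': "F.eigensystem N \<psi> \<Lambda>" and expand: "\<forall>v\<in>V. v = (\<Sum>i<N. (v \<bullet> \<psi> i) *\<^sub>R \<psi> i)"
    using F.eigenbasis_exists by (elim exE conjE)
  have ex: "v = (\<Sum>i<N. (v \<bullet> \<psi> i) *\<^sub>R \<psi> i)" if "v \<in> V" for v using bspec[OF expand that] .
  have \<psi>V: "\<psi> i \<in> V" and \<Lambda>0: "\<Lambda> i > 0" if "i < N" for i using es' that by (auto simp: F.eigensystem_def)
  have on: "\<psi> i \<bullet> \<psi> j = (if i = j then 1 else 0)" if "i < N" "j < N" for i j
    using es' that by (simp add: F.eigensystem_def)
  have ei: "a (\<psi> i) v = \<Lambda> i * (\<psi> i \<bullet> v)" if "i < N" "v \<in> V" for i v using es' that by (simp add: F.eigensystem_def)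
  define Th where "Th f = (\<Sum>i<N. (f \<bullet> \<psi> i / \<Lambda> i) *\<^sub>R \<psi> i)" for f
  have Th: "elliptic_solution \<Omega> A c V f = Th f" for f
    unfolding elliptic_solution_def Th_def a_def[symmetric] by (rule F.Galerkin_solution_eq[OF es' ex])
  have ThV: "Th f \<in> V" for f
    unfolding Th_def by (intro subspace_sum[OF F.V] subspace_scale[OF F.V] \<psi>V) auto
  have Th\<psi>: "Th f \<bullet> \<psi> i = f \<bullet> \<psi> i / \<Lambda> i" if "i < N" for f i
    unfolding Th_def by (rule orthonormal_sum_inner[OF on that])
  have Thd: "Th (f - g) = Th f - Th g" for f g
    by (simp add: Th_def inner_diff_left diff_divide_distrib scaleR_diff_left sum_subtractf)
  define \<rho> where "\<rho> t = Th (- w t) - u t" for t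
  have TT: "elliptic_solution \<Omega> A c (H10 \<Omega>) (- w t) = u t" if t: "t \<in> {0<..T}" for t
    by (rule elliptic_solution_H10_eq[OF es uH[OF t]]) (use wa[OF t] in \<open>simp add: a_def\<close>)
  \<comment> \<open>One power of \<open>lam j\<close>, which comes from \<open>w = - lam j * u\<close>, is shared by the dual norm of order \<open>1 - s\<close>, the smoothing of order \<open>\<theta>\<close> and the regularity \<open>\<delta>\<close> of the initial value.\<close>
  have powers: "lam j = lam j powr ((1 - s) / 2) * (lam j powr \<theta> * lam j powr (\<delta> / 2))" for j
  proof -
    have "(1 - s) / 2 + (\<theta> + \<delta> / 2) = 1" by (simp add: \<theta>_def field_simps)
    then show ?thesis using lam[of j] by (simp add: powr_add[symmetric])
  qed
  have minus_w: "- w t \<in> L2_on \<Omega>" if "t \<in> {0<..T}" for t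
    using L2_on_scaleR[OF wL[OF that], of "-1"] by simp
  have \<rho>1: "norm (\<rho> t) \<le> K * (S * t powr (- \<alpha> * \<theta>) * U)" if t: "t \<in> {0<..T}" for t
  proof -
    have f: "\<bar>(- w t) \<bullet> \<phi> j\<bar> \<le> lam j powr ((1 - s) / 2) * (S * t powr (- \<alpha> * \<theta>) * (lam j powr (\<delta> / 2) * \<bar>u0 \<bullet> \<phi> j\<bar>))" for j
    proof -
      have r0: "relaxation \<alpha> (lam j) t \<ge> 0" using t by (intro relaxation_nonneg \<alpha> lam) auto
      have "\<bar>(- w t) \<bullet> \<phi> j\<bar> = lam j * (relaxation \<alpha> (lam j) t * \<bar>u0 \<bullet> \<phi> j\<bar>)"
        using w\<phi>[OF t, of j] u\<phi>[OF t, of j] lam[of j] r0 by (simp add: abs_mult)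
      also have "\<dots> = lam j powr ((1 - s) / 2) * ((lam j powr \<theta> * relaxation \<alpha> (lam j) t) * (lam j powr (\<delta> / 2) * \<bar>u0 \<bullet> \<phi> j\<bar>))"
        by (subst powers) (simp add: mult_ac)
      also have "\<dots> \<le> lam j powr ((1 - s) / 2) * ((S * t powr (- \<alpha> * \<theta>)) * (lam j powr (\<delta> / 2) * \<bar>u0 \<bullet> \<phi> j\<bar>))"
        unfolding S_def using t by (intro mult_left_mono mult_right_mono relaxation_smoothing \<alpha> lam \<theta>) auto
      finally show ?thesis .
    qed
    have B0: "S * t powr (- \<alpha> * \<theta>) \<ge> 0" using S1 by simp
    note d = dual_norm_bound[OF \<phi>on \<phi>exp lam u0 B0 f]
    show ?thesis
      using fem[OF minus_w[OF t] d] unfolding Th[unfolded V_def] TT[OF t] \<rho>_def U_def .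
  qed
  have \<rho>2: "norm (\<rho> r - \<rho> t) \<le> K * (S * ((t - r) / r) * r powr (- \<alpha> * \<theta>) * U)" if t: "t \<in> {0<..T}" and r: "0 < r" "r \<le> t" for r t
  proof -
    have rT: "r \<in> {0<..T}" using r t by simp
    have f: "\<bar>(- w r - - w t) \<bullet> \<phi> j\<bar> \<le> lam j powr ((1 - s) / 2) * (S * ((t - r) / r) * r powr (- \<alpha> * \<theta>) * (lam j powr (\<delta> / 2) * \<bar>u0 \<bullet> \<phi> j\<bar>))" for j
    proof -
      have "(- w r - - w t) \<bullet> \<phi> j = lam j * ((relaxation \<alpha> (lam j) r - relaxation \<alpha> (lam j) t) * (u0 \<bullet> \<phi> j))"
        using w\<phi>[OF t, of j] u\<phi>[OF t, of j] w\<phi>[OF rT, of j] u\<phi>[OF rT, of j] by (simp add: inner_diff_left algebra_simps)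
      then have "\<bar>(- w r - - w t) \<bullet> \<phi> j\<bar> = lam j * (\<bar>relaxation \<alpha> (lam j) r - relaxation \<alpha> (lam j) t\<bar> * \<bar>u0 \<bullet> \<phi> j\<bar>)"
        using lam[of j] by (simp add: abs_mult)
      also have "\<dots> = lam j powr ((1 - s) / 2) * ((lam j powr \<theta> * \<bar>relaxation \<alpha> (lam j) r - relaxation \<alpha> (lam j) t\<bar>) * (lam j powr (\<delta> / 2) * \<bar>u0 \<bullet> \<phi> j\<bar>))"
        by (subst powers) (simp add: mult_ac)
      also have "\<dots> \<le> lam j powr ((1 - s) / 2) * ((S * ((t - r) / r) * r powr (- \<alpha> * \<theta>)) * (lam j powr (\<delta> / 2) * \<bar>u0 \<bullet> \<phi> j\<bar>))"
        unfolding S_def using r by (intro mult_left_mono mult_right_mono relaxation_difference_smoothing \<alpha> lam \<theta>) auto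
      finally show ?thesis .
    qed
    have B0: "S * ((t - r) / r) * r powr (- \<alpha> * \<theta>) \<ge> 0" using S1 r by simp
    note d = dual_norm_bound[OF \<phi>on \<phi>exp lam u0 B0 f]
    have L: "- w r - - w t \<in> L2_on \<Omega>" by (rule L2_on_diff[OF minus_w[OF rT] minus_w[OF t]])
    \<comment> \<open>By linearity the increment of \<open>\<rho>\<close> is again an elliptic finite element error, with the increment of \<open>- w\<close> as data.\<close>
    have TTd: "elliptic_solution \<Omega> A c (H10 \<Omega>) (- w r - - w t) = u r - u t"
    proof (rule elliptic_solution_H10_eq[OF es H10_diff[OF uH[OF rT] uH[OF t]]])
      fix v assume v: "v \<in> H10 \<Omega>"
      show "bilinear_form \<Omega> A c (u r - u t) v = (- w r - - w t) \<bullet> v"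
        using form_diff[OF H10_weak_gradient[OF uH[OF rT]] H10_weak_gradient[OF uH[OF t]], of v] wa[OF rT v] wa[OF t v]
        by (simp add: a_def inner_diff_left)
    qed
    have "\<rho> r - \<rho> t = Th (- w r - - w t) - (u r - u t)" unfolding Thd by (simp add: \<rho>_def)
    then show ?thesis using fem[OF L d] unfolding Th[unfolded V_def] TTd U_def by simp
  qed
  define e where "e i r = (uh r - u r) \<bullet> \<psi> i" for i r
  define P where "P = K * S * U"
  have P0: "P \<ge> 0" using K S1 U0 by (simp add: P_def)
  have \<gamma>: "0 \<le> \<alpha> * \<theta>" "\<alpha> * \<theta> \<le> \<alpha>" using \<alpha> \<theta> by (auto simp: mult_left_le)
  have ec: "continuous_on {0..T} (e i)" for i unfolding e_def by (intro continuous_intros uc uhc)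
  have t': "0 < t" "t \<le> T" using t by auto
  have conv: "L2_set (\<lambda>i. e i t) {..<N} \<le> convolution_const \<alpha> * P * t powr (- (\<alpha> * \<theta>))"
  proof (rule convolution_error_bound[OF \<alpha> \<Lambda>0 t' ec _ \<gamma> P0])
    fix i x assume i: "i < N" and x: "0 < x" "x \<le> T"
    \<comment> \<open>The discrete initial value is the projection of \<open>u0\<close>, so the error has no component in the finite element space at time 0.\<close>
    have e0: "e i 0 = 0"
    proof -
      have "uh 0 = (\<Sum>i<N. (u0 \<bullet> \<psi> i) *\<^sub>R \<psi> i)"
        unfolding uh0 L2_projection_def by (rule F.projection_eq[OF es' ex])
      then have "uh 0 \<bullet> \<psi> i = u0 \<bullet> \<psi> i" using orthonormal_sum_inner[OF on i] by simp
      then show ?thesis by (simp add: e_def inner_diff_left u00)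
    qed
    have "((\<lambda>s. (1 - relaxation \<alpha> (\<Lambda> i) (x - s)) * (\<Lambda> i * (\<rho> s \<bullet> \<psi> i))) has_integral
       (\<Lambda> i * integral {0..x} (e i) - \<Lambda> i * e i 0 * integral {0..x} (relaxation \<alpha> (\<Lambda> i)))) {0..x}"
    proof (rule caputo_solution_integrated[OF \<alpha> \<Lambda>0[OF i] x continuous_on_subset[OF ec]])
      show "{0..x} \<subseteq> {0..T}" using x by auto
      fix r assume r: "0 < r" "r \<le> x"
      then have rT: "r \<in> {0<..T}" "r \<in> {0..T}" using x by auto
      obtain wh where wh: "has_caputo_derivative \<alpha> T uh wh r" "\<forall>v\<in>V. wh \<bullet> v + a (uh r) v = 0"
        using uhw[OF rT(1)] by (elim exE conjE)
      have "wh \<bullet> \<psi> i + a (uh r) (\<psi> i) = 0" using wh(2) \<psi>V[OF i] by (rule bspec)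
      moreover have "a (uh r) (\<psi> i) = \<Lambda> i * (uh r \<bullet> \<psi> i)"
        using F.sym[OF uhV[OF rT(1)] \<psi>V[OF i]] ei[OF i uhV[OF rT(1)]] by (simp add: inner_commute)
      moreover have "\<rho> r \<bullet> \<psi> i = - (w r \<bullet> \<psi> i) / \<Lambda> i - u r \<bullet> \<psi> i"
        by (simp add: \<rho>_def inner_diff_left Th\<psi>[OF i])
      ultimately have eq: "(wh - w r) \<bullet> \<psi> i = \<Lambda> i * (\<rho> r \<bullet> \<psi> i) - \<Lambda> i * e i r"
        using \<Lambda>0[OF i] by (simp add: e_def inner_diff_left right_diff_distrib)
      have "has_caputo_derivative \<alpha> T (\<lambda>s. uh s - u s) (wh - w r) r"
        by (rule has_caputo_derivative_diff[OF \<alpha> uhc uc rT(2) wh(1) wc[OF rT(1)]])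
      from has_caputo_derivative_inner[OF \<alpha> continuous_on_diff[OF uhc uc] rT(2) this, of "\<psi> i"]
      have "has_caputo_derivative \<alpha> T (e i) ((wh - w r) \<bullet> \<psi> i) r" unfolding e_def .
      then show "has_caputo_derivative \<alpha> T (e i) (\<Lambda> i * (\<rho> r \<bullet> \<psi> i) - \<Lambda> i * e i r) r"
        unfolding eq .
    qed
    from has_integral_mult_right[OF this, of "1 / \<Lambda> i"]
    show "((\<lambda>s. (1 - relaxation \<alpha> (\<Lambda> i) (x - s)) * (\<rho> s \<bullet> \<psi> i)) has_integral integral {0..x} (e i)) {0..x}"
      using \<Lambda>0[OF i] e0 by (simp add: mult.left_commute)
  next
    fix r assume r: "0 < r" "r \<le> t"
    then have rT: "r \<in> {0<..T}" using t' by simp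
    have "L2_set (\<lambda>i. \<rho> r \<bullet> \<psi> i) {..<N} \<le> norm (\<rho> r)" by (rule Bessel[OF on])
    also have "\<dots> \<le> P * r powr (- (\<alpha> * \<theta>))" using \<rho>1[OF rT] by (simp add: P_def mult_ac)
    finally show "L2_set (\<lambda>i. \<rho> r \<bullet> \<psi> i) {..<N} \<le> P * r powr (- (\<alpha> * \<theta>))" .
    have "L2_set (\<lambda>i. (\<rho> r - \<rho> t) \<bullet> \<psi> i) {..<N} \<le> norm (\<rho> r - \<rho> t)" by (rule Bessel[OF on])
    also have "\<dots> \<le> P * ((t - r) / r) * r powr (- (\<alpha> * \<theta>))" using \<rho>2[OF t r] by (simp add: P_def mult_ac)
    finally show "L2_set (\<lambda>i. \<rho> r \<bullet> \<psi> i - \<rho> t \<bullet> \<psi> i) {..<N} \<le> P * ((t - r) / r) * r powr (- (\<alpha> * \<theta>))"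
      by (simp add: inner_diff_left)
  qed
  let ?e = "uh t - u t"
  let ?p = "\<Sum>i<N. (?e \<bullet> \<psi> i) *\<^sub>R \<psi> i"
  have "norm ?p \<le> convolution_const \<alpha> * P * t powr (- (\<alpha> * \<theta>))"
    using conv by (simp add: orthonormal_sum_norm[OF on] e_def)
  moreover have "norm (?e - ?p) \<le> norm (\<rho> t)"
  proof -
    \<comment> \<open>The projection of \<open>?e\<close> is at least as close to \<open>?e\<close> as the element \<open>uh t - Th (- w t)\<close>, whose distance is the norm of \<open>\<rho> t\<close>.\<close>
    have "uh t - Th (- w t) \<in> V" using subspace_diff[OF F.V uhV[OF t] ThV] .
    from orthonormal_best_approximation[OF on ex[OF this], of ?e]
    have "norm (?e - ?p) \<le> norm (?e - (uh t - Th (- w t)))" .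
    also have "?e - (uh t - Th (- w t)) = \<rho> t" by (simp add: \<rho>_def)
    finally show ?thesis .
  qed
  moreover have "norm (\<rho> t) \<le> P * t powr (- (\<alpha> * \<theta>))" using \<rho>1[OF t] by (simp add: P_def mult_ac)
  moreover have "norm ?e \<le> norm ?p + norm (?e - ?p)" using norm_triangle_ineq[of ?p "?e - ?p"] by simp
  ultimately have "norm ?e \<le> convolution_const \<alpha> * P * t powr (- (\<alpha> * \<theta>)) + P * t powr (- (\<alpha> * \<theta>))" by linarith
  also have "\<dots> = (convolution_const \<alpha> + 1) * S * K * t powr (- (\<alpha> * \<theta>)) * U" by (simp add: P_def algebra_simps)
  also have "- (\<alpha> * \<theta>) = - \<alpha> * (1 + s - \<delta>) / 2" by (simp add: \<theta>_def)
  finally show ?thesis unfolding S_def U_def .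
qed

end

theorem theorem4p2:
  fixes \<Omega> :: "plane set" and A :: "plane \<Rightarrow> real^2^2" and c :: "plane \<Rightarrow> real"
    and lam :: "nat \<Rightarrow> real" and \<phi> :: "nat \<Rightarrow> (plane, real) L2"
    and F :: "plane set set set"
    and \<alpha> T \<omega> \<beta> s :: real
  assumes "polygonal_domain \<Omega>"
    and "pi < \<omega>" and "\<omega> < 2 * pi" and "only_reentrant_angle \<Omega> \<omega>"
    and "\<beta> = pi / \<omega>"
    and "0 < T" and "0 < \<alpha>" and "\<alpha> < 1"
    and "elliptic_coefficients \<Omega> A c"
    and "dirichlet_eigensystem \<Omega> A c lam \<phi>"
    and "\<forall>\<T>\<in>F. triangular_mesh \<Omega> \<T> \<and> mesh_size \<T> < 1"
    and "shape_regular_family F"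
    and "\<forall>\<sigma>. \<beta> < \<sigma> \<and> \<sigma> \<le> 1 \<longrightarrow> fe_error_estimate \<Omega> A c lam \<phi> F \<beta> \<sigma>"
    and "\<beta> < s" and "s \<le> 1"
  shows "\<exists>C. \<forall>\<delta> \<T> u0 u uh.
           0 \<le> \<delta> \<and> \<delta> \<le> 1 + s \<and> \<T> \<in> F \<and> u0 \<in> Hdot \<Omega> lam \<phi> \<delta> \<and>
           weak_solution \<Omega> A c lam \<phi> \<alpha> T u0 u \<and>
           semidiscrete_solution \<Omega> A c \<T> \<alpha> T u0 uh \<longrightarrow>
           (\<forall>t\<in>{0<..T}. norm (uh t - u t)
              \<le> C * mesh_size \<T> powr (2 * \<beta>) * t powr (- \<alpha> * (1 + s - \<delta>) / 2)
                * Hdot_norm lam \<phi> \<delta> u0)"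
proof -
  interpret elliptic_problem \<Omega> A c
    by unfold_locales (use assms(1,9) in \<open>simp_all add: polygonal_domain_def\<close>)
  have "fe_error_estimate \<Omega> A c lam \<phi> F \<beta> s" using assms(13-15) by simp
  then obtain C0 where "\<forall>\<T>\<in>F. \<forall>f\<in>L2_on \<Omega>.
      norm (elliptic_solution \<Omega> A c (fe_space \<Omega> \<T>) f - elliptic_solution \<Omega> A c (H10 \<Omega>) f)
       + mesh_size \<T> powr \<beta> * norm (weak_gradient \<Omega> (elliptic_solution \<Omega> A c (fe_space \<Omega> \<T>) f - elliptic_solution \<Omega> A c (H10 \<Omega>) f))
      \<le> C0 * mesh_size \<T> powr (2 * \<beta>) * Hdot_dual_norm \<Omega> lam \<phi> (1 - s) f"
    unfolding fe_error_estimate_def Let_def by (elim exE) (rule that)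
  note C0 = bspec[OF bspec[OF this]]
  have fem: "norm (elliptic_solution \<Omega> A c (fe_space \<Omega> \<T>) f - elliptic_solution \<Omega> A c (H10 \<Omega>) f)
      \<le> (\<bar>C0\<bar> * mesh_size \<T> powr (2 * \<beta>)) * D"
    if "\<T> \<in> F" "f \<in> L2_on \<Omega>" "0 \<le> Hdot_dual_norm \<Omega> lam \<phi> (1 - s) f" "Hdot_dual_norm \<Omega> lam \<phi> (1 - s) f \<le> D" for \<T> f D
  proof -
    let ?d = "elliptic_solution \<Omega> A c (fe_space \<Omega> \<T>) f - elliptic_solution \<Omega> A c (H10 \<Omega>) f"
    have "norm ?d \<le> norm ?d + mesh_size \<T> powr \<beta> * norm (weak_gradient \<Omega> ?d)" by simp
    also have "\<dots> \<le> C0 * mesh_size \<T> powr (2 * \<beta>) * Hdot_dual_norm \<Omega> lam \<phi> (1 - s) f" by (rule C0[OF that(1,2)])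
    also have "\<dots> \<le> \<bar>C0\<bar> * mesh_size \<T> powr (2 * \<beta>) * Hdot_dual_norm \<Omega> lam \<phi> (1 - s) f"
      by (intro mult_right_mono that(3)) auto
    also have "\<dots> \<le> \<bar>C0\<bar> * mesh_size \<T> powr (2 * \<beta>) * D" by (intro mult_left_mono that(4)) auto
    finally show ?thesis .
  qed
  define C where "C = (convolution_const \<alpha> + 1) * smoothing_const \<alpha> * \<bar>C0\<bar>"
  show ?thesis
  proof (intro exI[of _ C] allI impI ballI, elim conjE)
    fix \<delta> \<T> u0 u uh t
    assume \<delta>: "0 \<le> \<delta>" "\<delta> \<le> 1 + s" and \<T>: "\<T> \<in> F" and u0: "u0 \<in> Hdot \<Omega> lam \<phi> \<delta>"
      and u: "weak_solution \<Omega> A c lam \<phi> \<alpha> T u0 u" and uh: "semidiscrete_solution \<Omega> A c \<T> \<alpha> T u0 uh" and t: "t \<in> {0<..T}"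
    have mesh: "triangular_mesh \<Omega> \<T>" using assms(11) \<T> by simp
    have "norm (uh t - u t) \<le> (convolution_const \<alpha> + 1) * smoothing_const \<alpha> * (\<bar>C0\<bar> * mesh_size \<T> powr (2 * \<beta>))
        * t powr (- \<alpha> * (1 + s - \<delta>) / 2) * Hdot_norm lam \<phi> \<delta> u0"
      by (rule semidiscrete_error[OF assms(10,6,7,8) mesh assms(15) \<delta> u0 u uh _ fem[OF \<T>] t]) simp
    then show "norm (uh t - u t) \<le> C * mesh_size \<T> powr (2 * \<beta>) * t powr (- \<alpha> * (1 + s - \<delta>) / 2) * Hdot_norm lam \<phi> \<delta> u0"
      by (simp add: C_def mult.assoc)
  qed
qed

end
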